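(* Let $p\in(1,\infty)$, $k\in\mathbb{N}_0\cup\{-1\}$, $\tilde\gamma\in(-1,2p-1)\setminus\{p-1\}$ such that $\tilde\gamma+kp>-1$, $\omega\in(0,\pi)$ and let $X$ be a $\mathrm{UMD}$ Banach space. Then for all $f\in W^{k+1,p}(\mathbb{R}_+,w_{\tilde\gamma+kp};X)$ and $\lambda\in\Sigma_{\pi-\omega}$ there exists a unique $u\in W^{k+3,p}_{\mathrm{Neu}}(\mathbb{R}_+,w_{\tilde\gamma+kp};X)$ such that $\lambda u-\Delta_{\mathrm{Neu}}u=f$. Moreover, this solution satisfies $$\sum_{j=0}^2|\lambda|^{1-\frac j2}\|\partial_x^ju\|_{W^{k+1,p}(\mathbb{R}_+,w_{\tilde\gamma+kp};X)}\le C\,h_{k+1,\tilde\gamma}(\lambda)\,\|f\|_{W^{k+1,p}(\mathbb{R}_+,w_{\tilde\gamma+kp};X)},$$ where $$h_{k+1,\tilde\gamma}(\lambda):=1+|\lambda|^{-\frac{(\tilde\gamma+(k+1)p-2p+1)_+}{2p}}$$ and the constant $C>0$ only depends on $p,k,\tilde\gamma,\omega$ and $X$.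
   Context: $\mathbb{N}_0=\{0,1,2,\dots\}$, $\mathbb{R}_+=(0,\infty)$, $(a)_+:=\max\{a,0\}$ for $a\in\mathbb{R}$, and $\Sigma_\theta=\{z\in\mathbb{C}\setminus\{0\}:|\arg z|<\theta\}$ for $\theta\in(0,\pi)$. For $\gamma>-1$, $w_\gamma(x)=|x|^\gamma$ on $\mathbb{R}_+$; $L^p(\mathbb{R}_+,w_\gamma;X)$ is the space of strongly measurable $f:\mathbb{R}_+\to X$ with $\int_0^\infty\|f(x)\|_X^px^\gamma\,dx<\infty$, and for $m\in\mathbb{N}_0$, $W^{m,p}(\mathbb{R}_+,w_\gamma;X)$ is the space of $X$-valued distributions on $\mathbb{R}_+$ all of whose derivatives of order $\le m$ lie in $L^p(\mathbb{R}_+,w_\gamma;X)$, with its canonical norm. $W^{k+3,p}_{\mathrm{Neu}}(\mathbb{R}_+,w_\gamma;X):=\{u\in W^{k+3,p}(\mathbb{R}_+,w_\gamma;X):\mathrm{Tr}\,\partial_xu=(\partial_xu)(0)=0\}$ (the trace is well defined for the weight exponents considered). $\Delta_{\mathrm{Neu}}u=\partial_x^2u$ for $u$ in this space. *)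

theory Defs
  imports "HOL-Probability.Probability"
begin

section \<open>Complex Banach spaces\<close>

text \<open>The class \<^class>\<open>banach\<close> only provides real scalars; the complex ones are required to
  extend them.\<close>

class complex_banach = banach +
  fixes scaleC :: "complex \<Rightarrow> 'a \<Rightarrow> 'a" (infixr \<open>*\<^sub>C\<close> 75)
  assumes scaleC_add_right: "a *\<^sub>C (x + y) = a *\<^sub>C x + a *\<^sub>C y"
    and scaleC_add_left: "(a + b) *\<^sub>C x = a *\<^sub>C x + b *\<^sub>C x"
    and scaleC_scaleC: "a *\<^sub>C (b *\<^sub>C x) = (a * b) *\<^sub>C x"
    and scaleC_of_real: "complex_of_real r *\<^sub>C x = r *\<^sub>R x"
    and norm_scaleC: "norm (a *\<^sub>C x) = cmod a * norm x"

instantiation complex :: complex_banach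
begin

definition scaleC_complex :: "complex \<Rightarrow> complex \<Rightarrow> complex" where
  "scaleC_complex a x = a * x"

instance
  by standard
    (simp_all add: scaleC_complex_def distrib_left distrib_right mult.assoc
      scaleR_conv_of_real norm_mult)

end

section \<open>Strong measurability, Bochner integral and Lebesgue--Bochner spaces\<close>

definition strongly_measurable :: "'s measure \<Rightarrow> ('s \<Rightarrow> 'a::real_normed_vector) \<Rightarrow> bool" where
  "strongly_measurable M f \<longleftrightarrow>
     (\<exists>s. (\<forall>i::nat. simple_function M (s i)) \<and> (\<forall>x\<in>space M. (\<lambda>i. s i x) \<longlonglongrightarrow> f x))"

text \<open>The library's \<^const>\<open>has_bochner_integral\<close> requires the value space to be second countable,
  that is separable. The following is the same notion without that restriction.\<close>

definition has_strong_integral ::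
    "'s measure \<Rightarrow> ('s \<Rightarrow> 'a) \<Rightarrow> 'a::real_normed_vector \<Rightarrow> bool" where
  "has_strong_integral M f I \<longleftrightarrow> strongly_measurable M f \<and>
     (\<exists>s. (\<forall>i. Bochner_Integration.simple_bochner_integrable M (s i)) \<and>
          (\<lambda>i. \<integral>\<^sup>+x. ennreal (norm (f x - s i x)) \<partial>M) \<longlonglongrightarrow> 0 \<and>
          (\<lambda>i. Bochner_Integration.simple_bochner_integral M (s i)) \<longlonglongrightarrow> I)"

definition strong_integral :: "'s measure \<Rightarrow> ('s \<Rightarrow> 'a) \<Rightarrow> 'a::real_normed_vector" where
  "strong_integral M f = (THE I. has_strong_integral M f I)"

lemma strongly_measurable_iff_borel_measurable:
  fixes f :: "'s \<Rightarrow> 'a::{real_normed_vector, second_countable_topology}"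
  shows "strongly_measurable M f \<longleftrightarrow> f \<in> borel_measurable M"
proof
  assume "strongly_measurable M f"
  then obtain s where s: "\<And>i::nat. simple_function M (s i)"
    "\<And>x. x \<in> space M \<Longrightarrow> (\<lambda>i. s i x) \<longlonglongrightarrow> f x"
    unfolding strongly_measurable_def by blast
  show "f \<in> borel_measurable M"
    by (rule borel_measurable_LIMSEQ_metric[OF borel_measurable_simple_function[OF s(1)] s(2)])
next
  assume "f \<in> borel_measurable M"
  from borel_measurable_implies_sequence_metric[OF this, of 0]
  show "strongly_measurable M f"
    unfolding strongly_measurable_def by blast
qed

lemma has_strong_integral_iff_has_bochner_integral:
  fixes f :: "'s \<Rightarrow> 'a::{real_normed_vector, second_countable_topology}"
  shows "has_strong_integral M f I \<longleftrightarrow> has_bochner_integral M f I"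
  unfolding has_strong_integral_def has_bochner_integral.simps
    strongly_measurable_iff_borel_measurable by blast

definition Lp_space :: "real \<Rightarrow> 's measure \<Rightarrow> ('s \<Rightarrow> 'a::real_normed_vector) set" where
  "Lp_space p M = {f. strongly_measurable M f \<and> integrable M (\<lambda>x. norm (f x) powr p)}"

definition Lp_norm :: "real \<Rightarrow> 's measure \<Rightarrow> ('s \<Rightarrow> 'a::real_normed_vector) \<Rightarrow> real" where
  "Lp_norm p M f = (\<integral>x. norm (f x) powr p \<partial>M) powr (1 / p)"

section \<open>UMD spaces\<close>

text \<open>\<open>f 0, \<dots>, f N\<close> is a martingale in \<open>L\<^sup>p(M)\<close> for the filtration \<open>F 0, \<dots>, F N\<close>. The last
  conjunct says that the conditional expectation of \<open>f (n + 1)\<close> given \<open>F n\<close> is \<open>f n\<close>; the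
  library has conditional expectations of real-valued functions only.\<close>

definition Lp_martingale ::
    "real \<Rightarrow> 's measure \<Rightarrow> nat \<Rightarrow> (nat \<Rightarrow> 's measure) \<Rightarrow> (nat \<Rightarrow> 's \<Rightarrow> 'a::banach) \<Rightarrow> bool" where
  "Lp_martingale p M N F f \<longleftrightarrow>
     (\<forall>n\<le>N. subalgebra M (F n)) \<and>
     (\<forall>n<N. subalgebra (F (Suc n)) (F n)) \<and>
     (\<forall>n\<le>N. strongly_measurable (F n) (f n) \<and> f n \<in> Lp_space p M) \<and>
     (\<forall>n<N. \<forall>A\<in>sets (F n).
        strong_integral M (\<lambda>x. indicator A x *\<^sub>R f (Suc n) x) =
        strong_integral M (\<lambda>x. indicator A x *\<^sub>R f n x))"

text \<open>Unconditionality of martingale differences. A definition cannot quantify over types, so the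
  probability spaces are those with underlying set \<open>\<real>\<close> (and an arbitrary sigma-algebra). Nothing
  is lost: the inequality only depends on the joint law of \<open>f 0, \<dots>, f N\<close>, which is carried by a
  Polish space.\<close>

definition UMD :: "'a::banach itself \<Rightarrow> bool" where
  "UMD _ \<longleftrightarrow>
     (\<forall>p>1. \<exists>\<beta>\<ge>0. \<forall>(M :: real measure) N F (f :: nat \<Rightarrow> real \<Rightarrow> 'a) (\<epsilon> :: nat \<Rightarrow> real).
        prob_space M \<longrightarrow> Lp_martingale p M N F f \<longrightarrow> (\<forall>n. \<epsilon> n \<in> {-1, 1}) \<longrightarrow>
        Lp_norm p M (\<lambda>x. \<Sum>n<N. \<epsilon> n *\<^sub>R (f (Suc n) x - f n x))
          \<le> \<beta> * Lp_norm p M (\<lambda>x. \<Sum>n<N. f (Suc n) x - f n x))"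

section \<open>Weighted Sobolev spaces on the half-line\<close>

abbreviation halfline :: "real measure" where
  "halfline \<equiv> restrict_space lborel {0<..}"

definition power_weighted :: "real \<Rightarrow> real measure" where
  "power_weighted \<gamma> = density halfline (\<lambda>x. ennreal (\<bar>x\<bar> powr \<gamma>))"

definition test_function :: "(real \<Rightarrow> real) \<Rightarrow> bool" where
  "test_function \<phi> \<longleftrightarrow>
     (\<forall>n x. ((deriv ^^ n) \<phi>) field_differentiable (at x)) \<and>
     compact (closure {x. \<phi> x \<noteq> 0}) \<and> closure {x. \<phi> x \<noteq> 0} \<subseteq> {0<..}"

definition locally_integrable :: "(real \<Rightarrow> 'a::real_normed_vector) \<Rightarrow> bool" where
  "locally_integrable u \<longleftrightarrow> strongly_measurable halfline u \<and>
     (\<forall>K. compact K \<longrightarrow> K \<subseteq> {0<..} \<longrightarrow> set_integrable halfline K (\<lambda>x. norm (u x)))"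

text \<open>The \<open>j\<close>-th distributional derivative of the regular distribution \<open>u\<close> on \<open>(0, \<infinity>)\<close> is the
  regular distribution \<open>v\<close>.\<close>

definition has_weak_deriv ::
    "nat \<Rightarrow> (real \<Rightarrow> 'a::real_normed_vector) \<Rightarrow> (real \<Rightarrow> 'a) \<Rightarrow> bool" where
  "has_weak_deriv j u v \<longleftrightarrow> locally_integrable u \<and> locally_integrable v \<and>
     (\<forall>\<phi>. test_function \<phi> \<longrightarrow>
        strong_integral halfline (\<lambda>x. (deriv ^^ j) \<phi> x *\<^sub>R u x) =
        (-1) ^ j *\<^sub>R strong_integral halfline (\<lambda>x. \<phi> x *\<^sub>R v x))"

text \<open>A representative of the \<open>j\<close>-th weak derivative, if there is one; it is determined up to
  null sets, and everything below only depends on its class modulo null sets.\<close>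

definition weak_deriv :: "nat \<Rightarrow> (real \<Rightarrow> 'a::real_normed_vector) \<Rightarrow> real \<Rightarrow> 'a" where
  "weak_deriv j u = (SOME v. has_weak_deriv j u v)"

text \<open>Elements of Sobolev spaces are functions rather than classes of functions; their values
  outside \<open>(0, \<infinity>)\<close> are irrelevant.\<close>

definition sobolev :: "nat \<Rightarrow> real \<Rightarrow> real \<Rightarrow> (real \<Rightarrow> 'a::real_normed_vector) set" where
  "sobolev m p \<gamma> = {u \<in> Lp_space p (power_weighted \<gamma>).
     \<forall>j\<le>m. \<exists>v\<in>Lp_space p (power_weighted \<gamma>). has_weak_deriv j u v}"

definition sobolev_norm ::
    "nat \<Rightarrow> real \<Rightarrow> real \<Rightarrow> (real \<Rightarrow> 'a::real_normed_vector) \<Rightarrow> real" where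
  "sobolev_norm m p \<gamma> u = (\<Sum>j\<le>m. Lp_norm p (power_weighted \<gamma>) (weak_deriv j u))"

text \<open>The trace at \<open>0\<close> is the value at \<open>0\<close> of the representative that is continuous on \<open>[0, \<infinity>)\<close>.\<close>

definition has_trace :: "(real \<Rightarrow> 'a::real_normed_vector) \<Rightarrow> 'a \<Rightarrow> bool" where
  "has_trace v c \<longleftrightarrow>
     (\<exists>g. continuous_on {0..} g \<and> (AE x in halfline. v x = g x) \<and> g 0 = c)"

definition sobolev_Neu :: "nat \<Rightarrow> real \<Rightarrow> real \<Rightarrow> (real \<Rightarrow> 'a::real_normed_vector) set" where
  "sobolev_Neu m p \<gamma> = {u \<in> sobolev m p \<gamma>. has_trace (weak_deriv 1 u) 0}"

section \<open>The resolvent equation\<close>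

definition sector :: "real \<Rightarrow> complex set" where
  "sector \<theta> = {z. z \<noteq> 0 \<and> \<bar>Arg z\<bar> < \<theta>}"

definition resolvent_eq ::
    "complex \<Rightarrow> (real \<Rightarrow> 'a::complex_banach) \<Rightarrow> (real \<Rightarrow> 'a) \<Rightarrow> bool" where
  "resolvent_eq \<mu> u f \<longleftrightarrow> (AE x in halfline. \<mu> *\<^sub>C u x - weak_deriv 2 u x = f x)"

definition h_fun :: "real \<Rightarrow> int \<Rightarrow> real \<Rightarrow> complex \<Rightarrow> real" where
  "h_fun p m \<gamma> \<mu> = 1 + cmod \<mu> powr (- (max (\<gamma> + of_int m * p - 2 * p + 1) 0 / (2 * p)))"

end

theory Submission
  imports Defs
begin

text \<open>Write \<open>\<mu> = s * s\<close> with \<open>Re s > 0\<close>; on the sector \<open>Re s\<close> is comparable with the modulus of \<open>s\<close>.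
  The operator factorises as \<open>\<mu> - \<partial>\<^sup>2 = (s - \<partial>) (s + \<partial>)\<close>, and the equation becomes the pair of
  first-order equations \<open>G' = s G - f\<close> and \<open>u' = G - s u\<close>. The bounded solution \<open>G\<close> of the first
  one averages \<open>f\<close> over \<open>(x, \<infinity>)\<close>; the solution of the second one with \<open>u' 0 = 0\<close> is given by the
  explicit Neumann kernel, which is dominated by \<open>exp (- a \<bar>x - y\<bar>) / \<bar>s\<bar>\<close> with \<open>a\<close> proportional
  to \<open>\<bar>s\<bar>\<close>. The theorem thus becomes a matter of estimating positive scalar kernels on weighted
  spaces.

  Let \<open>\<delta> = \<gamma> + k p\<close> be the weight exponent. The two-sided exponential kernel is bounded on the
  weighted space, uniformly after scaling, for exponents in \<open>(-1, p - 1)\<close> only; this is Schur's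
  test with a power as test weight (\<open>expker_bound\<close>). The one-sided kernel that produces \<open>G\<close> is
  bounded for all exponents above \<open>-1\<close> (\<open>expker_forward_bound\<close>). Moreover the \<open>i\<close>-th derivative
  of \<open>G\<close> solves the same equation with the \<open>i\<close>-th derivative of \<open>f\<close> as right-hand side, so \<open>G\<close>
  is under control in all the norms (\<open>res_Gs_bound\<close>).

  For \<open>u\<close> write \<open>\<delta> = \<eta> + n p\<close> with \<open>\<eta>\<close> in \<open>(-1, p - 1)\<close>; the exclusion of \<open>\<gamma> = p - 1\<close> makes this
  possible with \<open>n\<close> equal to \<open>k\<close> or \<open>k + 1\<close>. Hardy's inequality (\<open>hardy_bound\<close>) exchanges a
  derivative of \<open>f\<close> for a decrease of the exponent by \<open>p\<close>, so \<open>f\<close> belongs to the space with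
  exponent \<open>\<eta>\<close>, where the kernel is bounded. For \<open>\<bar>s\<bar> \<ge> 1\<close> one climbs back from \<open>\<eta>\<close> to \<open>\<delta>\<close> in
  steps of \<open>p\<close>: the function \<open>x\<^sup>j\<close> times a derivative of \<open>u\<close> satisfies the second first-order
  equation again, up to a term of lower order (\<open>res_us_large_weight_step\<close>). For \<open>\<bar>s\<bar> \<le> 1\<close> the
  derivatives of \<open>u\<close> follow from \<open>u' = G - s u\<close> by induction, and only \<open>u\<close> itself has to be
  estimated with exponent \<open>\<delta>\<close>. If \<open>\<delta> > p - 1\<close>, then \<open>f\<close> is integrable, because it lies in the
  spaces with exponents \<open>\<eta>\<close> and \<open>\<delta>\<close>; the decay of the kernel away from the diagonal then costs a
  negative power of \<open>\<bar>s\<bar>\<close>, and this is the singular factor in the estimate (\<open>expker_L1_bound\<close>).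

  Uniqueness uses the same factorisation: for the difference \<open>z\<close> of two solutions, \<open>z' + s z\<close> is
  a multiple of \<open>exp (s x)\<close> in a weighted space and hence vanishes, and then \<open>z'\<close> is a multiple
  of \<open>exp (- s x)\<close> with trace \<open>0\<close>.

  Two foundations precede the estimates. The Banach space need not be separable, so the integral
  is developed from approximation by simple functions. Weak derivatives are reduced to
  absolutely continuous representatives by the fundamental lemma of the calculus of variations
  and the lemma of du Bois-Reymond; from then on an element of a Sobolev space is a finite chain
  of functions each of which is an antiderivative of the next.\<close>

section \<open>Strongly measurable functions\<close>

lemma ennreal_le_plus:
  "x \<le> a + b \<Longrightarrow> 0 \<le> a \<Longrightarrow> 0 \<le> b \<Longrightarrow> ennreal x \<le> ennreal a + ennreal b"
  by (metis ennreal_leI ennreal_plus)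

text \<open>Applying a continuous function to two approximating sequences of simple functions; all closure
  properties of strong measurability are instances.\<close>

lemma strongly_measurable_compose2:
  fixes h :: "'a::real_normed_vector \<Rightarrow> 'b::real_normed_vector \<Rightarrow> 'c::real_normed_vector"
  assumes f: "strongly_measurable M f" and g: "strongly_measurable M g"
    and h: "continuous_on UNIV (\<lambda>z. h (fst z) (snd z))"
  shows "strongly_measurable M (\<lambda>x. h (f x) (g x))"
proof -
  obtain s where s: "\<And>i::nat. simple_function M (s i)" "\<And>x. x \<in> space M \<Longrightarrow> (\<lambda>i. s i x) \<longlonglongrightarrow> f x"
    using f unfolding strongly_measurable_def by blast
  obtain t where t: "\<And>i::nat. simple_function M (t i)" "\<And>x. x \<in> space M \<Longrightarrow> (\<lambda>i. t i x) \<longlonglongrightarrow> g x"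
    using g unfolding strongly_measurable_def by blast
  have "(\<lambda>i. h (s i x) (t i x)) \<longlonglongrightarrow> h (f x) (g x)" if "x \<in> space M" for x
    using continuous_on_tendsto_compose[OF h tendsto_Pair[OF s(2)[OF that] t(2)[OF that]]] by simp
  moreover have "simple_function M (\<lambda>x. h (s i x) (t i x))" for i
    by (rule simple_function_compose2[OF s(1) t(1)])
  ultimately show ?thesis
    unfolding strongly_measurable_def by (intro exI[of _ "\<lambda>i x. h (s i x) (t i x)"]) blast
qed

lemma strongly_measurable_simple: "simple_function M f \<Longrightarrow> strongly_measurable M f"
  unfolding strongly_measurable_def by (intro exI[of _ "\<lambda>_. f"]) auto

lemma strongly_measurable_const: "strongly_measurable M (\<lambda>_. c)"
  by (rule strongly_measurable_simple) simp

lemma strongly_measurable_compose: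
  fixes h :: "'a::real_normed_vector \<Rightarrow> 'b::real_normed_vector"
  assumes "strongly_measurable M f" "continuous_on UNIV h"
  shows "strongly_measurable M (\<lambda>x. h (f x))"
  using assms(1) assms(1)
  by (rule strongly_measurable_compose2) (rule continuous_on_compose2[OF assms(2)], auto intro: continuous_intros)

lemma strongly_measurable_add:
  "strongly_measurable M f \<Longrightarrow> strongly_measurable M g \<Longrightarrow> strongly_measurable M (\<lambda>x. f x + g x)"
  by (erule (1) strongly_measurable_compose2) (intro continuous_intros)

lemma strongly_measurable_diff:
  "strongly_measurable M f \<Longrightarrow> strongly_measurable M g \<Longrightarrow> strongly_measurable M (\<lambda>x. f x - g x)"
  by (erule (1) strongly_measurable_compose2) (intro continuous_intros)

lemma strongly_measurable_bilinear:
  "bounded_bilinear B \<Longrightarrow> strongly_measurable M f \<Longrightarrow> strongly_measurable M g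
    \<Longrightarrow> strongly_measurable M (\<lambda>x. B (f x) (g x))"
  by (erule (1) strongly_measurable_compose2)
    (rule bounded_bilinear.continuous_on, auto intro: continuous_intros)

lemma strongly_measurable_scaleR:
  "\<lbrakk>f \<in> borel_measurable M; strongly_measurable M g\<rbrakk> \<Longrightarrow> strongly_measurable M (\<lambda>x. f x *\<^sub>R g x)"
  by (rule strongly_measurable_bilinear[OF bounded_bilinear_scaleR])
    (simp_all add: strongly_measurable_iff_borel_measurable)

lemma borel_measurable_norm_strongly:
  assumes "strongly_measurable M f" shows "(\<lambda>x. norm (f x)) \<in> borel_measurable M"
  using strongly_measurable_compose[OF assms, of norm]
  by (simp add: strongly_measurable_iff_borel_measurable continuous_on_norm_id)

lemma borel_measurable_norm_diff_strongly:
  "strongly_measurable M f \<Longrightarrow> strongly_measurable M g \<Longrightarrow> (\<lambda>x. norm (f x - g x)) \<in> borel_measurable M"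
  by (intro borel_measurable_norm_strongly strongly_measurable_diff)

lemma strongly_measurable_cong_sets:
  assumes "sets M = sets N" "strongly_measurable M f"
  shows "strongly_measurable N f"
proof -
  have "space M = space N" using assms(1) by (rule sets_eq_imp_space_eq)
  then have "simple_function M = simple_function N"
    by (intro ext) (simp add: simple_function_def assms(1))
  then show ?thesis using assms(2) \<open>space M = space N\<close> unfolding strongly_measurable_def by (simp add: simple_function_def assms(1))
qed

text \<open>Simple functions that converge to the identity are composed with \<open>f\<close>. The function is only
  known to be continuous on the open half-line, hence values of the simple functions outside of
  it are first replaced by \<open>1\<close>.\<close>

lemma continuous_imp_strongly_measurable:
  fixes f :: "real \<Rightarrow> 'a::real_normed_vector"
  assumes "continuous_on {0<..} f" shows "strongly_measurable halfline f"
proof -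
  have "(\<lambda>x::real. x) \<in> borel_measurable halfline" by (intro measurable_restrict_space1) simp
  then obtain s where s: "\<And>i::nat. simple_function halfline (s i)"
    "\<And>x. x \<in> space halfline \<Longrightarrow> (\<lambda>i. s i x) \<longlonglongrightarrow> (x::real)"
    unfolding strongly_measurable_iff_borel_measurable[symmetric] strongly_measurable_def by blast
  define t where "t i x = (if 0 < s i x then s i x else 1)" for i x
  have "(\<lambda>i. f (t i x)) \<longlonglongrightarrow> f x" if x: "x \<in> space halfline" for x
  proof (rule continuous_on_tendsto_compose[OF assms])
    have x0: "x > 0" using x by (simp add: space_restrict_space)
    have "eventually (\<lambda>i. s i x > 0) sequentially" using order_tendstoD(1)[OF s(2)[OF x] x0] .
    then have "eventually (\<lambda>i. s i x = t i x) sequentially" by eventually_elim (simp add: t_def)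
    with s(2)[OF x] show "(\<lambda>i. t i x) \<longlonglongrightarrow> x" by (rule Lim_transform_eventually)
    show "x \<in> {0<..}" "\<forall>\<^sub>F i in sequentially. t i x \<in> {0<..}" using x0 by (auto simp: t_def)
  qed
  moreover have "simple_function halfline (\<lambda>x. f (t i x))" for i
    unfolding t_def by (rule simple_function_compose1[OF s(1)[of i], of "\<lambda>y. f (if 0 < y then y else 1)"])
  ultimately show ?thesis
    unfolding strongly_measurable_def by (intro exI[of _ "\<lambda>i x. f (t i x)"]) blast
qed

lemma simple_function_finite_support_sets:
  assumes "simple_function M f" shows "{x\<in>space M. f x \<noteq> c} \<in> sets M"
proof -
  have "{x\<in>space M. f x \<noteq> c} = space M - (f -` {c} \<inter> space M)" by auto
  then show ?thesis using simple_functionD(2)[OF assms, of "{c}"] by auto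
qed

section \<open>The strong integral\<close>

lemma simple_bochner_strongly_measurable:
  "Bochner_Integration.simple_bochner_integrable M s \<Longrightarrow> strongly_measurable M s"
  by (rule strongly_measurable_simple) (auto elim: simple_bochner_integrable.cases)

lemma simple_bochner_integral_norm_le:
  assumes "Bochner_Integration.simple_bochner_integrable M s"
  shows "ennreal (norm (Bochner_Integration.simple_bochner_integral M s)) \<le> (\<integral>\<^sup>+x. norm (s x) \<partial>M)"
proof -
  have "Bochner_Integration.simple_bochner_integrable M (\<lambda>x. norm (s x))"
    using simple_bochner_integrable_compose2[of "\<lambda>x y. norm x" M s s] assms by auto
  then have "Bochner_Integration.simple_bochner_integral M (\<lambda>x. norm (s x)) = (\<integral>\<^sup>+x. norm (s x) \<partial>M)"
    by (rule simple_bochner_integral_eq_nn_integral) simp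
  with simple_bochner_integral_norm_bound[OF assms] show ?thesis by (metis ennreal_leI)
qed

text \<open>The estimate for simple functions passes to the limit. Applied to a difference, it gives the
  uniqueness of the integral.\<close>

lemma has_strong_integral_norm_le:
  assumes "has_strong_integral M f I" shows "ennreal (norm I) \<le> (\<integral>\<^sup>+x. norm (f x) \<partial>M)"
proof -
  from assms obtain s where f: "strongly_measurable M f"
    and s: "\<And>i. Bochner_Integration.simple_bochner_integrable M (s i)"
      "(\<lambda>i. \<integral>\<^sup>+x. ennreal (norm (f x - s i x)) \<partial>M) \<longlonglongrightarrow> 0"
      "(\<lambda>i. Bochner_Integration.simple_bochner_integral M (s i)) \<longlonglongrightarrow> I"
    unfolding has_strong_integral_def by blast
  note sm = simple_bochner_strongly_measurable[OF s(1)]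
  have le: "ennreal (norm (Bochner_Integration.simple_bochner_integral M (s i)))
      \<le> (\<integral>\<^sup>+x. norm (f x - s i x) \<partial>M) + (\<integral>\<^sup>+x. norm (f x) \<partial>M)" for i
  proof -
    have "(\<integral>\<^sup>+x. norm (s i x) \<partial>M) \<le> (\<integral>\<^sup>+x. ennreal (norm (f x - s i x)) + norm (f x) \<partial>M)"
    proof (rule nn_integral_mono)
      fix x show "ennreal (norm (s i x)) \<le> ennreal (norm (f x - s i x)) + norm (f x)"
        using norm_triangle_sub[of "s i x" "f x"] by (intro ennreal_le_plus) (auto simp: norm_minus_commute)
    qed
    also have "\<dots> = (\<integral>\<^sup>+x. norm (f x - s i x) \<partial>M) + (\<integral>\<^sup>+x. norm (f x) \<partial>M)"
      using borel_measurable_norm_diff_strongly[OF f sm, of i] borel_measurable_norm_strongly[OF f]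
      by (intro nn_integral_add) auto
    finally show ?thesis using simple_bochner_integral_norm_le[OF s(1)] by (rule order_trans[rotated])
  qed
  show ?thesis
  proof (rule LIMSEQ_le[OF tendsto_ennrealI[OF tendsto_norm[OF s(3)]]])
    show "(\<lambda>i. (\<integral>\<^sup>+x. norm (f x - s i x) \<partial>M) + (\<integral>\<^sup>+x. norm (f x) \<partial>M)) \<longlonglongrightarrow> (\<integral>\<^sup>+x. norm (f x) \<partial>M)"
      using tendsto_add[OF s(2) tendsto_const[of "\<integral>\<^sup>+x. norm (f x) \<partial>M"]] by simp
  qed (use le in blast)
qed

lemma has_strong_integral_add:
  assumes "has_strong_integral M f I" "has_strong_integral M g J"
  shows "has_strong_integral M (\<lambda>x. f x + g x) (I + J)"
proof -
  from assms(1) obtain s where f: "strongly_measurable M f"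
    and s: "\<And>i. Bochner_Integration.simple_bochner_integrable M (s i)"
      "(\<lambda>i. \<integral>\<^sup>+x. ennreal (norm (f x - s i x)) \<partial>M) \<longlonglongrightarrow> 0"
      "(\<lambda>i. Bochner_Integration.simple_bochner_integral M (s i)) \<longlonglongrightarrow> I"
    unfolding has_strong_integral_def by blast
  from assms(2) obtain t where g: "strongly_measurable M g"
    and t: "\<And>i. Bochner_Integration.simple_bochner_integrable M (t i)"
      "(\<lambda>i. \<integral>\<^sup>+x. ennreal (norm (g x - t i x)) \<partial>M) \<longlonglongrightarrow> 0"
      "(\<lambda>i. Bochner_Integration.simple_bochner_integral M (t i)) \<longlonglongrightarrow> J"
    unfolding has_strong_integral_def by blast
  note sm = simple_bochner_strongly_measurable[OF s(1)] simple_bochner_strongly_measurable[OF t(1)]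
  have le: "(\<integral>\<^sup>+x. ennreal (norm (f x + g x - (s i x + t i x))) \<partial>M)
      \<le> (\<integral>\<^sup>+x. norm (f x - s i x) \<partial>M) + (\<integral>\<^sup>+x. norm (g x - t i x) \<partial>M)" for i
  proof -
    have "(\<integral>\<^sup>+x. ennreal (norm (f x + g x - (s i x + t i x))) \<partial>M)
      \<le> (\<integral>\<^sup>+x. ennreal (norm (f x - s i x)) + norm (g x - t i x) \<partial>M)"
      by (intro nn_integral_mono ennreal_le_plus norm_diff_triangle_ineq) auto
    also have "\<dots> = (\<integral>\<^sup>+x. norm (f x - s i x) \<partial>M) + (\<integral>\<^sup>+x. norm (g x - t i x) \<partial>M)"
      using borel_measurable_norm_diff_strongly[OF f sm(1), of i] borel_measurable_norm_diff_strongly[OF g sm(2), of i]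
      by (intro nn_integral_add) auto
    finally show ?thesis .
  qed
  show ?thesis unfolding has_strong_integral_def
  proof (intro conjI exI[of _ "\<lambda>i x. s i x + t i x"] allI)
    show "strongly_measurable M (\<lambda>x. f x + g x)" by (rule strongly_measurable_add[OF f g])
    show "Bochner_Integration.simple_bochner_integrable M (\<lambda>x. s i x + t i x)" for i
      using s(1) t(1) by (simp add: simple_bochner_integrable_compose2)
    show "(\<lambda>i. Bochner_Integration.simple_bochner_integral M (\<lambda>x. s i x + t i x)) \<longlonglongrightarrow> I + J"
      using tendsto_add[OF s(3) t(3)] by (simp add: simple_bochner_integral_add s(1) t(1))
    show "(\<lambda>i. \<integral>\<^sup>+ x. ennreal (norm (f x + g x - (s i x + t i x))) \<partial>M) \<longlonglongrightarrow> 0"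
      by (rule tendsto_sandwich[OF _ _ tendsto_const tendsto_add[OF s(2) t(2), simplified]]) (use le in auto)
  qed
qed

lemma has_strong_integral_bounded_linear:
  assumes T: "bounded_linear T" and "has_strong_integral M f I"
  shows "has_strong_integral M (\<lambda>x. T (f x)) (T I)"
proof -
  interpret T: bounded_linear T by fact
  from assms(2) obtain s where f: "strongly_measurable M f"
    and s: "\<And>i. Bochner_Integration.simple_bochner_integrable M (s i)"
      "(\<lambda>i. \<integral>\<^sup>+x. ennreal (norm (f x - s i x)) \<partial>M) \<longlonglongrightarrow> 0"
      "(\<lambda>i. Bochner_Integration.simple_bochner_integral M (s i)) \<longlonglongrightarrow> I"
    unfolding has_strong_integral_def by blast
  note sm = simple_bochner_strongly_measurable[OF s(1)]
  obtain K where K: "K > 0" "\<And>x. norm (T x) \<le> norm x * K" using T.pos_bounded by auto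
  have le: "(\<integral>\<^sup>+x. ennreal (norm (T (f x) - T (s i x))) \<partial>M) \<le> ennreal K * (\<integral>\<^sup>+x. norm (f x - s i x) \<partial>M)" for i
  proof -
    have "(\<integral>\<^sup>+x. ennreal (norm (T (f x) - T (s i x))) \<partial>M) \<le> (\<integral>\<^sup>+x. ennreal K * norm (f x - s i x) \<partial>M)"
      using K by (intro nn_integral_mono) (auto simp: ac_simps ennreal_mult[symmetric] T.diff[symmetric] intro: ennreal_leI)
    also have "\<dots> = ennreal K * (\<integral>\<^sup>+x. norm (f x - s i x) \<partial>M)"
      using borel_measurable_norm_diff_strongly[OF f sm, of i] by (intro nn_integral_cmult) auto
    finally show ?thesis .
  qed
  show ?thesis unfolding has_strong_integral_def
  proof (intro conjI exI[of _ "\<lambda>i x. T (s i x)"] allI)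
    show "strongly_measurable M (\<lambda>x. T (f x))"
      by (rule strongly_measurable_compose[OF f]) (intro T.continuous_on continuous_on_id)
    show "Bochner_Integration.simple_bochner_integrable M (\<lambda>x. T (s i x))" for i
      using simple_bochner_integrable_compose2[of "\<lambda>x y. T x" M "s i" "s i"] s(1) T.zero by auto
    show "(\<lambda>i. Bochner_Integration.simple_bochner_integral M (\<lambda>x. T (s i x))) \<longlonglongrightarrow> T I"
      using T.tendsto[OF s(3)] by (simp add: simple_bochner_integral_linear[OF T.linear_axioms] s(1))
    have "(\<lambda>i. ennreal K * (\<integral>\<^sup>+x. norm (f x - s i x) \<partial>M)) \<longlonglongrightarrow> 0"
      using ennreal_tendsto_cmult[OF _ s(2), of "ennreal K"] by simp
    from tendsto_sandwich[OF _ _ tendsto_const this]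
    show "(\<lambda>i. \<integral>\<^sup>+ x. ennreal (norm (T (f x) - T (s i x))) \<partial>M) \<longlonglongrightarrow> 0"
      using le by simp
  qed
qed

lemma has_strong_integral_diff:
  assumes "has_strong_integral M f I" "has_strong_integral M g J"
  shows "has_strong_integral M (\<lambda>x. f x - g x) (I - J)"
  using has_strong_integral_add[OF assms(1) has_strong_integral_bounded_linear[OF bounded_linear_minus[OF bounded_linear_ident] assms(2)]]
  by simp

lemma has_strong_integral_unique:
  assumes "has_strong_integral M f I" "has_strong_integral M f J" shows "I = J"
  using has_strong_integral_norm_le[OF has_strong_integral_diff[OF assms]] by simp

lemma strong_integral_eqI: "has_strong_integral M f I \<Longrightarrow> strong_integral M f = I"
  unfolding strong_integral_def using has_strong_integral_unique by blast

definition strong_integrable :: "'s measure \<Rightarrow> ('s \<Rightarrow> 'a::real_normed_vector) \<Rightarrow> bool" where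
  "strong_integrable M f \<longleftrightarrow> strongly_measurable M f \<and> (\<integral>\<^sup>+x. norm (f x) \<partial>M) < \<infinity>"

text \<open>Simple functions that converge to \<open>f\<close> pointwise are cut off where their norm exceeds twice
  that of a simple minorant of \<^term>\<open>norm \<circ> f\<close>; this makes dominated convergence applicable.\<close>

lemma strong_integrable_approx:
  assumes "strong_integrable M f"
  obtains s where "\<And>i::nat. Bochner_Integration.simple_bochner_integrable M (s i)"
    "(\<lambda>i. \<integral>\<^sup>+x. ennreal (norm (f x - s i x)) \<partial>M) \<longlonglongrightarrow> 0"
proof -
  from assms have f: "strongly_measurable M f" and fin: "(\<integral>\<^sup>+x. norm (f x) \<partial>M) < \<infinity>"
    by (auto simp: strong_integrable_def)
  note nf[measurable] = borel_measurable_norm_strongly[OF f]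
  obtain s where s: "\<And>i::nat. simple_function M (s i)" "\<And>x. x \<in> space M \<Longrightarrow> (\<lambda>i. s i x) \<longlonglongrightarrow> f x"
    using f unfolding strongly_measurable_def by blast
  obtain r where r: "\<And>i. simple_function M (r i)" "\<And>x i. 0 \<le> r i x" "\<And>x i. r i x \<le> norm (f x)"
    "\<And>x. (\<lambda>i. r i x) \<longlonglongrightarrow> norm (f x)"
  proof -
    obtain r where r: "\<And>i. simple_function M (r i)" "incseq r" "\<And>i x. 0 \<le> r i x" "\<And>x. (\<lambda>i. r i x) \<longlonglongrightarrow> norm (f x)"
    proof -
      obtain r where r: "\<And>i. simple_function M (r i)" "incseq r" "\<And>i x. 0 \<le> r i x"
        "\<And>x. bdd_above (range (\<lambda>i. r i x))" "(\<lambda>x. norm (f x)) = Sup (range r)"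
        using borel_measurable_implies_simple_function_sequence_real[OF nf] by auto
      have "(\<lambda>i. r i x) \<longlonglongrightarrow> norm (f x)" for x
      proof -
        have "norm (f x) = (SUP i. r i x)" using fun_cong[OF r(5), of x] by (simp add: image_comp)
        then show ?thesis
          using LIMSEQ_incseq_SUP[OF r(4)[of x]] r(2) by (simp add: incseq_def le_fun_def)
      qed
      with r show thesis by (intro that[of r]) auto
    qed
    have "r i x \<le> norm (f x)" for i x
      using incseq_le[OF _ r(4)] r(2) by (auto simp: incseq_def le_fun_def)
    with r show thesis by (intro that[of r]) auto
  qed
  (* The factor 2 makes the condition hold eventually wherever f x is not 0; where f x = 0 the
     minorant vanishes and so does t i x. *)
  define t where "t i x = (if norm (s i x) \<le> 2 * r i x then s i x else 0)" for i x
  have st: "simple_function M (t i)" for i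
    unfolding t_def by (rule simple_function_compose2[OF s(1)[of i] r(1)[of i], of "\<lambda>a b. if norm a \<le> 2 * b then a else 0"])
  have nt: "norm (t i x) \<le> 2 * norm (f x)" for i x
    using r(2,3)[of i x] by (auto simp: t_def intro: order_trans)
  have lim: "(\<lambda>i. t i x) \<longlonglongrightarrow> f x" if x: "x \<in> space M" for x
  proof (cases "f x = 0")
    case True
    then have "r i x = 0" for i using r(2,3)[of i x] by simp
    then have "t i x = 0" for i by (auto simp: t_def)
    then show ?thesis using True by simp
  next
    case False
    have "(\<lambda>i. 2 * r i x - norm (s i x)) \<longlonglongrightarrow> 2 * norm (f x) - norm (f x)"
      by (intro tendsto_intros r(4) s(2)[OF x])
    then have "eventually (\<lambda>i. 2 * r i x - norm (s i x) > 0) sequentially"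
      using False by (intro order_tendstoD(1)) auto
    then have "eventually (\<lambda>i. s i x = t i x) sequentially" by eventually_elim (simp add: t_def)
    with s(2)[OF x] show ?thesis by (rule Lim_transform_eventually)
  qed
  have fin2: "(\<integral>\<^sup>+x. ennreal (3 * norm (f x)) \<partial>M) < \<infinity>"
    using fin by (simp add: ennreal_mult nn_integral_cmult ennreal_mult_less_top)
  have fint: "(\<integral>\<^sup>+x. ennreal (norm (t i x)) \<partial>M) < \<infinity>" for i
    by (rule le_less_trans[OF nn_integral_mono fin2], rule ennreal_leI, rule order_trans[OF nt]) simp
  show thesis
  proof
    show "Bochner_Integration.simple_bochner_integrable M (t i)" for i
      using st fint by (rule simple_bochner_integrableI_bounded)
    have "(\<lambda>i. \<integral>\<^sup>+x. ennreal (norm (f x - t i x)) \<partial>M) \<longlonglongrightarrow> (\<integral>\<^sup>+x. 0 \<partial>M)"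
    proof (rule nn_integral_dominated_convergence[where w="\<lambda>x. ennreal (3 * norm (f x))"])
      show "(\<lambda>x. ennreal (norm (f x - t i x))) \<in> borel_measurable M" for i
        using borel_measurable_norm_diff_strongly[OF f strongly_measurable_simple[OF st]] by measurable
      show "AE x in M. ennreal (norm (f x - t i x)) \<le> ennreal (3 * norm (f x))" for i
      proof (intro AE_I2 ennreal_leI)
        fix x show "norm (f x - t i x) \<le> 3 * norm (f x)"
          using nt[of i x] norm_triangle_ineq4[of "f x" "t i x"] by linarith
      qed
      show "AE x in M. (\<lambda>i. ennreal (norm (f x - t i x))) \<longlonglongrightarrow> 0"
      proof (rule AE_I2)
        fix x assume "x \<in> space M"
        from tendsto_ennrealI[OF tendsto_norm[OF tendsto_diff[OF tendsto_const[of "f x"] lim[OF this]]]]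
        show "(\<lambda>i. ennreal (norm (f x - t i x))) \<longlonglongrightarrow> 0" by simp
      qed
    qed (use fin2 in auto)
    then show "(\<lambda>i. \<integral>\<^sup>+x. ennreal (norm (f x - t i x)) \<partial>M) \<longlonglongrightarrow> 0" by simp
  qed
qed

text \<open>The integrals of the approximating simple functions form a Cauchy sequence, because the
  distance of two of them is at most the sum of their \<open>L\<^sup>1\<close>-distances to \<open>f\<close>; this is where
  completeness of the space of values enters.\<close>

lemma strong_integrable_has_strong_integral:
  fixes f :: "'s \<Rightarrow> 'a::banach"
  assumes "strong_integrable M f" shows "has_strong_integral M f (strong_integral M f)"
proof -
  from assms have f: "strongly_measurable M f" by (auto simp: strong_integrable_def)
  obtain s where s: "\<And>i::nat. Bochner_Integration.simple_bochner_integrable M (s i)"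
    and lim: "(\<lambda>i. \<integral>\<^sup>+x. ennreal (norm (f x - s i x)) \<partial>M) \<longlonglongrightarrow> 0"
    using strong_integrable_approx[OF assms] by blast
  note sm = simple_bochner_strongly_measurable[OF s]
  let ?S = "\<lambda>i. Bochner_Integration.simple_bochner_integral M (s i)"
  have d: "ennreal (norm (?S i - ?S j)) \<le>
      (\<integral>\<^sup>+x. norm (f x - s i x) \<partial>M) + (\<integral>\<^sup>+x. norm (f x - s j x) \<partial>M)" for i j
  proof -
    have "Bochner_Integration.simple_bochner_integrable M (\<lambda>x. s i x - s j x)"
      using simple_bochner_integrable_compose2[of "(-)" M "s i" "s j"] s by auto
    from simple_bochner_integral_norm_le[OF this]
    have "ennreal (norm (?S i - ?S j)) \<le> (\<integral>\<^sup>+x. norm (s i x - s j x) \<partial>M)"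
      by (simp add: simple_bochner_integral_diff s)
    also have "\<dots> \<le> (\<integral>\<^sup>+x. ennreal (norm (f x - s i x)) + norm (f x - s j x) \<partial>M)"
    proof (rule nn_integral_mono)
      fix x show "ennreal (norm (s i x - s j x)) \<le> ennreal (norm (f x - s i x)) + norm (f x - s j x)"
        using norm_triangle_ineq4[of "f x - s j x" "f x - s i x"]
        by (intro ennreal_le_plus) (auto simp: algebra_simps)
    qed
    also have "\<dots> = (\<integral>\<^sup>+x. norm (f x - s i x) \<partial>M) + (\<integral>\<^sup>+x. norm (f x - s j x) \<partial>M)"
      using borel_measurable_norm_diff_strongly[OF f sm, of i] borel_measurable_norm_diff_strongly[OF f sm, of j]
      by (intro nn_integral_add) auto
    finally show ?thesis .
  qed
  have "Cauchy ?S"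
  proof (rule metric_CauchyI)
    fix e :: real assume e: "e > 0"
    then have "eventually (\<lambda>i. (\<integral>\<^sup>+x. norm (f x - s i x) \<partial>M) < ennreal (e/2)) sequentially"
      by (intro order_tendstoD(2)[OF lim]) simp
    then obtain N where N: "\<And>i. i \<ge> N \<Longrightarrow> (\<integral>\<^sup>+x. norm (f x - s i x) \<partial>M) < ennreal (e/2)"
      by (auto simp: eventually_sequentially)
    have "dist (?S i) (?S j) < e" if "i \<ge> N" "j \<ge> N" for i j
    proof -
      have "ennreal (norm (?S i - ?S j)) < ennreal (e/2) + ennreal (e/2)"
        using d[of i j] add_strict_mono[OF N[OF that(1)] N[OF that(2)]] by (rule le_less_trans)
      also have "\<dots> = ennreal e" using e by (subst ennreal_plus[symmetric]) auto
      finally show ?thesis by (simp add: dist_norm ennreal_less_iff)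
    qed
    then show "\<exists>N. \<forall>i\<ge>N. \<forall>j\<ge>N. dist (?S i) (?S j) < e" by blast
  qed
  then obtain I where "?S \<longlonglongrightarrow> I" by (auto simp: Cauchy_convergent_iff convergent_def)
  then have "has_strong_integral M f I" unfolding has_strong_integral_def using f s lim by blast
  then show ?thesis by (simp add: strong_integral_eqI)
qed

lemma strong_integral_norm_le:
  fixes f :: "'s \<Rightarrow> 'a::banach"
  shows "strong_integrable M f \<Longrightarrow> ennreal (norm (strong_integral M f)) \<le> (\<integral>\<^sup>+x. norm (f x) \<partial>M)"
  by (rule has_strong_integral_norm_le[OF strong_integrable_has_strong_integral])

lemma strong_integrable_bound:
  assumes "strongly_measurable M f" "strong_integrable M g" "C \<ge> 0"
    "\<And>x. x \<in> space M \<Longrightarrow> norm (f x) \<le> C * norm (g x)"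
  shows "strong_integrable M f"
proof -
  have "(\<integral>\<^sup>+x. norm (f x) \<partial>M) \<le> (\<integral>\<^sup>+x. ennreal C * norm (g x) \<partial>M)"
    using assms by (intro nn_integral_mono) (auto simp: ennreal_mult[symmetric] intro: ennreal_leI)
  also have "\<dots> = ennreal C * (\<integral>\<^sup>+x. norm (g x) \<partial>M)"
    using assms(2) borel_measurable_norm_strongly[of M g]
    by (intro nn_integral_cmult) (auto simp: strong_integrable_def)
  also have "\<dots> < \<infinity>" using assms(2) by (simp add: strong_integrable_def ennreal_mult_less_top)
  finally show ?thesis using assms(1) by (simp add: strong_integrable_def)
qed

lemma strong_integrable_add:
  assumes "strong_integrable M f" "strong_integrable M g"
  shows "strong_integrable M (\<lambda>x. f x + g x)"
proof -
  have "(\<integral>\<^sup>+x. norm (f x + g x) \<partial>M) \<le> (\<integral>\<^sup>+x. ennreal (norm (f x)) + norm (g x) \<partial>M)"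
    by (intro nn_integral_mono ennreal_le_plus norm_triangle_ineq) auto
  also have "\<dots> = (\<integral>\<^sup>+x. norm (f x) \<partial>M) + (\<integral>\<^sup>+x. norm (g x) \<partial>M)"
    using assms borel_measurable_norm_strongly[of M f] borel_measurable_norm_strongly[of M g]
    by (intro nn_integral_add) (auto simp: strong_integrable_def)
  also have "\<dots> < \<infinity>" using assms by (simp add: strong_integrable_def)
  finally show ?thesis using assms strongly_measurable_add by (auto simp: strong_integrable_def)
qed

lemma strong_integrable_bounded_linear:
  assumes "bounded_linear T" "strong_integrable M f" shows "strong_integrable M (\<lambda>x. T (f x))"
proof -
  interpret T: bounded_linear T by fact
  obtain K where K: "K > 0" "\<And>x. norm (T x) \<le> norm x * K" using T.pos_bounded by auto
  have "strongly_measurable M (\<lambda>x. T (f x))"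
    by (rule strongly_measurable_compose[OF _ T.continuous_on[OF continuous_on_id]])
      (use assms(2) in \<open>simp add: strong_integrable_def\<close>)
  then show ?thesis
    by (rule strong_integrable_bound[OF _ assms(2), where C=K]) (use K in \<open>auto simp: mult.commute\<close>)
qed

lemma strong_integrable_diff:
  "strong_integrable M f \<Longrightarrow> strong_integrable M g \<Longrightarrow> strong_integrable M (\<lambda>x. f x - g x)"
  using strong_integrable_add[of M f "\<lambda>x. - g x"]
    strong_integrable_bounded_linear[OF bounded_linear_minus[OF bounded_linear_ident], of M g] by simp

lemma strong_integral_add:
  fixes f :: "'s \<Rightarrow> 'a::banach"
  shows "strong_integrable M f \<Longrightarrow> strong_integrable M g \<Longrightarrow>
    strong_integral M (\<lambda>x. f x + g x) = strong_integral M f + strong_integral M g"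
  by (rule strong_integral_eqI[OF has_strong_integral_add[OF strong_integrable_has_strong_integral strong_integrable_has_strong_integral]])

lemma strong_integral_diff:
  fixes f :: "'s \<Rightarrow> 'a::banach"
  shows "strong_integrable M f \<Longrightarrow> strong_integrable M g \<Longrightarrow>
    strong_integral M (\<lambda>x. f x - g x) = strong_integral M f - strong_integral M g"
  by (rule strong_integral_eqI[OF has_strong_integral_diff[OF strong_integrable_has_strong_integral strong_integrable_has_strong_integral]])

lemma strong_integral_bounded_linear:
  fixes f :: "'s \<Rightarrow> 'a::banach"
  shows "bounded_linear T \<Longrightarrow> strong_integrable M f \<Longrightarrow>
    strong_integral M (\<lambda>x. T (f x)) = T (strong_integral M f)"
  by (rule strong_integral_eqI[OF has_strong_integral_bounded_linear[OF _ strong_integrable_has_strong_integral]])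

lemma strong_integral_scaleR:
  fixes f :: "'s \<Rightarrow> 'a::banach"
  shows "strong_integrable M f \<Longrightarrow> strong_integral M (\<lambda>x. c *\<^sub>R f x) = c *\<^sub>R strong_integral M f"
  by (rule strong_integral_bounded_linear[OF bounded_linear_scaleR_right])

lemma strong_integrable_zero: "strong_integrable M (\<lambda>x. 0)"
  by (simp add: strong_integrable_def strongly_measurable_const)

lemma strong_integral_AE_eq:
  fixes f :: "'s \<Rightarrow> 'a::banach"
  assumes f: "strong_integrable M f" and g: "strongly_measurable M g" and eq: "AE x in M. f x = g x"
  shows "strong_integrable M g" "strong_integral M g = strong_integral M f"
proof -
  have "(\<integral>\<^sup>+x. norm (g x) \<partial>M) = (\<integral>\<^sup>+x. norm (f x) \<partial>M)"
    using eq by (intro nn_integral_cong_AE) auto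
  then show i: "strong_integrable M g" using f g by (simp add: strong_integrable_def)
  have "(\<integral>\<^sup>+x. norm (g x - f x) \<partial>M) = (\<integral>\<^sup>+x. 0 \<partial>M)"
    using eq by (intro nn_integral_cong_AE) auto
  with strong_integral_norm_le[OF strong_integrable_diff[OF i f]]
  have "norm (strong_integral M (\<lambda>x. g x - f x)) = 0" by simp
  then show "strong_integral M g = strong_integral M f" by (simp add: strong_integral_diff[OF i f])
qed

lemma strong_integral_cong:
  fixes f :: "'s \<Rightarrow> 'a::banach"
  assumes "\<And>x. x \<in> space M \<Longrightarrow> f x = g x"
  shows "strong_integral M f = strong_integral M g"
proof -
  have "has_strong_integral M f I = has_strong_integral M g I" for I
    unfolding has_strong_integral_def strongly_measurable_def
    using assms by (simp cong: nn_integral_cong_simp)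
  then have "has_strong_integral M f = has_strong_integral M g" by blast
  then show ?thesis unfolding strong_integral_def by simp
qed

lemma strong_integral_zero [simp]: "strong_integral M (\<lambda>x. 0 :: 'a::banach) = 0"
  using strong_integral_norm_le[OF strong_integrable_zero, where 'a='a and M = M] by simp

lemma strong_integral_dominated_convergence:
  fixes f :: "'s \<Rightarrow> 'a::banach"
  assumes f: "strong_integrable M f" and g: "\<And>n::nat. strong_integrable M (g n)" and h: "strong_integrable M h"
    and dom: "\<And>n x. x \<in> space M \<Longrightarrow> norm (f x - g n x) \<le> norm (h x)"
    and lim: "\<And>x. x \<in> space M \<Longrightarrow> (\<lambda>n. g n x) \<longlonglongrightarrow> f x"
  shows "(\<lambda>n. strong_integral M (g n)) \<longlonglongrightarrow> strong_integral M f"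
proof -
  note [measurable] = borel_measurable_norm_strongly[of M h]
  have "(\<lambda>n. \<integral>\<^sup>+x. ennreal (norm (f x - g n x)) \<partial>M) \<longlonglongrightarrow> (\<integral>\<^sup>+x. 0 \<partial>M)"
  proof (rule nn_integral_dominated_convergence[where w="\<lambda>x. ennreal (norm (h x))"])
    show "(\<lambda>x. ennreal (norm (f x - g i x))) \<in> borel_measurable M" for i
      using borel_measurable_norm_diff_strongly[of M f "g i"] f g[of i] by (auto simp: strong_integrable_def)
    show "(\<lambda>x. ennreal (norm (h x))) \<in> borel_measurable M" "(\<integral>\<^sup>+x. ennreal (norm (h x)) \<partial>M) < \<infinity>"
      using h by (auto simp: strong_integrable_def)
    show "AE x in M. ennreal (norm (f x - g n x)) \<le> ennreal (norm (h x))" for n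
      using dom by (intro AE_I2 ennreal_leI) auto
    show "AE x in M. (\<lambda>n. ennreal (norm (f x - g n x))) \<longlonglongrightarrow> 0"
    proof (rule AE_I2)
      fix x assume "x \<in> space M"
      from tendsto_ennrealI[OF tendsto_norm[OF tendsto_diff[OF tendsto_const[of "f x"] lim[OF this]]]]
      show "(\<lambda>n. ennreal (norm (f x - g n x))) \<longlonglongrightarrow> 0" by simp
    qed
  qed auto
  then have l0: "(\<lambda>n. \<integral>\<^sup>+x. ennreal (norm (f x - g n x)) \<partial>M) \<longlonglongrightarrow> 0" by simp
  have "(\<lambda>n. ennreal (norm (strong_integral M f - strong_integral M (g n)))) \<longlonglongrightarrow> 0"
    by (rule tendsto_sandwich[OF _ _ tendsto_const l0])
      (use strong_integral_norm_le[OF strong_integrable_diff[OF f g]] in \<open>auto simp: strong_integral_diff[OF f g]\<close>)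
  then have "(\<lambda>n. norm (strong_integral M f - strong_integral M (g n))) \<longlonglongrightarrow> 0"
    by (subst (asm) ennreal_0[symmetric], subst (asm) tendsto_ennreal_iff) auto
  then have "(\<lambda>n. strong_integral M f - strong_integral M (g n)) \<longlonglongrightarrow> 0"
    by (rule tendsto_norm_zero_cancel)
  from tendsto_diff[OF tendsto_const[of "strong_integral M f"] this] show ?thesis by simp
qed

lemma strong_integral_indicator:
  fixes c :: "'a::banach" and M :: "'s measure"
  assumes "A \<in> sets M" "emeasure M A < \<infinity>"
  shows "strong_integrable M (\<lambda>x. indicator A x *\<^sub>R c)"
    "strong_integral M (\<lambda>x. indicator A x *\<^sub>R c) = measure M A *\<^sub>R c"
proof -
  have "has_strong_integral M (indicator A :: 's \<Rightarrow> real) (measure M A)"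
    using assms by (simp add: has_strong_integral_iff_has_bochner_integral has_bochner_integral_real_indicator)
  from has_strong_integral_bounded_linear[OF bounded_linear_scaleR_left this]
  show "strong_integral M (\<lambda>x. indicator A x *\<^sub>R c) = measure M A *\<^sub>R c" by (intro strong_integral_eqI)
  have "(\<integral>\<^sup>+x. norm (indicator A x *\<^sub>R c) \<partial>M) = (\<integral>\<^sup>+x. ennreal (norm c) * indicator A x \<partial>M)"
    by (intro nn_integral_cong) (auto split: split_indicator)
  also have "\<dots> < \<infinity>" using assms by (simp add: nn_integral_cmult_indicator ennreal_mult_less_top)
  finally show "strong_integrable M (\<lambda>x. indicator A x *\<^sub>R c)"
    using assms by (auto simp: strong_integrable_def intro!: strongly_measurable_scaleR strongly_measurable_const)
qed

text \<open>Let \<open>s\<close> be a simple function. On the level set \<open>A\<close> where \<open>s = y\<close> the hypothesis shows that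
  \<open>measure M A *\<^sub>R y\<close> is the integral of \<open>y - f\<close> over \<open>A\<close>. Summing over the finitely many values
  of \<open>s\<close> bounds the \<open>L\<^sup>1\<close>-norm of \<open>s\<close> by its distance to \<open>f\<close>, which can be made arbitrarily
  small. Unlike the usual proof by a countable norming set of functionals, this works in
  non-separable spaces.\<close>

lemma strong_integral_all_sets_zero_imp_AE_zero:
  fixes f :: "'s \<Rightarrow> 'a::banach"
  assumes f: "strong_integrable M f"
    and z: "\<And>A. A \<in> sets M \<Longrightarrow> strong_integral M (\<lambda>x. indicator A x *\<^sub>R f x) = 0"
  shows "AE x in M. f x = 0"
proof -
  obtain s where s: "\<And>i::nat. Bochner_Integration.simple_bochner_integrable M (s i)"
    and lim: "(\<lambda>i. \<integral>\<^sup>+x. ennreal (norm (f x - s i x)) \<partial>M) \<longlonglongrightarrow> 0"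
    using strong_integrable_approx[OF f] by blast
  have fm: "strongly_measurable M f" using f by (simp add: strong_integrable_def)
  note sm = simple_bochner_strongly_measurable[OF s]
  note [measurable] = borel_measurable_norm_diff_strongly[OF fm sm] borel_measurable_norm_strongly[OF fm]
    borel_measurable_norm_strongly[OF sm]
  have bound: "(\<integral>\<^sup>+x. norm (s i x) \<partial>M) \<le> (\<integral>\<^sup>+x. norm (f x - s i x) \<partial>M)" for i
  proof -
    have sf: "simple_function M (s i)" and fin: "emeasure M {x\<in>space M. s i x \<noteq> 0} \<noteq> \<infinity>"
      using s[of i] by (auto elim: simple_bochner_integrable.cases)
    let ?Y = "s i ` space M - {0}" and ?A = "\<lambda>y. s i -` {y} \<inter> space M"
    have fY: "finite ?Y" using sf by (auto simp: simple_function_def)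
    have Am[measurable]: "?A y \<in> sets M" for y using sf by (rule simple_functionD)
    have decomp: "ennreal (h x) * indicator (space M \<inter> {x. s i x \<noteq> 0}) x = (\<Sum>y\<in>?Y. ennreal (h x) * indicator (?A y) x)"
      if "x \<in> space M" for h :: "'s \<Rightarrow> real" and x
    proof (cases "s i x = 0")
      case True then show ?thesis by (auto intro!: sum.neutral[symmetric] split: split_indicator)
    next
      case False
      then have "(\<Sum>y\<in>?Y. ennreal (h x) * indicator (?A y) x) = (\<Sum>y\<in>{s i x}. ennreal (h x) * indicator (?A y) x)"
        using that fY by (intro sum.mono_neutral_right) (auto split: split_indicator)
      then show ?thesis using False that by simp
    qed
    have one: "(\<integral>\<^sup>+x. ennreal (norm (s i x)) * indicator (?A y) x \<partial>M)
        \<le> (\<integral>\<^sup>+x. ennreal (norm (f x - s i x)) * indicator (?A y) x \<partial>M)" if y: "y \<in> ?Y" for y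
    proof -
      have fA: "emeasure M (?A y) < \<infinity>"
        using fin y by (intro le_less_trans[OF emeasure_mono[of "?A y" "{x\<in>space M. s i x \<noteq> 0}"]])
          (auto simp: less_top intro!: simple_function_finite_support_sets[OF sf])
      note I = strong_integral_indicator[OF Am fA, of y]
      have J: "strong_integrable M (\<lambda>x. indicator (?A y) x *\<^sub>R f x)"
        by (rule strong_integrable_bound[OF strongly_measurable_scaleR[OF _ fm] f, where C=1])
          (auto split: split_indicator)
      have "(\<integral>\<^sup>+x. ennreal (norm (s i x)) * indicator (?A y) x \<partial>M) = (\<integral>\<^sup>+x. ennreal (norm y) * indicator (?A y) x \<partial>M)"
        by (intro nn_integral_cong) (auto split: split_indicator)
      also have "\<dots> = ennreal (norm y) * emeasure M (?A y)" by (simp add: nn_integral_cmult_indicator)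
      also have "\<dots> = ennreal (norm (measure M (?A y) *\<^sub>R y))"
        using fA by (simp add: emeasure_eq_ennreal_measure ennreal_mult[symmetric] mult.commute)
      also have "\<dots> = ennreal (norm (strong_integral M (\<lambda>x. indicator (?A y) x *\<^sub>R f x - indicator (?A y) x *\<^sub>R y)))"
        by (simp add: strong_integral_diff[OF J I(1)] I(2) z[OF Am])
      also have "\<dots> \<le> (\<integral>\<^sup>+x. norm (indicator (?A y) x *\<^sub>R f x - indicator (?A y) x *\<^sub>R y) \<partial>M)"
        by (rule strong_integral_norm_le[OF strong_integrable_diff[OF J I(1)]])
      also have "\<dots> = (\<integral>\<^sup>+x. ennreal (norm (f x - s i x)) * indicator (?A y) x \<partial>M)"
        by (intro nn_integral_cong) (auto split: split_indicator)
      finally show ?thesis .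
    qed
    have "(\<integral>\<^sup>+x. norm (s i x) \<partial>M) = (\<integral>\<^sup>+x. ennreal (norm (s i x)) * indicator (space M \<inter> {x. s i x \<noteq> 0}) x \<partial>M)"
      by (intro nn_integral_cong) (auto split: split_indicator)
    also have "\<dots> = (\<integral>\<^sup>+x. (\<Sum>y\<in>?Y. ennreal (norm (s i x)) * indicator (?A y) x) \<partial>M)"
      by (intro nn_integral_cong decomp)
    also have "\<dots> = (\<Sum>y\<in>?Y. \<integral>\<^sup>+x. ennreal (norm (s i x)) * indicator (?A y) x \<partial>M)"
      by (intro nn_integral_sum) auto
    also have "\<dots> \<le> (\<Sum>y\<in>?Y. \<integral>\<^sup>+x. ennreal (norm (f x - s i x)) * indicator (?A y) x \<partial>M)"
      by (intro sum_mono one)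
    also have "\<dots> = (\<integral>\<^sup>+x. (\<Sum>y\<in>?Y. ennreal (norm (f x - s i x)) * indicator (?A y) x) \<partial>M)"
      by (intro nn_integral_sum[symmetric]) auto
    also have "\<dots> = (\<integral>\<^sup>+x. ennreal (norm (f x - s i x)) * indicator (space M \<inter> {x. s i x \<noteq> 0}) x \<partial>M)"
      by (intro nn_integral_cong decomp[symmetric])
    also have "\<dots> \<le> (\<integral>\<^sup>+x. norm (f x - s i x) \<partial>M)"
      by (intro nn_integral_mono) (auto split: split_indicator)
    finally show ?thesis .
  qed
  have "(\<integral>\<^sup>+x. norm (f x) \<partial>M) \<le> 0"
  proof (rule LIMSEQ_le_const)
    show "(\<lambda>i. (\<integral>\<^sup>+x. norm (f x - s i x) \<partial>M) + (\<integral>\<^sup>+x. norm (f x - s i x) \<partial>M)) \<longlonglongrightarrow> 0"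
      using tendsto_add[OF lim lim] by simp
    have "(\<integral>\<^sup>+x. norm (f x) \<partial>M) \<le> (\<integral>\<^sup>+x. norm (f x - s i x) \<partial>M) + (\<integral>\<^sup>+x. norm (f x - s i x) \<partial>M)" for i
    proof -
      have "(\<integral>\<^sup>+x. norm (f x) \<partial>M) \<le> (\<integral>\<^sup>+x. ennreal (norm (f x - s i x)) + norm (s i x) \<partial>M)"
        using norm_triangle_sub[of "f x" "s i x" for x]
        by (intro nn_integral_mono ennreal_le_plus) (auto simp: add.commute)
      also have "\<dots> = (\<integral>\<^sup>+x. norm (f x - s i x) \<partial>M) + (\<integral>\<^sup>+x. norm (s i x) \<partial>M)"
        by (intro nn_integral_add) auto
      finally show ?thesis using bound[of i] by (meson add_left_mono order_trans)
    qed
    then show "\<exists>N. \<forall>i\<ge>N. (\<integral>\<^sup>+x. norm (f x) \<partial>M) \<le>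
       (\<integral>\<^sup>+x. norm (f x - s i x) \<partial>M) + (\<integral>\<^sup>+x. norm (f x - s i x) \<partial>M)" by blast
  qed
  then show ?thesis by (simp add: nn_integral_0_iff_AE)
qed

section \<open>Locally absolutely continuous functions on the half-line\<close>

lemma space_halfline [simp]: "space halfline = {0<..}"
  by (simp add: space_restrict_space)

lemma borel_measurable_halfline: "f \<in> borel_measurable borel \<Longrightarrow> f \<in> borel_measurable halfline"
  by (intro measurable_restrict_space1) simp

lemma borel_measurable_halfline_indicator [measurable]:
  "A \<in> sets borel \<Longrightarrow> indicator A \<in> borel_measurable halfline"
  "A \<in> sets borel \<Longrightarrow> (indicator A :: real \<Rightarrow> ennreal) \<in> borel_measurable halfline"
  by (intro borel_measurable_halfline borel_measurable_indicator; simp)+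

lemma strong_integrable_indicator:
  assumes "strong_integrable halfline f" "A \<in> sets borel"
  shows "strong_integrable halfline (\<lambda>t. indicator A t *\<^sub>R f t)"
proof -
  have "strongly_measurable halfline (\<lambda>t. indicator A t *\<^sub>R f t)"
    using assms by (intro strongly_measurable_scaleR borel_measurable_halfline_indicator)
      (auto simp: strong_integrable_def)
  then show ?thesis
    by (rule strong_integrable_bound[OF _ assms(1), where C=1]) (auto split: split_indicator)
qed

text \<open>Half-open intervals make the integral additive over adjacent intervals as an identity of
  integrands, without an exceptional point.\<close>

abbreviation ivl_integral :: "real \<Rightarrow> real \<Rightarrow> (real \<Rightarrow> 'a) \<Rightarrow> 'a::real_normed_vector" where
  "ivl_integral x y f \<equiv> strong_integral halfline (\<lambda>t. indicator {x<..y} t *\<^sub>R f t)"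

abbreviation ivl_integrable :: "real \<Rightarrow> real \<Rightarrow> (real \<Rightarrow> 'a::real_normed_vector) \<Rightarrow> bool" where
  "ivl_integrable x y f \<equiv> strong_integrable halfline (\<lambda>t. indicator {x<..y} t *\<^sub>R f t)"

lemma ivl_integrable_subset:
  assumes "ivl_integrable x y f" "x \<le> u" "v \<le> y"
  shows "ivl_integrable u v f"
proof -
  have "(\<lambda>t. indicator {u<..v} t *\<^sub>R indicator {x<..y} t *\<^sub>R f t) = (\<lambda>t. indicator {u<..v} t *\<^sub>R f t)"
    using assms by (auto split: split_indicator)
  then show ?thesis using strong_integrable_indicator[OF assms(1), of "{u<..v}"] by simp
qed

lemma ivl_integral_split:
  fixes f :: "real \<Rightarrow> 'a::banach"
  assumes "ivl_integrable x z f" "x \<le> y" "y \<le> z"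
  shows "ivl_integral x z f = ivl_integral x y f + ivl_integral y z f"
proof -
  have "ivl_integrable x y f" "ivl_integrable y z f"
    using assms by (auto intro: ivl_integrable_subset)
  from strong_integral_add[OF this]
  have "ivl_integral x y f + ivl_integral y z f
      = strong_integral halfline (\<lambda>t. indicator {x<..y} t *\<^sub>R f t + indicator {y<..z} t *\<^sub>R f t)" by simp
  also have "(\<lambda>t. indicator {x<..y} t *\<^sub>R f t + indicator {y<..z} t *\<^sub>R f t) = (\<lambda>t. indicator {x<..z} t *\<^sub>R f t)"
    using assms(2,3) by (auto simp: fun_eq_iff split: split_indicator)
  finally show ?thesis by simp
qed

lemma ivl_integral_empty [simp]: "y \<le> x \<Longrightarrow> ivl_integral x y (f :: real \<Rightarrow> 'a::banach) = 0"
proof -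
  assume "y \<le> x"
  then have "(\<lambda>t. indicator {x<..y} t *\<^sub>R f t) = (\<lambda>t. 0)" by auto
  then show ?thesis by simp
qed

lemma norm_indicator_scaleR:
  "ennreal (norm (indicator A t *\<^sub>R f t)) = ennreal (norm (f t)) * indicator A t"
  by (auto split: split_indicator)

lemma ivl_integral_norm_le:
  fixes f :: "real \<Rightarrow> 'a::banach"
  assumes "ivl_integrable x y f"
  shows "ennreal (norm (ivl_integral x y f)) \<le> (\<integral>\<^sup>+t. ennreal (norm (f t)) * indicator {x<..y} t \<partial>halfline)"
  using strong_integral_norm_le[OF assms] unfolding norm_indicator_scaleR .

lemma ivl_integrable_iff:
  assumes "strongly_measurable halfline f"
  shows "ivl_integrable x y f \<longleftrightarrow> (\<integral>\<^sup>+t. ennreal (norm (f t)) * indicator {x<..y} t \<partial>halfline) < \<infinity>"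
proof -
  have "strongly_measurable halfline (\<lambda>t. indicator {x<..y} t *\<^sub>R f t)"
    by (intro strongly_measurable_scaleR borel_measurable_halfline_indicator assms) simp
  then show ?thesis unfolding strong_integrable_def norm_indicator_scaleR by blast
qed

text \<open>A compact subset of the open half-line stays away from \<open>0\<close>, so it is enough to consider
  intervals with positive left end point.\<close>

lemma locally_integrable_iff:
  "locally_integrable f \<longleftrightarrow> strongly_measurable halfline f \<and> (\<forall>x y. 0 < x \<longrightarrow> ivl_integrable x y f)"
proof (intro iffI conjI allI impI)
  assume l: "locally_integrable f"
  then show sm: "strongly_measurable halfline f" by (simp add: locally_integrable_def)
  fix x y :: real assume x: "0 < x"
  have "set_integrable halfline {x..y} (\<lambda>t. norm (f t))"
    using l x by (simp add: locally_integrable_def subset_iff)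
  then have "(\<integral>\<^sup>+t. ennreal (norm (indicator {x..y} t *\<^sub>R norm (f t))) \<partial>halfline) < \<infinity>"
    by (simp add: set_integrable_def integrable_iff_bounded)
  moreover have "(\<integral>\<^sup>+t. ennreal (norm (f t)) * indicator {x<..y} t \<partial>halfline)
     \<le> (\<integral>\<^sup>+t. ennreal (norm (indicator {x..y} t *\<^sub>R norm (f t))) \<partial>halfline)"
    by (intro nn_integral_mono) (auto split: split_indicator)
  ultimately show "ivl_integrable x y f" by (simp add: ivl_integrable_iff[OF sm])
next
  assume a: "strongly_measurable halfline f \<and> (\<forall>x y. 0 < x \<longrightarrow> ivl_integrable x y f)"
  then have sm: "strongly_measurable halfline f" by blast
  note [measurable] = borel_measurable_norm_strongly[OF sm]
  show "locally_integrable f" unfolding locally_integrable_def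
  proof (intro conjI allI impI sm)
    fix K :: "real set" assume K: "compact K" "K \<subseteq> {0<..}"
    show "set_integrable halfline K (\<lambda>x. norm (f x))"
    proof (cases "K = {}")
      case True then show ?thesis by (simp add: set_integrable_def)
    next
      case False
      obtain s where s: "s \<in> K" "\<And>t. t \<in> K \<Longrightarrow> s \<le> t" using compact_attains_inf[OF K(1) False] by blast
      obtain S where S: "\<And>t. t \<in> K \<Longrightarrow> t \<le> S" using compact_attains_sup[OF K(1) False] by blast
      have s0: "0 < s" using s K by auto
      have Kb: "K \<in> sets borel" using K(1) by (simp add: compact_imp_closed)
      have "(\<integral>\<^sup>+t. ennreal (norm (indicator K t *\<^sub>R norm (f t))) \<partial>halfline)
        \<le> (\<integral>\<^sup>+t. ennreal (norm (f t)) * indicator {s/2<..S} t \<partial>halfline)"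
        using s(2) S s0 by (intro nn_integral_mono) (fastforce split: split_indicator)
      also have "\<dots> < \<infinity>" using a s0 ivl_integrable_iff[OF sm, of "s/2" S] by simp
      finally have fin: "(\<integral>\<^sup>+t. ennreal (norm (indicator K t *\<^sub>R norm (f t))) \<partial>halfline) < \<infinity>" .
      have "(\<lambda>t. indicator K t *\<^sub>R norm (f t)) \<in> borel_measurable halfline"
        by (intro borel_measurable_scaleR borel_measurable_halfline_indicator Kb) measurable
      with fin show ?thesis by (simp only: set_integrable_def integrable_iff_bounded)
    qed
  qed
qed

text \<open>Local absolute continuity is expressed by the fundamental theorem of calculus. For values in a
  general Banach space this is stronger than the usual \<open>\<epsilon>\<close>-\<open>\<delta>\<close> definition, which does not yield
  differentiability almost everywhere. The derivative \<open>r\<close> is determined up to null sets only.\<close>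

definition has_ac_deriv :: "(real \<Rightarrow> 'a::banach) \<Rightarrow> (real \<Rightarrow> 'a) \<Rightarrow> bool" where
  "has_ac_deriv w r \<longleftrightarrow> locally_integrable r \<and>
     (\<forall>x y. 0 < x \<longrightarrow> x \<le> y \<longrightarrow> w y - w x = ivl_integral x y r)"

lemma has_ac_deriv_integrable: "has_ac_deriv w r \<Longrightarrow> 0 < x \<Longrightarrow> ivl_integrable x y r"
  by (simp add: has_ac_deriv_def locally_integrable_iff)

lemma has_ac_deriv_norm_le:
  "\<lbrakk>has_ac_deriv w r; 0 < x; x \<le> y\<rbrakk> \<Longrightarrow>
    ennreal (norm (w y - w x)) \<le> (\<integral>\<^sup>+t. ennreal (norm (r t)) * indicator {x<..y} t \<partial>halfline)"
  using ivl_integral_norm_le[OF has_ac_deriv_integrable] by (auto simp: has_ac_deriv_def)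

lemma AE_halfline_neq: "AE t in halfline. t \<noteq> c"
proof -
  have "AE t in lborel. t \<noteq> c" by (rule AE_lborel_singleton)
  then show ?thesis by (subst AE_restrict_space_iff) auto
qed

text \<open>By dominated convergence the integrals of \<open>g\<close> over intervals shrinking to a point tend to \<open>0\<close>.\<close>

lemma continuous_on_if_increment_bound:
  fixes w :: "real \<Rightarrow> 'a::real_normed_vector"
  assumes g: "g \<in> borel_measurable halfline" "(\<integral>\<^sup>+t. g t \<partial>halfline) < \<infinity>"
    and le: "\<And>x y. x \<in> S \<Longrightarrow> y \<in> S \<Longrightarrow> x \<le> y \<Longrightarrow>
      ennreal (norm (w y - w x)) \<le> (\<integral>\<^sup>+t. g t * indicator {x<..y} t \<partial>halfline)"
  shows "continuous_on S w"
proof (rule continuous_on_sequentiallyI)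
  fix u :: "nat \<Rightarrow> real" and a
  assume u: "\<forall>n. u n \<in> S" and a: "a \<in> S" and lim: "u \<longlonglongrightarrow> a"
  define I where "I n = {min (u n) a<..max (u n) a}" for n
  have "(\<lambda>n. \<integral>\<^sup>+t. g t * indicator (I n) t \<partial>halfline) \<longlonglongrightarrow> (\<integral>\<^sup>+t. 0 \<partial>halfline)"
  proof (rule nn_integral_dominated_convergence[where w=g])
    show "(\<lambda>t. g t * indicator (I n) t) \<in> borel_measurable halfline" for n
      using g(1) by (intro borel_measurable_times_ennreal borel_measurable_halfline_indicator) (auto simp: I_def)
    show "AE t in halfline. g t * indicator (I n) t \<le> g t" for n
      by (intro AE_I2) (auto split: split_indicator)
    show "AE t in halfline. (\<lambda>n. g t * indicator (I n) t) \<longlonglongrightarrow> 0"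
      using AE_halfline_neq[of a]
    proof eventually_elim
      fix t assume "t \<noteq> a"
      then have "eventually (\<lambda>n. \<bar>u n - a\<bar> < \<bar>t - a\<bar>) sequentially"
        using tendstoD[OF lim, of "\<bar>t - a\<bar>"] by (simp add: dist_real_def)
      then have "eventually (\<lambda>n. g t * indicator (I n) t = 0) sequentially"
        by eventually_elim (auto simp: I_def split: split_indicator)
      then show "(\<lambda>n. g t * indicator (I n) t) \<longlonglongrightarrow> 0" by (rule tendsto_eventually)
    qed
  qed (use g in auto)
  then have l0: "(\<lambda>n. \<integral>\<^sup>+t. g t * indicator (I n) t \<partial>halfline) \<longlonglongrightarrow> 0" by simp
  have le': "ennreal (norm (w (u n) - w a)) \<le> (\<integral>\<^sup>+t. g t * indicator (I n) t \<partial>halfline)" for n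
    using le[of "u n" a] le[of a "u n"] u a
    by (cases "u n \<le> a") (auto simp: I_def norm_minus_commute min_def max_def)
  have "(\<lambda>n. ennreal (norm (w (u n) - w a))) \<longlonglongrightarrow> 0"
    by (rule tendsto_sandwich[OF _ _ tendsto_const l0]) (use le' in auto)
  then have "(\<lambda>n. norm (w (u n) - w a)) \<longlonglongrightarrow> 0"
    by (subst (asm) ennreal_0[symmetric], subst (asm) tendsto_ennreal_iff) auto
  then show "(\<lambda>n. w (u n)) \<longlonglongrightarrow> w a" by (simp add: tendsto_norm_zero_iff LIM_zero_cancel)
qed

lemma continuous_on_open_if_local:
  fixes w :: "real \<Rightarrow> 'a::topological_space"
  assumes "\<And>a b. 0 < a \<Longrightarrow> continuous_on {a<..<b} w"
  shows "continuous_on {0<..} w"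
proof -
  have "continuous_on (\<Union>n::nat. {1 / (n + 1)<..<real n + 1}) w"
    by (rule continuous_on_open_UN) (auto intro!: assms)
  moreover have "{0<..} \<subseteq> (\<Union>n::nat. {1 / (n + 1)<..<real n + 1})"
  proof
    fix x :: real assume "x \<in> {0<..}"
    then have x: "0 < x" by simp
    obtain n1 where n1: "x < real n1" using reals_Archimedean2 by blast
    obtain n2 where n2: "1 / x < real n2" using reals_Archimedean2 by blast
    have "1 / x < real (max n1 n2) + 1" "x < real (max n1 n2) + 1" using n1 n2 by linarith+
    then have "1 / (real (max n1 n2) + 1) < x" using x by (simp add: field_simps)
    then show "x \<in> (\<Union>n::nat. {1 / (n + 1)<..<real n + 1})"
      using \<open>x < real (max n1 n2) + 1\<close> by (intro UN_I[of "max n1 n2"]) (auto simp: add.commute)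
  qed
  ultimately show ?thesis by (rule continuous_on_subset)
qed

lemma has_ac_deriv_continuous:
  assumes "has_ac_deriv w r" shows "continuous_on {0<..} w"
proof (rule continuous_on_open_if_local)
  fix a b :: real assume a: "0 < a"
  have sm: "strongly_measurable halfline r"
    using assms by (simp add: has_ac_deriv_def locally_integrable_def)
  show "continuous_on {a<..<b} w"
  proof (rule continuous_on_if_increment_bound[where g="\<lambda>t. ennreal (norm (r t)) * indicator {a<..b} t"])
    show "(\<lambda>t. ennreal (norm (r t)) * indicator {a<..b} t) \<in> borel_measurable halfline"
      using borel_measurable_norm_strongly[OF sm] borel_measurable_halfline_indicator[of "{a<..b}"]
      by measurable
    show "(\<integral>\<^sup>+t. ennreal (norm (r t)) * indicator {a<..b} t \<partial>halfline) < \<infinity>"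
      using has_ac_deriv_integrable[OF assms a] by (simp add: ivl_integrable_iff[OF sm])
    fix x y assume xy: "x \<in> {a<..<b}" "y \<in> {a<..<b}" "x \<le> y"
    have "(\<integral>\<^sup>+t. ennreal (norm (r t)) * indicator {x<..y} t \<partial>halfline)
       \<le> (\<integral>\<^sup>+t. ennreal (norm (r t)) * indicator {a<..b} t * indicator {x<..y} t \<partial>halfline)"
      using xy by (intro nn_integral_mono) (auto split: split_indicator)
    with has_ac_deriv_norm_le[OF assms, of x y] xy a
    show "ennreal (norm (w y - w x)) \<le> (\<integral>\<^sup>+t. ennreal (norm (r t)) * indicator {a<..b} t * indicator {x<..y} t \<partial>halfline)"
      by (auto intro: order_trans)
  qed
qed

lemma continuous_imp_ivl_integrable:
  fixes w :: "real \<Rightarrow> 'a::real_normed_vector"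
  assumes "continuous_on {0<..} w" "0 < x" shows "ivl_integrable x y w"
proof -
  have sm: "strongly_measurable halfline w" by (rule continuous_imp_strongly_measurable[OF assms(1)])
  have "compact (w ` {x..y})"
    by (intro compact_continuous_image continuous_on_subset[OF assms(1)]) (use assms(2) in auto)
  then obtain C where C: "\<And>t. t \<in> {x..y} \<Longrightarrow> norm (w t) \<le> C"
    by (meson bounded_iff compact_imp_bounded imageI)
  have "(\<integral>\<^sup>+t. ennreal (norm (w t)) * indicator {x<..y} t \<partial>halfline)
      \<le> (\<integral>\<^sup>+t. ennreal C * indicator {x..y} t \<partial>halfline)"
    using C by (intro nn_integral_mono) (auto split: split_indicator intro: ennreal_leI)
  also have "\<dots> \<le> (\<integral>\<^sup>+t. ennreal C * indicator {x..y} t \<partial>lborel)"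
    by (subst nn_integral_restrict_space) (auto intro!: nn_integral_mono split: split_indicator)
  also have "\<dots> < \<infinity>" by (simp add: nn_integral_cmult_indicator ennreal_mult_less_top emeasure_lborel_Icc_eq)
  finally show ?thesis by (simp add: ivl_integrable_iff[OF sm])
qed

lemma continuous_imp_locally_integrable:
  fixes w :: "real \<Rightarrow> 'a::real_normed_vector"
  assumes "continuous_on {0<..} w" shows "locally_integrable w"
  using continuous_imp_strongly_measurable continuous_imp_ivl_integrable assms
  by (auto simp: locally_integrable_iff)

lemma has_ac_deriv_locally_integrable: "has_ac_deriv w r \<Longrightarrow> locally_integrable w"
  by (rule continuous_imp_locally_integrable[OF has_ac_deriv_continuous])

lemma locally_integrable_add:
  "locally_integrable f \<Longrightarrow> locally_integrable g \<Longrightarrow> locally_integrable (\<lambda>t. f t + g t)"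
  unfolding locally_integrable_iff
proof (intro conjI allI impI)
  assume f: "strongly_measurable halfline f \<and> (\<forall>x y. 0 < x \<longrightarrow> ivl_integrable x y f)"
    and g: "strongly_measurable halfline g \<and> (\<forall>x y. 0 < x \<longrightarrow> ivl_integrable x y g)"
  show "strongly_measurable halfline (\<lambda>t. f t + g t)"
    by (rule strongly_measurable_add) (use f g in blast)+
  fix x y :: real assume "0 < x"
  then have "strong_integrable halfline (\<lambda>t. indicator {x<..y} t *\<^sub>R f t + indicator {x<..y} t *\<^sub>R g t)"
    by (intro strong_integrable_add) (use f g in blast)+
  then show "ivl_integrable x y (\<lambda>t. f t + g t)" by (simp only: scaleR_add_right)
qed

lemma locally_integrable_bounded_linear:
  assumes "bounded_linear T" "locally_integrable f" shows "locally_integrable (\<lambda>t. T (f t))"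
proof -
  interpret T: bounded_linear T by fact
  show ?thesis unfolding locally_integrable_iff
  proof (intro conjI allI impI)
    show "strongly_measurable halfline (\<lambda>t. T (f t))"
      using assms(2) by (intro strongly_measurable_compose[OF _ T.continuous_on[OF continuous_on_id]])
        (simp add: locally_integrable_iff)
    show "ivl_integrable x y (\<lambda>t. T (f t))" if "0 < x" for x y
      using strong_integrable_bounded_linear[OF assms(1), of halfline "\<lambda>t. indicator {x<..y} t *\<^sub>R f t"] assms(2) that
      by (simp add: locally_integrable_iff T.scaleR)
  qed
qed

lemma locally_integrable_diff:
  "locally_integrable f \<Longrightarrow> locally_integrable g \<Longrightarrow> locally_integrable (\<lambda>t. f t - g t)"
  using locally_integrable_add[of f "\<lambda>t. - g t"]
    locally_integrable_bounded_linear[OF bounded_linear_minus[OF bounded_linear_ident], of g] by simp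

lemma has_ac_deriv_add:
  assumes "has_ac_deriv w r" "has_ac_deriv w' r'"
  shows "has_ac_deriv (\<lambda>t. w t + w' t) (\<lambda>t. r t + r' t)"
  unfolding has_ac_deriv_def
proof (intro conjI allI impI)
  show "locally_integrable (\<lambda>t. r t + r' t)"
    by (rule locally_integrable_add) (use assms in \<open>simp_all add: has_ac_deriv_def\<close>)
  fix x y :: real assume xy: "0 < x" "x \<le> y"
  have "w y - w x = ivl_integral x y r" "w' y - w' x = ivl_integral x y r'"
    using assms xy by (simp_all add: has_ac_deriv_def)
  then show "w y + w' y - (w x + w' x) = ivl_integral x y (\<lambda>t. r t + r' t)"
    using strong_integral_add[OF has_ac_deriv_integrable[OF assms(1) xy(1)] has_ac_deriv_integrable[OF assms(2) xy(1)], of y y]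
    by (simp only: scaleR_add_right) (simp add: algebra_simps)
qed

lemma has_ac_deriv_bounded_linear:
  assumes "bounded_linear T" "has_ac_deriv w r"
  shows "has_ac_deriv (\<lambda>t. T (w t)) (\<lambda>t. T (r t))"
proof -
  interpret T: bounded_linear T by fact
  show ?thesis unfolding has_ac_deriv_def
  proof (intro conjI allI impI)
    show "locally_integrable (\<lambda>t. T (r t))"
      by (rule locally_integrable_bounded_linear[OF assms(1)]) (use assms in \<open>simp add: has_ac_deriv_def\<close>)
    fix x y :: real assume xy: "0 < x" "x \<le> y"
    have "w y - w x = ivl_integral x y r" using assms xy by (simp add: has_ac_deriv_def)
    then show "T (w y) - T (w x) = ivl_integral x y (\<lambda>t. T (r t))"
      using strong_integral_bounded_linear[OF assms(1) has_ac_deriv_integrable[OF assms(2) xy(1)], of y]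
      by (simp add: T.scaleR T.diff[symmetric])
  qed
qed

lemma has_ac_deriv_diff:
  assumes "has_ac_deriv w r" "has_ac_deriv w' r'"
  shows "has_ac_deriv (\<lambda>t. w t - w' t) (\<lambda>t. r t - r' t)"
  using has_ac_deriv_add[OF assms(1) has_ac_deriv_bounded_linear[OF bounded_linear_minus[OF bounded_linear_ident] assms(2)]]
  by simp

lemma locally_integrable_AE_eq:
  fixes f :: "real \<Rightarrow> 'a::banach"
  assumes "locally_integrable f" "strongly_measurable halfline g" "AE t in halfline. f t = g t"
  shows "locally_integrable g" "0 < x \<Longrightarrow> ivl_integral x y g = ivl_integral x y f"
proof -
  have *: "ivl_integrable x y g \<and> ivl_integral x y g = ivl_integral x y f" if "0 < x" for x y
  proof -
    have "ivl_integrable x y f" using assms(1) that by (simp add: locally_integrable_iff)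
    moreover have "strongly_measurable halfline (\<lambda>t. indicator {x<..y} t *\<^sub>R g t)"
      by (intro strongly_measurable_scaleR borel_measurable_halfline_indicator assms) simp
    moreover have "AE t in halfline. indicator {x<..y} t *\<^sub>R f t = indicator {x<..y} t *\<^sub>R g t"
      using assms(3) by eventually_elim simp
    ultimately show ?thesis
      using strong_integral_AE_eq[of halfline "\<lambda>t. indicator {x<..y} t *\<^sub>R f t" "\<lambda>t. indicator {x<..y} t *\<^sub>R g t"] by blast
  qed
  then show "locally_integrable g" using assms(2) by (simp add: locally_integrable_iff)
  show "0 < x \<Longrightarrow> ivl_integral x y g = ivl_integral x y f" using * by blast
qed

lemma has_ac_deriv_AE_eq:
  assumes "has_ac_deriv w r" "strongly_measurable halfline r'" "AE t in halfline. r t = r' t"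
  shows "has_ac_deriv w r'"
  using locally_integrable_AE_eq[of r r'] assms by (auto simp: has_ac_deriv_def)

lemma has_ac_deriv_cong:
  assumes "has_ac_deriv w r" "\<And>t. 0 < t \<Longrightarrow> w t = w' t" "\<And>t. 0 < t \<Longrightarrow> r t = r' t"
  shows "has_ac_deriv w' r'"
proof -
  have "strongly_measurable halfline r"
    using assms(1) by (simp add: has_ac_deriv_def locally_integrable_iff)
  then have "strongly_measurable halfline r'"
    unfolding strongly_measurable_def using assms(3) by simp
  moreover have "AE t in halfline. r t = r' t" using assms(3) by (intro AE_I2) simp
  ultimately have "has_ac_deriv w r'" using assms(1) has_ac_deriv_AE_eq by blast
  then show ?thesis using assms(2) by (simp add: has_ac_deriv_def)
qed

text \<open>Divide \<open>[x, y]\<close> into equal intervals shorter than \<open>d\<close>. The increments of \<open>N\<close> telescope, so the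
  increment of \<open>E\<close> over \<open>[x, y]\<close> is at most \<open>e * (N y - N x)\<close> for every \<open>e\<close>.\<close>

lemma zero_if_increments_small:
  fixes E :: "real \<Rightarrow> 'a::real_normed_vector" and N :: "real \<Rightarrow> real"
  assumes xy: "x \<le> y"
    and small: "\<And>e. e > 0 \<Longrightarrow> \<exists>d>0. \<forall>u v. x \<le> u \<longrightarrow> u \<le> v \<longrightarrow> v \<le> y \<longrightarrow> v - u < d \<longrightarrow>
      norm (E v - E u) \<le> e * (N v - N u)"
  shows "E x = E y"
proof -
  have key: "norm (E y - E x) \<le> e * (N y - N x)" if e0: "e > 0" for e
  proof -
    obtain d where d: "d > 0" "\<And>u v. \<lbrakk>x \<le> u; u \<le> v; v \<le> y; v - u < d\<rbrakk> \<Longrightarrow> norm (E v - E u) \<le> e * (N v - N u)"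
      using small[OF e0] by blast
    obtain n :: nat where n: "(y - x) / d < real n" using reals_Archimedean2 by blast
    define q where "q = (y - x) / real (Suc n)"
    have q: "0 \<le> q" "real (Suc n) * q = y - x" using xy by (simp_all add: q_def)
    define t where "t i = x + real i * q" for i :: nat
    have inc: "t i \<le> t (Suc i)" for i using q by (simp add: t_def distrib_right)
    have tx: "x \<le> t i" for i using q by (simp add: t_def)
    have step: "t (Suc i) - t i < d" for i
    proof -
      have "y - x < real n * d" using n d(1) by (simp add: field_simps)
      also have "\<dots> \<le> real (Suc n) * d" using d(1) by simp
      finally have "q < d" unfolding q_def by (simp add: field_simps)
      then show ?thesis by (simp add: t_def distrib_right)
    qed
    have ty: "t i \<le> y" if "i \<le> Suc n" for i
    proof -
      have "real i * q \<le> real (Suc n) * q" using that q by (intro mult_right_mono) auto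
      then show ?thesis using q(2) by (simp add: t_def)
    qed
    have "norm (E (t i) - E x) \<le> e * (N (t i) - N x)" if "i \<le> Suc n" for i
      using that
    proof (induction i)
      case 0 then show ?case by (simp add: t_def)
    next
      case (Suc i)
      have "norm (E (t (Suc i)) - E x) \<le> norm (E (t (Suc i)) - E (t i)) + norm (E (t i) - E x)"
        using norm_triangle_ineq[of "E (t (Suc i)) - E (t i)" "E (t i) - E x"] by simp
      also have "\<dots> \<le> e * (N (t (Suc i)) - N (t i)) + e * (N (t i) - N x)"
        using Suc d(2)[OF tx inc ty step, of i] by (intro add_mono) auto
      finally show ?case by (simp add: algebra_simps)
    qed
    from this[of "Suc n"] show ?thesis using q(2) by (simp add: t_def)
  qed
  have "norm (E y - E x) \<le> 0"
  proof (rule field_le_epsilon)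
    fix e :: real assume e: "e > 0"
    have "norm (E y - E x) \<le> e / (1 + \<bar>N y - N x\<bar>) * (N y - N x)" using e by (intro key) auto
    also have "\<dots> \<le> e / (1 + \<bar>N y - N x\<bar>) * (1 + \<bar>N y - N x\<bar>)" using e by (intro mult_left_mono) auto
    also have "\<dots> = e" by (simp add: add_pos_nonneg pos_add_strict)
    finally show "norm (E y - E x) \<le> 0 + e" by simp
  qed
  then show ?thesis by simp
qed

section \<open>Integrals over intervals and the product rule\<close>

lemma strong_integral_real:
  fixes f :: "'s \<Rightarrow> real"
  assumes "strong_integrable M f"
  shows "integrable M f" "strong_integral M f = integral\<^sup>L M f"
proof -
  show i: "integrable M f"
    using assms by (auto simp: strong_integrable_def strongly_measurable_iff_borel_measurable integrable_iff_bounded)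
  then show "strong_integral M f = integral\<^sup>L M f"
    by (intro strong_integral_eqI) (simp add: has_strong_integral_iff_has_bochner_integral has_bochner_integral_integrable)
qed

lemma ivl_integral_norm_le_real:
  fixes f :: "real \<Rightarrow> 'a::banach"
  assumes f: "ivl_integrable u v f" and g: "ivl_integrable u v g"
    and le: "\<And>t. u < t \<Longrightarrow> t \<le> v \<Longrightarrow> 0 < t \<Longrightarrow> norm (f t) \<le> g t"
  shows "norm (ivl_integral u v f) \<le> ivl_integral u v g"
proof -
  have nn: "AE t in halfline. 0 \<le> indicator {u<..v} t *\<^sub>R g t"
  proof (rule AE_I2)
    fix t assume "t \<in> space halfline"
    then show "0 \<le> indicator {u<..v} t *\<^sub>R g t"
      using order_trans[OF norm_ge_zero le[of t]] by (auto split: split_indicator)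
  qed
  have "ennreal (norm (ivl_integral u v f)) \<le> (\<integral>\<^sup>+t. ennreal (norm (indicator {u<..v} t *\<^sub>R f t)) \<partial>halfline)"
    by (rule strong_integral_norm_le[OF f])
  also have "\<dots> \<le> (\<integral>\<^sup>+t. ennreal (indicator {u<..v} t *\<^sub>R g t) \<partial>halfline)"
    using le by (intro nn_integral_mono ennreal_leI) (auto split: split_indicator)
  also have "\<dots> = ennreal (integral\<^sup>L halfline (\<lambda>t. indicator {u<..v} t *\<^sub>R g t))"
    by (rule nn_integral_eq_integral[OF strong_integral_real(1)[OF g] nn])
  also have "\<dots> = ennreal (ivl_integral u v g)" by (simp only: strong_integral_real(2)[OF g])
  finally have 1: "ennreal (norm (ivl_integral u v f)) \<le> ennreal (ivl_integral u v g)" .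
  have "0 \<le> ivl_integral u v g" unfolding strong_integral_real(2)[OF g] by (rule integral_nonneg_AE[OF nn])
  with 1 show ?thesis by (simp only: ennreal_le_iff)
qed

lemma ivl_integrable_const: "0 \<le> u \<Longrightarrow> ivl_integrable u v (\<lambda>t. c :: 'a::banach)"
  and ivl_integral_const: "0 \<le> u \<Longrightarrow> u \<le> v \<Longrightarrow> ivl_integral u v (\<lambda>t. c :: 'a::banach) = (v - u) *\<^sub>R c"
proof -
  have sub: "{u<..v} \<subseteq> {0<..}" if "0 \<le> u" using that by auto
  have s: "{u<..v} \<in> sets halfline" if "0 \<le> u"
    using sub[OF that] by (simp add: sets_restrict_space_iff)
  have e: "emeasure halfline {u<..v} = emeasure lborel {u<..v}" if "0 \<le> u"
    using sub[OF that] by (intro emeasure_restrict_space) auto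
  have f: "emeasure halfline {u<..v} < \<infinity>" if "0 \<le> u"
    using e[OF that] by (cases "u \<le> v") auto
  show "0 \<le> u \<Longrightarrow> ivl_integrable u v (\<lambda>t. c)" using strong_integral_indicator(1)[OF s f] .
  show "0 \<le> u \<Longrightarrow> u \<le> v \<Longrightarrow> ivl_integral u v (\<lambda>t. c) = (v - u) *\<^sub>R c"
    using strong_integral_indicator(2)[OF s f] e by (simp add: measure_def)
qed

lemma ivl_integral_diff:
  fixes f g :: "real \<Rightarrow> 'a::banach"
  assumes "ivl_integrable u v f" "ivl_integrable u v g"
  shows "ivl_integrable u v (\<lambda>t. f t - g t)" "ivl_integral u v (\<lambda>t. f t - g t) = ivl_integral u v f - ivl_integral u v g"
  using strong_integrable_diff[OF assms] strong_integral_diff[OF assms] by (simp_all only: scaleR_diff_right)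

lemma ivl_integral_add:
  fixes f g :: "real \<Rightarrow> 'a::banach"
  assumes "ivl_integrable u v f" "ivl_integrable u v g"
  shows "ivl_integrable u v (\<lambda>t. f t + g t)" "ivl_integral u v (\<lambda>t. f t + g t) = ivl_integral u v f + ivl_integral u v g"
  using strong_integrable_add[OF assms] strong_integral_add[OF assms] by (simp_all only: scaleR_add_right)

lemma ivl_integral_bounded_linear:
  fixes f :: "real \<Rightarrow> 'a::banach"
  assumes T: "bounded_linear T" and f: "ivl_integrable u v f"
  shows "ivl_integrable u v (\<lambda>t. T (f t))" "ivl_integral u v (\<lambda>t. T (f t)) = T (ivl_integral u v f)"
proof -
  interpret T: bounded_linear T by fact
  show "ivl_integrable u v (\<lambda>t. T (f t))" "ivl_integral u v (\<lambda>t. T (f t)) = T (ivl_integral u v f)"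
    using strong_integrable_bounded_linear[OF T f] strong_integral_bounded_linear[OF T f]
    by (simp_all only: T.scaleR)
qed

lemma ivl_integral_scaleR:
  fixes f :: "real \<Rightarrow> 'a::banach"
  assumes f: "ivl_integrable u v f"
  shows "ivl_integrable u v (\<lambda>t. c *\<^sub>R f t)" "ivl_integral u v (\<lambda>t. c *\<^sub>R f t) = c *\<^sub>R ivl_integral u v f"
  using ivl_integral_bounded_linear[OF bounded_linear_scaleR_right f, of c] by auto

lemma ivl_integrable_norm: "ivl_integrable u v f \<Longrightarrow> ivl_integrable u v (\<lambda>t. norm (f t))"
proof -
  assume f: "ivl_integrable u v f"
  have "strongly_measurable halfline (\<lambda>t. norm (indicator {u<..v} t *\<^sub>R f t))"
    using f by (intro strongly_measurable_compose[of _ _ norm]) (auto simp: strong_integrable_def continuous_on_norm_id)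
  moreover have "(\<lambda>t. norm (indicator {u<..v} t *\<^sub>R f t)) = (\<lambda>t. indicator {u<..v} t *\<^sub>R norm (f t))"
    by (auto simp: fun_eq_iff split: split_indicator)
  ultimately have "strongly_measurable halfline (\<lambda>t. indicator {u<..v} t *\<^sub>R norm (f t))" by simp
  then show ?thesis using f
    by (rule strong_integrable_bound[where C=1]) auto
qed

lemma ivl_integrable_bilinear_continuous:
  fixes r :: "real \<Rightarrow> 'c::real_normed_vector"
  assumes B: "bounded_bilinear B" and a: "continuous_on {0<..} a" and r: "strongly_measurable halfline r"
    and i: "ivl_integrable x y r"
    and bd: "\<And>t. 0 < t \<Longrightarrow> x < t \<Longrightarrow> t \<le> y \<Longrightarrow> norm (a t) \<le> C"
  shows "ivl_integrable x y (\<lambda>t. B (a t) (r t))"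
proof -
  interpret B: bounded_bilinear B by fact
  obtain K where K: "K > 0" "\<And>u v. norm (B u v) \<le> norm u * norm v * K" using B.pos_bounded by auto
  have "strongly_measurable halfline (\<lambda>t. indicator {x<..y} t *\<^sub>R B (a t) (r t))"
    by (intro strongly_measurable_scaleR borel_measurable_halfline_indicator
        strongly_measurable_bilinear[OF B] continuous_imp_strongly_measurable a r) simp
  then show ?thesis using i
  proof (rule strong_integrable_bound)
    show "0 \<le> \<bar>C\<bar> * K" using K by simp
    fix t assume t: "t \<in> space halfline"
    show "norm (indicator {x<..y} t *\<^sub>R B (a t) (r t)) \<le> \<bar>C\<bar> * K * norm (indicator {x<..y} t *\<^sub>R r t)"
    proof (cases "t \<in> {x<..y}")
      case True
      have "norm (B (a t) (r t)) \<le> norm (a t) * norm (r t) * K" by (rule K)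
      also have "\<dots> \<le> \<bar>C\<bar> * norm (r t) * K" using bd[of t] True t K by (intro mult_right_mono) auto
      finally show ?thesis using True by (simp add: mult_ac)
    qed simp
  qed
qed

lemma bounded_on_compact_ivl:
  fixes f :: "real \<Rightarrow> 'a::real_normed_vector"
  assumes "continuous_on {0<..} f" "0 < x"
  obtains C where "C > 0" "\<And>t. x \<le> t \<Longrightarrow> t \<le> y \<Longrightarrow> norm (f t) \<le> C"
proof -
  have "compact (f ` {x..y})"
    by (rule compact_continuous_image[OF continuous_on_subset[OF assms(1)]]) (use assms(2) in auto)
  then have "bounded (f ` {x..y})" by (rule compact_imp_bounded)
  then obtain C where "C > 0" "\<And>t. t \<in> {x..y} \<Longrightarrow> norm (f t) \<le> C"
    unfolding bounded_pos by blast
  then show thesis by (intro that[of C]) auto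
qed

lemma uniformly_continuous_ivl:
  fixes f :: "real \<Rightarrow> 'a::real_normed_vector"
  assumes "continuous_on {0<..} f" "0 < x" "e > 0"
  obtains d where "d > 0" "\<And>u v. \<lbrakk>x \<le> u; u \<le> y; x \<le> v; v \<le> y; \<bar>u - v\<bar> < d\<rbrakk> \<Longrightarrow> norm (f u - f v) \<le> e"
proof -
  have "uniformly_continuous_on {x..y} f"
    by (rule compact_uniformly_continuous[OF continuous_on_subset[OF assms(1)]]) (use assms(2) in auto)
  then obtain d where "d > 0" "\<forall>u\<in>{x..y}. \<forall>v\<in>{x..y}. dist v u < d \<longrightarrow> dist (f v) (f u) < e"
    using assms(3) unfolding uniformly_continuous_on_def by blast
  then show thesis by (intro that[of d]) (fastforce simp: dist_norm norm_minus_commute)+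
qed

text \<open>The factor \<open>w\<close> satisfies the fundamental theorem of calculus without being differentiable at
  any given point, so increments over short intervals are compared instead of derivatives. The
  functions \<open>a\<close>, \<open>a'\<close> and \<open>h = B a' w\<close> are uniformly continuous on \<open>[x, y]\<close>; replacing them by
  constants on a short interval makes an error that is a small multiple of its length plus the
  integral of \<open>norm r\<close>, and \<open>zero_if_increments_small\<close> adds up these errors.\<close>

lemma has_ac_deriv_bilinear:
  fixes B :: "'b::real_normed_vector \<Rightarrow> 'c::banach \<Rightarrow> 'd::banach"
  assumes B: "bounded_bilinear B"
    and a: "\<And>t. 0 < t \<Longrightarrow> (a has_vector_derivative a' t) (at t)" and a': "continuous_on {0<..} a'"
    and w: "has_ac_deriv w r"
  shows "has_ac_deriv (\<lambda>t. B (a t) (w t)) (\<lambda>t. B (a' t) (w t) + B (a t) (r t))"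
proof -
  interpret B: bounded_bilinear B by fact
  obtain K where K: "K > 0" "\<And>u v. norm (B u v) \<le> norm u * norm v * K" using B.pos_bounded by auto
  have ac: "continuous_on {0<..} a"
    using a by (intro continuous_at_imp_continuous_on ballI) (auto intro: has_vector_derivative_continuous)
  have wc: "continuous_on {0<..} w" by (rule has_ac_deriv_continuous[OF w])
  define h where "h t = B (a' t) (w t)" for t
  have hc: "continuous_on {0<..} h" unfolding h_def by (rule B.continuous_on[OF a' wc])
  have r: "strongly_measurable halfline r" "\<And>x y. 0 < x \<Longrightarrow> ivl_integrable x y r"
    using w by (auto simp: has_ac_deriv_def locally_integrable_iff)
  have li: "locally_integrable (\<lambda>t. B (a t) (r t))" unfolding locally_integrable_iff
  proof (intro conjI allI impI)
    show "strongly_measurable halfline (\<lambda>t. B (a t) (r t))"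
      by (intro strongly_measurable_bilinear[OF B] continuous_imp_strongly_measurable ac r)
    fix x y :: real assume x: "0 < x"
    obtain C where "\<And>t. x \<le> t \<Longrightarrow> t \<le> y \<Longrightarrow> norm (a t) \<le> C"
      using bounded_on_compact_ivl[OF ac x] by blast
    then show "ivl_integrable x y (\<lambda>t. B (a t) (r t))"
      by (intro ivl_integrable_bilinear_continuous[OF B ac r(1) r(2)[OF x], where C=C]) auto
  qed
  have hi: "ivl_integrable u v h" if "0 < u" for u v by (rule continuous_imp_ivl_integrable[OF hc that])
  define s where "s t = h t + B (a t) (r t)" for t
  have si: "ivl_integrable u v s" if "0 < u" for u v
    using ivl_integral_add(1)[OF hi[OF that], of v] li that unfolding s_def by (simp add: locally_integrable_iff)
  show ?thesis unfolding has_ac_deriv_def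
  proof (intro conjI allI impI)
    show "locally_integrable (\<lambda>t. B (a' t) (w t) + B (a t) (r t))"
      using locally_integrable_add[OF continuous_imp_locally_integrable[OF hc] li] by (simp add: h_def)
    fix x y :: real assume x: "0 < x" and xy: "x \<le> y"
    obtain W where W: "W > 0" "\<And>t. x \<le> t \<Longrightarrow> t \<le> y \<Longrightarrow> norm (w t) \<le> W"
      using bounded_on_compact_ivl[OF wc x] by blast
    (* E is the defect in the fundamental theorem for the product. The increments of N bound
       those of E up to the small factor e. *)
    define E where "E v = B (a v) (w v) - ivl_integral x v s" for v
    define N where "N v = K * ivl_integral x v (\<lambda>t. norm (r t)) + (W * K + 1) * (v - x)" for v
    have "E x = E y"
    proof (rule zero_if_increments_small[OF xy, where N=N])
      fix e :: real assume e: "e > 0"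
      obtain d1 where d1: "d1 > 0" "\<And>u v. \<lbrakk>x \<le> u; u \<le> y; x \<le> v; v \<le> y; \<bar>u - v\<bar> < d1\<rbrakk> \<Longrightarrow> norm (a u - a v) \<le> e"
        using uniformly_continuous_ivl[OF ac x e] by blast
      obtain d2 where d2: "d2 > 0" "\<And>u v. \<lbrakk>x \<le> u; u \<le> y; x \<le> v; v \<le> y; \<bar>u - v\<bar> < d2\<rbrakk> \<Longrightarrow> norm (a' u - a' v) \<le> e"
        using uniformly_continuous_ivl[OF a' x e] by blast
      obtain d3 where d3: "d3 > 0" "\<And>u v. \<lbrakk>x \<le> u; u \<le> y; x \<le> v; v \<le> y; \<bar>u - v\<bar> < d3\<rbrakk> \<Longrightarrow> norm (h u - h v) \<le> e"
        using uniformly_continuous_ivl[OF hc x e] by blast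
      have "norm (E v - E u) \<le> e * (N v - N u)"
        if u: "x \<le> u" and uv: "u \<le> v" and v: "v \<le> y" and vu: "v - u < min d1 (min d2 d3)" for u v
      proof -
        have u0: "0 < u" using x u by simp
        have sp: "ivl_integral x v s = ivl_integral x u s + ivl_integral u v s"
          by (rule ivl_integral_split[OF si[OF x] u uv])
        have rp: "ivl_integral x v (\<lambda>t. norm (r t)) = ivl_integral x u (\<lambda>t. norm (r t)) + ivl_integral u v (\<lambda>t. norm (r t))"
          by (rule ivl_integral_split[OF ivl_integrable_norm[OF r(2)[OF x]] u uv])
        have bi: "ivl_integrable u v (\<lambda>t. B (a t) (r t))" using li u0 by (simp add: locally_integrable_iff)
        have ci: "ivl_integrable u v (\<lambda>t. B (a v) (r t))"
          and ce: "ivl_integral u v (\<lambda>t. B (a v) (r t)) = B (a v) (w v - w u)"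
          using ivl_integral_bounded_linear[OF B.bounded_linear_right[of "a v"] r(2)[OF u0], of v] w u0 uv
          by (simp_all add: has_ac_deriv_def)
        (* Three errors on [u, v]: freezing a at v under the integral of r, linearising a at u,
           and freezing h at u. *)
        have n1: "norm (B (a v) (w v - w u) - ivl_integral u v (\<lambda>t. B (a t) (r t))) \<le> e * K * ivl_integral u v (\<lambda>t. norm (r t))"
        proof -
          have "B (a v) (w v - w u) - ivl_integral u v (\<lambda>t. B (a t) (r t)) = ivl_integral u v (\<lambda>t. B (a v) (r t) - B (a t) (r t))"
            by (simp only: ivl_integral_diff[OF ci bi] ce)
          also have "norm \<dots> \<le> ivl_integral u v (\<lambda>t. (e * K) *\<^sub>R norm (r t))"
          proof (rule ivl_integral_norm_le_real)
            show "ivl_integrable u v (\<lambda>t. B (a v) (r t) - B (a t) (r t))" by (rule ivl_integral_diff(1)[OF ci bi])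
            show "ivl_integrable u v (\<lambda>t. (e * K) *\<^sub>R norm (r t))"
              by (rule ivl_integral_scaleR(1)[OF ivl_integrable_norm[OF r(2)[OF u0]]])
            fix t assume t: "u < t" "t \<le> v"
            have "norm (B (a v) (r t) - B (a t) (r t)) \<le> norm (a v - a t) * norm (r t) * K"
              using K(2)[of "a v - a t" "r t"] by (simp add: B.diff_left)
            also have "\<dots> \<le> e * norm (r t) * K"
              using d1(2)[of v t] t u uv v vu K by (intro mult_right_mono) auto
            finally show "norm (B (a v) (r t) - B (a t) (r t)) \<le> (e * K) *\<^sub>R norm (r t)" by (simp add: mult_ac)
          qed
          also have "\<dots> = e * K * ivl_integral u v (\<lambda>t. norm (r t))"
            by (simp only: ivl_integral_scaleR(2)[OF ivl_integrable_norm[OF r(2)[OF u0]]]) simp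
          finally show ?thesis .
        qed
        have n2: "norm (B (a v - a u - (v - u) *\<^sub>R a' u) (w u)) \<le> (v - u) * e * W * K"
        proof -
          have "norm (a v - a u - (v - u) *\<^sub>R a' u) \<le> norm (v - u) * e"
          proof (rule vector_differentiable_bound_linearization[where S="{u..v}"])
            show "(a has_vector_derivative a' t) (at t within {u..v})" if "t \<in> {u..v}" for t
              using a[of t] that u0 by (auto intro: has_vector_derivative_at_within)
            show "norm (a' t - a' u) \<le> e" if "t \<in> {u..v}" for t
              using d2(2)[of t u] that u uv v vu by auto
          qed (use uv in \<open>auto simp: closed_segment_eq_real_ivl\<close>)
          then have "norm (a v - a u - (v - u) *\<^sub>R a' u) * norm (w u) * K \<le> ((v - u) * e) * W * K"
            using W(2)[of u] u uv v K e by (intro mult_right_mono mult_mono) auto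
          then show ?thesis using K(2)[of "a v - a u - (v - u) *\<^sub>R a' u" "w u"] by (rule order_trans[rotated])
        qed
        have n3: "norm ((v - u) *\<^sub>R h u - ivl_integral u v h) \<le> e * (v - u)"
        proof -
          have u0': "0 \<le> u" using u0 by simp
          have "(v - u) *\<^sub>R h u - ivl_integral u v h = ivl_integral u v (\<lambda>t. h u - h t)"
            by (simp only: ivl_integral_diff[OF ivl_integrable_const[OF u0'] hi[OF u0]] ivl_integral_const[OF u0' uv])
          also have "norm \<dots> \<le> ivl_integral u v (\<lambda>t. e)"
          proof (rule ivl_integral_norm_le_real)
            show "ivl_integrable u v (\<lambda>t. h u - h t)" by (rule ivl_integral_diff(1)[OF ivl_integrable_const[OF u0'] hi[OF u0]])
            show "ivl_integrable u v (\<lambda>t. e)" by (rule ivl_integrable_const[OF u0'])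
            show "norm (h u - h t) \<le> e" if "u < t" "t \<le> v" for t
              using d3(2)[of u t] that u uv v vu by auto
          qed
          also have "\<dots> = e * (v - u)" by (subst ivl_integral_const[OF u0' uv]) simp
          finally show ?thesis .
        qed
        have "E v - E u = (B (a v) (w v - w u) - ivl_integral u v (\<lambda>t. B (a t) (r t)))
          + B (a v - a u - (v - u) *\<^sub>R a' u) (w u) + ((v - u) *\<^sub>R h u - ivl_integral u v h)"
        proof -
          have "ivl_integral u v s = ivl_integral u v h + ivl_integral u v (\<lambda>t. B (a t) (r t))"
            unfolding s_def by (rule ivl_integral_add(2)[OF hi[OF u0] bi])
          then show ?thesis
            unfolding E_def sp by (simp add: B.add_left B.diff_left B.diff_right B.scaleR_left h_def algebra_simps)
        qed
        also have "norm \<dots> \<le> e * K * ivl_integral u v (\<lambda>t. norm (r t)) + (v - u) * e * W * K + e * (v - u)"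
          by (intro norm_triangle_le add_mono n1 n2 n3)
        also have "\<dots> = e * (N v - N u)" unfolding N_def rp by (simp add: algebra_simps)
        finally show ?thesis .
      qed
      then show "\<exists>d>0. \<forall>u v. x \<le> u \<longrightarrow> u \<le> v \<longrightarrow> v \<le> y \<longrightarrow> v - u < d \<longrightarrow> norm (E v - E u) \<le> e * (N v - N u)"
        using d1 d2 d3 by (intro exI[of _ "min d1 (min d2 d3)"]) auto
    qed
    then show "B (a y) (w y) - B (a x) (w x) = ivl_integral x y (\<lambda>t. B (a' t) (w t) + B (a t) (r t))"
      unfolding E_def s_def h_def by (simp add: algebra_simps)
  qed
qed

lemma has_ac_deriv_const: "has_ac_deriv (\<lambda>t. c) (\<lambda>t. 0)"
proof -
  have "locally_integrable (\<lambda>t. 0 :: 'a)" by (intro continuous_imp_locally_integrable continuous_on_const)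
  then show ?thesis by (simp add: has_ac_deriv_def)
qed

lemma has_vector_derivative_imp_has_ac_deriv:
  fixes a :: "real \<Rightarrow> 'a::banach"
  assumes "\<And>t. 0 < t \<Longrightarrow> (a has_vector_derivative a' t) (at t)" "continuous_on {0<..} a'"
  shows "has_ac_deriv a a'"
  using has_ac_deriv_bilinear[where B="\<lambda>a c. c *\<^sub>R a", OF bounded_bilinear.flip[OF bounded_bilinear_scaleR] assms has_ac_deriv_const[of "1::real"]]
  by simp

section \<open>Smooth cut-off functions\<close>

definition smooth :: "(real \<Rightarrow> real) \<Rightarrow> bool" where
  "smooth f \<longleftrightarrow> (\<forall>n x. ((deriv ^^ n) f) field_differentiable (at x))"

lemma smooth_has_deriv:
  assumes "smooth f" shows "(f has_real_derivative deriv f x) (at x)"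
proof -
  have "((deriv ^^ 0) f) field_differentiable (at x)" using assms unfolding smooth_def by blast
  then show ?thesis by (simp add: DERIV_deriv_iff_field_differentiable)
qed

lemma smooth_deriv: "smooth f \<Longrightarrow> smooth (deriv f)"
  unfolding smooth_def by (metis funpow_Suc_right o_apply)

text \<open>A set of functions that is closed under differentiation consists of smooth functions; this
  avoids formulas for higher derivatives.\<close>

lemma smooth_coinduct:
  assumes "f \<in> S" and S: "\<And>g. g \<in> S \<Longrightarrow> \<exists>g'\<in>S. \<forall>x. (g has_real_derivative g' x) (at x)"
  shows "smooth f"
proof -
  have "(deriv ^^ n) f \<in> S" for n
  proof (induction n)
    case (Suc n)
    then obtain g' where g': "g' \<in> S" "\<forall>x. ((deriv ^^ n) f has_real_derivative g' x) (at x)"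
      using S by blast
    then have "deriv ((deriv ^^ n) f) = g'" by (intro ext DERIV_imp_deriv) auto
    then show ?case using g' by simp
  qed (use assms in simp)
  then show ?thesis unfolding smooth_def using S by (meson field_differentiable_def)
qed

text \<open>The derivative of a product or of an exponential is a sum of products. Closing a set of
  functions under both operations therefore makes it stable under differentiation as soon as the
  generators have their derivatives in it.\<close>

inductive_set function_algebra :: "(real \<Rightarrow> real) set \<Rightarrow> (real \<Rightarrow> real) set" for G where
  base: "g \<in> G \<Longrightarrow> g \<in> function_algebra G"
| add: "f \<in> function_algebra G \<Longrightarrow> g \<in> function_algebra G \<Longrightarrow> (\<lambda>x. f x + g x) \<in> function_algebra G"
| mult: "f \<in> function_algebra G \<Longrightarrow> g \<in> function_algebra G \<Longrightarrow> (\<lambda>x. f x * g x) \<in> function_algebra G"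

lemma smooth_function_algebra:
  assumes G: "\<And>g. g \<in> G \<Longrightarrow> \<exists>g'\<in>function_algebra G. \<forall>x. (g has_real_derivative g' x) (at x)"
    and f: "f \<in> function_algebra G"
  shows "smooth f"
proof (rule smooth_coinduct[OF f])
  fix g assume "g \<in> function_algebra G"
  then show "\<exists>g'\<in>function_algebra G. \<forall>x. (g has_real_derivative g' x) (at x)"
  proof induction
    case (base g) then show ?case using G by blast
  next
    case (add f g)
    then obtain f' g' where "f' \<in> function_algebra G" "\<forall>x. (f has_real_derivative f' x) (at x)"
      "g' \<in> function_algebra G" "\<forall>x. (g has_real_derivative g' x) (at x)" by blast
    then show ?case
      by (intro bexI[of _ "\<lambda>x. f' x + g' x"] function_algebra.add) (auto intro!: derivative_eq_intros)
  next
    case (mult f g)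
    then obtain f' g' where d: "f' \<in> function_algebra G" "\<forall>x. (f has_real_derivative f' x) (at x)"
      "g' \<in> function_algebra G" "\<forall>x. (g has_real_derivative g' x) (at x)" by blast
    have "(\<lambda>x. f x * g' x + f' x * g x) \<in> function_algebra G"
      by (rule function_algebra.add; rule function_algebra.mult) (use d mult in blast)+
    moreover have "\<forall>x. ((\<lambda>x. f x * g x) has_real_derivative (f x * g' x + f' x * g x)) (at x)"
      using d by (auto intro!: derivative_eq_intros)
    ultimately show ?case by (intro bexI[of _ "\<lambda>x. f x * g' x + f' x * g x"])
  qed
qed

lemma smooth_const: "smooth (\<lambda>x. c)"
  by (rule smooth_coinduct[of _ "range (\<lambda>c x. c)"]) (auto intro!: derivative_eq_intros)

lemma smooth_base_algebra: "f \<in> function_algebra (Collect smooth) \<Longrightarrow> smooth f"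
  by (rule smooth_function_algebra[of "Collect smooth"])
    (blast intro: function_algebra.base smooth_deriv smooth_has_deriv)+

lemma smooth_add: "smooth f \<Longrightarrow> smooth g \<Longrightarrow> smooth (\<lambda>x. f x + g x)"
  by (rule smooth_base_algebra) (intro function_algebra.add function_algebra.base; simp)

lemma smooth_mult: "smooth f \<Longrightarrow> smooth g \<Longrightarrow> smooth (\<lambda>x. f x * g x)"
  by (rule smooth_base_algebra) (intro function_algebra.mult function_algebra.base; simp)

lemma smooth_exp:
  assumes "smooth f" shows "smooth (\<lambda>x. exp (f x))"
proof (rule smooth_function_algebra[of "insert (\<lambda>x. exp (f x)) (Collect smooth)"])
  let ?G = "insert (\<lambda>x. exp (f x)) (Collect smooth)"
  show "(\<lambda>x. exp (f x)) \<in> function_algebra ?G" by (rule function_algebra.base) simp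
  fix g assume "g \<in> ?G"
  then consider "g = (\<lambda>x. exp (f x))" | "smooth g" by blast
  then show "\<exists>g'\<in>function_algebra ?G. \<forall>x. (g has_real_derivative g' x) (at x)"
  proof cases
    case 1
    have "(\<lambda>x. exp (f x) * deriv f x) \<in> function_algebra ?G"
      by (intro function_algebra.mult function_algebra.base) (use smooth_deriv[OF assms] in auto)
    then show ?thesis
      by (rule bexI[rotated]) (auto simp: 1 intro!: derivative_eq_intros smooth_has_deriv[OF assms])
  next
    case 2
    then show ?thesis using smooth_deriv[of g] smooth_has_deriv[of g]
      by (intro bexI[of _ "deriv g"] function_algebra.base) auto
  qed
qed

lemma smooth_affine:
  assumes "smooth f" shows "smooth (\<lambda>x. f (c * x + d))"
proof (rule smooth_coinduct[of _ "{\<lambda>x. k * g (c * x + d) |k g. smooth g}"])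
  show "(\<lambda>x. f (c * x + d)) \<in> {\<lambda>x. k * g (c * x + d) |k g. smooth g}"
    using assms by (intro CollectI exI[of _ 1] exI[of _ f]) auto
  fix h assume "h \<in> {\<lambda>x. k * g (c * x + d) |k g. smooth g}"
  then obtain k g where h: "h = (\<lambda>x. k * g (c * x + d))" and g: "smooth g" by blast
  have "\<forall>x. (h has_real_derivative (k * c) * deriv g (c * x + d)) (at x)"
    unfolding h by (auto intro!: derivative_eq_intros DERIV_chain2[OF smooth_has_deriv[OF g]])
  moreover have "(\<lambda>x. (k * c) * deriv g (c * x + d)) \<in> {\<lambda>x. k * g (c * x + d) |k g. smooth g}"
    using smooth_deriv[OF g] by blast
  ultimately show "\<exists>g'\<in>{\<lambda>x. k * g (c * x + d) |k g. smooth g}. \<forall>x. (h has_real_derivative g' x) (at x)"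
    by (rule bexI)
qed

text \<open>The function \<open>exp (- 1 / x)\<close>, continued by \<open>0\<close>; the polynomial factor in \<open>1 / x\<close> makes the
  family closed under differentiation.\<close>

definition flat :: "real poly \<Rightarrow> real \<Rightarrow> real" where
  "flat P x = (if 0 < x then poly P (1 / x) * exp (- (1 / x)) else 0)"

lemma poly_times_exp_tendsto_0: "((\<lambda>t::real. poly P t * exp (- t)) \<longlongrightarrow> 0) at_top"
proof -
  have eq: "poly P t * exp (- t) = (\<Sum>i\<le>degree P. coeff P i * (t ^ i / exp t))" for t
    by (simp add: poly_altdef sum_distrib_right exp_minus divide_inverse mult.assoc)
  have "((\<lambda>t. \<Sum>i\<le>degree P. coeff P i * (t ^ i / exp t)) \<longlongrightarrow> (\<Sum>i\<le>degree P. coeff P i * 0)) at_top"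
    by (intro tendsto_sum tendsto_mult tendsto_const tendsto_power_div_exp_0)
  then show ?thesis by (simp add: eq)
qed

text \<open>At \<open>0\<close> the difference quotient is a polynomial in \<open>1 / x\<close> times \<open>exp (- 1 / x)\<close>, and the
  exponential wins.\<close>

lemma flat_has_deriv: "(flat P has_real_derivative flat ([:0, 0, 1:] * (P - pderiv P)) x) (at x)"
proof -
  consider "x > 0" | "x < 0" | "x = 0" by linarith
  then show ?thesis
  proof cases
    case 1
    have "((\<lambda>x. poly P (1 / x) * exp (- (1 / x))) has_real_derivative
        flat ([:0, 0, 1:] * (P - pderiv P)) x) (at x)"
      using 1 by (auto intro!: derivative_eq_intros DERIV_chain2[OF poly_DERIV]
        simp: flat_def field_simps power2_eq_square)
    then show ?thesis
      by (rule has_field_derivative_transform_within_open[of _ _ _ "{0<..}"]) (use 1 in \<open>auto simp: flat_def\<close>)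
  next
    case 2
    have "((\<lambda>x. 0) has_real_derivative flat ([:0, 0, 1:] * (P - pderiv P)) x) (at x)"
      using 2 by (auto simp: flat_def)
    then show ?thesis
      by (rule has_field_derivative_transform_within_open[of _ _ _ "{..<0}"]) (use 2 in \<open>auto simp: flat_def\<close>)
  next
    case 3
    have "((\<lambda>h. (flat P (0 + h) - flat P 0) / h) \<longlongrightarrow> 0) (at 0)"
    proof (rule filterlim_split_at)
      have "eventually (\<lambda>h. (flat P (0 + h) - flat P 0) / h = 0) (at_left (0::real))"
        unfolding eventually_at by (intro exI[of _ 1]) (auto simp: flat_def)
      then show "((\<lambda>h. (flat P (0 + h) - flat P 0) / h) \<longlongrightarrow> 0) (at_left 0)" by (rule tendsto_eventually)
      show "((\<lambda>h. (flat P (0 + h) - flat P 0) / h) \<longlongrightarrow> 0) (at_right 0)"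
        unfolding filterlim_at_right_to_top
      proof (rule Lim_transform_eventually)
        show "((\<lambda>t. poly ([:0, 1:] * P) t * exp (- t)) \<longlongrightarrow> 0) at_top" by (rule poly_times_exp_tendsto_0)
        show "eventually (\<lambda>t. poly ([:0, 1:] * P) t * exp (- t) = (flat P (0 + inverse t) - flat P 0) / inverse t) at_top"
          using eventually_gt_at_top[of 0] by eventually_elim (auto simp: flat_def field_simps)
      qed
    qed
    then show ?thesis unfolding DERIV_def using 3 by (simp add: flat_def)
  qed
qed

lemma smooth_flat: "smooth (flat P)"
  by (rule smooth_coinduct[of _ "range flat"]) (blast intro: flat_has_deriv)+

lemma flat_1_pos: "flat 1 x > 0 \<longleftrightarrow> x > 0" and flat_1_nonneg: "flat 1 x \<ge> 0"
  by (auto simp: flat_def)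

lemma test_function_iff:
  "test_function \<phi> \<longleftrightarrow> smooth \<phi> \<and> (\<exists>a b. 0 < a \<and> a \<le> b \<and> (\<forall>x. x \<notin> {a..b} \<longrightarrow> \<phi> x = 0))"
proof (intro iffI conjI)
  assume t: "test_function \<phi>"
  then show "smooth \<phi>" by (simp add: test_function_def smooth_def)
  let ?C = "closure {x. \<phi> x \<noteq> 0}"
  have sub: "{x. \<phi> x \<noteq> 0} \<subseteq> ?C" by (rule closure_subset)
  show "\<exists>a b. 0 < a \<and> a \<le> b \<and> (\<forall>x. x \<notin> {a..b} \<longrightarrow> \<phi> x = 0)"
  proof (cases "?C = {}")
    case True
    then have "\<phi> x = 0" for x using sub by auto
    then show ?thesis by (intro exI[of _ 1]) auto
  next
    case False
    have C: "compact ?C" "?C \<subseteq> {0<..}" using t by (auto simp: test_function_def)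
    obtain a where a: "a \<in> ?C" "\<And>t. t \<in> ?C \<Longrightarrow> a \<le> t" using compact_attains_inf[OF C(1) False] by blast
    obtain b where b: "b \<in> ?C" "\<And>t. t \<in> ?C \<Longrightarrow> t \<le> b" using compact_attains_sup[OF C(1) False] by blast
    have "\<phi> x = 0" if "x \<notin> {a..b}" for x
    proof (rule ccontr)
      assume "\<phi> x \<noteq> 0"
      then have "x \<in> ?C" using sub by blast
      then show False using a(2) b(2) that by force
    qed
    moreover have "0 < a" using a(1) C(2) by blast
    moreover have "a \<le> b" by (rule a(2)[OF b(1)])
    ultimately show ?thesis by blast
  qed
next
  assume a: "smooth \<phi> \<and> (\<exists>a b. 0 < a \<and> a \<le> b \<and> (\<forall>x. x \<notin> {a..b} \<longrightarrow> \<phi> x = 0))"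
  then obtain a b where ab: "0 < a" "\<And>x. x \<notin> {a..b} \<Longrightarrow> \<phi> x = 0" by blast
  have sub: "closure {x. \<phi> x \<noteq> 0} \<subseteq> {a..b}" using ab(2) by (intro closure_minimal subsetI closed_atLeastAtMost) blast
  moreover have "compact (closure {x. \<phi> x \<noteq> 0})"
    using sub by (meson bounded_closed_interval bounded_subset closed_closure compact_eq_bounded_closed)
  moreover have "{a..b} \<subseteq> {0<..}" using ab(1) by auto
  ultimately show "test_function \<phi>" using a unfolding test_function_def smooth_def by blast
qed

lemma test_function_deriv:
  assumes "test_function \<phi>" shows "test_function (deriv \<phi>)"
proof -
  obtain a b where ab: "0 < a" "a \<le> b" "\<And>x. x \<notin> {a..b} \<Longrightarrow> \<phi> x = 0" and s: "smooth \<phi>"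
    using assms unfolding test_function_iff by blast
  have "deriv \<phi> x = 0" if "x \<notin> {a..b}" for x
  proof (rule DERIV_imp_deriv)
    have "((\<lambda>x. 0) has_real_derivative 0) (at x)" by simp
    then show "(\<phi> has_real_derivative 0) (at x)"
      by (rule has_field_derivative_transform_within_open[of _ _ _ "- {a..b}"]) (use that ab in auto)
  qed
  then show ?thesis using smooth_deriv[OF s] ab unfolding test_function_iff by blast
qed

lemma test_function_continuous: "test_function \<phi> \<Longrightarrow> continuous_on S \<phi>"
  unfolding test_function_iff
  by (meson DERIV_continuous_on has_field_derivative_at_within smooth_has_deriv)

lemma test_function_scale_add:
  assumes "test_function \<phi>" "test_function \<psi>" shows "test_function (\<lambda>x. \<phi> x + c * \<psi> x)"
proof -
  obtain a b where ab: "0 < a" "a \<le> b" "\<And>x. x \<notin> {a..b} \<Longrightarrow> \<phi> x = 0" and s: "smooth \<phi>"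
    using assms(1) unfolding test_function_iff by blast
  obtain a' b' where ab': "0 < a'" "a' \<le> b'" "\<And>x. x \<notin> {a'..b'} \<Longrightarrow> \<psi> x = 0" and s': "smooth \<psi>"
    using assms(2) unfolding test_function_iff by blast
  have "smooth (\<lambda>x. \<phi> x + c * \<psi> x)" by (intro smooth_add smooth_mult smooth_const s s')
  moreover have "\<phi> x + c * \<psi> x = 0" if "x \<notin> {min a a'..max b b'}" for x
  proof -
    have "x \<notin> {a..b}" "x \<notin> {a'..b'}" using that by auto
    then show ?thesis using ab(3) ab'(3) by simp
  qed
  ultimately show ?thesis unfolding test_function_iff using ab ab'
    by (intro conjI exI[of _ "min a a'"] exI[of _ "max b b'"]) auto
qed

text \<open>The product of the two flat functions is positive exactly on \<open>(a, b)\<close>. Hence these functions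
  increase to the indicator of \<open>(a, b)\<close> as \<open>n\<close> tends to infinity.\<close>

definition cutoff :: "real \<Rightarrow> real \<Rightarrow> nat \<Rightarrow> real \<Rightarrow> real" where
  "cutoff a b n x = 1 - exp (- real n * (flat 1 (x - a) * flat 1 (b - x)))"

lemma test_function_cutoff:
  assumes "0 < a" "a < b" shows "test_function (cutoff a b n)"
proof -
  have "smooth (\<lambda>x. 1 + (-1) * exp (- real n * (flat 1 (1 * x + (- a)) * flat 1 ((-1) * x + b))))"
    by (intro smooth_add smooth_mult smooth_exp smooth_const smooth_affine smooth_flat)
  then have "smooth (cutoff a b n)" by (simp add: cutoff_def[abs_def])
  moreover have "cutoff a b n x = 0" if "x \<notin> {a..b}" for x using that by (auto simp: cutoff_def flat_def)
  ultimately show ?thesis unfolding test_function_iff using assms by (meson less_imp_le)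
qed

lemma cutoff_bounds: "0 \<le> cutoff a b n x" "cutoff a b n x \<le> 1"
  using flat_1_nonneg[of "x - a"] flat_1_nonneg[of "b - x"] by (auto simp: cutoff_def)

lemma cutoff_outside: "x \<notin> {a<..<b} \<Longrightarrow> cutoff a b n x = 0"
  by (auto simp: cutoff_def flat_def)

lemma cutoff_tendsto: "(\<lambda>n. cutoff a b n x) \<longlonglongrightarrow> indicator {a<..<b} x"
proof (cases "x \<in> {a<..<b}")
  case True
  define c where "c = flat 1 (x - a) * flat 1 (b - x)"
  have "c > 0" using True flat_1_pos[of "x - a"] flat_1_pos[of "b - x"] by (simp add: c_def)
  then have "exp (- c) < 1" by simp
  then have "(\<lambda>n. 1 - exp (- c) ^ n) \<longlonglongrightarrow> 1 - 0" by (intro tendsto_intros LIMSEQ_power_zero) auto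
  moreover have "cutoff a b n x = 1 - exp (- c) ^ n" for n
    by (simp add: cutoff_def c_def[symmetric] exp_of_nat_mult[symmetric])
  ultimately show ?thesis using True by simp
qed (simp add: cutoff_outside)

section \<open>The fundamental lemma of the calculus of variations\<close>

lemma test_function_times_integrable:
  fixes u :: "real \<Rightarrow> 'a::real_normed_vector"
  assumes \<phi>: "test_function \<phi>" and u: "locally_integrable u"
  shows "strong_integrable halfline (\<lambda>x. \<phi> x *\<^sub>R u x)"
proof -
  obtain a b where ab: "0 < a" "a \<le> b" "\<And>x. x \<notin> {a..b} \<Longrightarrow> \<phi> x = 0"
    using \<phi> unfolding test_function_iff by blast
  have c: "continuous_on {0<..} \<phi>" by (rule test_function_continuous[OF \<phi>])
  obtain C where C: "\<And>t. a/2 \<le> t \<Longrightarrow> t \<le> b \<Longrightarrow> norm (\<phi> t) \<le> C"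
    using bounded_on_compact_ivl[OF c, of "a/2" b] ab(1) by auto
  have "ivl_integrable (a/2) b (\<lambda>x. \<phi> x *\<^sub>R u x)"
    using u ab(1) C
    by (intro ivl_integrable_bilinear_continuous[OF bounded_bilinear_scaleR c, where C=C])
      (auto simp: locally_integrable_iff)
  moreover have "(\<lambda>x. indicator {a/2<..b} x *\<^sub>R \<phi> x *\<^sub>R u x) = (\<lambda>x. \<phi> x *\<^sub>R u x)"
  proof
    fix x show "indicator {a/2<..b} x *\<^sub>R \<phi> x *\<^sub>R u x = \<phi> x *\<^sub>R u x"
      using ab(1) ab(3)[of x] by (cases "x \<in> {a..b}") (auto split: split_indicator)
  qed
  ultimately show ?thesis by (simp only:)
qed

lemma halfline_sets_borel:
  assumes "A \<in> sets halfline" obtains A' where "A' \<in> sets borel" "A = A' \<inter> {0<..}"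
  using assms unfolding sets_restrict_space by auto

lemma borel_real_open_intervals: "(borel :: real measure) = sigma UNIV (range (\<lambda>(u, v). {u<..<v}))"
  using borel_eq_box[where 'a=real] by simp

text \<open>The open intervals are stable under intersection and generate the Borel sets, while the sets
  over which the integral vanishes form a Dynkin system.\<close>

lemma integrals_zero_imp_set_integrals_zero:
  fixes f :: "real \<Rightarrow> 'a::banach"
  assumes f: "strong_integrable halfline f"
    and ivl: "\<And>u v. strong_integral halfline (\<lambda>x. indicator {u<..<v} x *\<^sub>R f x) = 0"
    and tot: "strong_integral halfline f = 0"
    and A: "A \<in> sets borel"
  shows "strong_integral halfline (\<lambda>x. indicator A x *\<^sub>R f x) = 0"
proof -
  let ?G = "range (\<lambda>(u, v). {u<..<v::real})"
  have "Int_stable ?G"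
  proof (rule Int_stableI_image)
    fix i j :: "real \<times> real"
    show "\<exists>k\<in>UNIV. (case i of (u, v) \<Rightarrow> {u<..<v}) \<inter> (case j of (u, v) \<Rightarrow> {u<..<v}) = (case k of (u, v) \<Rightarrow> {u<..<v})"
      by (intro bexI[of _ "(max (fst i) (fst j), min (snd i) (snd j))"]) (auto split: prod.split)
  qed
  moreover have "?G \<subseteq> Pow UNIV" by simp
  moreover have "A \<in> sigma_sets UNIV ?G" using A by (simp add: borel_real_open_intervals)
  ultimately show ?thesis
  proof (induction rule: sigma_sets_induct_disjoint[consumes 3])
    case (basic B) then show ?case using ivl by auto
  next
    case empty then show ?case by simp
  next
    case (compl B)
    then have B: "B \<in> sets borel" by (simp add: borel_real_open_intervals)
    have "strong_integral halfline (\<lambda>x. f x - indicator B x *\<^sub>R f x) = 0"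
      using compl tot by (simp add: strong_integral_diff[OF f strong_integrable_indicator[OF f B]])
    moreover have "(\<lambda>x. f x - indicator B x *\<^sub>R f x) = (\<lambda>x. indicator (UNIV - B) x *\<^sub>R f x)"
      by (auto simp: fun_eq_iff split: split_indicator)
    ultimately show ?case by simp
  next
    case (union B)
    have B: "B i \<in> sets borel" for i using union(2) by (auto simp: borel_real_open_intervals)
    have d: "disjoint_family B" by (rule union(1))
    have UB: "\<Union>(range B) \<in> sets borel" "(\<Union>i<n. B i) \<in> sets borel" for n using B by auto
    have 0: "strong_integral halfline (\<lambda>x. indicator (\<Union>i<n. B i) x *\<^sub>R f x) = 0" for n
    proof (induction n)
      case (Suc n)
      have "(\<lambda>x. indicator (\<Union>i<Suc n. B i) x *\<^sub>R f x) = (\<lambda>x. indicator (\<Union>i<n. B i) x *\<^sub>R f x + indicator (B n) x *\<^sub>R f x)"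
      proof
        fix x
        have "B i \<inter> B n = {}" if "i < n" for i using d that by (auto simp: disjoint_family_on_def)
        then have "x \<in> B n \<Longrightarrow> x \<notin> (\<Union>i<n. B i)" by blast
        then show "indicator (\<Union>i<Suc n. B i) x *\<^sub>R f x = indicator (\<Union>i<n. B i) x *\<^sub>R f x + indicator (B n) x *\<^sub>R f x"
          by (auto simp: lessThan_Suc split: split_indicator)
      qed
      then show ?case
        using Suc union(3)[of n] strong_integral_add[OF strong_integrable_indicator[OF f UB(2)] strong_integrable_indicator[OF f B], of n n]
        by simp
    qed simp
    have "(\<lambda>n. strong_integral halfline (\<lambda>x. indicator (\<Union>i<n. B i) x *\<^sub>R f x))
       \<longlonglongrightarrow> strong_integral halfline (\<lambda>x. indicator (\<Union>(range B)) x *\<^sub>R f x)"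
    proof (rule strong_integral_dominated_convergence[OF strong_integrable_indicator[OF f UB(1)] strong_integrable_indicator[OF f UB(2)] f])
      fix n x
      show "norm (indicator (\<Union>(range B)) x *\<^sub>R f x - indicator (\<Union>i<n. B i) x *\<^sub>R f x) \<le> norm (f x)"
        by (auto split: split_indicator)
      have "eventually (\<lambda>n. indicator (\<Union>i<n. B i) x *\<^sub>R f x = indicator (\<Union>(range B)) x *\<^sub>R f x) sequentially"
      proof (cases "x \<in> \<Union>(range B)")
        case True
        then obtain i where i: "x \<in> B i" by blast
        show ?thesis
          by (rule eventually_mono[OF eventually_gt_at_top[of i]]) (use i in \<open>auto split: split_indicator\<close>)
      qed (auto split: split_indicator)
      then show "(\<lambda>n. indicator (\<Union>i<n. B i) x *\<^sub>R f x) \<longlonglongrightarrow> indicator (\<Union>(range B)) x *\<^sub>R f x"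
        by (rule tendsto_eventually)
    qed
    with 0 show ?case by (simp add: LIMSEQ_const_iff)
  qed
qed

text \<open>The fundamental lemma: approximating the indicator of an interval by the cut-off functions
  shows that the integral over every interval vanishes, hence the integral over every Borel set
  inside \<open>(a, b)\<close>, and such a function is zero almost everywhere.\<close>

lemma test_integrals_zero_imp_AE_zero:
  fixes z :: "real \<Rightarrow> 'a::banach"
  assumes z: "locally_integrable z"
    and 0: "\<And>\<phi>. test_function \<phi> \<Longrightarrow> strong_integral halfline (\<lambda>x. \<phi> x *\<^sub>R z x) = 0"
  shows "AE x in halfline. z x = 0"
proof -
  have zi: "strong_integrable halfline (\<lambda>x. indicator {a<..<b} x *\<^sub>R z x)" if "0 < a" for a b
  proof -
    have "(\<lambda>x. indicator {a<..<b} x *\<^sub>R z x) = (\<lambda>x. indicator {a<..<b} x *\<^sub>R indicator {a<..b} x *\<^sub>R z x)"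
      by (auto simp: fun_eq_iff split: split_indicator)
    then show ?thesis
      using strong_integrable_indicator[of "\<lambda>x. indicator {a<..b} x *\<^sub>R z x" "{a<..<b}"] z that
      by (simp add: locally_integrable_iff)
  qed
  have open0: "strong_integral halfline (\<lambda>x. indicator {a<..<b} x *\<^sub>R z x) = 0" if a: "0 < a" for a b
  proof (cases "a < b")
    case True
    have "(\<lambda>n. strong_integral halfline (\<lambda>x. cutoff a b n x *\<^sub>R z x))
       \<longlonglongrightarrow> strong_integral halfline (\<lambda>x. indicator {a<..<b} x *\<^sub>R z x)"
    proof (rule strong_integral_dominated_convergence[OF zi[OF a] test_function_times_integrable[OF test_function_cutoff[OF a True] z] zi[OF a]])
      fix n x
      have "norm (indicator {a<..<b} x *\<^sub>R z x - cutoff a b n x *\<^sub>R z x) = \<bar>indicator {a<..<b} x - cutoff a b n x\<bar> * norm (z x)"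
        by (metis norm_scaleR real_norm_def scaleR_diff_left)
      also have "\<dots> \<le> indicator {a<..<b} x * norm (z x)"
        using cutoff_bounds[of a b n x] cutoff_outside[of x a b n]
        by (intro mult_right_mono) (auto split: split_indicator)
      finally show "norm (indicator {a<..<b} x *\<^sub>R z x - cutoff a b n x *\<^sub>R z x) \<le> norm (indicator {a<..<b} x *\<^sub>R z x)"
        by (auto split: split_indicator)
      show "(\<lambda>n. cutoff a b n x *\<^sub>R z x) \<longlonglongrightarrow> indicator {a<..<b} x *\<^sub>R z x"
        by (intro tendsto_scaleR cutoff_tendsto tendsto_const)
    qed
    then show ?thesis by (simp add: 0[OF test_function_cutoff[OF a True]] LIMSEQ_const_iff)
  qed simp
  have "AE x in halfline. indicator {a<..<b} x *\<^sub>R z x = 0" if a: "0 < a" for a b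
  proof (rule strong_integral_all_sets_zero_imp_AE_zero[OF zi[OF a]])
    fix A assume "A \<in> sets halfline"
    then obtain A' where A': "A' \<in> sets borel" "A = A' \<inter> {0<..}" by (rule halfline_sets_borel)
    have "strong_integral halfline (\<lambda>x. indicator A' x *\<^sub>R indicator {a<..<b} x *\<^sub>R z x) = 0"
    proof (rule integrals_zero_imp_set_integrals_zero[OF zi[OF a] _ open0[OF a] A'(1)])
      fix u v :: real
      have "(\<lambda>x. indicator {u<..<v} x *\<^sub>R indicator {a<..<b} x *\<^sub>R z x) = (\<lambda>x. indicator {max u a<..<min v b} x *\<^sub>R z x)"
        by (auto simp: fun_eq_iff split: split_indicator)
      then show "strong_integral halfline (\<lambda>x. indicator {u<..<v} x *\<^sub>R indicator {a<..<b} x *\<^sub>R z x) = 0"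
        using open0[of "max u a" "min v b"] a by simp
    qed
    also have "strong_integral halfline (\<lambda>x. indicator A' x *\<^sub>R indicator {a<..<b} x *\<^sub>R z x)
      = strong_integral halfline (\<lambda>x. indicator A x *\<^sub>R indicator {a<..<b} x *\<^sub>R z x)"
      by (rule strong_integral_cong) (auto simp: A' split: split_indicator)
    finally show "strong_integral halfline (\<lambda>x. indicator A x *\<^sub>R indicator {a<..<b} x *\<^sub>R z x) = 0" .
  qed
  then have "AE x in halfline. \<forall>n::nat. indicator {1 / (real n + 1)<..<real n + 1} x *\<^sub>R z x = 0"
    unfolding AE_all_countable by simp
  then show ?thesis
  proof (rule AE_mp, intro AE_I2 impI)
    fix x assume x: "x \<in> space halfline" and *: "\<forall>n::nat. indicator {1 / (real n + 1)<..<real n + 1} x *\<^sub>R z x = 0"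
    obtain n1 where n1: "x < real n1" using reals_Archimedean2 by blast
    obtain n2 where n2: "1 / x < real n2" using reals_Archimedean2 by blast
    have "1 / x < real (max n1 n2) + 1" "x < real (max n1 n2) + 1" using n1 n2 by linarith+
    moreover have "1 / (real (max n1 n2) + 1) < x" using x calculation(1) by (simp add: field_simps)
    ultimately have "x \<in> {1 / (real (max n1 n2) + 1)<..<real (max n1 n2) + 1}" by simp
    with *[rule_format, of "max n1 n2"] show "z x = 0" by simp
  qed
qed

section \<open>Weak derivatives and absolute continuity\<close>

lemma AE_halfline_obtain:
  assumes "AE x in halfline. P x" "0 \<le> a" "a < b"
  obtains x where "a < x" "x < b" "P x"
proof (rule ccontr)
  assume n: "\<not> thesis"
  note obt = that
  have n: "\<not> P x" if "a < x" "x < b" for x using n obt[OF that] by blast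
  have "AE x in halfline. x \<notin> {a<..<b}"
    using assms(1) by eventually_elim (use n in auto)
  then have "AE x in lborel. 0 < x \<longrightarrow> x \<notin> {a<..<b}" by (subst (asm) AE_restrict_space_iff) auto
  then have "AE x in lborel. x \<notin> {a<..<b}" by eventually_elim (use assms(2) in auto)
  then have "emeasure lborel {a<..<b} = 0" by (subst (asm) AE_iff_measurable[of "{a<..<b}"]) auto
  then show False using assms(3) by simp
qed

lemma test_function_supports:
  assumes "test_function \<phi>"
  obtains a b where "0 < a" "a \<le> b" "\<And>x. x \<notin> {a..b} \<Longrightarrow> \<phi> x = 0" "\<And>x. x \<notin> {a..b} \<Longrightarrow> deriv \<phi> x = 0"
proof -
  obtain a b where 1: "0 < a" "a \<le> b" "\<And>x. x \<notin> {a..b} \<Longrightarrow> \<phi> x = 0"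
    using assms unfolding test_function_iff by blast
  obtain a' b' where 2: "0 < a'" "a' \<le> b'" "\<And>x. x \<notin> {a'..b'} \<Longrightarrow> deriv \<phi> x = 0"
    using test_function_deriv[OF assms] unfolding test_function_iff by blast
  have out: "x \<notin> {a..b}" "x \<notin> {a'..b'}" if "x \<notin> {min a a'..max b b'}" for x using that by auto
  show thesis
  proof (rule that)
    show "0 < min a a'" "min a a' \<le> max b b'" using 1 2 by auto
    show "\<phi> x = 0" if "x \<notin> {min a a'..max b b'}" for x by (rule 1(3)[OF out(1)[OF that]])
    show "deriv \<phi> x = 0" if "x \<notin> {min a a'..max b b'}" for x by (rule 2(3)[OF out(2)[OF that]])
  qed
qed

text \<open>Integration by parts: the product \<open>\<phi> w\<close> vanishes to the left and to the right of the support
  of \<open>\<phi>\<close>.\<close>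

lemma has_ac_deriv_imp_test_integral:
  assumes w: "has_ac_deriv w r" and \<phi>: "test_function \<phi>"
  shows "strong_integral halfline (\<lambda>x. deriv \<phi> x *\<^sub>R w x) = - strong_integral halfline (\<lambda>x. \<phi> x *\<^sub>R r x)"
proof -
  obtain a b where ab: "0 < a" "a \<le> b" "\<And>x. x \<notin> {a..b} \<Longrightarrow> \<phi> x = 0" "\<And>x. x \<notin> {a..b} \<Longrightarrow> deriv \<phi> x = 0"
    using test_function_supports[OF \<phi>] by blast
  let ?s = "\<lambda>x. deriv \<phi> x *\<^sub>R w x + \<phi> x *\<^sub>R r x"
  have "smooth \<phi>" using \<phi> by (simp add: test_function_iff)
  then have "has_ac_deriv (\<lambda>x. \<phi> x *\<^sub>R w x) ?s"
    by (intro has_ac_deriv_bilinear[OF bounded_bilinear_scaleR _ _ w] test_function_continuous[OF test_function_deriv[OF \<phi>]])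
      (auto simp: has_real_derivative_iff_has_vector_derivative[symmetric] intro: smooth_has_deriv)
  then have "\<phi> (b + 1) *\<^sub>R w (b + 1) - \<phi> (a / 2) *\<^sub>R w (a / 2) = ivl_integral (a / 2) (b + 1) ?s"
    using ab(1,2) unfolding has_ac_deriv_def by auto
  moreover have "\<phi> (b + 1) = 0" "\<phi> (a / 2) = 0" using ab(1,2) by (auto intro!: ab(3))
  moreover have "(\<lambda>x. indicator {a / 2<..b + 1} x *\<^sub>R ?s x) = ?s"
  proof
    fix x show "indicator {a / 2<..b + 1} x *\<^sub>R ?s x = ?s x"
      using ab(1) ab(3,4)[of x] by (cases "x \<in> {a..b}") (auto split: split_indicator)
  qed
  ultimately have "strong_integral halfline ?s = 0" by simp
  moreover have "locally_integrable r" "locally_integrable w"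
    using w has_ac_deriv_locally_integrable by (auto simp: has_ac_deriv_def)
  ultimately show ?thesis
    using strong_integral_add[OF test_function_times_integrable[OF test_function_deriv[OF \<phi>]] test_function_times_integrable[OF \<phi>], of w r]
    by (simp add: eq_neg_iff_add_eq_0)
qed

text \<open>The antiderivative that vanishes to the left of the support of \<open>\<psi>\<close> also vanishes to the right
  of it, because the total integral is \<open>0\<close>.\<close>

lemma test_function_antiderivative:
  assumes \<psi>: "test_function \<psi>" and 0: "strong_integral halfline \<psi> = 0"
  obtains \<Phi> where "test_function \<Phi>" "deriv \<Phi> = \<psi>"
proof -
  obtain a b where ab: "0 < a" "a \<le> b" "\<And>x. x \<notin> {a..b} \<Longrightarrow> \<psi> x = 0"
    using \<psi> unfolding test_function_iff by blast
  define g where "g x = integral {0..x} \<psi>" for x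
  have g: "(g has_real_derivative \<psi> x) (at x)" if "0 < x" for x
  proof -
    have "(g has_real_derivative \<psi> x) (at x within {0..x + 1})"
      unfolding g_def using that
      by (intro integral_has_real_derivative test_function_continuous[OF \<psi>]) auto
    then show ?thesis using that by (simp add: at_within_Icc_at)
  qed
  then have ac: "has_ac_deriv g \<psi>"
    by (intro has_vector_derivative_imp_has_ac_deriv test_function_continuous[OF \<psi>])
      (auto simp: has_real_derivative_iff_has_vector_derivative[symmetric])
  define \<Phi> where "\<Phi> x = (if 0 < x then g x - g (a / 2) else 0)" for x
  have below: "\<Phi> x = 0" if "x < a" for x
  proof (cases "0 < x")
    case True
    have "ivl_integral u v \<psi> = 0" if "v < a" for u v
    proof -
      have "(\<lambda>t. indicator {u<..v} t *\<^sub>R \<psi> t) = (\<lambda>t. 0)"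
      proof
        fix t show "indicator {u<..v} t *\<^sub>R \<psi> t = 0"
          using that ab(3)[of t] by (cases "t \<in> {a..b}") (auto split: split_indicator)
      qed
      then show ?thesis by simp
    qed
    then have "g v - g u = 0" if "0 < u" "u \<le> v" "v < a" for u v
      using ac that unfolding has_ac_deriv_def by metis
    from this[of x "a / 2"] this[of "a / 2" x] show ?thesis
      using True that ab(1) by (cases "x \<le> a / 2") (auto simp: \<Phi>_def)
  qed (simp add: \<Phi>_def)
  have above: "\<Phi> x = 0" if "b < x" for x
  proof -
    have "(\<lambda>t. indicator {a / 2<..x} t *\<^sub>R \<psi> t) = \<psi>"
    proof
      fix t show "indicator {a / 2<..x} t *\<^sub>R \<psi> t = \<psi> t"
        using that ab(1,2) ab(3)[of t] by (cases "t \<in> {a..b}") (auto split: split_indicator)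
    qed
    then have "g x - g (a / 2) = 0"
      using ac ab(1,2) that 0 unfolding has_ac_deriv_def by auto
    then show ?thesis by (simp add: \<Phi>_def)
  qed
  have d: "(\<Phi> has_real_derivative \<psi> x) (at x)" for x
  proof (cases "0 < x")
    case True
    have "((\<lambda>x. g x - g (a / 2)) has_real_derivative \<psi> x) (at x)"
      using g[OF True] by (auto intro!: derivative_eq_intros)
    then show ?thesis
      by (rule has_field_derivative_transform_within_open[of _ _ _ "{0<..}"]) (use True in \<open>auto simp: \<Phi>_def\<close>)
  next
    case False
    then have "\<psi> x = 0" using ab by (intro ab(3)) auto
    then have "((\<lambda>x. 0) has_real_derivative \<psi> x) (at x)" by simp
    then show ?thesis
      by (rule has_field_derivative_transform_within_open[of _ _ _ "{..<a}"]) (use False ab below in auto)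
  qed
  have "deriv \<Phi> = \<psi>" using d by (intro ext DERIV_imp_deriv)
  moreover have "smooth \<Phi>"
  proof (rule smooth_coinduct[of _ "insert \<Phi> (Collect smooth)"])
    fix h assume h: "h \<in> insert \<Phi> (Collect smooth)"
    show "\<exists>g'\<in>insert \<Phi> (Collect smooth). \<forall>x. (h has_real_derivative g' x) (at x)"
    proof (cases "h = \<Phi>")
      case True
      then show ?thesis using d \<psi> by (intro bexI[of _ \<psi>]) (simp_all add: test_function_iff)
    next
      case False
      then have "smooth h" using h by simp
      then show ?thesis by (intro bexI[of _ "deriv h"]) (simp_all add: smooth_deriv smooth_has_deriv)
    qed
  qed simp
  moreover have "\<forall>x. x \<notin> {a..b} \<longrightarrow> \<Phi> x = 0" using below above by (auto simp: not_le)
  ultimately show thesis using ab by (intro that[of \<Phi>]) (auto simp: test_function_iff)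
qed

lemma test_function_imp_strong_integrable: "test_function \<phi> \<Longrightarrow> strong_integrable halfline \<phi>"
  using test_function_times_integrable[of \<phi> "\<lambda>_. 1::real"] continuous_imp_locally_integrable[of "\<lambda>_. 1::real"]
  by simp

lemma test_function_nonzero_integral:
  obtains \<rho> where "test_function \<rho>" "strong_integral halfline \<rho> \<noteq> 0"
proof (rule ccontr)
  assume n: "\<not> thesis"
  note obt = that
  have "strong_integral halfline \<rho> = 0" if "test_function \<rho>" for \<rho> using n obt[OF that] by blast
  then have "AE x in halfline. (1::real) = 0"
    by (intro test_integrals_zero_imp_AE_zero continuous_imp_locally_integrable continuous_on_const) simp
  from AE_halfline_obtain[OF this, of 0 1] show False by auto
qed

text \<open>Every test function is the sum of a derivative of a test function and a multiple of a fixed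
  \<open>\<rho>\<close> with non-zero integral. The derivative does not contribute, so integrating a test function
  against \<open>z\<close> gives the same as integrating it against the constant \<open>c\<close>.\<close>

lemma du_Bois_Reymond:
  fixes z :: "real \<Rightarrow> 'a::banach"
  assumes z: "locally_integrable z"
    and 0: "\<And>\<phi>. test_function \<phi> \<Longrightarrow> strong_integral halfline (\<lambda>x. deriv \<phi> x *\<^sub>R z x) = 0"
  obtains c where "AE x in halfline. z x = c"
proof -
  obtain \<rho> where \<rho>: "test_function \<rho>" "strong_integral halfline \<rho> \<noteq> 0"
    by (rule test_function_nonzero_integral)
  let ?I = "strong_integral halfline"
  define c where "c = (1 / ?I \<rho>) *\<^sub>R ?I (\<lambda>x. \<rho> x *\<^sub>R z x)"
  have lc: "locally_integrable (\<lambda>x. c)" by (intro continuous_imp_locally_integrable continuous_on_const)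
  have "AE x in halfline. z x - c = 0"
  proof (rule test_integrals_zero_imp_AE_zero)
    show "locally_integrable (\<lambda>x. z x - c)" by (rule locally_integrable_diff[OF z lc])
    fix \<phi> assume \<phi>: "test_function \<phi>"
    (* With this k the function \<phi> + k \<rho> has integral 0, so it is the derivative of a test
       function. *)
    define k where "k = - ?I \<phi> / ?I \<rho>"
    have \<psi>: "test_function (\<lambda>x. \<phi> x + k * \<rho> x)" by (rule test_function_scale_add[OF \<phi> \<rho>(1)])
    have i\<rho>: "strong_integrable halfline (\<lambda>x. k *\<^sub>R \<rho> x)"
      by (rule strong_integrable_bounded_linear[OF bounded_linear_scaleR_right test_function_imp_strong_integrable[OF \<rho>(1)]])
    have "?I (\<lambda>x. \<phi> x + k * \<rho> x) = ?I \<phi> + k * ?I \<rho>"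
      using strong_integral_add[OF test_function_imp_strong_integrable[OF \<phi>] i\<rho>]
        strong_integral_scaleR[OF test_function_imp_strong_integrable[OF \<rho>(1)], of k] by simp
    then have "?I (\<lambda>x. \<phi> x + k * \<rho> x) = 0" using \<rho>(2) by (simp add: k_def)
    then obtain \<Phi> where \<Phi>: "test_function \<Phi>" "deriv \<Phi> = (\<lambda>x. \<phi> x + k * \<rho> x)"
      using test_function_antiderivative[OF \<psi>] by blast
    note iz = test_function_times_integrable[OF \<phi> z] test_function_times_integrable[OF \<rho>(1) z]
    have ikz: "strong_integrable halfline (\<lambda>x. k *\<^sub>R \<rho> x *\<^sub>R z x)"
      by (rule strong_integrable_bounded_linear[OF bounded_linear_scaleR_right iz(2)])
    have "0 = ?I (\<lambda>x. deriv \<Phi> x *\<^sub>R z x)" using 0[OF \<Phi>(1)] by simp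
    also have "\<dots> = ?I (\<lambda>x. \<phi> x *\<^sub>R z x + k *\<^sub>R \<rho> x *\<^sub>R z x)" by (simp add: \<Phi>(2) scaleR_add_left)
    also have "\<dots> = ?I (\<lambda>x. \<phi> x *\<^sub>R z x) + k *\<^sub>R ?I (\<lambda>x. \<rho> x *\<^sub>R z x)"
      by (simp only: strong_integral_add[OF iz(1) ikz] strong_integral_scaleR[OF iz(2)])
    also have "k *\<^sub>R ?I (\<lambda>x. \<rho> x *\<^sub>R z x) = - (?I \<phi> *\<^sub>R c)" by (simp add: k_def c_def)
    finally have "?I (\<lambda>x. \<phi> x *\<^sub>R z x) = ?I \<phi> *\<^sub>R c" by simp
    also have "\<dots> = ?I (\<lambda>x. \<phi> x *\<^sub>R c)"
      using strong_integral_bounded_linear[OF bounded_linear_scaleR_left test_function_imp_strong_integrable[OF \<phi>], of c] by simp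
    finally show "?I (\<lambda>x. \<phi> x *\<^sub>R (z x - c)) = 0"
      using strong_integral_diff[OF iz(1) test_function_times_integrable[OF \<phi> lc]] by (simp add: scaleR_diff_right)
  qed
  then have "AE x in halfline. z x = c" by eventually_elim simp
  then show thesis by (rule that)
qed

lemma has_weak_deriv_1_iff:
  "has_weak_deriv 1 u v \<longleftrightarrow> locally_integrable u \<and> locally_integrable v \<and>
     (\<forall>\<phi>. test_function \<phi> \<longrightarrow> strong_integral halfline (\<lambda>x. deriv \<phi> x *\<^sub>R u x) = - strong_integral halfline (\<lambda>x. \<phi> x *\<^sub>R v x))"
  by (simp add: has_weak_deriv_def)

lemma ex_has_ac_deriv:
  fixes r :: "real \<Rightarrow> 'a::banach"
  assumes r: "locally_integrable r" obtains w where "has_ac_deriv w r"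
proof -
  define w where "w y = (if 1 \<le> y then ivl_integral 1 y r else - ivl_integral y 1 r)" for y
  have i: "ivl_integrable x y r" if "0 < x" for x y using r that by (simp add: locally_integrable_iff)
  have "w y - w x = ivl_integral x y r" if x: "0 < x" and xy: "x \<le> y" for x y
  proof -
    consider "1 \<le> x" | "x < 1" "1 \<le> y" | "y < 1" by linarith
    then show ?thesis
    proof cases
      case 1 then show ?thesis using ivl_integral_split[OF i[of 1], of x y] xy by (simp add: w_def)
    next
      case 2 then show ?thesis using ivl_integral_split[OF i[OF x], of 1 y] xy by (simp add: w_def)
    next
      case 3 then show ?thesis using ivl_integral_split[OF i[OF x], of y 1] xy by (simp add: w_def)
    qed
  qed
  then show thesis using r by (intro that[of w]) (simp add: has_ac_deriv_def)
qed

text \<open>An antiderivative \<open>w\<close> of \<open>v\<close> has weak derivative \<open>v\<close> by integration by parts. So \<open>u - w\<close> has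
  weak derivative \<open>0\<close> and is constant.\<close>

lemma has_weak_deriv_imp_has_ac_deriv:
  fixes u v :: "real \<Rightarrow> 'a::banach"
  assumes uv: "has_weak_deriv 1 u v"
  obtains w where "has_ac_deriv w v" "AE x in halfline. u x = w x"
proof -
  have l: "locally_integrable u" "locally_integrable v" using uv by (auto simp: has_weak_deriv_def)
  obtain w where w: "has_ac_deriv w v" by (rule ex_has_ac_deriv[OF l(2)])
  have lw: "locally_integrable w" by (rule has_ac_deriv_locally_integrable[OF w])
  have "strong_integral halfline (\<lambda>x. deriv \<phi> x *\<^sub>R (u x - w x)) = 0" if \<phi>: "test_function \<phi>" for \<phi>
    using strong_integral_diff[OF test_function_times_integrable[OF test_function_deriv[OF \<phi>] l(1)]
        test_function_times_integrable[OF test_function_deriv[OF \<phi>] lw]]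
      has_ac_deriv_imp_test_integral[OF w \<phi>] uv[unfolded has_weak_deriv_1_iff] \<phi>
    by (simp add: scaleR_diff_right)
  then obtain c where c: "AE x in halfline. u x - w x = c"
    using du_Bois_Reymond[OF locally_integrable_diff[OF l(1) lw]] by blast
  have "has_ac_deriv (\<lambda>x. w x + c) v" using has_ac_deriv_add[OF w has_ac_deriv_const] by simp
  moreover have "AE x in halfline. u x = w x + c" using c by eventually_elim (simp add: algebra_simps)
  ultimately show thesis by (rule that)
qed

lemma test_function_higher_deriv: "test_function \<phi> \<Longrightarrow> test_function ((deriv ^^ n) \<phi>)"
  by (induction n) (auto intro: test_function_deriv)

lemma test_integral_AE_eq:
  fixes u :: "real \<Rightarrow> 'a::banach"
  assumes "test_function \<phi>" "locally_integrable u" "locally_integrable u'" "AE x in halfline. u x = u' x"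
  shows "strong_integral halfline (\<lambda>x. \<phi> x *\<^sub>R u' x) = strong_integral halfline (\<lambda>x. \<phi> x *\<^sub>R u x)"
proof (rule strong_integral_AE_eq(2)[OF test_function_times_integrable[OF assms(1,2)]])
  show "strongly_measurable halfline (\<lambda>x. \<phi> x *\<^sub>R u' x)"
    using test_function_times_integrable[OF assms(1,3)] by (simp add: strong_integrable_def)
  show "AE x in halfline. \<phi> x *\<^sub>R u x = \<phi> x *\<^sub>R u' x" using assms(4) by eventually_elim simp
qed

lemma has_weak_deriv_AE_eq:
  fixes u v :: "real \<Rightarrow> 'a::banach"
  assumes "has_weak_deriv j u v" "locally_integrable u'" "AE x in halfline. u x = u' x"
    "locally_integrable v'" "AE x in halfline. v x = v' x"
  shows "has_weak_deriv j u' v'"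
  unfolding has_weak_deriv_def
proof (intro conjI allI impI assms)
  fix \<phi> assume \<phi>: "test_function \<phi>"
  have l: "locally_integrable u" "locally_integrable v" using assms(1) by (auto simp: has_weak_deriv_def)
  show "strong_integral halfline (\<lambda>x. (deriv ^^ j) \<phi> x *\<^sub>R u' x) = (-1) ^ j *\<^sub>R strong_integral halfline (\<lambda>x. \<phi> x *\<^sub>R v' x)"
    using assms(1) \<phi>
    by (simp add: has_weak_deriv_def test_integral_AE_eq[OF \<phi> l(2) assms(4,5)]
        test_integral_AE_eq[OF test_function_higher_deriv[OF \<phi>] l(1) assms(2,3)])
qed

lemma has_weak_deriv_unique:
  fixes u v :: "real \<Rightarrow> 'a::banach"
  assumes "has_weak_deriv j u v" "has_weak_deriv j u v'" shows "AE x in halfline. v x = v' x"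
proof -
  have l: "locally_integrable v" "locally_integrable v'" using assms by (auto simp: has_weak_deriv_def)
  have "AE x in halfline. v x - v' x = 0"
  proof (rule test_integrals_zero_imp_AE_zero)
    show "locally_integrable (\<lambda>x. v x - v' x)" by (rule locally_integrable_diff[OF l])
    fix \<phi> assume \<phi>: "test_function \<phi>"
    have "(-1) ^ j *\<^sub>R strong_integral halfline (\<lambda>x. \<phi> x *\<^sub>R v x) = (-1) ^ j *\<^sub>R strong_integral halfline (\<lambda>x. \<phi> x *\<^sub>R v' x)"
      using assms[unfolded has_weak_deriv_def] \<phi> by simp
    then have "strong_integral halfline (\<lambda>x. \<phi> x *\<^sub>R v x) = strong_integral halfline (\<lambda>x. \<phi> x *\<^sub>R v' x)" by simp
    then show "strong_integral halfline (\<lambda>x. \<phi> x *\<^sub>R (v x - v' x)) = 0"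
      using strong_integral_diff[OF test_function_times_integrable[OF \<phi> l(1)] test_function_times_integrable[OF \<phi> l(2)]]
      by (simp add: scaleR_diff_right)
  qed
  then show ?thesis by eventually_elim simp
qed

lemma weak_deriv_eqI:
  fixes u v :: "real \<Rightarrow> 'a::banach"
  assumes "has_weak_deriv j u v"
  shows "has_weak_deriv j u (weak_deriv j u)" "AE x in halfline. weak_deriv j u x = v x"
proof -
  show 1: "has_weak_deriv j u (weak_deriv j u)" unfolding weak_deriv_def by (rule someI[where P="has_weak_deriv j u", OF assms])
  show "AE x in halfline. weak_deriv j u x = v x" by (rule has_weak_deriv_unique[OF 1 assms])
qed

lemma has_weak_deriv_0: "locally_integrable u \<Longrightarrow> has_weak_deriv 0 u u"
  by (simp add: has_weak_deriv_def)

text \<open>Compare the order \<open>j + 1\<close> relation for \<open>\<phi>\<close> with the order \<open>j\<close> relation for its derivative.\<close>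

lemma has_weak_deriv_Suc_imp:
  fixes u v :: "real \<Rightarrow> 'a::banach"
  assumes "has_weak_deriv j u v" "has_weak_deriv (Suc j) u v'" shows "has_weak_deriv 1 v v'"
  unfolding has_weak_deriv_1_iff
proof (intro conjI allI impI)
  show "locally_integrable v" "locally_integrable v'" using assms by (auto simp: has_weak_deriv_def)
  fix \<phi> assume \<phi>: "test_function \<phi>"
  have "(-1) ^ j *\<^sub>R strong_integral halfline (\<lambda>x. deriv \<phi> x *\<^sub>R v x) = strong_integral halfline (\<lambda>x. (deriv ^^ j) (deriv \<phi>) x *\<^sub>R u x)"
    using assms(1) test_function_deriv[OF \<phi>] by (simp add: has_weak_deriv_def)
  also have "(deriv ^^ j) (deriv \<phi>) = (deriv ^^ Suc j) \<phi>" by (simp only: funpow_Suc_right o_apply)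
  also have "strong_integral halfline (\<lambda>x. (deriv ^^ Suc j) \<phi> x *\<^sub>R u x) = (-1) ^ Suc j *\<^sub>R strong_integral halfline (\<lambda>x. \<phi> x *\<^sub>R v' x)"
    using assms(2) \<phi> unfolding has_weak_deriv_def by blast
  finally have "(-1) ^ j *\<^sub>R strong_integral halfline (\<lambda>x. deriv \<phi> x *\<^sub>R v x) = (-1) ^ j *\<^sub>R (- strong_integral halfline (\<lambda>x. \<phi> x *\<^sub>R v' x))"
    by simp
  then show "strong_integral halfline (\<lambda>x. deriv \<phi> x *\<^sub>R v x) = - strong_integral halfline (\<lambda>x. \<phi> x *\<^sub>R v' x)"
    by (simp del: scaleR_minus_right)
qed

lemma has_ac_deriv_chain_imp_has_weak_deriv:
  fixes w :: "nat \<Rightarrow> real \<Rightarrow> 'a::banach"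
  assumes ac: "\<And>i. i < n \<Longrightarrow> has_ac_deriv (w i) (w (Suc i))" and l: "\<And>i. i \<le> n \<Longrightarrow> locally_integrable (w i)"
    and ij: "i + j \<le> n"
  shows "has_weak_deriv j (w i) (w (i + j))"
  unfolding has_weak_deriv_def
proof (intro conjI)
  show "locally_integrable (w i)" "locally_integrable (w (i + j))" using l ij by auto
  show "\<forall>\<phi>. test_function \<phi> \<longrightarrow> strong_integral halfline (\<lambda>x. (deriv ^^ j) \<phi> x *\<^sub>R w i x) =
     (-1) ^ j *\<^sub>R strong_integral halfline (\<lambda>x. \<phi> x *\<^sub>R w (i + j) x)"
    using ij
  proof (induction j)
    case (Suc j)
    show ?case
    proof (intro allI impI)
      fix \<phi> assume \<phi>: "test_function \<phi>"
      have "(deriv ^^ Suc j) \<phi> = (deriv ^^ j) (deriv \<phi>)" by (simp only: funpow_Suc_right o_apply)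
      then have "strong_integral halfline (\<lambda>x. (deriv ^^ Suc j) \<phi> x *\<^sub>R w i x) = (-1) ^ j *\<^sub>R strong_integral halfline (\<lambda>x. deriv \<phi> x *\<^sub>R w (i + j) x)"
        using Suc test_function_deriv[OF \<phi>] by simp
      also have "\<dots> = (-1) ^ Suc j *\<^sub>R strong_integral halfline (\<lambda>x. \<phi> x *\<^sub>R w (i + Suc j) x)"
        using has_ac_deriv_imp_test_integral[OF ac \<phi>, of "i + j"] Suc.prems by simp
      finally show "strong_integral halfline (\<lambda>x. (deriv ^^ Suc j) \<phi> x *\<^sub>R w i x) = (-1) ^ Suc j *\<^sub>R strong_integral halfline (\<lambda>x. \<phi> x *\<^sub>R w (i + Suc j) x)" .
    qed
  qed simp
qed

section \<open>Power-weighted Lebesgue spaces\<close>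

abbreviation wLp :: "real \<Rightarrow> real \<Rightarrow> (real \<Rightarrow> 'a::real_normed_vector) set" where
  "wLp p \<gamma> \<equiv> Lp_space p (power_weighted \<gamma>)"

abbreviation wnorm :: "real \<Rightarrow> real \<Rightarrow> (real \<Rightarrow> 'a::real_normed_vector) \<Rightarrow> real" where
  "wnorm p \<gamma> \<equiv> Lp_norm p (power_weighted \<gamma>)"

text \<open>The \<open>p\<close>-th power of the norm, as a nonnegative integral that exists for every measurable
  function.\<close>

definition wint :: "real \<Rightarrow> real \<Rightarrow> (real \<Rightarrow> 'a::real_normed_vector) \<Rightarrow> ennreal" where
  "wint p \<gamma> v = (\<integral>\<^sup>+x. ennreal (norm (v x) powr p * x powr \<gamma>) \<partial>halfline)"

lemma borel_measurable_id_halfline [measurable]: "(\<lambda>x. x) \<in> borel_measurable halfline"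
  by (rule borel_measurable_halfline) simp

lemma sets_power_weighted: "sets (power_weighted \<gamma>) = sets halfline"
  by (simp add: power_weighted_def)

lemma wint_eq:
  assumes v: "strongly_measurable halfline v"
  shows "(\<integral>\<^sup>+x. ennreal (norm (v x) powr p) \<partial>power_weighted \<gamma>) = wint p \<gamma> v"
proof -
  note [measurable] = borel_measurable_norm_strongly[OF v]
  have "(\<integral>\<^sup>+x. ennreal (norm (v x) powr p) \<partial>power_weighted \<gamma>) =
      (\<integral>\<^sup>+x. ennreal (\<bar>x\<bar> powr \<gamma>) * ennreal (norm (v x) powr p) \<partial>halfline)"
    unfolding power_weighted_def by (rule nn_integral_density) measurable
  also have "\<dots> = wint p \<gamma> v" unfolding wint_def
    by (intro nn_integral_cong) (auto simp: ennreal_mult[symmetric] mult.commute)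
  finally show ?thesis .
qed

lemma wLp_iff: "v \<in> wLp p \<gamma> \<longleftrightarrow> strongly_measurable halfline v \<and> wint p \<gamma> v < \<infinity>"
proof -
  have sm: "strongly_measurable (power_weighted \<gamma>) v \<longleftrightarrow> strongly_measurable halfline v"
    using strongly_measurable_cong_sets[OF sets_power_weighted] strongly_measurable_cong_sets[OF sets_power_weighted[symmetric]]
    by blast
  have "integrable (power_weighted \<gamma>) (\<lambda>x. norm (v x) powr p) \<longleftrightarrow> wint p \<gamma> v < \<infinity>"
    if v: "strongly_measurable halfline v"
  proof -
    have "(\<lambda>x. norm (v x) powr p) \<in> borel_measurable (power_weighted \<gamma>)"
      using borel_measurable_norm_strongly[OF v] unfolding measurable_cong_sets[OF sets_power_weighted refl] by measurable
    then show ?thesis by (simp add: integrable_iff_bounded wint_eq[OF v])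
  qed
  then show ?thesis by (auto simp: Lp_space_def sm)
qed

lemma wnorm_eq:
  assumes v: "strongly_measurable halfline v"
  shows "wnorm p \<gamma> v = enn2real (wint p \<gamma> v) powr (1 / p)"
proof -
  have "(\<lambda>x. norm (v x) powr p) \<in> borel_measurable (power_weighted \<gamma>)"
    using borel_measurable_norm_strongly[OF v] unfolding measurable_cong_sets[OF sets_power_weighted refl] by measurable
  then show ?thesis unfolding Lp_norm_def wint_eq[OF v, symmetric]
    by (subst integral_eq_nn_integral) auto
qed

lemma wnorm_nonneg: "0 \<le> wnorm p \<gamma> v" by (simp add: Lp_norm_def)

lemma wint_eq_wnorm:
  assumes "v \<in> wLp p \<gamma>" "p > 0" shows "wint p \<gamma> v = ennreal (wnorm p \<gamma> v powr p)"
  using assms by (auto simp: wLp_iff wnorm_eq powr_powr enn2real_nonneg less_top)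

lemma wLp_strongly_measurable: "v \<in> wLp p \<gamma> \<Longrightarrow> strongly_measurable halfline v"
  by (simp add: wLp_iff)

lemma wLp_I:
  assumes v: "strongly_measurable halfline v" and p: "p > 0" and N: "N \<ge> 0" and le: "wint p \<gamma> v \<le> ennreal (N powr p)"
  shows "v \<in> wLp p \<gamma>" "wnorm p \<gamma> v \<le> N"
proof -
  show "v \<in> wLp p \<gamma>" using v le by (auto simp: wLp_iff intro: le_less_trans)
  have "enn2real (wint p \<gamma> v) \<le> N powr p" using le by (metis enn2real_leI powr_ge_zero)
  then have "enn2real (wint p \<gamma> v) powr (1 / p) \<le> (N powr p) powr (1 / p)"
    using p by (intro powr_mono2) auto
  then show "wnorm p \<gamma> v \<le> N" using p N by (simp add: wnorm_eq[OF v] powr_powr)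
qed

lemma wLp_compare:
  assumes f: "f \<in> wLp p \<beta>" and g: "strongly_measurable halfline g" and p: "p > 0" and C: "C \<ge> 0"
    and le: "wint p \<gamma> g \<le> ennreal (C powr p) * wint p \<beta> f"
  shows "g \<in> wLp p \<gamma>" "wnorm p \<gamma> g \<le> C * wnorm p \<beta> f"
proof -
  have "wint p \<gamma> g \<le> ennreal ((C * wnorm p \<beta> f) powr p)"
    using le C wnorm_nonneg[of p \<beta> f] by (simp add: wint_eq_wnorm[OF f p] powr_mult ennreal_mult[symmetric])
  from wLp_I[OF g p _ this] C wnorm_nonneg[of p \<beta> f]
  show "g \<in> wLp p \<gamma>" "wnorm p \<gamma> g \<le> C * wnorm p \<beta> f" by simp_all
qed

lemma wLp_norm_le:
  assumes f: "f \<in> wLp p \<gamma>" and g: "strongly_measurable halfline g" and p: "p > 0" and C: "C \<ge> 0"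
    and le: "\<And>x. 0 < x \<Longrightarrow> norm (g x) \<le> C * norm (f x)"
  shows "g \<in> wLp p \<gamma>" "wnorm p \<gamma> g \<le> C * wnorm p \<gamma> f"
proof -
  note [measurable] = borel_measurable_norm_strongly[OF wLp_strongly_measurable[OF f]]
  have "wint p \<gamma> g \<le> (\<integral>\<^sup>+x. ennreal (C powr p) * ennreal (norm (f x) powr p * x powr \<gamma>) \<partial>halfline)"
    unfolding wint_def
  proof (rule nn_integral_mono)
    fix x assume "x \<in> space halfline"
    then have "norm (g x) powr p \<le> (C * norm (f x)) powr p" using le p by (intro powr_mono2) auto
    then have "norm (g x) powr p * x powr \<gamma> \<le> C powr p * (norm (f x) powr p * x powr \<gamma>)"
      using C by (simp add: powr_mult mult.assoc[symmetric] mult_right_mono)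
    then show "ennreal (norm (g x) powr p * x powr \<gamma>) \<le> ennreal (C powr p) * ennreal (norm (f x) powr p * x powr \<gamma>)"
      by (simp add: ennreal_mult[symmetric] ennreal_leI)
  qed
  also have "\<dots> = ennreal (C powr p) * wint p \<gamma> f" unfolding wint_def by (rule nn_integral_cmult) measurable
  finally show "g \<in> wLp p \<gamma>" "wnorm p \<gamma> g \<le> C * wnorm p \<gamma> f"
    using wLp_compare[OF f g p C] by blast+
qed

lemma powr_add_le:
  fixes a b p :: real
  assumes "a \<ge> 0" "b \<ge> 0" "p > 0" shows "(a + b) powr p \<le> 2 powr p * (a powr p + b powr p)"
proof -
  have "(a + b) powr p \<le> (2 * max a b) powr p" using assms by (intro powr_mono2) auto
  also have "\<dots> = 2 powr p * max a b powr p" using assms by (simp add: powr_mult)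
  also have "max a b powr p \<le> a powr p + b powr p" by (simp add: max_def)
  finally show ?thesis by simp
qed

lemma powr_superadditive:
  fixes a b p :: real
  assumes "a \<ge> 0" "b \<ge> 0" "p \<ge> 1" shows "a powr p + b powr p \<le> (a + b) powr p"
proof -
  have *: "c powr p = c * c powr (p - 1)" if "c \<ge> 0" for c :: real
    using that assms powr_mult_base[of c "p - 1"] by simp
  have "a powr p + b powr p \<le> a * (a + b) powr (p - 1) + b * (a + b) powr (p - 1)"
    using assms by (simp only: *[OF assms(1)] *[OF assms(2)]) (intro add_mono mult_left_mono powr_mono2, auto)
  also have "\<dots> = (a + b) powr p" using assms by (simp add: * distrib_right)
  finally show ?thesis .
qed

text \<open>The triangle inequality up to a constant, from \<open>(a + b)\<^sup>p \<le> 2\<^sup>p (a\<^sup>p + b\<^sup>p)\<close>; the constants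
  are not tracked, so this is all that the estimates require.\<close>

lemma wLp_add:
  assumes f: "f \<in> wLp p \<gamma>" and g: "g \<in> wLp p \<gamma>" and p: "p \<ge> 1"
  shows "(\<lambda>x. f x + g x) \<in> wLp p \<gamma>" "wnorm p \<gamma> (\<lambda>x. f x + g x) \<le> 2 * (wnorm p \<gamma> f + wnorm p \<gamma> g)"
proof -
  note sm = wLp_strongly_measurable[OF f] wLp_strongly_measurable[OF g]
  note [measurable] = borel_measurable_norm_strongly[OF sm(1)] borel_measurable_norm_strongly[OF sm(2)]
  let ?F = "\<lambda>x. norm (f x) powr p * x powr \<gamma>" and ?G = "\<lambda>x. norm (g x) powr p * x powr \<gamma>"
  have "wint p \<gamma> (\<lambda>x. f x + g x) \<le> (\<integral>\<^sup>+x. ennreal (2 powr p) * (ennreal (?F x) + ennreal (?G x)) \<partial>halfline)"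
    unfolding wint_def
  proof (rule nn_integral_mono)
    fix x :: real
    have "norm (f x + g x) powr p \<le> (norm (f x) + norm (g x)) powr p"
      using p by (intro powr_mono2 norm_triangle_ineq) auto
    also have "\<dots> \<le> 2 powr p * (norm (f x) powr p + norm (g x) powr p)" using p by (intro powr_add_le) auto
    finally have "norm (f x + g x) powr p * x powr \<gamma> \<le> 2 powr p * (norm (f x) powr p + norm (g x) powr p) * x powr \<gamma>"
      by (intro mult_right_mono) auto
    then show "ennreal (norm (f x + g x) powr p * x powr \<gamma>) \<le> ennreal (2 powr p) * (ennreal (?F x) + ennreal (?G x))"
      by (simp add: ennreal_mult[symmetric] ennreal_plus[symmetric] algebra_simps ennreal_leI del: ennreal_plus)
  qed
  also have "\<dots> = ennreal (2 powr p) * (wint p \<gamma> f + wint p \<gamma> g)"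
    unfolding wint_def by (subst nn_integral_cmult, measurable, subst nn_integral_add, measurable)
  also have "\<dots> = ennreal (2 powr p * (wnorm p \<gamma> f powr p + wnorm p \<gamma> g powr p))"
    using p by (simp add: wint_eq_wnorm f g ennreal_mult)
  also have "\<dots> \<le> ennreal (2 powr p * (wnorm p \<gamma> f + wnorm p \<gamma> g) powr p)"
    using p by (intro ennreal_leI mult_left_mono powr_superadditive wnorm_nonneg) auto
  also have "\<dots> = ennreal ((2 * (wnorm p \<gamma> f + wnorm p \<gamma> g)) powr p)"
    using wnorm_nonneg[of p \<gamma> f] wnorm_nonneg[of p \<gamma> g] by (subst powr_mult) auto
  finally have le: "wint p \<gamma> (\<lambda>x. f x + g x) \<le> \<dots>" .
  have "0 \<le> 2 * (wnorm p \<gamma> f + wnorm p \<gamma> g)" using wnorm_nonneg[of p \<gamma> f] wnorm_nonneg[of p \<gamma> g] by simp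
  from wLp_I[OF strongly_measurable_add[OF sm] _ this le] p
  show "(\<lambda>x. f x + g x) \<in> wLp p \<gamma>" "wnorm p \<gamma> (\<lambda>x. f x + g x) \<le> 2 * (wnorm p \<gamma> f + wnorm p \<gamma> g)"
    by simp_all
qed

lemma wLp_AE_eq:
  assumes f: "f \<in> wLp p \<gamma>" and g: "strongly_measurable halfline g" and eq: "AE x in halfline. f x = g x"
  shows "g \<in> wLp p \<gamma>" "wnorm p \<gamma> g = wnorm p \<gamma> f"
proof -
  have "wint p \<gamma> g = wint p \<gamma> f" unfolding wint_def using eq by (intro nn_integral_cong_AE) auto
  then show "g \<in> wLp p \<gamma>" "wnorm p \<gamma> g = wnorm p \<gamma> f"
    using f g by (auto simp: wLp_iff wnorm_eq)
qed

text \<open>The means of reducing an estimate with one exponent to an estimate with another.\<close>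

lemma wLp_powr_scale:
  assumes "p > 0" and v: "strongly_measurable halfline v"
  shows "(\<lambda>x. x powr d *\<^sub>R v x) \<in> wLp p \<gamma> \<longleftrightarrow> v \<in> wLp p (\<gamma> + d * p)"
    "wnorm p \<gamma> (\<lambda>x. x powr d *\<^sub>R v x) = wnorm p (\<gamma> + d * p) v"
proof -
  have sm: "strongly_measurable halfline (\<lambda>x. x powr d *\<^sub>R v x)"
    by (intro strongly_measurable_scaleR v) measurable
  have "wint p \<gamma> (\<lambda>x. x powr d *\<^sub>R v x) = wint p (\<gamma> + d * p) v" unfolding wint_def
    by (intro nn_integral_cong) (auto simp: powr_mult powr_powr powr_add mult_ac)
  then show "(\<lambda>x. x powr d *\<^sub>R v x) \<in> wLp p \<gamma> \<longleftrightarrow> v \<in> wLp p (\<gamma> + d * p)"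
    "wnorm p \<gamma> (\<lambda>x. x powr d *\<^sub>R v x) = wnorm p (\<gamma> + d * p) v"
    by (auto simp: wLp_iff sm v wnorm_eq)
qed

section \<open>Schur's test with power weights\<close>

text \<open>Young's inequality up to a constant: for \<open>z \<le> t\<close> the second term suffices, and for \<open>z > t\<close> the
  first one.\<close>

lemma le_powr_times_powr_add:
  fixes z t p :: real
  assumes "z \<ge> 0" "t > 0" "p > 1" shows "z \<le> z powr p * t powr (1 - p) + t"
proof (cases "z \<le> t")
  case False
  then have z: "z > 0" using assms by simp
  have "1 \<le> (z / t) powr (p - 1)" using False assms by (intro ge_one_powr_ge_zero) auto
  then have "z * 1 \<le> z * (z / t) powr (p - 1)" using z by (intro mult_left_mono) auto
  also have "\<dots> = z powr p * t powr (1 - p)"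
  proof -
    have "z powr p = z * z powr (p - 1)" using z powr_mult_base[of z "p - 1"] by simp
    then show ?thesis using z assms by (simp add: powr_divide powr_diff field_simps)
  qed
  finally show ?thesis using assms by simp
qed (use assms in \<open>simp add: add_nonneg_nonneg add.commute add_increasing2\<close>)

text \<open>Hoelder's inequality up to a factor \<open>2\<close>, with the weight \<open>\<theta>\<close> distributed over both factors:
  \<open>le_powr_times_powr_add\<close> is applied under the integral with \<open>t * \<theta> y\<close> in place of \<open>t\<close>, and the
  parameter \<open>t\<close> is optimised afterwards.\<close>

lemma holder_weighted:
  fixes F \<theta> :: "'s \<Rightarrow> real"
  assumes p: "p > 1" and [measurable]: "k \<in> borel_measurable M" "F \<in> borel_measurable M" "\<theta> \<in> borel_measurable M"
    and F: "\<And>y. y \<in> space M \<Longrightarrow> 0 \<le> F y" and \<theta>: "\<And>y. y \<in> space M \<Longrightarrow> 0 < \<theta> y"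
    and X: "(\<integral>\<^sup>+y. k y * ennreal (\<theta> y) \<partial>M) \<le> ennreal X" "X > 0"
    and N: "(\<integral>\<^sup>+y. k y * ennreal (F y powr p * \<theta> y powr (1 - p)) \<partial>M) \<le> ennreal (N powr p)" "N \<ge> 0"
  shows "(\<integral>\<^sup>+y. k y * ennreal (F y) \<partial>M) \<le> ennreal (2 * N * X powr (1 - 1 / p))"
proof -
  have le: "(\<integral>\<^sup>+y. k y * ennreal (F y) \<partial>M) \<le> ennreal (N powr p * t powr (1 - p) + t * X)" if t: "t > 0" for t
  proof -
    have "(\<integral>\<^sup>+y. k y * ennreal (F y) \<partial>M) \<le>
      (\<integral>\<^sup>+y. ennreal (t powr (1 - p)) * (k y * ennreal (F y powr p * \<theta> y powr (1 - p))) + ennreal t * (k y * ennreal (\<theta> y)) \<partial>M)"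
    proof (rule nn_integral_mono)
      fix y assume y: "y \<in> space M"
      have "F y \<le> F y powr p * (t * \<theta> y) powr (1 - p) + t * \<theta> y"
        using le_powr_times_powr_add[OF F[OF y] _ p, of "t * \<theta> y"] t \<theta>[OF y] by simp
      also have "(t * \<theta> y) powr (1 - p) = t powr (1 - p) * \<theta> y powr (1 - p)" using t \<theta>[OF y] by (simp add: powr_mult)
      finally have "ennreal (F y) \<le> ennreal (t powr (1 - p) * (F y powr p * \<theta> y powr (1 - p)) + t * \<theta> y)"
        by (simp add: mult_ac ennreal_leI)
      also have "\<dots> = ennreal (t powr (1 - p)) * ennreal (F y powr p * \<theta> y powr (1 - p)) + ennreal t * ennreal (\<theta> y)"
        using t \<theta>[OF y] by (simp add: ennreal_mult[symmetric])
      finally have "k y * ennreal (F y) \<le> k y * \<dots>" by (rule mult_left_mono) simp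
      then show "k y * ennreal (F y) \<le> ennreal (t powr (1 - p)) * (k y * ennreal (F y powr p * \<theta> y powr (1 - p))) + ennreal t * (k y * ennreal (\<theta> y))"
        by (simp add: distrib_left mult_ac)
    qed
    also have "\<dots> = ennreal (t powr (1 - p)) * (\<integral>\<^sup>+y. k y * ennreal (F y powr p * \<theta> y powr (1 - p)) \<partial>M) + ennreal t * (\<integral>\<^sup>+y. k y * ennreal (\<theta> y) \<partial>M)"
      by (subst nn_integral_add, measurable, subst nn_integral_cmult, measurable, subst nn_integral_cmult, measurable)
    also have "\<dots> \<le> ennreal (t powr (1 - p)) * ennreal (N powr p) + ennreal t * ennreal X"
      by (intro add_mono mult_left_mono X N) auto
    also have "\<dots> = ennreal (N powr p * t powr (1 - p) + t * X)"
      using t X by (simp add: ennreal_mult[symmetric] mult.commute)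
    finally show ?thesis .
  qed
  show ?thesis
  proof (cases "N = 0")
    case True
    have "(\<integral>\<^sup>+y. k y * ennreal (F y) \<partial>M) \<le> ennreal e" if "e > 0" for e
      using le[of "e / X"] that X True by simp
    then have "(\<integral>\<^sup>+y. k y * ennreal (F y) \<partial>M) \<le> 0 + ennreal e" if "e > 0" for e using that by simp
    from ennreal_le_epsilon[OF this] show ?thesis by simp
  next
    case False
    then have N0: "N > 0" using N by simp
    (* This value makes both terms equal to N * X powr (1 - 1 / p). *)
    define t where "t = N * X powr (- (1 / p))"
    have t: "t > 0" using N0 X by (simp add: t_def)
    have "t * X = N * X powr (1 - 1 / p)" using X by (simp add: t_def powr_diff powr_minus field_simps)
    moreover have "N powr p * t powr (1 - p) = N * X powr (1 - 1 / p)"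
    proof -
      have "t powr (1 - p) = N powr (1 - p) * X powr (- (1 / p) * (1 - p))"
        using N0 X by (simp add: t_def powr_mult powr_powr)
      moreover have "- (1 / p) * (1 - p) = 1 - 1 / p" using p by (simp add: field_simps)
      moreover have "N powr p * N powr (1 - p) = N" using N0 by (simp add: powr_add[symmetric])
      ultimately show ?thesis by (simp add: mult.assoc[symmetric])
    qed
    ultimately show ?thesis using le[OF t] by (simp add: mult.assoc)
  qed
qed

lemma sigma_finite_halfline: "sigma_finite_measure halfline"
  by (intro sigma_finite_measure_restrict_space sigma_finite_lborel) simp

text \<open>Hoelder's inequality with weight \<open>y powr b\<close> in the inner integral uses the first condition on
  the kernel and gives a pointwise bound of \<open>norm (g x) powr p\<close> by an integral that is linear in
  the kernel. After exchanging the order of integration, the second condition applies.\<close>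

lemma schur_test:
  fixes f :: "real \<Rightarrow> 'b::real_normed_vector" and g :: "real \<Rightarrow> 'c::real_normed_vector"
  assumes p: "p > 1" and k[measurable]: "case_prod k \<in> borel_measurable (halfline \<Otimes>\<^sub>M halfline)"
    and A: "A > 0" "\<And>x. 0 < x \<Longrightarrow> (\<integral>\<^sup>+y. k x y * ennreal (y powr b) \<partial>halfline) \<le> ennreal (A * x powr b)"
    and B: "B \<ge> 0" "\<And>y. 0 < y \<Longrightarrow> (\<integral>\<^sup>+x. k x y * ennreal (x powr (b * (p - 1) + \<gamma>)) \<partial>halfline) \<le> ennreal (B * y powr (b * (p - 1) + \<gamma>))"
    and f: "strongly_measurable halfline f" and g: "strongly_measurable halfline g"
    and le: "\<And>x. 0 < x \<Longrightarrow> ennreal (norm (g x)) \<le> (\<integral>\<^sup>+y. k x y * ennreal (norm (f y)) \<partial>halfline)"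
  shows "wint p \<gamma> g \<le> ennreal (2 powr p * A powr (p - 1) * B) * wint p \<gamma> f"
proof -
  note [measurable] = borel_measurable_norm_strongly[OF f] borel_measurable_norm_strongly[OF g]
  interpret sigma_finite_measure halfline by (rule sigma_finite_halfline)
  interpret P: pair_sigma_finite halfline halfline ..
  let ?H = "\<lambda>y. norm (f y) powr p * (y powr b) powr (1 - p)"
  define c where "c = 2 powr p * A powr (p - 1)"
  have c: "c > 0" using A by (simp add: c_def)
  have km[measurable]: "(\<lambda>y. k x y) \<in> borel_measurable halfline" if "x \<in> space halfline" for x
    using measurable_Pair2[OF k that] by simp
  have pt: "ennreal (norm (g x) powr p) \<le> ennreal (c * x powr (b * (p - 1))) * (\<integral>\<^sup>+y. k x y * ennreal (?H y) \<partial>halfline)"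
    (is "_ \<le> _ * ?Y") if x: "x > 0" for x
  proof (cases "?Y = \<infinity>")
    case True
    then show ?thesis using c x by (simp add: ennreal_mult_eq_top_iff ennreal_mult_top)
  next
    case False
    define N where "N = enn2real ?Y powr (1 / p)"
    have N: "N \<ge> 0" "ennreal (N powr p) = ?Y"
      using False p by (auto simp: N_def powr_powr enn2real_nonneg less_top)
    have [measurable]: "(\<lambda>y. k x y) \<in> borel_measurable halfline" using km x by simp
    have "(\<integral>\<^sup>+y. k x y * ennreal (norm (f y)) \<partial>halfline) \<le> ennreal (2 * N * (A * x powr b) powr (1 - 1 / p))"
    proof (rule holder_weighted[OF p, where \<theta>="\<lambda>y. y powr b"])
      show "?Y \<le> ennreal (N powr p)" by (simp only: N(2))
      show "(\<integral>\<^sup>+y. k x y * ennreal (y powr b) \<partial>halfline) \<le> ennreal (A * x powr b)" by (rule A(2)[OF x])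
      show "0 < A * x powr b" using A(1) x by simp
    qed (use N(1) in auto)
    with le[OF x] have "ennreal (norm (g x)) \<le> ennreal (2 * N * (A * x powr b) powr (1 - 1 / p))"
      by (rule order_trans)
    then have "norm (g x) \<le> 2 * N * (A * x powr b) powr (1 - 1 / p)"
      using N A x by (subst (asm) ennreal_le_iff) auto
    then have "norm (g x) powr p \<le> (2 * N * (A * x powr b) powr (1 - 1 / p)) powr p"
      using p by (intro powr_mono2) auto
    also have "\<dots> = 2 powr p * N powr p * (A * x powr b) powr (p - 1)"
    proof -
      have "(1 - 1 / p) * p = p - 1" using p by (simp add: field_simps)
      then have "((A * x powr b) powr (1 - 1 / p)) powr p = (A * x powr b) powr (p - 1)" by (simp only: powr_powr)
      then show ?thesis using N(1) by (simp add: powr_mult)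
    qed
    also have "\<dots> = (c * x powr (b * (p - 1))) * N powr p"
      using A x by (simp add: c_def powr_mult powr_powr mult_ac)
    finally have "ennreal (norm (g x) powr p) \<le> ennreal (c * x powr (b * (p - 1)) * N powr p)" by (rule ennreal_leI)
    also have "\<dots> = ennreal (c * x powr (b * (p - 1))) * ?Y" using c by (simp add: ennreal_mult N(2))
    finally show ?thesis .
  qed
  let ?e = "b * (p - 1) + \<gamma>"
  have "wint p \<gamma> g \<le> (\<integral>\<^sup>+x. ennreal c * (\<integral>\<^sup>+y. k x y * ennreal (x powr ?e) * ennreal (?H y) \<partial>halfline) \<partial>halfline)"
    unfolding wint_def
  proof (rule nn_integral_mono)
    fix x assume xs: "x \<in> space halfline"
    then have x: "x > 0" by simp
    have [measurable]: "(\<lambda>y. k x y) \<in> borel_measurable halfline" using km xs by simp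
    have "ennreal (norm (g x) powr p * x powr \<gamma>) = ennreal (x powr \<gamma>) * ennreal (norm (g x) powr p)"
      by (simp add: ennreal_mult mult.commute)
    also have "\<dots> \<le> ennreal (x powr \<gamma>) * (ennreal (c * x powr (b * (p - 1))) * (\<integral>\<^sup>+y. k x y * ennreal (?H y) \<partial>halfline))"
      by (intro mult_left_mono pt x) simp
    also have "\<dots> = ennreal (c * x powr ?e) * (\<integral>\<^sup>+y. k x y * ennreal (?H y) \<partial>halfline)"
    proof -
      have "ennreal (x powr \<gamma>) * ennreal (c * x powr (b * (p - 1))) = ennreal (c * x powr ?e)"
        using c x by (simp add: ennreal_mult[symmetric] powr_add mult_ac)
      then show ?thesis by (simp only: mult.assoc[symmetric])
    qed
    also have "\<dots> = ennreal c * (\<integral>\<^sup>+y. ennreal (x powr ?e) * (k x y * ennreal (?H y)) \<partial>halfline)"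
      using c by (subst nn_integral_cmult) (measurable, simp add: ennreal_mult mult.assoc)
    finally show "ennreal (norm (g x) powr p * x powr \<gamma>) \<le> ennreal c * (\<integral>\<^sup>+y. k x y * ennreal (x powr ?e) * ennreal (?H y) \<partial>halfline)"
      by (simp add: mult_ac)
  qed
  also have "\<dots> = ennreal c * (\<integral>\<^sup>+x. (\<integral>\<^sup>+y. k x y * ennreal (x powr ?e) * ennreal (?H y) \<partial>halfline) \<partial>halfline)"
    by (rule nn_integral_cmult) measurable
  also have "(\<integral>\<^sup>+x. (\<integral>\<^sup>+y. k x y * ennreal (x powr ?e) * ennreal (?H y) \<partial>halfline) \<partial>halfline)
     = (\<integral>\<^sup>+y. (\<integral>\<^sup>+x. k x y * ennreal (x powr ?e) * ennreal (?H y) \<partial>halfline) \<partial>halfline)"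
    by (rule P.Fubini'[symmetric]) measurable
  also have "\<dots> \<le> (\<integral>\<^sup>+y. ennreal B * ennreal (norm (f y) powr p * y powr \<gamma>) \<partial>halfline)"
  proof (rule nn_integral_mono)
    fix y assume ys: "y \<in> space halfline"
    then have y: "y > 0" by simp
    have [measurable]: "(\<lambda>x. k x y) \<in> borel_measurable halfline" using measurable_Pair1[OF k ys] by simp
    have "(\<integral>\<^sup>+x. k x y * ennreal (x powr ?e) * ennreal (?H y) \<partial>halfline) = (\<integral>\<^sup>+x. k x y * ennreal (x powr ?e) \<partial>halfline) * ennreal (?H y)"
      by (rule nn_integral_multc) measurable
    also have "\<dots> \<le> ennreal (B * y powr ?e) * ennreal (?H y)" by (intro mult_right_mono B y) simp
    also have "\<dots> = ennreal B * ennreal (norm (f y) powr p * y powr \<gamma>)"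
    proof -
      have "y powr ?e * (y powr b) powr (1 - p) = y powr \<gamma>"
        using y by (simp add: powr_powr powr_add[symmetric] algebra_simps)
      then have "B * y powr ?e * ?H y = B * (norm (f y) powr p * y powr \<gamma>)" by (simp add: mult_ac)
      then show ?thesis using B(1) by (simp add: ennreal_mult[symmetric])
    qed
    finally show "(\<integral>\<^sup>+x. k x y * ennreal (x powr ?e) * ennreal (?H y) \<partial>halfline) \<le> ennreal B * ennreal (norm (f y) powr p * y powr \<gamma>)" .
  qed
  also have "\<dots> = ennreal B * wint p \<gamma> f" unfolding wint_def by (rule nn_integral_cmult) measurable
  finally have "wint p \<gamma> g \<le> ennreal c * (ennreal B * wint p \<gamma> f)" by (simp add: mult_left_mono)
  then show ?thesis using c B(1) by (simp add: c_def ennreal_mult mult.assoc)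
qed

section \<open>Exponential kernels and Hardy's inequality\<close>

lemma nn_integral_halfline_le:
  assumes "\<And>x. x \<in> \<Omega> \<Longrightarrow> 0 \<le> f x" "(f has_integral I) \<Omega>"
  shows "(\<integral>\<^sup>+x. ennreal (f x) * indicator \<Omega> x \<partial>halfline) \<le> ennreal I"
proof -
  have "(\<integral>\<^sup>+x. ennreal (f x) * indicator \<Omega> x \<partial>halfline) = (\<integral>\<^sup>+x. ennreal (f x) * indicator \<Omega> x * indicator {0<..} x \<partial>lborel)"
    by (rule nn_integral_restrict_space) simp
  also have "\<dots> \<le> (\<integral>\<^sup>+x. ennreal (f x) * indicator \<Omega> x \<partial>lborel)"
    by (intro nn_integral_mono) (auto split: split_indicator)
  also have "\<dots> = ennreal I" by (rule nn_integral_has_integral_lebesgue'[OF assms])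
  finally show ?thesis .
qed

lemma nn_integral_powr_0:
  assumes "-1 < \<beta>" "0 \<le> c"
  shows "(\<integral>\<^sup>+y. ennreal (y powr \<beta>) * indicator {0..c} y \<partial>halfline) \<le> ennreal (c powr (\<beta> + 1) / (\<beta> + 1))"
  by (rule nn_integral_halfline_le[OF _ has_integral_powr_from_0[OF assms]]) simp

lemma nn_integral_powr_inf:
  assumes "\<beta> < -1" "0 < c"
  shows "(\<integral>\<^sup>+y. ennreal (y powr \<beta>) * indicator {c..} y \<partial>halfline) \<le> ennreal (- (c powr (\<beta> + 1)) / (\<beta> + 1))"
  by (rule nn_integral_halfline_le[OF _ has_integral_powr_to_inf[OF assms]]) simp

definition expker :: "real \<Rightarrow> real \<Rightarrow> real \<Rightarrow> ennreal" where
  "expker a x y = ennreal (exp (- (a * \<bar>x - y\<bar>)))"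

lemma expker_commute: "expker a x y = expker a y x"
  by (simp add: expker_def abs_minus_commute)

lemma measurable_expker [measurable]:
  "(\<lambda>(x, y). expker a x y) \<in> borel_measurable (halfline \<Otimes>\<^sub>M halfline)"
  "(\<lambda>y. expker a x y) \<in> borel_measurable halfline"
  "(\<lambda>y. expker a y x) \<in> borel_measurable halfline"
  unfolding expker_def case_prod_beta by measurable

lemma nn_integral_exp_right:
  assumes a: "a > 0"
  shows "(\<integral>\<^sup>+y. expker a x y * indicator {x..} y \<partial>halfline) \<le> ennreal (1 / a)"
proof -
  have "((\<lambda>y. exp (a * x) * exp (- a * y)) has_integral (exp (a * x) * (exp (- a * x) / a))) {x..}"
    by (intro has_integral_mult_right has_integral_exp_minus_to_infinity a)
  then have 1: "((\<lambda>y. exp (a * x) * exp (- a * y)) has_integral (1 / a)) {x..}"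
    by (simp add: exp_minus)
  have "(\<integral>\<^sup>+y. expker a x y * indicator {x..} y \<partial>halfline) = (\<integral>\<^sup>+y. ennreal (exp (a * x) * exp (- a * y)) * indicator {x..} y \<partial>halfline)"
    by (intro nn_integral_cong) (auto simp: expker_def exp_add[symmetric] algebra_simps split: split_indicator)
  also have "\<dots> \<le> ennreal (1 / a)" by (rule nn_integral_halfline_le[OF _ 1]) simp
  finally show ?thesis .
qed

lemma nn_integral_exp_left:
  assumes a: "a > 0" and x: "x \<ge> 0"
  shows "(\<integral>\<^sup>+y. expker a x y * indicator {0..x} y \<partial>halfline) \<le> ennreal (1 / a)"
proof -
  have 1: "((\<lambda>y. exp (- (a * (x - y)))) has_integral (exp (- (a * (x - x))) / a - exp (- (a * (x - 0))) / a)) {0..x}"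
    using a by (intro fundamental_theorem_of_calculus x)
      (auto simp: has_real_derivative_iff_has_vector_derivative[symmetric] intro!: derivative_eq_intros)
  have "(\<integral>\<^sup>+y. expker a x y * indicator {0..x} y \<partial>halfline) = (\<integral>\<^sup>+y. ennreal (exp (- (a * (x - y)))) * indicator {0..x} y \<partial>halfline)"
    by (intro nn_integral_cong) (auto simp: expker_def split: split_indicator)
  also have "\<dots> \<le> ennreal (exp (- (a * (x - x))) / a - exp (- (a * (x - 0))) / a)"
    by (rule nn_integral_halfline_le[OF _ 1]) simp
  also have "\<dots> \<le> ennreal (1 / a)" using a by (intro ennreal_leI) simp
  finally show ?thesis .
qed

lemma nn_integral_expker:
  assumes a: "a > 0" and x: "x \<ge> 0"
  shows "(\<integral>\<^sup>+y. expker a x y \<partial>halfline) \<le> ennreal (2 / a)"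
proof -
  have "(\<integral>\<^sup>+y. expker a x y \<partial>halfline) \<le> (\<integral>\<^sup>+y. expker a x y * indicator {0..x} y + expker a x y * indicator {x..} y \<partial>halfline)"
    by (intro nn_integral_mono) (auto split: split_indicator)
  also have "\<dots> = (\<integral>\<^sup>+y. expker a x y * indicator {0..x} y \<partial>halfline) + (\<integral>\<^sup>+y. expker a x y * indicator {x..} y \<partial>halfline)"
    by (intro nn_integral_add borel_measurable_times_ennreal measurable_expker borel_measurable_halfline_indicator) auto
  also have "\<dots> \<le> ennreal (1 / a) + ennreal (1 / a)"
    by (intro add_mono nn_integral_exp_left nn_integral_exp_right assms)
  also have "\<dots> = ennreal (2 / a)" using a by (simp add: ennreal_plus[symmetric] del: ennreal_plus)
  finally show ?thesis .
qed

text \<open>The integral is split at \<open>y = x / 2\<close>. On the right part \<open>y powr \<beta>\<close> is comparable with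
  \<open>x powr \<beta>\<close>; on the left part the kernel is at most \<open>exp (- a x / 2)\<close>, which turns the
  additional factor \<open>x\<close> from integrating \<open>y powr \<beta>\<close> into \<open>1 / a\<close>.\<close>

lemma nn_integral_expker_powr:
  assumes \<beta>: "-1 < \<beta>" "\<beta> \<le> 0" and a: "a > 0" and x: "x > 0"
  shows "(\<integral>\<^sup>+y. expker a x y * ennreal (y powr \<beta>) \<partial>halfline) \<le> ennreal (2 powr (- \<beta>) * (1 / (\<beta> + 1) + 2) / a * x powr \<beta>)"
proof -
  have "(\<integral>\<^sup>+y. expker a x y * ennreal (y powr \<beta>) \<partial>halfline) \<le>
    (\<integral>\<^sup>+y. ennreal (exp (- (a * x / 2))) * (ennreal (y powr \<beta>) * indicator {0..x/2} y) + ennreal ((x/2) powr \<beta>) * expker a x y \<partial>halfline)"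
  proof (rule nn_integral_mono)
    fix y assume "y \<in> space halfline"
    then have y: "0 < y" by simp
    show "expker a x y * ennreal (y powr \<beta>) \<le> ennreal (exp (- (a * x / 2))) * (ennreal (y powr \<beta>) * indicator {0..x/2} y) + ennreal ((x/2) powr \<beta>) * expker a x y"
    proof (cases "y \<le> x / 2")
      case True
      then have "x / 2 \<le> \<bar>x - y\<bar>" using y by auto
      then have "a * (x / 2) \<le> a * \<bar>x - y\<bar>" using a by (intro mult_left_mono) auto
      then have "expker a x y \<le> ennreal (exp (- (a * x / 2)))" unfolding expker_def by (intro ennreal_leI) simp
      then have "expker a x y * ennreal (y powr \<beta>) \<le> ennreal (exp (- (a * x / 2))) * ennreal (y powr \<beta>)"
        by (rule mult_right_mono) simp
      then show ?thesis using True y by (simp add: add_increasing2)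
    next
      case False
      then have "y powr \<beta> \<le> (x/2) powr \<beta>" using \<beta> x by (intro powr_mono2') auto
      then have "expker a x y * ennreal (y powr \<beta>) \<le> expker a x y * ennreal ((x/2) powr \<beta>)"
        by (intro mult_left_mono ennreal_leI) auto
      then show ?thesis by (simp add: mult.commute add_increasing)
    qed
  qed
  also have "\<dots> = ennreal (exp (- (a * x / 2))) * (\<integral>\<^sup>+y. ennreal (y powr \<beta>) * indicator {0..x/2} y \<partial>halfline)
      + ennreal ((x/2) powr \<beta>) * (\<integral>\<^sup>+y. expker a x y \<partial>halfline)"
  proof -
    have [measurable]: "(\<lambda>y. ennreal (y powr \<beta>) * indicator {0..x/2} y) \<in> borel_measurable halfline"
      by (intro borel_measurable_times_ennreal borel_measurable_halfline_indicator) measurable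
    show ?thesis by (subst nn_integral_add, measurable, subst nn_integral_cmult, measurable, subst nn_integral_cmult, measurable)
  qed
  also have "\<dots> \<le> ennreal (exp (- (a * x / 2))) * ennreal ((x/2) powr (\<beta> + 1) / (\<beta> + 1)) + ennreal ((x/2) powr \<beta>) * ennreal (2 / a)"
    using x by (intro add_mono mult_left_mono nn_integral_powr_0 nn_integral_expker \<beta> a) auto
  also have "\<dots> = ennreal (exp (- (a * x / 2)) * ((x/2) powr (\<beta> + 1) / (\<beta> + 1)) + (x/2) powr \<beta> * (2 / a))"
    using \<beta> a by (simp add: ennreal_mult[symmetric])
  also have "\<dots> \<le> ennreal (2 powr (- \<beta>) * (1 / (\<beta> + 1) + 2) / a * x powr \<beta>)"
  proof (rule ennreal_leI)
    have t: "exp (- (a * x / 2)) * (x / 2) \<le> 1 / a"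
    proof -
      have "a * x / 2 \<le> exp (a * x / 2)" using exp_ge_add_one_self[of "a * x / 2"] by linarith
      then have "a * x / 2 * exp (- (a * x / 2)) \<le> exp (a * x / 2) * exp (- (a * x / 2))" by (rule mult_right_mono) simp
      then show ?thesis using a by (simp add: exp_minus field_simps)
    qed
    have "exp (- (a * x / 2)) * ((x/2) powr (\<beta> + 1) / (\<beta> + 1)) = (exp (- (a * x / 2)) * (x / 2)) * ((x/2) powr \<beta> / (\<beta> + 1))"
      using x by (simp add: powr_add)
    also have "\<dots> \<le> (1 / a) * ((x/2) powr \<beta> / (\<beta> + 1))" using \<beta> by (intro mult_right_mono t) auto
    finally have E: "exp (- (a * x / 2)) * ((x/2) powr (\<beta> + 1) / (\<beta> + 1)) \<le> (1 / a) * ((x/2) powr \<beta> / (\<beta> + 1))" .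
    define Q r where "Q = (x/2) powr \<beta>" and "r = 1 / (\<beta> + 1)"
    have "exp (- (a * x / 2)) * ((x/2) powr (\<beta> + 1) / (\<beta> + 1)) + (x/2) powr \<beta> * (2 / a) \<le> (1 / a) * (Q * r) + Q * (2 / a)"
      using E by (simp add: Q_def r_def)
    also have "\<dots> = Q * (r + 2) / a" by (simp add: algebra_simps add_divide_distrib)
    also have "Q = 2 powr (- \<beta>) * x powr \<beta>" using x by (simp add: Q_def powr_divide powr_minus field_simps)
    finally show "exp (- (a * x / 2)) * ((x/2) powr (\<beta> + 1) / (\<beta> + 1)) + (x/2) powr \<beta> * (2 / a) \<le> 2 powr (- \<beta>) * (1 / (\<beta> + 1) + 2) / a * x powr \<beta>"
      by (simp add: r_def mult_ac)
  qed
  finally show ?thesis .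
qed

text \<open>Both integrals in Schur's test are of order \<open>1 / a\<close>, which gives the factor \<open>a\<close> on the
  left-hand side with a constant independent of \<open>a\<close>.\<close>

lemma expker_bound:
  assumes p: "p > 1" and \<gamma>: "-1 < \<gamma>" "\<gamma> < p - 1"
  obtains C where "C > 0" "\<And>a (f :: real \<Rightarrow> 'b::real_normed_vector) (g :: real \<Rightarrow> 'c::real_normed_vector).
    \<lbrakk>a > 0; f \<in> wLp p \<gamma>; strongly_measurable halfline g;
      \<And>x. 0 < x \<Longrightarrow> ennreal (norm (g x)) \<le> (\<integral>\<^sup>+y. expker a x y * ennreal (norm (f y)) \<partial>halfline)\<rbrakk>
    \<Longrightarrow> g \<in> wLp p \<gamma> \<and> a * wnorm p \<gamma> g \<le> C * wnorm p \<gamma> f"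
proof -
  (* With this choice b and b (p - 1) + \<gamma> = min \<gamma> 0 both lie in (-1, 0], the range in which the
     kernel maps powers to powers. *)
  define b where "b = - max \<gamma> 0 / (p - 1)"
  have b: "-1 < b" "b \<le> 0" "b * (p - 1) + \<gamma> = min \<gamma> 0"
    using p \<gamma> by (auto simp: b_def field_simps max_def min_def)
  define e where "e = min \<gamma> 0"
  have e: "-1 < e" "e \<le> 0" using \<gamma> by (auto simp: e_def)
  define A where "A = 2 powr (- b) * (1 / (b + 1) + 2)"
  define B where "B = 2 powr (- e) * (1 / (e + 1) + 2)"
  have AB: "A > 0" "B > 0" unfolding A_def B_def using b e by (auto intro!: mult_pos_pos add_pos_pos)
  define C where "C = 2 * (A powr (p - 1) * B) powr (1 / p)"
  have C: "C > 0" using AB by (simp add: C_def)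
  show thesis
  proof (rule that[OF C])
    fix a and f :: "real \<Rightarrow> 'b" and g :: "real \<Rightarrow> 'c"
    assume a: "a > 0" and f: "f \<in> wLp p \<gamma>" and g: "strongly_measurable halfline g"
      and le: "\<And>x. 0 < x \<Longrightarrow> ennreal (norm (g x)) \<le> (\<integral>\<^sup>+y. expker a x y * ennreal (norm (f y)) \<partial>halfline)"
    have Aa: "A / a > 0" and Ba: "B / a \<ge> 0" using AB a by auto
    have hA: "(\<integral>\<^sup>+y. expker a x y * ennreal (y powr b) \<partial>halfline) \<le> ennreal (A / a * x powr b)" if "0 < x" for x
      using nn_integral_expker_powr[OF b(1,2) a that] by (simp add: A_def)
    have hB: "(\<integral>\<^sup>+x. expker a x y * ennreal (x powr (b * (p - 1) + \<gamma>)) \<partial>halfline) \<le> ennreal (B / a * y powr (b * (p - 1) + \<gamma>))" if "0 < y" for y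
      using nn_integral_expker_powr[OF e a that] by (simp add: B_def b(3) e_def expker_commute[of a _ y])
    have "wint p \<gamma> g \<le> ennreal (2 powr p * (A / a) powr (p - 1) * (B / a)) * wint p \<gamma> f"
      by (rule schur_test[OF p measurable_expker(1) Aa hA Ba hB wLp_strongly_measurable[OF f] g le])
    also have "2 powr p * (A / a) powr (p - 1) * (B / a) = (C / a) powr p"
    proof -
      have "(C / a) powr p = 2 powr p * (A powr (p - 1) * B) / a powr p"
        using AB a p by (simp add: C_def powr_divide powr_mult powr_powr)
      also have "a powr p = a * a powr (p - 1)" using a powr_mult_base[of a "p - 1"] by simp
      finally show ?thesis using AB a by (simp add: powr_divide mult_ac)
    qed
    finally have le2: "wint p \<gamma> g \<le> ennreal ((C / a) powr p) * wint p \<gamma> f" .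
    have p0: "p > 0" and Ca: "C / a \<ge> 0" using p C a by auto
    show "g \<in> wLp p \<gamma> \<and> a * wnorm p \<gamma> g \<le> C * wnorm p \<gamma> f"
      using wLp_compare[OF f g p0 Ca le2] a by (simp add: field_simps)
  qed
qed

text \<open>Only the values \<open>f y\<close> with \<open>y > x\<close> contribute, and there \<open>x powr d \<le> y powr d\<close> for \<open>d \<ge> 0\<close>. So
  a positive exponent is moved from \<open>g\<close> to \<open>f\<close> and the case \<open>\<beta> = 0\<close> applies; this is why the
  exponent has no upper bound.\<close>

lemma expker_forward_bound:
  assumes p: "p > 1" and \<beta>: "-1 < \<beta>"
  obtains C where "C > 0" "\<And>a (f :: real \<Rightarrow> 'b::real_normed_vector) (g :: real \<Rightarrow> 'c::real_normed_vector).
    \<lbrakk>a > 0; f \<in> wLp p \<beta>; strongly_measurable halfline g;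
      \<And>x. 0 < x \<Longrightarrow> ennreal (norm (g x)) \<le> (\<integral>\<^sup>+y. expker a x y * (ennreal (norm (f y)) * indicator {x<..} y) \<partial>halfline)\<rbrakk>
    \<Longrightarrow> g \<in> wLp p \<beta> \<and> a * wnorm p \<beta> g \<le> C * wnorm p \<beta> f"
proof (cases "\<beta> \<le> 0")
  case True
  obtain C where C: "C > 0" "\<And>a (f :: real \<Rightarrow> 'b) (g :: real \<Rightarrow> 'c).
    \<lbrakk>a > 0; f \<in> wLp p \<beta>; strongly_measurable halfline g;
      \<And>x. 0 < x \<Longrightarrow> ennreal (norm (g x)) \<le> (\<integral>\<^sup>+y. expker a x y * ennreal (norm (f y)) \<partial>halfline)\<rbrakk>
    \<Longrightarrow> g \<in> wLp p \<beta> \<and> a * wnorm p \<beta> g \<le> C * wnorm p \<beta> f"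
    using expker_bound[where 'b='b and 'c='c, OF p \<beta>] True p by auto
  show thesis
  proof (rule that[OF C(1)])
    fix a and f :: "real \<Rightarrow> 'b" and g :: "real \<Rightarrow> 'c"
    assume a: "a > 0" and f: "f \<in> wLp p \<beta>" and g: "strongly_measurable halfline g"
      and le: "\<And>x. 0 < x \<Longrightarrow> ennreal (norm (g x)) \<le> (\<integral>\<^sup>+y. expker a x y * (ennreal (norm (f y)) * indicator {x<..} y) \<partial>halfline)"
    show "g \<in> wLp p \<beta> \<and> a * wnorm p \<beta> g \<le> C * wnorm p \<beta> f"
    proof (rule C(2)[OF a f g])
      fix x :: real assume "0 < x"
      from le[OF this] show "ennreal (norm (g x)) \<le> (\<integral>\<^sup>+y. expker a x y * ennreal (norm (f y)) \<partial>halfline)"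
        by (rule order_trans) (intro nn_integral_mono, auto split: split_indicator)
    qed
  qed
next
  case False
  obtain C where C: "C > 0" "\<And>a (f :: real \<Rightarrow> 'b) (g :: real \<Rightarrow> 'c).
    \<lbrakk>a > 0; f \<in> wLp p 0; strongly_measurable halfline g;
      \<And>x. 0 < x \<Longrightarrow> ennreal (norm (g x)) \<le> (\<integral>\<^sup>+y. expker a x y * ennreal (norm (f y)) \<partial>halfline)\<rbrakk>
    \<Longrightarrow> g \<in> wLp p 0 \<and> a * wnorm p 0 g \<le> C * wnorm p 0 f"
    using expker_bound[where 'b='b and 'c='c, OF p, of 0] p by auto
  define d where "d = \<beta> / p"
  have d: "d > 0" "d * p = \<beta>" using False p by (auto simp: d_def)
  have p0: "p > 0" using p by simp
  show thesis
  proof (rule that[OF C(1)])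
    fix a and f :: "real \<Rightarrow> 'b" and g :: "real \<Rightarrow> 'c"
    assume a: "a > 0" and f: "f \<in> wLp p \<beta>" and g: "strongly_measurable halfline g"
      and le: "\<And>x. 0 < x \<Longrightarrow> ennreal (norm (g x)) \<le> (\<integral>\<^sup>+y. expker a x y * (ennreal (norm (f y)) * indicator {x<..} y) \<partial>halfline)"
    note fs = wLp_strongly_measurable[OF f]
    note [measurable] = borel_measurable_norm_strongly[OF fs]
    have "(\<lambda>x. x powr d *\<^sub>R g x) \<in> wLp p 0 \<and> a * wnorm p 0 (\<lambda>x. x powr d *\<^sub>R g x) \<le> C * wnorm p 0 (\<lambda>x. x powr d *\<^sub>R f x)"
    proof (rule C(2)[OF a])
      show "(\<lambda>x. x powr d *\<^sub>R f x) \<in> wLp p 0" using f by (simp add: wLp_powr_scale[OF p0 fs] d)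
      show "strongly_measurable halfline (\<lambda>x. x powr d *\<^sub>R g x)" by (intro strongly_measurable_scaleR g) measurable
      fix x :: real assume x: "0 < x"
      have [measurable]: "(\<lambda>y. expker a x y * (ennreal (norm (f y)) * indicator {x<..} y)) \<in> borel_measurable halfline"
        by (intro borel_measurable_times_ennreal borel_measurable_halfline_indicator) measurable
      have "ennreal (norm (x powr d *\<^sub>R g x)) = ennreal (x powr d) * ennreal (norm (g x))" by (simp add: ennreal_mult)
      also have "\<dots> \<le> ennreal (x powr d) * (\<integral>\<^sup>+y. expker a x y * (ennreal (norm (f y)) * indicator {x<..} y) \<partial>halfline)"
        by (intro mult_left_mono le x) simp
      also have "\<dots> = (\<integral>\<^sup>+y. ennreal (x powr d) * (expker a x y * (ennreal (norm (f y)) * indicator {x<..} y)) \<partial>halfline)"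
        by (rule nn_integral_cmult[symmetric]) measurable
      also have "\<dots> \<le> (\<integral>\<^sup>+y. expker a x y * ennreal (norm (y powr d *\<^sub>R f y)) \<partial>halfline)"
      proof (rule nn_integral_mono)
        fix y :: real
        show "ennreal (x powr d) * (expker a x y * (ennreal (norm (f y)) * indicator {x<..} y)) \<le> expker a x y * ennreal (norm (y powr d *\<^sub>R f y))"
        proof (cases "x < y")
          case True
          then have "ennreal (x powr d) \<le> ennreal (y powr d)" using x d by (intro ennreal_leI powr_mono2) auto
          then have "ennreal (x powr d) * (expker a x y * ennreal (norm (f y))) \<le> ennreal (y powr d) * (expker a x y * ennreal (norm (f y)))"
            by (rule mult_right_mono) simp
          then show ?thesis using True by (simp add: ennreal_mult mult_ac)
        qed simp
      qed
      finally show "ennreal (norm (x powr d *\<^sub>R g x)) \<le> (\<integral>\<^sup>+y. expker a x y * ennreal (norm (y powr d *\<^sub>R f y)) \<partial>halfline)" .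
    qed
    then show "g \<in> wLp p \<beta> \<and> a * wnorm p \<beta> g \<le> C * wnorm p \<beta> f"
      by (simp add: wLp_powr_scale[OF p0 fs] wLp_powr_scale[OF p0 g] d)
  qed
qed

text \<open>Hardy's inequality is Schur's test for the kernel \<open>1 / y\<close> on \<open>x < y\<close>, applied to \<open>y *\<^sub>R f y\<close>.\<close>

lemma hardy_bound:
  assumes p: "p > 1" and \<beta>: "-1 < \<beta>"
  obtains C where "C > 0" "\<And>(f :: real \<Rightarrow> 'b::real_normed_vector) (g :: real \<Rightarrow> 'c::real_normed_vector).
    \<lbrakk>f \<in> wLp p (\<beta> + p); strongly_measurable halfline g;
      \<And>x. 0 < x \<Longrightarrow> ennreal (norm (g x)) \<le> (\<integral>\<^sup>+y. ennreal (norm (f y)) * indicator {x<..} y \<partial>halfline)\<rbrakk>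
    \<Longrightarrow> g \<in> wLp p \<beta> \<and> wnorm p \<beta> g \<le> C * wnorm p (\<beta> + p) f"
proof -
  (* Schur's test needs b < 0 at infinity and b (p - 1) + \<beta> > -1 at 0. The choice b (p - 1) = -
     (\<beta> + 1) / 2 is in the middle of the admissible range. *)
  define b where "b = (- (\<beta> + 1) / 2) / (p - 1)"
  define e where "e = b * (p - 1) + \<beta>"
  have b: "b < 0" unfolding b_def using p \<beta> by (intro divide_neg_pos) auto
  have "p - 1 \<noteq> 0" using p by simp
  then have "b * (p - 1) = - (\<beta> + 1) / 2" using nonzero_eq_divide_eq[of "p - 1" b "- (\<beta> + 1) / 2"] b_def by blast
  then have e: "-1 < e" using \<beta> by (simp add: e_def)
  define k where "k x y = (if x < y then ennreal (1 / y) else 0)" for x y :: real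
  have km: "case_prod k \<in> borel_measurable (halfline \<Otimes>\<^sub>M halfline)"
    unfolding k_def case_prod_beta by measurable
  define A where "A = - (1 / b)"
  define B where "B = 1 / (e + 1)"
  have AB: "A > 0" "B \<ge> 0" using b e by (auto simp: A_def B_def)
  define C where "C = (2 powr p * A powr (p - 1) * B) powr (1 / p)"
  have C: "C > 0" using AB e by (simp add: C_def B_def)
  have p0: "p > 0" using p by simp
  have hA: "(\<integral>\<^sup>+y. k x y * ennreal (y powr b) \<partial>halfline) \<le> ennreal (A * x powr b)" if x: "0 < x" for x
  proof -
    have "(\<integral>\<^sup>+y. k x y * ennreal (y powr b) \<partial>halfline) \<le> (\<integral>\<^sup>+y. ennreal (y powr (b - 1)) * indicator {x..} y \<partial>halfline)"
    proof (rule nn_integral_mono)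
      fix y assume "y \<in> space halfline"
      then show "k x y * ennreal (y powr b) \<le> ennreal (y powr (b - 1)) * indicator {x..} y"
        by (auto simp: k_def ennreal_mult[symmetric] powr_diff split: split_indicator)
    qed
    also have "\<dots> \<le> ennreal (- (x powr ((b - 1) + 1)) / ((b - 1) + 1))"
      by (rule nn_integral_powr_inf) (use b x in auto)
    finally show ?thesis by (simp add: A_def)
  qed
  have hB: "(\<integral>\<^sup>+x. k x y * ennreal (x powr (b * (p - 1) + \<beta>)) \<partial>halfline) \<le> ennreal (B * y powr (b * (p - 1) + \<beta>))" if y: "0 < y" for y
  proof -
    have [measurable]: "(\<lambda>x. ennreal (x powr e) * indicator {0..y} x) \<in> borel_measurable halfline"
      by (intro borel_measurable_times_ennreal borel_measurable_halfline_indicator) measurable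
    have "(\<integral>\<^sup>+x. k x y * ennreal (x powr e) \<partial>halfline) \<le> (\<integral>\<^sup>+x. ennreal (1 / y) * (ennreal (x powr e) * indicator {0..y} x) \<partial>halfline)"
      by (intro nn_integral_mono) (auto simp: k_def split: split_indicator)
    also have "\<dots> = ennreal (1 / y) * (\<integral>\<^sup>+x. ennreal (x powr e) * indicator {0..y} x \<partial>halfline)"
      by (rule nn_integral_cmult) measurable
    also have "\<dots> \<le> ennreal (1 / y) * ennreal (y powr (e + 1) / (e + 1))"
      using y by (intro mult_left_mono nn_integral_powr_0 e) auto
    also have "\<dots> = ennreal (B * y powr e)" using y e by (simp add: ennreal_mult[symmetric] powr_add B_def)
    finally show ?thesis by (simp add: e_def)
  qed
  show thesis
  proof (rule that[OF C])
    fix f :: "real \<Rightarrow> 'b" and g :: "real \<Rightarrow> 'c"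
    assume f: "f \<in> wLp p (\<beta> + p)" and g: "strongly_measurable halfline g"
      and le: "\<And>x. 0 < x \<Longrightarrow> ennreal (norm (g x)) \<le> (\<integral>\<^sup>+y. ennreal (norm (f y)) * indicator {x<..} y \<partial>halfline)"
    note fs = wLp_strongly_measurable[OF f]
    let ?f = "\<lambda>y. y powr 1 *\<^sub>R f y"
    have f1: "?f \<in> wLp p \<beta>" and f2: "wnorm p \<beta> ?f = wnorm p (\<beta> + p) f"
      using f wLp_powr_scale(1)[OF p0 fs, of 1 \<beta>] wLp_powr_scale(2)[OF p0 fs, of \<beta> 1] by auto
    have le': "ennreal (norm (g x)) \<le> (\<integral>\<^sup>+y. k x y * ennreal (norm (?f y)) \<partial>halfline)" if x: "0 < x" for x
    proof -
      have "(\<integral>\<^sup>+y. ennreal (norm (f y)) * indicator {x<..} y \<partial>halfline) = (\<integral>\<^sup>+y. k x y * ennreal (norm (?f y)) \<partial>halfline)"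
        by (intro nn_integral_cong) (auto simp: k_def ennreal_mult[symmetric] split: split_indicator)
      with le[OF x] show ?thesis by simp
    qed
    have "wint p \<beta> g \<le> ennreal (2 powr p * A powr (p - 1) * B) * wint p \<beta> ?f"
      by (rule schur_test[OF p km AB(1) hA AB(2) hB wLp_strongly_measurable[OF f1] g le'])
    also have "2 powr p * A powr (p - 1) * B = C powr p" using AB p by (simp add: C_def powr_powr)
    finally have "wint p \<beta> g \<le> ennreal (C powr p) * wint p \<beta> ?f" .
    from wLp_compare[OF f1 g p0 _ this] C f2
    show "g \<in> wLp p \<beta> \<and> wnorm p \<beta> g \<le> C * wnorm p (\<beta> + p) f" by auto
  qed
qed

section \<open>Integrability near the endpoint and at infinity\<close>

lemma powr_le_exp:
  fixes a d t :: real
  assumes "a > 0" "d > 0" "t \<ge> 0"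
  shows "t powr d \<le> (2 * d / a) powr d * exp (a * t / 2)"
proof -
  have "a * t / (2 * d) \<le> exp (a * t / (2 * d))" using exp_ge_add_one_self[of "a * t / (2 * d)"] by linarith
  then have "(a * t / (2 * d)) powr d \<le> exp (a * t / (2 * d)) powr d"
    using assms by (intro powr_mono2) auto
  also have "\<dots> = exp (a * t / 2)" using assms by (simp add: powr_def)
  finally have "(2 * d / a) powr d * (a * t / (2 * d)) powr d \<le> (2 * d / a) powr d * exp (a * t / 2)"
    by (rule mult_left_mono) simp
  then show ?thesis using assms by (simp add: powr_mult[symmetric])
qed

lemma borel_measurable_indicator_ennreal_halfline:
  "A \<in> sets borel \<Longrightarrow> (\<lambda>x. indicator A x :: ennreal) \<in> borel_measurable halfline"
  by (rule borel_measurable_halfline_indicator)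

text \<open>Hoelder's inequality against the dual weight \<open>y powr b\<close>, which is integrable near \<open>0\<close> because
  \<open>\<gamma> < p - 1\<close> and at infinity thanks to the exponential.\<close>

lemma wLp_exp_integrable:
  fixes f :: "real \<Rightarrow> 'a::real_normed_vector"
  assumes p: "p > 1" and \<gamma>: "-1 < \<gamma>" "\<gamma> < p - 1" and f: "f \<in> wLp p \<gamma>" and a: "a > 0"
  shows "(\<integral>\<^sup>+y. expker a 0 y * ennreal (norm (f y)) \<partial>halfline) < \<infinity>"
proof -
  note [measurable] = borel_measurable_norm_strongly[OF wLp_strongly_measurable[OF f]]
  define b where "b = - \<gamma> / (p - 1)"
  have b: "-1 < b" using p \<gamma> by (simp add: b_def field_simps)
  have "p - 1 \<noteq> 0" using p by simp
  then have "b * (p - 1) = - \<gamma>" using nonzero_eq_divide_eq[of "p - 1" b "- \<gamma>"] b_def by blast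
  then have b': "b * (1 - p) = \<gamma>" by (simp add: algebra_simps)
  (* On [1, \<infinity>) the weight is at most D times exp (a y / 2). *)
  define D where "D = 1 + (2 * \<bar>b\<bar> / a) powr b"
  have D: "D > 0" by (simp add: D_def add_pos_nonneg)
  define X where "X = 1 / (b + 1) + D * (4 / a)"
  have X: "X > 0" using b D a by (auto simp: X_def intro!: add_pos_pos)
  have [measurable]: "(\<lambda>y. ennreal (y powr b) * indicator {0..1} y) \<in> borel_measurable halfline"
    by (intro borel_measurable_times_ennreal borel_measurable_halfline_indicator) measurable
  have "(\<integral>\<^sup>+y. expker a 0 y * ennreal (y powr b) \<partial>halfline) \<le>
    (\<integral>\<^sup>+y. ennreal (y powr b) * indicator {0..1} y + ennreal D * expker (a/2) 0 y \<partial>halfline)"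
  proof (rule nn_integral_mono)
    fix y assume "y \<in> space halfline"
    then have y: "0 < y" by simp
    show "expker a 0 y * ennreal (y powr b) \<le> ennreal (y powr b) * indicator {0..1} y + ennreal D * expker (a/2) 0 y"
    proof (cases "y \<le> 1")
      case True
      have "expker a 0 y \<le> 1" unfolding expker_def using a y by simp
      then have "expker a 0 y * ennreal (y powr b) \<le> 1 * ennreal (y powr b)" by (rule mult_right_mono) simp
      then show ?thesis using True y by (simp add: add_increasing2)
    next
      case False
      have "y powr b \<le> D * exp (a * y / 2)"
      proof (cases "b \<le> 0")
        case True
        then have "y powr b \<le> 1" using False powr_mono[of b 0 y] by simp
        also have "1 \<le> D * exp (a * y / 2)"
        proof -
          have "1 * 1 \<le> D * exp (a * y / 2)" using a y by (intro mult_mono) (auto simp: D_def)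
          then show ?thesis by simp
        qed
        finally show ?thesis .
      next
        case False
        then have "y powr b \<le> (2 * b / a) powr b * exp (a * y / 2)" using powr_le_exp[OF a, of b y] y by simp
        also have "\<dots> \<le> D * exp (a * y / 2)" using False by (intro mult_right_mono) (auto simp: D_def)
        finally show ?thesis .
      qed
      then have "exp (- (a * y)) * y powr b \<le> exp (- (a * y)) * (D * exp (a * y / 2))" by (rule mult_left_mono) simp
      also have "exp (- (a * y)) * (D * exp (a * y / 2)) = D * exp (- (a / 2 * y))"
        by (simp add: exp_add[symmetric] mult.left_commute field_simps)
      finally have "expker a 0 y * ennreal (y powr b) \<le> ennreal D * expker (a/2) 0 y"
        using y D by (simp add: expker_def ennreal_mult[symmetric] ennreal_leI)
      then show ?thesis by (simp add: add_increasing)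
    qed
  qed
  also have "\<dots> = (\<integral>\<^sup>+y. ennreal (y powr b) * indicator {0..1} y \<partial>halfline) + ennreal D * (\<integral>\<^sup>+y. expker (a/2) 0 y \<partial>halfline)"
    by (subst nn_integral_add, measurable, subst nn_integral_cmult, measurable)
  also have "\<dots> \<le> ennreal (1 powr (b + 1) / (b + 1)) + ennreal D * ennreal (2 / (a / 2))"
    using a by (intro add_mono mult_left_mono nn_integral_powr_0 nn_integral_expker b) auto
  also have "\<dots> = ennreal X" using b D a by (simp add: X_def ennreal_mult[symmetric])
  finally have X': "(\<integral>\<^sup>+y. expker a 0 y * ennreal (y powr b) \<partial>halfline) \<le> ennreal X" .
  have p0: "p > 0" using p by simp
  have "(\<integral>\<^sup>+y. expker a 0 y * ennreal (norm (f y)) \<partial>halfline) \<le> ennreal (2 * wnorm p \<gamma> f * X powr (1 - 1 / p))"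
  proof (rule holder_weighted[OF p _ _ _ _ _ X' X])
    have "(\<integral>\<^sup>+y. expker a 0 y * ennreal (norm (f y) powr p * (y powr b) powr (1 - p)) \<partial>halfline) \<le> wint p \<gamma> f"
      unfolding wint_def
    proof (rule nn_integral_mono)
      fix y assume "y \<in> space halfline"
      then have y: "0 < y" by simp
      have "expker a 0 y \<le> 1" unfolding expker_def using a y by simp
      then have "expker a 0 y * ennreal (norm (f y) powr p * y powr \<gamma>) \<le> 1 * ennreal (norm (f y) powr p * y powr \<gamma>)"
        by (rule mult_right_mono) simp
      then show "expker a 0 y * ennreal (norm (f y) powr p * (y powr b) powr (1 - p)) \<le> ennreal (norm (f y) powr p * y powr \<gamma>)"
        by (simp add: powr_powr b')
    qed
    then show "(\<integral>\<^sup>+y. expker a 0 y * ennreal (norm (f y) powr p * (y powr b) powr (1 - p)) \<partial>halfline) \<le> ennreal (wnorm p \<gamma> f powr p)"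
      by (simp only: wint_eq_wnorm[OF f p0])
  qed (auto simp: wnorm_nonneg)
  then show ?thesis by (rule le_less_trans) simp
qed

text \<open>The small exponent gives integrability on \<open>(0, 1]\<close>, the large one on \<open>[1, \<infinity>)\<close>.\<close>

lemma wLp_L1_bound:
  assumes p: "p > 1" and \<gamma>: "\<gamma> < p - 1" and \<delta>: "p - 1 < \<delta>"
  obtains C where "C > 0" "\<And>f :: real \<Rightarrow> 'a::real_normed_vector. f \<in> wLp p \<gamma> \<Longrightarrow> f \<in> wLp p \<delta> \<Longrightarrow>
    (\<integral>\<^sup>+y. ennreal (norm (f y)) \<partial>halfline) \<le> ennreal (C * (wnorm p \<gamma> f + wnorm p \<delta> f))"
proof -
  define b where "b = - \<gamma> / (p - 1)"
  define b2 where "b2 = - \<delta> / (p - 1)"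
  have b: "-1 < b" "b2 < -1" using p \<gamma> \<delta> by (simp_all add: b_def b2_def field_simps)
  have p1: "p - 1 \<noteq> 0" and p0: "p > 0" using p by simp_all
  have "b * (p - 1) = - \<gamma>" "b2 * (p - 1) = - \<delta>"
    using nonzero_eq_divide_eq[OF p1, of b "- \<gamma>"] nonzero_eq_divide_eq[OF p1, of b2 "- \<delta>"] b_def b2_def by blast+
  then have b': "b * (1 - p) = \<gamma>" "b2 * (1 - p) = \<delta>" by (simp_all add: algebra_simps)
  define X where "X = 1 / (b + 1)"
  define X2 where "X2 = - (1 / (b2 + 1))"
  have X: "X > 0" "X2 > 0" using b by (auto simp: X_def X2_def)
  define C where "C = 2 * X powr (1 - 1 / p) + 2 * X2 powr (1 - 1 / p)"
  have C: "C > 0" using X by (simp add: C_def add_pos_pos)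
  show thesis
  proof (rule that[OF C])
    fix f :: "real \<Rightarrow> 'a" assume f: "f \<in> wLp p \<gamma>" "f \<in> wLp p \<delta>"
    note [measurable] = borel_measurable_norm_strongly[OF wLp_strongly_measurable[OF f(1)]]
    have part: "(\<integral>\<^sup>+y. indicator \<Omega> y * ennreal (norm (f y)) \<partial>halfline) \<le> ennreal (2 * wnorm p e f * Y powr (1 - 1 / p))"
      if \<Omega>: "\<Omega> \<in> sets borel" and Y: "(\<integral>\<^sup>+y. ennreal (y powr c) * indicator \<Omega> y \<partial>halfline) \<le> ennreal Y" "Y > 0"
        and c: "c * (1 - p) = e" and fe: "f \<in> wLp p e" for \<Omega> Y c e
    proof (rule holder_weighted[OF p _ _ _ _ _ _ Y(2), where \<theta>="\<lambda>y. y powr c"])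
      show "indicator \<Omega> \<in> borel_measurable halfline" by (rule borel_measurable_halfline_indicator[OF \<Omega>])
      show "(\<integral>\<^sup>+y. indicator \<Omega> y * ennreal (y powr c) \<partial>halfline) \<le> ennreal Y" using Y(1) by (simp add: mult.commute)
      have "(\<integral>\<^sup>+y. indicator \<Omega> y * ennreal (norm (f y) powr p * (y powr c) powr (1 - p)) \<partial>halfline) \<le> wint p e f"
        unfolding wint_def by (intro nn_integral_mono) (auto simp: powr_powr c split: split_indicator)
      then show "(\<integral>\<^sup>+y. indicator \<Omega> y * ennreal (norm (f y) powr p * (y powr c) powr (1 - p)) \<partial>halfline) \<le> ennreal (wnorm p e f powr p)"
        by (simp only: wint_eq_wnorm[OF fe p0])
    qed (auto simp: wnorm_nonneg)
    have Y1: "(\<integral>\<^sup>+y. ennreal (y powr b) * indicator {0..1} y \<partial>halfline) \<le> ennreal X"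
      using nn_integral_powr_0[OF b(1), of 1] by (simp add: X_def)
    have Y2: "(\<integral>\<^sup>+y. ennreal (y powr b2) * indicator {1..} y \<partial>halfline) \<le> ennreal X2"
      using nn_integral_powr_inf[OF b(2), of 1] by (simp add: X2_def)
    have "(\<integral>\<^sup>+y. ennreal (norm (f y)) \<partial>halfline) \<le>
      (\<integral>\<^sup>+y. indicator {0..1} y * ennreal (norm (f y)) + indicator {1..} y * ennreal (norm (f y)) \<partial>halfline)"
      by (intro nn_integral_mono) (auto split: split_indicator)
    also have "\<dots> = (\<integral>\<^sup>+y. indicator {0..1} y * ennreal (norm (f y)) \<partial>halfline) + (\<integral>\<^sup>+y. indicator {1..} y * ennreal (norm (f y)) \<partial>halfline)"
      by (intro nn_integral_add borel_measurable_times_ennreal borel_measurable_indicator_ennreal_halfline) auto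
    also have "\<dots> \<le> ennreal (2 * wnorm p \<gamma> f * X powr (1 - 1 / p)) + ennreal (2 * wnorm p \<delta> f * X2 powr (1 - 1 / p))"
      by (intro add_mono part[OF _ Y1 X(1) b'(1) f(1)] part[OF _ Y2 X(2) b'(2) f(2)]) auto
    also have "\<dots> = ennreal (2 * wnorm p \<gamma> f * X powr (1 - 1 / p) + 2 * wnorm p \<delta> f * X2 powr (1 - 1 / p))"
      by (intro ennreal_plus[symmetric] mult_nonneg_nonneg wnorm_nonneg) auto
    also have "\<dots> \<le> ennreal (C * (wnorm p \<gamma> f + wnorm p \<delta> f))"
    proof (rule ennreal_leI)
      have "0 \<le> 2 * wnorm p \<gamma> f * X2 powr (1 - 1 / p)" "0 \<le> 2 * wnorm p \<delta> f * X powr (1 - 1 / p)"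
        by (intro mult_nonneg_nonneg wnorm_nonneg; simp)+
      then show "2 * wnorm p \<gamma> f * X powr (1 - 1 / p) + 2 * wnorm p \<delta> f * X2 powr (1 - 1 / p) \<le> C * (wnorm p \<gamma> f + wnorm p \<delta> f)"
        by (simp add: C_def algebra_simps)
    qed
    finally show "(\<integral>\<^sup>+y. ennreal (norm (f y)) \<partial>halfline) \<le> ennreal (C * (wnorm p \<gamma> f + wnorm p \<delta> f))" .
  qed
qed

lemma wint_dyadic_lower_bound:
  assumes p: "p > 0" and v: "v \<in> wLp p \<gamma>" and \<eta>: "\<eta> > 0" and m: "m \<ge> 0"
    and ge: "\<And>x. \<eta> < x \<Longrightarrow> x \<le> 2 * \<eta> \<Longrightarrow> m \<le> norm (v x) powr p * x powr \<gamma>"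
  shows "m * \<eta> \<le> wnorm p \<gamma> v powr p"
proof -
  have s: "{\<eta><..2 * \<eta>} \<in> sets halfline" using \<eta> by (auto simp: sets_restrict_space_iff)
  have e: "emeasure halfline {\<eta><..2 * \<eta>} = ennreal \<eta>"
    using \<eta> by (subst emeasure_restrict_space) auto
  have "ennreal (m * \<eta>) = (\<integral>\<^sup>+x. ennreal m * indicator {\<eta><..2 * \<eta>} x \<partial>halfline)"
    using s e m \<eta> by (simp add: nn_integral_cmult_indicator ennreal_mult)
  also have "\<dots> \<le> wint p \<gamma> v" unfolding wint_def
    using ge by (intro nn_integral_mono) (auto split: split_indicator intro: ennreal_leI)
  also have "\<dots> = ennreal (wnorm p \<gamma> v powr p)" by (rule wint_eq_wnorm[OF v p])
  finally show ?thesis by simp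
qed

text \<open>Otherwise \<open>norm (v x) \<ge> e / x\<close> near \<open>0\<close>, and the weighted integral over \<open>(\<eta>, 2 \<eta>]\<close> is at least
  a multiple of \<open>\<eta> powr (\<gamma> - p + 1)\<close>, which is unbounded. This replaces a boundary value at \<open>0\<close>.\<close>

lemma wLp_small_near_0:
  assumes p: "p > 1" and \<gamma>: "\<gamma> < p - 1" and v: "v \<in> wLp p \<gamma>" and e: "e > 0"
  obtains x where "0 < x" "x < e" "x * norm (v x) < e"
proof (rule ccontr)
  assume n: "\<not> thesis"
  note obt = that
  have ge: "e / x \<le> norm (v x)" if "0 < x" "x < e" for x
  proof (rule ccontr)
    assume "\<not> e / x \<le> norm (v x)"
    then have "x * norm (v x) < e" using that by (simp add: field_simps)
    then show False using n obt[OF that] by blast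
  qed
  define q where "q = \<gamma> - p + 1"
  have q: "q < 0" using \<gamma> by (simp add: q_def)
  define c where "c = e powr p * 2 powr (\<gamma> - p)"
  have c: "c > 0" using e by (simp add: c_def)
  have le: "c * \<eta> powr q \<le> wnorm p \<gamma> v powr p" if \<eta>: "0 < \<eta>" "\<eta> < e / 2" for \<eta>
  proof -
    have "(e powr p * (2 * \<eta>) powr (\<gamma> - p)) * \<eta> \<le> wnorm p \<gamma> v powr p"
    proof (rule wint_dyadic_lower_bound[OF _ v \<eta>(1)])
      fix x assume x: "\<eta> < x" "x \<le> 2 * \<eta>"
      then have x0: "0 < x" "x < e" using \<eta> by auto
      have "(2 * \<eta>) powr (\<gamma> - p) \<le> x powr (\<gamma> - p)" using x x0 \<gamma> p by (intro powr_mono2') auto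
      then have "e powr p * (2 * \<eta>) powr (\<gamma> - p) \<le> e powr p * x powr (\<gamma> - p)" by (intro mult_left_mono) auto
      also have "\<dots> = (e / x) powr p * x powr \<gamma>" using e x0 by (simp add: powr_divide powr_diff)
      also have "\<dots> \<le> norm (v x) powr p * x powr \<gamma>" using ge[OF x0] e x0 p by (intro mult_right_mono powr_mono2) auto
      finally show "e powr p * (2 * \<eta>) powr (\<gamma> - p) \<le> norm (v x) powr p * x powr \<gamma>" .
    qed (use p in auto)
    moreover have "(e powr p * (2 * \<eta>) powr (\<gamma> - p)) * \<eta> = c * \<eta> powr q"
    proof -
      have "\<eta> powr q = \<eta> powr (\<gamma> - p) * \<eta>" using \<eta>(1) by (simp add: q_def powr_add)
      then show ?thesis using \<eta>(1) by (simp add: c_def powr_mult)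
    qed
    ultimately show ?thesis by simp
  qed
  (* For this \<eta> the lower bound is at least c * K, which exceeds the p-th power of the norm by
     c. *)
  define K where "K = wnorm p \<gamma> v powr p / c + 1"
  have K: "K > 0" using c by (simp add: K_def add_nonneg_pos)
  define \<eta> where "\<eta> = min (e / 4) (K powr (1 / q))"
  have \<eta>: "0 < \<eta>" "\<eta> < e / 2" using e K by (auto simp: \<eta>_def)
  have "(K powr (1 / q)) powr q \<le> \<eta> powr q" using \<eta> q K by (intro powr_mono2') (auto simp: \<eta>_def)
  then have "K \<le> \<eta> powr q" using q K by (simp add: powr_powr)
  then have "c * K \<le> wnorm p \<gamma> v powr p" using le[OF \<eta>] c by (meson mult_left_mono less_imp_le order_trans)
  moreover have "c * K = wnorm p \<gamma> v powr p + c" using c by (simp add: K_def distrib_left)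
  ultimately show False using c by linarith
qed

text \<open>Otherwise the weighted integral over \<open>(\<eta>, 2 \<eta>]\<close> is at least a multiple of \<open>\<eta> powr (\<delta> + 1)\<close>,
  which is unbounded. This replaces a boundary value at infinity.\<close>

lemma wLp_small_near_infinity:
  assumes p: "p > 1" and \<delta>: "-1 < \<delta>" and v: "v \<in> wLp p \<delta>" and e: "e > 0"
  obtains x where "R < x" "norm (v x) < e"
proof (rule ccontr)
  assume n: "\<not> thesis"
  note obt = that
  have ge: "e \<le> norm (v x)" if "R < x" for x using n obt[OF that] by force
  (* On (\<eta>, 2 \<eta>] the weight is at least k * \<eta> powr \<delta>, whatever the sign of \<delta>. *)
  define k where "k = min 1 (2 powr \<delta>)"
  have k: "k > 0" by (simp add: k_def)
  define c where "c = e powr p * k"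
  have c: "c > 0" using e k by (simp add: c_def)
  have le: "c * \<eta> powr (\<delta> + 1) \<le> wnorm p \<delta> v powr p" if \<eta>: "0 < \<eta>" "R < \<eta>" for \<eta>
  proof -
    have "(c * \<eta> powr \<delta>) * \<eta> \<le> wnorm p \<delta> v powr p"
    proof (rule wint_dyadic_lower_bound[OF _ v \<eta>(1)])
      fix x assume x: "\<eta> < x" "x \<le> 2 * \<eta>"
      have "k * \<eta> powr \<delta> \<le> x powr \<delta>"
      proof (cases "\<delta> \<ge> 0")
        case True
        have "k * \<eta> powr \<delta> \<le> 1 * \<eta> powr \<delta>" by (intro mult_right_mono) (auto simp: k_def)
        also have "\<dots> \<le> x powr \<delta>" using x \<eta> True by (simp add: powr_mono2)
        finally show ?thesis .
      next
        case False
        have "k * \<eta> powr \<delta> \<le> 2 powr \<delta> * \<eta> powr \<delta>" by (intro mult_right_mono) (auto simp: k_def)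
        also have "\<dots> = (2 * \<eta>) powr \<delta>" using \<eta> by (simp add: powr_mult)
        also have "\<dots> \<le> x powr \<delta>" using x \<eta> False by (intro powr_mono2') auto
        finally show ?thesis .
      qed
      moreover have "e powr p \<le> norm (v x) powr p" using ge[of x] x \<eta> e p by (intro powr_mono2) auto
      ultimately have "e powr p * (k * \<eta> powr \<delta>) \<le> norm (v x) powr p * x powr \<delta>"
        using k by (intro mult_mono) auto
      then show "c * \<eta> powr \<delta> \<le> norm (v x) powr p * x powr \<delta>" by (simp add: c_def mult.assoc)
    qed (use p c in auto)
    then show ?thesis using \<eta>(1) by (simp add: powr_add)
  qed
  define K where "K = wnorm p \<delta> v powr p / c + 1"
  have K: "K > 0" using c by (simp add: K_def add_nonneg_pos)
  define \<eta> where "\<eta> = max (\<bar>R\<bar> + 1) (K powr (1 / (\<delta> + 1)))"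
  have \<eta>: "0 < \<eta>" "R < \<eta>" by (auto simp: \<eta>_def)
  have "(K powr (1 / (\<delta> + 1))) powr (\<delta> + 1) \<le> \<eta> powr (\<delta> + 1)" using \<delta> K by (intro powr_mono2) (auto simp: \<eta>_def)
  then have "K \<le> \<eta> powr (\<delta> + 1)" using \<delta> K by (simp add: powr_powr)
  then have "c * K \<le> wnorm p \<delta> v powr p" using le[OF \<eta>] c by (meson mult_left_mono less_imp_le order_trans)
  moreover have "c * K = wnorm p \<delta> v powr p + c" using c by (simp add: K_def distrib_left)
  ultimately show False using c by linarith
qed

text \<open>For \<open>\<delta> > p - 1\<close> an element of the weighted space need not be integrable near \<open>0\<close>, so the
  integrability of \<open>f\<close> is a separate hypothesis. With \<open>d = \<delta> / p\<close> the weight satisfies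
  \<open>x powr d \<le> 2 powr d * (y powr d + \<bar>x - y\<bar> powr d)\<close>. The first term leads to the estimate with
  exponent \<open>0\<close>. The second one is absorbed by half of the exponential at the price of
  \<open>a powr (- d)\<close>; what remains is the convolution of the integrable function \<open>norm f\<close> with
  \<open>exp (- a \<bar>x\<bar> / 2)\<close>, whose \<open>L\<^sup>p\<close>-norm is at most a multiple of \<open>a powr (- 1 / p) * J\<close>.
  Together with the factor \<open>a\<close> on the left-hand side this is the power of \<open>a\<close> in the conclusion.\<close>

lemma expker_L1_bound:
  assumes p: "p > 1" and \<delta>: "p - 1 < \<delta>"
  obtains C where "C > 0" "\<And>a J (f :: real \<Rightarrow> 'b::real_normed_vector) (g :: real \<Rightarrow> 'c::real_normed_vector).
    \<lbrakk>a > 0; f \<in> wLp p \<delta>; J \<ge> 0; (\<integral>\<^sup>+y. ennreal (norm (f y)) \<partial>halfline) \<le> ennreal J; strongly_measurable halfline g;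
      \<And>x. 0 < x \<Longrightarrow> ennreal (norm (g x)) \<le> (\<integral>\<^sup>+y. expker a x y * ennreal (norm (f y)) \<partial>halfline)\<rbrakk>
    \<Longrightarrow> g \<in> wLp p \<delta> \<and> a * wnorm p \<delta> g \<le> C * (wnorm p \<delta> f + a powr (- (\<delta> + 1 - p) / p) * J)"
proof -
  have p0: "p > 0" using p by simp
  define d where "d = \<delta> / p"
  have d: "d > 0" "d * p = \<delta>" using \<delta> p by (auto simp: d_def)
  obtain C where C: "C > 0" "\<And>a (f :: real \<Rightarrow> 'b) (g :: real \<Rightarrow> real).
    \<lbrakk>a > 0; f \<in> wLp p 0; strongly_measurable halfline g;
      \<And>x. 0 < x \<Longrightarrow> ennreal (norm (g x)) \<le> (\<integral>\<^sup>+y. expker a x y * ennreal (norm (f y)) \<partial>halfline)\<rbrakk>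
    \<Longrightarrow> g \<in> wLp p 0 \<and> a * wnorm p 0 g \<le> C * wnorm p 0 f"
    using expker_bound[where 'b='b and 'c=real, OF p, of 0] p by auto
  define K0 where "K0 = 2 powr d * (2 * d) powr d"
  have K0: "K0 > 0" using d by (simp add: K0_def)
  define C' where "C' = 2 * (C * 2 powr d) + 2 * (K0 * 4 powr (1 / p))"
  have C': "C' > 0" using C K0 by (simp add: C'_def add_pos_pos)
  show thesis
  proof (rule that[OF C'])
    fix a J and f :: "real \<Rightarrow> 'b" and g :: "real \<Rightarrow> 'c"
    assume a: "a > 0" and f: "f \<in> wLp p \<delta>" and J: "J \<ge> 0" "(\<integral>\<^sup>+y. ennreal (norm (f y)) \<partial>halfline) \<le> ennreal J"
      and g: "strongly_measurable halfline g"
      and le: "\<And>x. 0 < x \<Longrightarrow> ennreal (norm (g x)) \<le> (\<integral>\<^sup>+y. expker a x y * ennreal (norm (f y)) \<partial>halfline)"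
    note fs = wLp_strongly_measurable[OF f]
    note [measurable] = borel_measurable_norm_strongly[OF fs] borel_measurable_norm_strongly[OF g]
    interpret sigma_finite_measure halfline by (rule sigma_finite_halfline)
    interpret P: pair_sigma_finite halfline halfline ..
    define K where "K = K0 * a powr (- d)"
    have K: "K > 0" using K0 a by (simp add: K_def)
    define G where "G x = (\<integral>\<^sup>+y. expker (a/2) x y * ennreal (norm (f y)) \<partial>halfline)" for x
    have Gm[measurable]: "G \<in> borel_measurable halfline" unfolding G_def[abs_def] by measurable
    have GJ: "G x \<le> ennreal J" for x
    proof -
      have "G x \<le> (\<integral>\<^sup>+y. ennreal (norm (f y)) \<partial>halfline)" unfolding G_def
      proof (rule nn_integral_mono)
        fix y :: real
        have "expker (a/2) x y \<le> 1" unfolding expker_def using a by simp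
        then have "expker (a/2) x y * ennreal (norm (f y)) \<le> 1 * ennreal (norm (f y))" by (rule mult_right_mono) simp
        then show "expker (a/2) x y * ennreal (norm (f y)) \<le> ennreal (norm (f y))" by simp
      qed
      then show ?thesis using J(2) by (rule order_trans)
    qed
    define h where "h x = enn2real (G x)" for x
    have h: "0 \<le> h x" "ennreal (h x) = G x" "h x \<le> J" for x
    proof -
      show "0 \<le> h x" by (simp add: h_def)
      show e: "ennreal (h x) = G x" unfolding h_def using GJ[of x] by (intro ennreal_enn2real) (auto intro: le_less_trans)
      show "h x \<le> J" using GJ[of x] J(1) unfolding e[symmetric] by (simp add: ennreal_le_iff)
    qed
    have hm[measurable]: "h \<in> borel_measurable halfline" unfolding h_def[abs_def] by measurable
    have hs: "strongly_measurable halfline h" using hm by (simp add: strongly_measurable_iff_borel_measurable)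
    (* Interpolation: h is bounded by J, and its integral is at most 4 / a times J. *)
    have "wint p 0 h \<le> (\<integral>\<^sup>+x. ennreal (J powr (p - 1)) * G x \<partial>halfline)" unfolding wint_def
    proof (rule nn_integral_mono)
      fix x assume "x \<in> space halfline"
      then have x: "0 < x" by simp
      have "norm (h x) powr p * x powr 0 = h x * h x powr (p - 1)"
        using x h(1)[of x] powr_mult_base[of "h x" "p - 1"] by simp
      also have "\<dots> \<le> h x * J powr (p - 1)" using h(1,3)[of x] p by (intro mult_left_mono powr_mono2) auto
      finally have "ennreal (norm (h x) powr p * x powr 0) \<le> ennreal (J powr (p - 1) * h x)"
        by (intro ennreal_leI) (simp add: mult.commute)
      then show "ennreal (norm (h x) powr p * x powr 0) \<le> ennreal (J powr (p - 1)) * G x"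
        by (simp only: ennreal_mult[OF powr_ge_zero h(1)] h(2))
    qed
    also have "\<dots> = ennreal (J powr (p - 1)) * (\<integral>\<^sup>+x. G x \<partial>halfline)" by (rule nn_integral_cmult) measurable
    also have "(\<integral>\<^sup>+x. G x \<partial>halfline) = (\<integral>\<^sup>+y. (\<integral>\<^sup>+x. expker (a/2) x y * ennreal (norm (f y)) \<partial>halfline) \<partial>halfline)"
      unfolding G_def by (rule P.Fubini'[symmetric]) measurable
    also have "\<dots> \<le> (\<integral>\<^sup>+y. ennreal (4 / a) * ennreal (norm (f y)) \<partial>halfline)"
    proof (rule nn_integral_mono)
      fix y assume "y \<in> space halfline"
      then have y: "0 \<le> y" by simp
      have "(\<integral>\<^sup>+x. expker (a/2) x y * ennreal (norm (f y)) \<partial>halfline) = (\<integral>\<^sup>+x. expker (a/2) x y \<partial>halfline) * ennreal (norm (f y))"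
        by (rule nn_integral_multc) measurable
      also have "\<dots> \<le> ennreal (4 / a) * ennreal (norm (f y))"
        using nn_integral_expker[of "a/2" y] a y by (intro mult_right_mono) (auto simp: expker_commute[of "a/2" _ y])
      finally show "(\<integral>\<^sup>+x. expker (a/2) x y * ennreal (norm (f y)) \<partial>halfline) \<le> ennreal (4 / a) * ennreal (norm (f y))" .
    qed
    also have "\<dots> = ennreal (4 / a) * (\<integral>\<^sup>+y. ennreal (norm (f y)) \<partial>halfline)" by (rule nn_integral_cmult) measurable
    also have "ennreal (J powr (p - 1)) * (ennreal (4 / a) * (\<integral>\<^sup>+y. ennreal (norm (f y)) \<partial>halfline)) \<le> ennreal (J powr (p - 1)) * (ennreal (4 / a) * ennreal J)"
      by (intro mult_left_mono J) auto
    also have "\<dots> = ennreal (((4 / a) powr (1 / p) * J) powr p)"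
    proof -
      have "((4 / a) powr (1 / p) * J) powr p = 4 / a * J powr p" using a J p by (simp add: powr_mult powr_powr)
      also have "J powr p = J * J powr (p - 1)" using J(1) powr_mult_base[of J "p - 1"] by simp
      finally have "((4 / a) powr (1 / p) * J) powr p = J powr (p - 1) * (4 / a * J)" by (simp add: mult_ac)
      moreover have "ennreal (4 / a) * ennreal J = ennreal (4 / a * J)"
        using a J(1) by (intro ennreal_mult[symmetric]) auto
      moreover have "ennreal (J powr (p - 1)) * ennreal (4 / a * J) = ennreal (J powr (p - 1) * (4 / a * J))"
        using a J(1) by (intro ennreal_mult[symmetric]) auto
      ultimately show ?thesis by (simp only:)
    qed
    finally have hw: "wint p 0 h \<le> ennreal (((4 / a) powr (1 / p) * J) powr p)" by (simp add: mult_left_mono)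
    have hN: "h \<in> wLp p 0" "wnorm p 0 h \<le> (4 / a) powr (1 / p) * J"
      using wLp_I[OF hs p0 _ hw] J(1) by auto
    have ker: "x powr d * exp (- (a * \<bar>x - y\<bar>)) \<le> exp (- (a * \<bar>x - y\<bar>)) * (2 powr d * y powr d) + K * exp (- (a/2 * \<bar>x - y\<bar>))"
      if x: "0 < x" and y: "0 < y" for x y
    proof -
      define t where "t = \<bar>x - y\<bar>"
      have t: "t \<ge> 0" "x \<le> y + t" by (auto simp: t_def)
      have "x powr d \<le> (y + t) powr d" using x t d by (intro powr_mono2) auto
      also have "\<dots> \<le> 2 powr d * (y powr d + t powr d)" using y t d by (intro powr_add_le) auto
      also have "\<dots> \<le> 2 powr d * (y powr d + (2 * d / a) powr d * exp (a * t / 2))"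
        using powr_le_exp[OF a d(1) t(1)] by (intro mult_left_mono add_left_mono) auto
      also have "\<dots> = 2 powr d * y powr d + K * exp (a * t / 2)"
        using a d by (simp add: K_def K0_def powr_divide powr_minus field_simps)
      finally have "x powr d * exp (- (a * t)) \<le> (2 powr d * y powr d + K * exp (a * t / 2)) * exp (- (a * t))"
        by (rule mult_right_mono) simp
      also have "\<dots> = exp (- (a * t)) * (2 powr d * y powr d) + K * (exp (a * t / 2) * exp (- (a * t)))"
        by (simp add: algebra_simps)
      also have "exp (a * t / 2) * exp (- (a * t)) = exp (- (a/2 * t))" by (simp add: exp_add[symmetric])
      finally show ?thesis by (simp add: t_def)
    qed
    (* The part of x powr d * norm (g x) that the convolution with the half exponential does not
       account for; it obeys the estimate with exponent 0. *)
    define w where "w x = max 0 (x powr d * norm (g x) - K * h x)" for x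
    have wm: "strongly_measurable halfline w" unfolding w_def[abs_def] strongly_measurable_iff_borel_measurable by measurable
    let ?F = "\<lambda>y. (2 powr d) *\<^sub>R (y powr d *\<^sub>R f y)"
    have f0: "(\<lambda>y. y powr d *\<^sub>R f y) \<in> wLp p 0" using f wLp_powr_scale(1)[OF p0 fs, of d 0] d by simp
    have f0n: "wnorm p 0 (\<lambda>y. y powr d *\<^sub>R f y) = wnorm p \<delta> f" using wLp_powr_scale(2)[OF p0 fs, of 0 d] d by simp
    have Fs: "strongly_measurable halfline ?F" by (intro strongly_measurable_scaleR wLp_strongly_measurable[OF f0]) simp
    have FL: "?F \<in> wLp p 0" "wnorm p 0 ?F \<le> 2 powr d * wnorm p \<delta> f"
      using wLp_norm_le[OF f0 Fs p0, of "2 powr d"] f0n by auto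
    have "w \<in> wLp p 0 \<and> a * wnorm p 0 w \<le> C * wnorm p 0 ?F"
    proof (rule C(2)[OF a FL(1) wm])
      fix x :: real assume x: "0 < x"
      let ?I = "\<integral>\<^sup>+y. expker a x y * ennreal (norm (?F y)) \<partial>halfline"
      have Fm: "(\<lambda>y. expker a x y * ennreal (norm (?F y))) \<in> borel_measurable halfline"
        using borel_measurable_norm_strongly[OF Fs] by measurable
      have "ennreal (x powr d * norm (g x)) \<le> ennreal (x powr d) * (\<integral>\<^sup>+y. expker a x y * ennreal (norm (f y)) \<partial>halfline)"
        using le[OF x] by (simp add: ennreal_mult mult_left_mono)
      also have "\<dots> = (\<integral>\<^sup>+y. ennreal (x powr d) * (expker a x y * ennreal (norm (f y))) \<partial>halfline)"
        by (rule nn_integral_cmult[symmetric]) measurable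
      also have "\<dots> \<le> (\<integral>\<^sup>+y. expker a x y * ennreal (norm (?F y)) + ennreal K * (expker (a/2) x y * ennreal (norm (f y))) \<partial>halfline)"
      proof (rule nn_integral_mono)
        fix y assume "y \<in> space halfline"
        then have y: "0 < y" by simp
        have "x powr d * exp (- (a * \<bar>x - y\<bar>)) * norm (f y) \<le> (exp (- (a * \<bar>x - y\<bar>)) * (2 powr d * y powr d) + K * exp (- (a/2 * \<bar>x - y\<bar>))) * norm (f y)"
          by (rule mult_right_mono[OF ker[OF x y]]) simp
        then have *: "x powr d * (exp (- (a * \<bar>x - y\<bar>)) * norm (f y)) \<le> exp (- (a * \<bar>x - y\<bar>)) * norm (?F y) + K * (exp (- (a/2 * \<bar>x - y\<bar>)) * norm (f y))"
          by (simp add: algebra_simps)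
        show "ennreal (x powr d) * (expker a x y * ennreal (norm (f y))) \<le> expker a x y * ennreal (norm (?F y)) + ennreal K * (expker (a/2) x y * ennreal (norm (f y)))"
          unfolding expker_def using K
          by (simp only: ennreal_mult[symmetric] exp_ge_zero norm_ge_zero powr_ge_zero mult_nonneg_nonneg less_imp_le)
            (rule ennreal_le_plus[OF *], auto)
      qed
      also have "\<dots> = ?I + ennreal K * G x"
        unfolding G_def using Fm by (subst nn_integral_add, measurable, subst nn_integral_cmult, measurable)
      finally have le1: "ennreal (x powr d * norm (g x)) \<le> ?I + ennreal (K * h x)"
        using K h by (simp add: ennreal_mult)
      show "ennreal (norm (w x)) \<le> ?I"
      proof (cases "?I = \<infinity>")
        case False
        then obtain i where i: "i \<ge> 0" "?I = ennreal i" by (cases ?I) auto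
        have "ennreal (x powr d * norm (g x)) \<le> ennreal (i + K * h x)"
          using le1 unfolding i(2) using i(1) K h(1)[of x] by (simp add: ennreal_plus[symmetric] del: ennreal_plus)
        then have "x powr d * norm (g x) \<le> i + K * h x"
          using i(1) K h(1)[of x] by (subst (asm) ennreal_le_iff) auto
        then have "norm (w x) \<le> i" using i(1) by (auto simp: w_def)
        then show ?thesis unfolding i(2) by (rule ennreal_leI)
      qed simp
    qed
    then have wL: "w \<in> wLp p 0" "a * wnorm p 0 w \<le> C * (2 powr d * wnorm p \<delta> f)"
      using order_trans[OF _ mult_left_mono[OF FL(2), of C]] C(1) by (blast, meson less_imp_le)
    have Khs: "strongly_measurable halfline (\<lambda>x. K * h x)" unfolding strongly_measurable_iff_borel_measurable by measurable
    have KhL: "(\<lambda>x. K * h x) \<in> wLp p 0" "wnorm p 0 (\<lambda>x. K * h x) \<le> K * ((4 / a) powr (1 / p) * J)"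
    proof -
      have Kle: "0 \<le> K" "\<And>x. norm (K * h x) \<le> K * norm (h x)" using K by (auto simp: abs_mult)
      show "(\<lambda>x. K * h x) \<in> wLp p 0" by (rule wLp_norm_le(1)[OF hN(1) Khs p0 Kle])
      show "wnorm p 0 (\<lambda>x. K * h x) \<le> K * ((4 / a) powr (1 / p) * J)"
        by (rule order_trans[OF wLp_norm_le(2)[OF hN(1) Khs p0 Kle] mult_left_mono[OF hN(2) Kle(1)]])
    qed
    have p1: "p \<ge> 1" using p by simp
    note S = wLp_add[OF wL(1) KhL(1) p1]
    have gs: "strongly_measurable halfline (\<lambda>x. x powr d *\<^sub>R g x)" by (intro strongly_measurable_scaleR g) measurable
    have "norm (x powr d *\<^sub>R g x) \<le> 1 * norm (w x + K * h x)" for x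
      using K h(1)[of x] by (auto simp: w_def)
    from wLp_norm_le[OF S(1) gs p0 _ this]
    have gL: "(\<lambda>x. x powr d *\<^sub>R g x) \<in> wLp p 0" "wnorm p 0 (\<lambda>x. x powr d *\<^sub>R g x) \<le> wnorm p 0 (\<lambda>x. w x + K * h x)" by auto
    have gd: "g \<in> wLp p \<delta>" using gL(1) wLp_powr_scale(1)[OF p0 g, of d 0] d by simp
    have "a * wnorm p \<delta> g = a * wnorm p 0 (\<lambda>x. x powr d *\<^sub>R g x)" using wLp_powr_scale(2)[OF p0 g, of 0 d] d by simp
    also have "\<dots> \<le> a * (2 * (wnorm p 0 w + wnorm p 0 (\<lambda>x. K * h x)))"
      using gL(2) S(2) a by (intro mult_left_mono) auto
    also have "\<dots> \<le> 2 * (a * wnorm p 0 w) + 2 * (a * (K * ((4 / a) powr (1 / p) * J)))"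
      using KhL(2) a by (simp add: algebra_simps)
    also have "\<dots> \<le> 2 * (C * (2 powr d * wnorm p \<delta> f)) + 2 * (a * (K * ((4 / a) powr (1 / p) * J)))"
      using wL(2) by simp
    also have "a * (K * ((4 / a) powr (1 / p) * J)) = K0 * 4 powr (1 / p) * (a powr (- (\<delta> + 1 - p) / p) * J)"
    proof -
      have "a powr 1 * a powr (- d) * a powr (- (1 / p)) = a powr (- (\<delta> + 1 - p) / p)"
      proof -
        have "1 + - d + - (1 / p) = - (\<delta> + 1 - p) / p" using p0 unfolding d_def by (simp add: field_simps)
        then show ?thesis by (simp only: powr_add[symmetric])
      qed
      moreover have "(4 / a) powr (1 / p) = 4 powr (1 / p) * a powr (- (1 / p))"
        using a by (simp add: powr_divide powr_minus field_simps)
      ultimately show ?thesis using a by (simp add: K_def mult_ac)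
    qed
    also have "2 * (C * (2 powr d * wnorm p \<delta> f)) + 2 * (K0 * 4 powr (1 / p) * (a powr (- (\<delta> + 1 - p) / p) * J))
      \<le> C' * (wnorm p \<delta> f + a powr (- (\<delta> + 1 - p) / p) * J)"
    proof -
      have "0 \<le> 2 * (C * 2 powr d) * (a powr (- (\<delta> + 1 - p) / p) * J)" "0 \<le> 2 * (K0 * 4 powr (1 / p)) * wnorm p \<delta> f"
        using C(1) J(1) K0 wnorm_nonneg[of p \<delta> f] by (intro mult_nonneg_nonneg; simp)+
      then show ?thesis by (simp add: C'_def algebra_simps)
    qed
    finally show "g \<in> wLp p \<delta> \<and> a * wnorm p \<delta> g \<le> C' * (wnorm p \<delta> f + a powr (- (\<delta> + 1 - p) / p) * J)"
      using gd by blast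
  qed
qed

section \<open>First-order equations\<close>

lemma has_ac_derivD: "has_ac_deriv w r \<Longrightarrow> 0 < x \<Longrightarrow> x \<le> y \<Longrightarrow> w y - w x = ivl_integral x y r"
  unfolding has_ac_deriv_def by blast

lemma eq_add_if_diff_eq: "b - a = c \<Longrightarrow> b = a + (c :: 'a::ab_group_add)"
  and eq_add_if_diff_minus_eq: "- a - - b = c \<Longrightarrow> b = a + (c :: 'a::ab_group_add)"
  by auto

lemma bounded_bilinear_scaleC: "bounded_bilinear (scaleC :: complex \<Rightarrow> 'a \<Rightarrow> 'a::complex_banach)"
proof
  fix a b :: complex and x y :: 'a and r :: real
  show "(a + b) *\<^sub>C x = a *\<^sub>C x + b *\<^sub>C x" by (rule scaleC_add_left)
  show "a *\<^sub>C (x + y) = a *\<^sub>C x + a *\<^sub>C y" by (rule scaleC_add_right)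
  show "(r *\<^sub>R a) *\<^sub>C x = r *\<^sub>R (a *\<^sub>C x)"
    by (simp add: scaleR_conv_of_real scaleC_scaleC[symmetric] scaleC_of_real)
  show "a *\<^sub>C (r *\<^sub>R x) = r *\<^sub>R (a *\<^sub>C x)"
    by (simp add: scaleC_of_real[symmetric] scaleC_scaleC mult.commute)
  show "\<exists>K. \<forall>a (x :: 'a). norm (a *\<^sub>C x) \<le> norm a * norm x * K"
    by (rule exI[of _ 1]) (simp add: norm_scaleC)
qed

interpretation scaleC: bounded_bilinear "scaleC :: complex \<Rightarrow> 'a \<Rightarrow> 'a::complex_banach"
  by (rule bounded_bilinear_scaleC)

lemma scaleC_one: "1 *\<^sub>C (x :: 'a::complex_banach) = x"
  using scaleC_of_real[of 1 x] by simp

definition expc :: "complex \<Rightarrow> real \<Rightarrow> complex" where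
  "expc s t = exp (s * complex_of_real t)"

lemma expc_has_deriv: "(expc s has_vector_derivative s * expc s t) (at t)"
  unfolding expc_def[abs_def]
  by (rule has_vector_derivative_real_field) (auto intro!: derivative_eq_intros)

lemma continuous_on_expc [continuous_intros]: "continuous_on S (expc s)"
  unfolding expc_def[abs_def] by (intro continuous_intros)

lemma norm_expc: "norm (expc s t) = exp (Re s * t)"
  by (simp add: expc_def norm_exp_eq_Re)

lemma expc_inverse: "expc (- s) t * expc s t = 1" "expc s t * expc (- s) t = 1" "expc s 0 = 1"
  by (simp_all add: expc_def exp_add[symmetric])

lemma has_ac_deriv_expc:
  fixes w :: "real \<Rightarrow> 'a::complex_banach"
  assumes "has_ac_deriv w r"
  shows "has_ac_deriv (\<lambda>t. expc s t *\<^sub>C w t) (\<lambda>t. expc s t *\<^sub>C (s *\<^sub>C w t + r t))"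
proof -
  have "has_ac_deriv (\<lambda>t. expc s t *\<^sub>C w t) (\<lambda>t. (s * expc s t) *\<^sub>C w t + expc s t *\<^sub>C r t)"
    by (rule has_ac_deriv_bilinear[OF bounded_bilinear_scaleC expc_has_deriv _ assms]) (intro continuous_intros)
  then show ?thesis
    by (rule has_ac_deriv_cong) (simp_all add: scaleC.add_right scaleC_scaleC mult.commute)
qed

lemma norm_expc_forward:
  fixes v :: "'a::complex_banach"
  assumes "a \<le> Re s" "t \<le> x"
  shows "ennreal (norm (expc (- s) x *\<^sub>C expc s t *\<^sub>C v)) \<le> expker a x t * ennreal (norm v)"
proof -
  have "a * (x - t) \<le> Re s * (x - t)" using assms by (intro mult_right_mono) auto
  then have "exp (- (Re s * x)) * exp (Re s * t) \<le> exp (- (a * \<bar>x - t\<bar>))"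
    using assms(2) by (simp add: exp_add[symmetric] algebra_simps)
  then have "exp (- (Re s * x)) * exp (Re s * t) * norm v \<le> exp (- (a * \<bar>x - t\<bar>)) * norm v" by (rule mult_right_mono) simp
  then show ?thesis by (simp add: norm_scaleC norm_expc expker_def ennreal_mult[symmetric] ennreal_leI mult.assoc)
qed

lemma norm_expc_backward:
  fixes v :: "'a::complex_banach"
  assumes "a \<le> Re s" "x \<le> t"
  shows "ennreal (norm (expc s x *\<^sub>C expc (- s) t *\<^sub>C v)) \<le> expker a x t * ennreal (norm v)"
proof -
  have "a * (t - x) \<le> Re s * (t - x)" using assms by (intro mult_right_mono) auto
  then have "exp (Re s * x) * exp (- (Re s * t)) \<le> exp (- (a * \<bar>x - t\<bar>))"
    using assms(2) by (simp add: exp_add[symmetric] algebra_simps)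
  then have "exp (Re s * x) * exp (- (Re s * t)) * norm v \<le> exp (- (a * \<bar>x - t\<bar>)) * norm v" by (rule mult_right_mono) simp
  then show ?thesis by (simp add: norm_scaleC norm_expc expker_def ennreal_mult[symmetric] ennreal_leI mult.assoc)
qed

lemma norm_expc_forward_indicator:
  fixes v :: "'a::complex_banach"
  assumes "a \<le> Re s" "A \<subseteq> {..x}" "A \<subseteq> B"
  shows "ennreal (norm (expc (- s) x *\<^sub>C expc s t *\<^sub>C v)) * indicator A t \<le> expker a x t * (ennreal (norm v) * indicator B t)"
proof (cases "t \<in> A")
  case True
  then have "t \<le> x" "t \<in> B" using assms(2,3) by auto
  then show ?thesis using True norm_expc_forward[OF assms(1), of t x v] by simp
qed simp

lemma norm_expc_backward_indicator:
  fixes v :: "'a::complex_banach"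
  assumes "a \<le> Re s" "A \<subseteq> {x<..}" "A \<subseteq> B"
  shows "ennreal (norm (expc s x *\<^sub>C expc (- s) t *\<^sub>C v)) * indicator A t \<le> expker a x t * (ennreal (norm v) * indicator B t)"
proof (cases "t \<in> A")
  case True
  then have "x \<le> t" "t \<in> B" using assms(2,3) by auto
  then show ?thesis using True norm_expc_backward[OF assms(1), of x t v] by simp
qed simp

text \<open>Variation of constants on \<open>[x0, x]\<close> for the equation \<open>w' = r - s w\<close>; the contribution of the
  initial value disappears because \<open>w\<close> is small at points \<open>x0\<close> arbitrarily close to \<open>0\<close>.\<close>

lemma first_order_forward_bound:
  fixes w r :: "real \<Rightarrow> 'a::complex_banach"
  assumes w: "has_ac_deriv w (\<lambda>t. r t - s *\<^sub>C w t)" and a: "0 \<le> a" "a \<le> Re s"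
    and near: "\<And>e. e > 0 \<Longrightarrow> \<exists>x0. 0 < x0 \<and> x0 < e \<and> norm (w x0) < e" and x: "0 < x"
  shows "ennreal (norm (w x)) \<le> (\<integral>\<^sup>+y. expker a x y * (ennreal (norm (r y)) * indicator {..x} y) \<partial>halfline)"
    (is "_ \<le> ?I")
proof (rule ennreal_le_epsilon)
  fix e :: real assume e: "0 < e"
  then obtain x0 where x0: "0 < x0" "x0 < min e x" "norm (w x0) < min e x" using near[of "min e x"] x by auto
  have d: "has_ac_deriv (\<lambda>t. expc s t *\<^sub>C w t) (\<lambda>t. expc s t *\<^sub>C r t)"
    using has_ac_deriv_expc[OF w, of s] by simp
  let ?T = "\<lambda>v. expc (- s) x *\<^sub>C v"
  let ?R = "\<lambda>t. ?T (expc s t *\<^sub>C r t)"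
  have i: "ivl_integrable x0 x ?R" "ivl_integral x0 x ?R = ?T (ivl_integral x0 x (\<lambda>t. expc s t *\<^sub>C r t))"
    using ivl_integral_bounded_linear[OF scaleC.bounded_linear_right has_ac_deriv_integrable[OF d x0(1)]] by auto
  have "expc s x *\<^sub>C w x = expc s x0 *\<^sub>C w x0 + ivl_integral x0 x (\<lambda>t. expc s t *\<^sub>C r t)"
    by (rule eq_add_if_diff_eq[OF has_ac_derivD[OF d x0(1)]]) (use x0(2) in simp)
  then have "?T (expc s x *\<^sub>C w x) = ?T (expc s x0 *\<^sub>C w x0) + ivl_integral x0 x ?R"
    by (simp add: scaleC.add_right i(2))
  then have eq: "w x = ?T (expc s x0 *\<^sub>C w x0) + ivl_integral x0 x ?R"
    by (simp add: scaleC_scaleC expc_inverse scaleC_one)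
  have 1: "ennreal (norm (?T (expc s x0 *\<^sub>C w x0))) \<le> ennreal e"
  proof -
    have "ennreal (norm (?T (expc s x0 *\<^sub>C w x0))) \<le> expker a x x0 * ennreal (norm (w x0))"
      by (rule norm_expc_forward) (use a x0 in auto)
    also have "\<dots> \<le> 1 * ennreal e" unfolding expker_def using a x0 by (intro mult_mono ennreal_leI) auto
    finally show ?thesis by simp
  qed
  have "ennreal (norm (ivl_integral x0 x ?R)) \<le> (\<integral>\<^sup>+t. ennreal (norm (?R t)) * indicator {x0<..x} t \<partial>halfline)"
    by (rule ivl_integral_norm_le[OF i(1)])
  also have "\<dots> \<le> ?I"
    by (rule nn_integral_mono, rule norm_expc_forward_indicator[OF a(2)]) auto
  finally have 2: "ennreal (norm (ivl_integral x0 x ?R)) \<le> ?I" .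
  have "ennreal (norm (w x)) \<le> ennreal (norm (?T (expc s x0 *\<^sub>C w x0))) + ennreal (norm (ivl_integral x0 x ?R))"
    unfolding eq by (intro ennreal_le_plus norm_triangle_ineq) auto
  also have "\<dots> \<le> ennreal e + ?I" by (rule add_mono[OF 1 2])
  finally show "ennreal (norm (w x)) \<le> ?I + ennreal e" by (simp add: add.commute)
qed

text \<open>The equation \<open>w' = s w - r\<close> is solved backwards from a point \<open>x1\<close> to the right of \<open>x\<close> at which
  \<open>w\<close> is small.\<close>

lemma first_order_backward_bound:
  fixes w r :: "real \<Rightarrow> 'a::complex_banach"
  assumes w: "has_ac_deriv w (\<lambda>t. s *\<^sub>C w t - r t)" and a: "0 \<le> a" "a \<le> Re s"
    and far: "\<And>e. e > 0 \<Longrightarrow> \<exists>x1>x. norm (w x1) < e" and x: "0 < x"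
  shows "ennreal (norm (w x)) \<le> (\<integral>\<^sup>+y. expker a x y * (ennreal (norm (r y)) * indicator {x<..} y) \<partial>halfline)"
    (is "_ \<le> ?I")
proof (rule ennreal_le_epsilon)
  fix e :: real assume e: "0 < e"
  then obtain x1 where x1: "x < x1" "norm (w x1) < e" using far by blast
  have d: "has_ac_deriv (\<lambda>t. expc (- s) t *\<^sub>C w t) (\<lambda>t. - (expc (- s) t *\<^sub>C r t))"
    using has_ac_deriv_expc[OF w, of "- s"] by (simp add: scaleC.minus_left scaleC.minus_right)
  have d': "has_ac_deriv (\<lambda>t. - (expc (- s) t *\<^sub>C w t)) (\<lambda>t. expc (- s) t *\<^sub>C r t)"
    using has_ac_deriv_bounded_linear[OF bounded_linear_minus[OF bounded_linear_ident] d] by simp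
  let ?T = "\<lambda>v. expc s x *\<^sub>C v"
  let ?R = "\<lambda>t. ?T (expc (- s) t *\<^sub>C r t)"
  have i: "ivl_integrable x x1 ?R" "ivl_integral x x1 ?R = ?T (ivl_integral x x1 (\<lambda>t. expc (- s) t *\<^sub>C r t))"
    using ivl_integral_bounded_linear[OF scaleC.bounded_linear_right has_ac_deriv_integrable[OF d' x]] by auto
  have "expc (- s) x *\<^sub>C w x = expc (- s) x1 *\<^sub>C w x1 + ivl_integral x x1 (\<lambda>t. expc (- s) t *\<^sub>C r t)"
    by (rule eq_add_if_diff_minus_eq[OF has_ac_derivD[OF d' x less_imp_le[OF x1(1)]]])
  then have "?T (expc (- s) x *\<^sub>C w x) = ?T (expc (- s) x1 *\<^sub>C w x1) + ivl_integral x x1 ?R"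
    by (simp add: scaleC.add_right i(2))
  then have eq: "w x = ?T (expc (- s) x1 *\<^sub>C w x1) + ivl_integral x x1 ?R"
    by (simp add: scaleC_scaleC expc_inverse scaleC_one)
  have 1: "ennreal (norm (?T (expc (- s) x1 *\<^sub>C w x1))) \<le> ennreal e"
  proof -
    have "ennreal (norm (?T (expc (- s) x1 *\<^sub>C w x1))) \<le> expker a x x1 * ennreal (norm (w x1))"
      by (rule norm_expc_backward) (use a x1 in auto)
    also have "\<dots> \<le> 1 * ennreal e" unfolding expker_def using a x1 by (intro mult_mono ennreal_leI) auto
    finally show ?thesis by simp
  qed
  have "ennreal (norm (ivl_integral x x1 ?R)) \<le> (\<integral>\<^sup>+t. ennreal (norm (?R t)) * indicator {x<..x1} t \<partial>halfline)"
    by (rule ivl_integral_norm_le[OF i(1)])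
  also have "\<dots> \<le> ?I"
    by (rule nn_integral_mono, rule norm_expc_backward_indicator[OF a(2)]) auto
  finally have 2: "ennreal (norm (ivl_integral x x1 ?R)) \<le> ?I" .
  have "ennreal (norm (w x)) \<le> ennreal (norm (?T (expc (- s) x1 *\<^sub>C w x1))) + ennreal (norm (ivl_integral x x1 ?R))"
    unfolding eq by (intro ennreal_le_plus norm_triangle_ineq) auto
  also have "\<dots> \<le> ennreal e + ?I" by (rule add_mono[OF 1 2])
  finally show "ennreal (norm (w x)) \<le> ?I + ennreal e" by (simp add: add.commute)
qed

section \<open>The Neumann resolvent kernel\<close>

text \<open>The right-hand sides for which the kernel formulas below make sense for all \<open>s\<close> with positive
  real part.\<close>

definition exp_integrable :: "(real \<Rightarrow> 'a::real_normed_vector) \<Rightarrow> bool" where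
  "exp_integrable f \<longleftrightarrow> strongly_measurable halfline f \<and>
     (\<forall>a>0. (\<integral>\<^sup>+y. expker a 0 y * ennreal (norm (f y)) \<partial>halfline) < \<infinity>)"

text \<open>Reflection at \<open>0\<close> gives the kernel \<open>(exp (- s \<bar>x - y\<bar>) + exp (- s (x + y))) / (2 s)\<close> for the
  Neumann problem. Its integral against \<open>f\<close> is \<open>res_u s f x\<close>, split at \<open>y = x\<close> into pieces that
  can be differentiated separately. The function \<open>res_G s f\<close> equals \<open>u' + s u\<close> for
  \<open>u = res_u s f\<close>, and it solves \<open>G' = s G - f\<close>.\<close>

definition res_A :: "complex \<Rightarrow> (real \<Rightarrow> 'a::complex_banach) \<Rightarrow> real \<Rightarrow> 'a" where
  "res_A s f x = ivl_integral 0 x (\<lambda>t. expc s t *\<^sub>C f t)"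

definition res_B :: "complex \<Rightarrow> (real \<Rightarrow> 'a::complex_banach) \<Rightarrow> real \<Rightarrow> 'a" where
  "res_B s f x = strong_integral halfline (\<lambda>t. indicator {x<..} t *\<^sub>R (expc (- s) t *\<^sub>C f t))"

definition res_G :: "complex \<Rightarrow> (real \<Rightarrow> 'a::complex_banach) \<Rightarrow> real \<Rightarrow> 'a" where
  "res_G s f x = expc s x *\<^sub>C res_B s f x"

definition res_u :: "complex \<Rightarrow> (real \<Rightarrow> 'a::complex_banach) \<Rightarrow> real \<Rightarrow> 'a" where
  "res_u s f x = (1 / (2 * s)) *\<^sub>C (expc (- s) x *\<^sub>C (res_A s f x + res_B s f 0) + res_G s f x)"

context
  fixes s :: complex and f :: "real \<Rightarrow> 'a::complex_banach"
  assumes s: "Re s > 0" and f: "exp_integrable f"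
begin

lemma res_measurable: "strongly_measurable halfline (\<lambda>t. expc z t *\<^sub>C f t)"
  by (rule strongly_measurable_bilinear[OF bounded_bilinear_scaleC continuous_imp_strongly_measurable[OF continuous_on_expc]])
    (use f in \<open>simp add: exp_integrable_def\<close>)

lemma res_integrable_minus: "strong_integrable halfline (\<lambda>t. expc (- s) t *\<^sub>C f t)"
proof -
  have "(\<integral>\<^sup>+t. ennreal (norm (expc (- s) t *\<^sub>C f t)) \<partial>halfline) = (\<integral>\<^sup>+y. expker (Re s) 0 y * ennreal (norm (f y)) \<partial>halfline)"
    by (intro nn_integral_cong) (auto simp: norm_scaleC norm_expc expker_def ennreal_mult[symmetric])
  also have "\<dots> < \<infinity>" using f s by (simp add: exp_integrable_def)
  finally show ?thesis using res_measurable[of "- s"] by (simp add: strong_integrable_def)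
qed

lemma res_ivl_integrable_minus: "ivl_integrable x y (\<lambda>t. expc (- s) t *\<^sub>C f t)"
  by (rule strong_integrable_indicator[OF res_integrable_minus]) simp

lemma res_ivl_integrable_plus: "ivl_integrable 0 b (\<lambda>t. expc s t *\<^sub>C f t)"
proof (rule strong_integrable_bound)
  show "strongly_measurable halfline (\<lambda>t. indicator {0<..b} t *\<^sub>R (expc s t *\<^sub>C f t))"
    by (intro strongly_measurable_scaleR borel_measurable_halfline_indicator res_measurable) simp
  show "ivl_integrable 0 b (\<lambda>t. expc (- s) t *\<^sub>C f t)" by (rule res_ivl_integrable_minus)
  fix t assume "t \<in> space halfline"
  show "norm (indicator {0<..b} t *\<^sub>R (expc s t *\<^sub>C f t)) \<le> exp (2 * Re s * b) * norm (indicator {0<..b} t *\<^sub>R (expc (- s) t *\<^sub>C f t))"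
  proof (cases "t \<in> {0<..b}")
    case True
    have "Re s * t \<le> Re s * b" using True s by (intro mult_left_mono) auto
    then have "Re s * t \<le> 2 * Re s * b + - (Re s * t)" by (simp add: mult.commute)
    then have "exp (Re s * t) \<le> exp (2 * Re s * b) * exp (- (Re s * t))"
      by (simp only: exp_add[symmetric] exp_le_cancel_iff)
    then have "exp (Re s * t) * norm (f t) \<le> (exp (2 * Re s * b) * exp (- (Re s * t))) * norm (f t)" by (rule mult_right_mono) simp
    then show ?thesis using True by (simp add: norm_scaleC norm_expc mult.assoc)
  qed simp
qed simp

lemma res_A_ac: "has_ac_deriv (res_A s f) (\<lambda>t. expc s t *\<^sub>C f t)"
  unfolding has_ac_deriv_def locally_integrable_iff
proof (intro conjI allI impI)
  show "ivl_integrable x y (\<lambda>t. expc s t *\<^sub>C f t)" if "0 < x" for x y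
    by (rule ivl_integrable_subset[OF res_ivl_integrable_plus]) (use that in auto)
  show "res_A s f y - res_A s f x = ivl_integral x y (\<lambda>t. expc s t *\<^sub>C f t)" if "0 < x" "x \<le> y" for x y
    using ivl_integral_split[OF res_ivl_integrable_plus, of x y] that by (simp add: res_A_def)
qed (rule res_measurable)

lemma res_B_diff:
  assumes "x \<le> y" shows "res_B s f x = ivl_integral x y (\<lambda>t. expc (- s) t *\<^sub>C f t) + res_B s f y"
proof -
  have i: "strong_integrable halfline (\<lambda>t. indicator {y<..} t *\<^sub>R (expc (- s) t *\<^sub>C f t))"
    by (rule strong_integrable_indicator[OF res_integrable_minus]) simp
  have "(\<lambda>t. indicator {x<..y} t *\<^sub>R (expc (- s) t *\<^sub>C f t) + indicator {y<..} t *\<^sub>R (expc (- s) t *\<^sub>C f t))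
    = (\<lambda>t. indicator {x<..} t *\<^sub>R (expc (- s) t *\<^sub>C f t))"
    using assms by (auto simp: fun_eq_iff split: split_indicator)
  then show ?thesis
    using strong_integral_add[OF res_ivl_integrable_minus[of x y] i] by (simp add: res_B_def)
qed

lemma res_B_ac: "has_ac_deriv (res_B s f) (\<lambda>t. - (expc (- s) t *\<^sub>C f t))"
proof -
  have "has_ac_deriv (\<lambda>x. - res_B s f x) (\<lambda>t. expc (- s) t *\<^sub>C f t)"
    unfolding has_ac_deriv_def locally_integrable_iff
  proof (intro conjI allI impI)
    show "ivl_integrable x y (\<lambda>t. expc (- s) t *\<^sub>C f t)" for x y by (rule res_ivl_integrable_minus)
    show "- res_B s f y - - res_B s f x = ivl_integral x y (\<lambda>t. expc (- s) t *\<^sub>C f t)" if "0 < x" "x \<le> y" for x y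
      using res_B_diff[OF that(2)] by simp
  qed (rule res_measurable)
  from has_ac_deriv_bounded_linear[OF bounded_linear_minus[OF bounded_linear_ident] this] show ?thesis by simp
qed

lemma res_G_ac: "has_ac_deriv (res_G s f) (\<lambda>t. s *\<^sub>C res_G s f t - f t)"
  using has_ac_deriv_expc[OF res_B_ac, of s] unfolding res_G_def[abs_def]
  by (rule has_ac_deriv_cong)
    (simp_all add: scaleC.add_right scaleC.diff_right scaleC_scaleC expc_inverse scaleC_one mult.commute)

lemma res_u_ac: "has_ac_deriv (res_u s f) (\<lambda>t. res_G s f t - s *\<^sub>C res_u s f t)"
proof -
  have s0: "s \<noteq> 0" using s by auto
  let ?P = "\<lambda>t. expc (- s) t *\<^sub>C (res_A s f t + res_B s f 0)"
  have "has_ac_deriv (\<lambda>t. res_A s f t + res_B s f 0) (\<lambda>t. expc s t *\<^sub>C f t)"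
    using has_ac_deriv_add[OF res_A_ac has_ac_deriv_const] by simp
  from has_ac_deriv_expc[OF this, of "- s"]
  have "has_ac_deriv ?P (\<lambda>t. f t - s *\<^sub>C ?P t)"
    by (rule has_ac_deriv_cong)
      (simp_all add: scaleC.add_right scaleC.diff_right scaleC.minus_left scaleC.minus_right scaleC_scaleC expc_inverse scaleC_one mult.commute)
  from has_ac_deriv_bounded_linear[OF scaleC.bounded_linear_right has_ac_deriv_add[OF this res_G_ac], of "1 / (2 * s)"]
  have "has_ac_deriv (res_u s f) (\<lambda>t. (1 / (2 * s)) *\<^sub>C (f t - s *\<^sub>C ?P t + (s *\<^sub>C res_G s f t - f t)))"
    by (rule has_ac_deriv_cong) (simp_all add: res_u_def)
  then show ?thesis
  proof (rule has_ac_deriv_cong)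
    fix t :: real
    have "(1 / (2 * s)) *\<^sub>C (f t - s *\<^sub>C ?P t + (s *\<^sub>C res_G s f t - f t)) = (1 / (2 * s)) *\<^sub>C (s *\<^sub>C res_G s f t - s *\<^sub>C ?P t)"
      by (simp add: algebra_simps)
    also have "\<dots> = (1 / 2) *\<^sub>C res_G s f t - (1 / 2) *\<^sub>C ?P t"
      using s0 by (simp add: scaleC.diff_right scaleC_scaleC)
    also have "\<dots> = res_G s f t - ((1 / 2) *\<^sub>C ?P t + (1 / 2) *\<^sub>C res_G s f t)"
    proof -
      have "(1 / 2) *\<^sub>C res_G s f t + (1 / 2) *\<^sub>C res_G s f t = res_G s f t"
        by (simp add: scaleC.add_left[symmetric] scaleC_one)
      then show ?thesis by (simp add: algebra_simps)
    qed
    also have "(1 / 2) *\<^sub>C ?P t + (1 / 2) *\<^sub>C res_G s f t = s *\<^sub>C res_u s f t"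
      using s0 by (simp add: res_u_def scaleC.add_right scaleC_scaleC)
    finally show "(1 / (2 * s)) *\<^sub>C (f t - s *\<^sub>C ?P t + (s *\<^sub>C res_G s f t - f t)) = res_G s f t - s *\<^sub>C res_u s f t" .
  qed simp
qed

lemma res_G_bound:
  assumes a: "a \<le> Re s"
  shows "ennreal (norm (res_G s f x)) \<le> (\<integral>\<^sup>+y. expker a x y * (ennreal (norm (f y)) * indicator {x<..} y) \<partial>halfline)"
proof -
  let ?h = "\<lambda>t. indicator {x<..} t *\<^sub>R (expc (- s) t *\<^sub>C f t)"
  have i: "strong_integrable halfline ?h" by (rule strong_integrable_indicator[OF res_integrable_minus]) simp
  have "res_G s f x = strong_integral halfline (\<lambda>t. expc s x *\<^sub>C ?h t)"
    unfolding res_G_def res_B_def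
    using strong_integral_bounded_linear[OF scaleC.bounded_linear_right i, of "expc s x"] by simp
  also have "ennreal (norm \<dots>) \<le> (\<integral>\<^sup>+t. ennreal (norm (expc s x *\<^sub>C ?h t)) \<partial>halfline)"
    by (rule strong_integral_norm_le[OF strong_integrable_bounded_linear[OF scaleC.bounded_linear_right i]])
  also have "\<dots> \<le> (\<integral>\<^sup>+y. expker a x y * (ennreal (norm (f y)) * indicator {x<..} y) \<partial>halfline)"
  proof (rule nn_integral_mono)
    fix t :: real
    have "ennreal (norm (expc s x *\<^sub>C ?h t)) = ennreal (norm (expc s x *\<^sub>C expc (- s) t *\<^sub>C f t)) * indicator {x<..} t"
      by (auto simp: scaleC.zero_right split: split_indicator)
    also have "\<dots> \<le> expker a x t * (ennreal (norm (f t)) * indicator {x<..} t)"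
      by (rule norm_expc_backward_indicator[OF a]) auto
    finally show "ennreal (norm (expc s x *\<^sub>C ?h t)) \<le> expker a x t * (ennreal (norm (f t)) * indicator {x<..} t)" .
  qed
  finally show ?thesis .
qed

text \<open>The reflected part of the kernel is dominated by the direct one since \<open>\<bar>x - y\<bar> \<le> x + y\<close>. So
  there are two copies of \<open>expker a x y\<close>, which cancel the factor \<open>1 / 2\<close>.\<close>

lemma res_u_bound:
  assumes a: "0 \<le> a" "a \<le> Re s" and x: "0 < x"
  shows "ennreal (norm (res_u s f x)) \<le> ennreal (1 / norm s) * (\<integral>\<^sup>+y. expker a x y * ennreal (norm (f y)) \<partial>halfline)"
    (is "_ \<le> _ * ?K")
proof -
  have fm[measurable]: "(\<lambda>y. norm (f y)) \<in> borel_measurable halfline"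
    using f by (intro borel_measurable_norm_strongly) (simp add: exp_integrable_def)
  let ?K1 = "\<integral>\<^sup>+y. expker a x y * (ennreal (norm (f y)) * indicator {0<..x} y) \<partial>halfline"
  let ?K2 = "\<integral>\<^sup>+y. expker a x y * (ennreal (norm (f y)) * indicator {x<..} y) \<partial>halfline"
  have km[measurable]: "(\<lambda>y. expker a x y * (ennreal (norm (f y)) * indicator \<Omega> y)) \<in> borel_measurable halfline"
    if "\<Omega> \<in> sets borel" for \<Omega>
    by (rule borel_measurable_times_ennreal[OF measurable_expker(2) borel_measurable_times_ennreal[OF _ borel_measurable_indicator_ennreal_halfline[OF that]]])
      measurable
  have K12: "?K1 + ?K2 = ?K"
  proof -
    have "?K1 + ?K2 = (\<integral>\<^sup>+y. expker a x y * (ennreal (norm (f y)) * indicator {0<..x} y) + expker a x y * (ennreal (norm (f y)) * indicator {x<..} y) \<partial>halfline)"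
      by (rule nn_integral_add[symmetric]) (auto intro: km)
    also have "\<dots> = ?K" using x by (intro nn_integral_cong) (auto split: split_indicator)
    finally show ?thesis .
  qed
  have A: "ennreal (norm (expc (- s) x *\<^sub>C res_A s f x)) \<le> ?K1"
  proof -
    note i = ivl_integral_bounded_linear[OF scaleC.bounded_linear_right[of "expc (- s) x"] res_ivl_integrable_plus[of x]]
    have "expc (- s) x *\<^sub>C res_A s f x = ivl_integral 0 x (\<lambda>t. expc (- s) x *\<^sub>C expc s t *\<^sub>C f t)"
      unfolding res_A_def by (rule i(2)[symmetric])
    also have "ennreal (norm \<dots>) \<le> (\<integral>\<^sup>+t. ennreal (norm (expc (- s) x *\<^sub>C expc s t *\<^sub>C f t)) * indicator {0<..x} t \<partial>halfline)"
      by (rule ivl_integral_norm_le[OF i(1)])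
    also have "\<dots> \<le> ?K1"
      by (rule nn_integral_mono, rule norm_expc_forward_indicator[OF a(2)]) auto
    finally show ?thesis .
  qed
  have B: "ennreal (norm (expc (- s) x *\<^sub>C res_B s f 0)) \<le> ?K"
  proof -
    let ?h = "\<lambda>t. indicator {0<..} t *\<^sub>R (expc (- s) t *\<^sub>C f t)"
    have i: "strong_integrable halfline ?h" by (rule strong_integrable_indicator[OF res_integrable_minus]) simp
    have "expc (- s) x *\<^sub>C res_B s f 0 = strong_integral halfline (\<lambda>t. expc (- s) x *\<^sub>C ?h t)"
      unfolding res_B_def using strong_integral_bounded_linear[OF scaleC.bounded_linear_right i, of "expc (- s) x"] by simp
    also have "ennreal (norm \<dots>) \<le> (\<integral>\<^sup>+t. ennreal (norm (expc (- s) x *\<^sub>C ?h t)) \<partial>halfline)"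
      by (rule strong_integral_norm_le[OF strong_integrable_bounded_linear[OF scaleC.bounded_linear_right i]])
    also have "\<dots> \<le> ?K"
    proof (rule nn_integral_mono)
      fix t assume "t \<in> space halfline"
      then have t: "0 < t" by simp
      have "a * \<bar>x - t\<bar> \<le> Re s * (x + t)" using a t x by (intro mult_mono) auto
      then have "exp (- (Re s * x)) * exp (- (Re s * t)) \<le> exp (- (a * \<bar>x - t\<bar>))"
        by (simp add: exp_add[symmetric] algebra_simps)
      then have "exp (- (Re s * x)) * exp (- (Re s * t)) * norm (f t) \<le> exp (- (a * \<bar>x - t\<bar>)) * norm (f t)" by (rule mult_right_mono) simp
      then show "ennreal (norm (expc (- s) x *\<^sub>C ?h t)) \<le> expker a x t * ennreal (norm (f t))"
        using t by (simp add: norm_scaleC norm_expc expker_def ennreal_mult[symmetric] ennreal_leI mult.assoc)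
    qed
    finally show ?thesis .
  qed
  have G: "ennreal (norm (res_G s f x)) \<le> ?K2" by (rule res_G_bound[OF a(2)])
  let ?a = "norm (expc (- s) x *\<^sub>C res_A s f x)" and ?b = "norm (expc (- s) x *\<^sub>C res_B s f 0)" and ?g = "norm (res_G s f x)"
  have "norm (res_u s f x) \<le> 1 / (2 * norm s) * ((?a + ?b) + ?g)"
  proof -
    have "norm (res_u s f x) = 1 / (2 * norm s) * norm (expc (- s) x *\<^sub>C res_A s f x + expc (- s) x *\<^sub>C res_B s f 0 + res_G s f x)"
      unfolding res_u_def scaleC.add_right[of "expc (- s) x"]
      by (simp only: norm_scaleC[of "1 / (2 * s)"] norm_divide norm_mult norm_one norm_numeral)
    also have "\<dots> \<le> 1 / (2 * norm s) * ((?a + ?b) + ?g)"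
      by (intro mult_left_mono norm_triangle_le add_mono norm_triangle_ineq) auto
    finally show ?thesis .
  qed
  then have "ennreal (norm (res_u s f x)) \<le> ennreal (1 / (2 * norm s)) * (ennreal ?a + ennreal ?b + ennreal ?g)"
    by (simp add: ennreal_plus[symmetric] ennreal_mult[symmetric] ennreal_leI del: ennreal_plus)
  also have "\<dots> \<le> ennreal (1 / (2 * norm s)) * (?K1 + ?K + ?K2)" by (intro mult_left_mono add_mono A B G) auto
  also have "?K1 + ?K + ?K2 = ennreal 2 * ?K"
  proof -
    have "?K1 + ?K + ?K2 = (?K1 + ?K2) + ?K" by (simp add: ac_simps)
    then show ?thesis by (simp only: K12) (simp add: mult_2)
  qed
  also have "ennreal (1 / (2 * norm s)) * (ennreal 2 * ?K) = ennreal (1 / norm s) * ?K"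
  proof -
    have "ennreal (1 / (2 * norm s)) * ennreal 2 = ennreal (1 / norm s)"
      by (subst ennreal_mult[symmetric]) auto
    then show ?thesis by (simp only: mult.assoc[symmetric])
  qed
  finally show ?thesis .
qed

text \<open>Both \<open>G\<close> and \<open>s u\<close> take the value \<open>res_B s f 0\<close> at \<open>0\<close>, which is the Neumann condition.\<close>

lemma res_u_deriv_continuous:
  "continuous_on {0..} (\<lambda>x. res_G s f x - s *\<^sub>C res_u s f x)" "res_G s f 0 - s *\<^sub>C res_u s f 0 = 0"
proof -
  have s0: "s \<noteq> 0" using s by auto
  have local: "continuous_on {0..} w" if loc: "\<And>b. continuous_on {0..b} w" for w :: "real \<Rightarrow> 'a"
  proof (rule continuous_on_sequentiallyI)
    fix u :: "nat \<Rightarrow> real" and a assume u: "\<forall>n. u n \<in> {0..}" and a: "a \<in> {0..}" and lim: "u \<longlonglongrightarrow> a"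
    have "eventually (\<lambda>n. u n < a + 1) sequentially" using order_tendstoD(2)[OF lim, of "a + 1"] by simp
    then have "eventually (\<lambda>n. u n \<in> {0..a + 1}) sequentially" by eventually_elim (use u in auto)
    with continuous_on_tendsto_compose[OF loc[of "a + 1"] lim] a show "(\<lambda>n. w (u n)) \<longlonglongrightarrow> w a" by simp
  qed
  have A: "continuous_on {0..} (res_A s f)"
  proof (rule local, rule continuous_on_if_increment_bound)
    fix b :: real
    let ?h = "\<lambda>t. ennreal (norm (indicator {0<..b} t *\<^sub>R (expc s t *\<^sub>C f t)))"
    show "?h \<in> borel_measurable halfline" "(\<integral>\<^sup>+t. ?h t \<partial>halfline) < \<infinity>"
      using res_ivl_integrable_plus[of b] borel_measurable_norm_strongly[of halfline "\<lambda>t. indicator {0<..b} t *\<^sub>R (expc s t *\<^sub>C f t)"]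
      by (auto simp: strong_integrable_def)
    fix x y assume xy: "x \<in> {0..b}" "y \<in> {0..b}" "x \<le> y"
    have i: "ivl_integrable x y (\<lambda>t. expc s t *\<^sub>C f t)"
      by (rule ivl_integrable_subset[OF res_ivl_integrable_plus]) (use xy in auto)
    have "res_A s f y - res_A s f x = ivl_integral x y (\<lambda>t. expc s t *\<^sub>C f t)"
      using ivl_integral_split[OF res_ivl_integrable_plus, of x y] xy by (simp add: res_A_def)
    also have "ennreal (norm \<dots>) \<le> (\<integral>\<^sup>+t. ennreal (norm (expc s t *\<^sub>C f t)) * indicator {x<..y} t \<partial>halfline)"
      by (rule ivl_integral_norm_le[OF i])
    also have "\<dots> \<le> (\<integral>\<^sup>+t. ?h t * indicator {x<..y} t \<partial>halfline)"
      using xy by (intro nn_integral_mono) (auto split: split_indicator)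
    finally show "ennreal (norm (res_A s f y - res_A s f x)) \<le> (\<integral>\<^sup>+t. ?h t * indicator {x<..y} t \<partial>halfline)" .
  qed
  have B: "continuous_on {0..} (res_B s f)"
  proof (rule continuous_on_if_increment_bound)
    let ?h = "\<lambda>t. ennreal (norm (expc (- s) t *\<^sub>C f t))"
    show "?h \<in> borel_measurable halfline" "(\<integral>\<^sup>+t. ?h t \<partial>halfline) < \<infinity>"
      using res_integrable_minus borel_measurable_norm_strongly[of halfline "\<lambda>t. expc (- s) t *\<^sub>C f t"]
      by (auto simp: strong_integrable_def)
    fix x y :: real assume xy: "x \<le> y"
    have "norm (res_B s f y - res_B s f x) = norm (ivl_integral x y (\<lambda>t. expc (- s) t *\<^sub>C f t))"
      using res_B_diff[OF xy] by simp
    also have "ennreal \<dots> \<le> (\<integral>\<^sup>+t. ?h t * indicator {x<..y} t \<partial>halfline)"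
      by (rule ivl_integral_norm_le[OF res_ivl_integrable_minus])
    finally show "ennreal (norm (res_B s f y - res_B s f x)) \<le> (\<integral>\<^sup>+t. ?h t * indicator {x<..y} t \<partial>halfline)" .
  qed
  show "continuous_on {0..} (\<lambda>x. res_G s f x - s *\<^sub>C res_u s f x)"
    unfolding res_u_def res_G_def
    by (intro continuous_on_diff scaleC.continuous_on continuous_on_add continuous_on_const continuous_on_expc A B)
  have "s *\<^sub>C res_u s f 0 = (1 / 2) *\<^sub>C (res_B s f 0 + res_B s f 0)"
    using s0 by (simp add: res_u_def res_G_def res_A_def expc_inverse scaleC_one scaleC_scaleC)
  also have "\<dots> = res_B s f 0"
    by (simp add: scaleC.add_right scaleC.add_left[symmetric] scaleC_one)
  finally show "res_G s f 0 - s *\<^sub>C res_u s f 0 = 0" by (simp add: res_G_def expc_inverse scaleC_one)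
qed

end

section \<open>The derivatives of the solution\<close>

lemma has_ac_deriv_strongly_measurable: "has_ac_deriv w r \<Longrightarrow> strongly_measurable halfline w"
  by (rule continuous_imp_strongly_measurable[OF has_ac_deriv_continuous])

lemma strongly_measurable_scaleC:
  "strongly_measurable halfline (v :: real \<Rightarrow> 'a::complex_banach) \<Longrightarrow> strongly_measurable halfline (\<lambda>x. z *\<^sub>C v x)"
  by (rule strongly_measurable_bilinear[OF bounded_bilinear_scaleC strongly_measurable_const])

lemma wLp_scaleC:
  fixes v :: "real \<Rightarrow> 'a::complex_banach"
  assumes "v \<in> wLp p \<gamma>" "p > 0"
  shows "(\<lambda>x. z *\<^sub>C v x) \<in> wLp p \<gamma>" "wnorm p \<gamma> (\<lambda>x. z *\<^sub>C v x) \<le> norm z * wnorm p \<gamma> v"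
  using wLp_norm_le[OF assms(1) strongly_measurable_scaleC[OF wLp_strongly_measurable[OF assms(1)]] assms(2), of "norm z" z]
  by (simp_all add: norm_scaleC)

lemma wLp_diff:
  assumes f: "f \<in> wLp p \<gamma>" and g: "g \<in> wLp p \<gamma>" and p: "p \<ge> 1"
  shows "(\<lambda>x. f x - g x) \<in> wLp p \<gamma>" "wnorm p \<gamma> (\<lambda>x. f x - g x) \<le> 2 * (wnorm p \<gamma> f + wnorm p \<gamma> g)"
proof -
  have p0: "p > 0" using p by simp
  have s: "strongly_measurable halfline (\<lambda>x. - g x)"
    using strongly_measurable_diff[OF strongly_measurable_const wLp_strongly_measurable[OF g], of 0] by simp
  have m: "(\<lambda>x. - g x) \<in> wLp p \<gamma>" "wnorm p \<gamma> (\<lambda>x. - g x) \<le> wnorm p \<gamma> g"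
    using wLp_norm_le[OF g s p0, of 1] by auto
  show "(\<lambda>x. f x - g x) \<in> wLp p \<gamma>" using wLp_add(1)[OF f m(1) p] by simp
  show "wnorm p \<gamma> (\<lambda>x. f x - g x) \<le> 2 * (wnorm p \<gamma> f + wnorm p \<gamma> g)"
    using wLp_add(2)[OF f m(1) p] m(2) by simp
qed

text \<open>If \<open>\<phi> i\<close> is the \<open>i\<close>-th derivative of \<open>f\<close>, then \<open>res_Gs s \<phi> i\<close> and \<open>res_us s \<phi> i\<close> are the
  \<open>i\<close>-th derivatives of \<open>res_G s f\<close> and \<open>res_u s f\<close>: the recursions are the differentiated
  first-order equations.\<close>

primrec res_Gs :: "complex \<Rightarrow> (nat \<Rightarrow> real \<Rightarrow> 'a::complex_banach) \<Rightarrow> nat \<Rightarrow> real \<Rightarrow> 'a" where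
  "res_Gs s \<phi> 0 = res_G s (\<phi> 0)"
| "res_Gs s \<phi> (Suc i) = (\<lambda>x. s *\<^sub>C res_Gs s \<phi> i x - \<phi> i x)"

primrec res_us :: "complex \<Rightarrow> (nat \<Rightarrow> real \<Rightarrow> 'a::complex_banach) \<Rightarrow> nat \<Rightarrow> real \<Rightarrow> 'a" where
  "res_us s \<phi> 0 = res_u s (\<phi> 0)"
| "res_us s \<phi> (Suc i) = (\<lambda>x. res_Gs s \<phi> i x - s *\<^sub>C res_us s \<phi> i x)"

lemma res_us_Suc_Suc: "res_us s \<phi> (Suc (Suc i)) x = (s * s) *\<^sub>C res_us s \<phi> i x - \<phi> i x"
  by (simp add: scaleC.diff_right scaleC_scaleC algebra_simps)

text \<open>The chain \<open>\<phi> 0, \<dots>, \<phi> m\<close> stands for the right-hand side and its derivatives, and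
  \<open>c * norm s \<le> Re s\<close> describes the square roots of the elements of a sector.\<close>

definition res_data :: "real \<Rightarrow> real \<Rightarrow> nat \<Rightarrow> real \<Rightarrow> complex \<Rightarrow> (nat \<Rightarrow> real \<Rightarrow> 'a::complex_banach) \<Rightarrow> bool" where
  "res_data p \<delta> m c s \<phi> \<longleftrightarrow> s \<noteq> 0 \<and> c * norm s \<le> Re s \<and> (\<forall>i\<le>m. \<phi> i \<in> wLp p \<delta>) \<and>
     (\<forall>i<m. has_ac_deriv (\<phi> i) (\<phi> (Suc i))) \<and> exp_integrable (\<phi> 0)"

definition data_norm :: "real \<Rightarrow> real \<Rightarrow> nat \<Rightarrow> (nat \<Rightarrow> real \<Rightarrow> 'a::real_normed_vector) \<Rightarrow> real" where
  "data_norm p \<delta> m \<phi> = (\<Sum>q\<le>m. wnorm p \<delta> (\<phi> q))"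

lemma data_norm_nonneg: "0 \<le> data_norm p \<delta> m \<phi>"
  unfolding data_norm_def by (intro sum_nonneg wnorm_nonneg)

lemma wnorm_le_data_norm: "i \<le> m \<Longrightarrow> wnorm p \<delta> (\<phi> i) \<le> data_norm p \<delta> m \<phi>"
  unfolding data_norm_def by (rule member_le_sum) (auto intro: wnorm_nonneg)

lemma res_data_Re: "res_data p \<delta> m c s \<phi> \<Longrightarrow> c > 0 \<Longrightarrow> Re s > 0"
proof -
  assume a: "res_data p \<delta> m c s \<phi>" "c > 0"
  then have "0 < c * norm s" "c * norm s \<le> Re s" by (auto simp: res_data_def)
  then show ?thesis by linarith
qed

lemma res_Gs_ac:
  assumes r: "res_data p \<delta> m c s \<phi>" "c > 0" and "i \<le> m"
  shows "has_ac_deriv (res_Gs s \<phi> i) (res_Gs s \<phi> (Suc i))"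
  using assms(3)
proof (induction i)
  case 0
  then show ?case using res_G_ac[OF res_data_Re[OF r], of "\<phi> 0"] r by (simp add: res_data_def)
next
  case (Suc i)
  then have ih: "has_ac_deriv (res_Gs s \<phi> i) (res_Gs s \<phi> (Suc i))" by simp
  have f: "has_ac_deriv (\<phi> i) (\<phi> (Suc i))" using r Suc.prems by (simp add: res_data_def)
  from has_ac_deriv_diff[OF has_ac_deriv_bounded_linear[OF scaleC.bounded_linear_right[of s] ih] f]
  show ?case by simp
qed

lemma res_us_ac:
  assumes r: "res_data p \<delta> m c s \<phi>" "c > 0" and "i \<le> Suc m"
  shows "has_ac_deriv (res_us s \<phi> i) (res_us s \<phi> (Suc i))"
  using assms(3)
proof (induction i)
  case 0
  then show ?case using res_u_ac[OF res_data_Re[OF r], of "\<phi> 0"] r by (simp add: res_data_def)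
next
  case (Suc i)
  then have ih: "has_ac_deriv (res_us s \<phi> i) (res_us s \<phi> (Suc i))" by simp
  have f: "has_ac_deriv (res_Gs s \<phi> i) (res_Gs s \<phi> (Suc i))" using res_Gs_ac[OF r] Suc.prems by simp
  from has_ac_deriv_diff[OF f has_ac_deriv_bounded_linear[OF scaleC.bounded_linear_right[of s] ih]]
  show ?case by simp
qed

text \<open>The \<open>i\<close>-th derivative of \<open>G\<close> lies in the weighted space, so it is small at some points near
  infinity, and it solves the backward equation with right-hand side \<open>\<phi> i\<close>. In contrast to \<open>u\<close>
  there is no boundary term at \<open>0\<close>.\<close>

lemma res_Gs_pointwise:
  fixes \<phi> :: "nat \<Rightarrow> real \<Rightarrow> 'a::complex_banach"
  assumes p: "p > 1" and \<delta>: "-1 < \<delta>" and r: "res_data p \<delta> m c s \<phi>" "c > 0" and i: "i \<le> m" and x: "0 < x"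
  shows "ennreal (norm (res_Gs s \<phi> i x)) \<le> (\<integral>\<^sup>+y. expker (c * norm s) x y * (ennreal (norm (\<phi> i y)) * indicator {x<..} y) \<partial>halfline)"
proof -
  have s: "c * norm s > 0" "c * norm s \<le> Re s" and \<phi>: "\<And>i. i \<le> m \<Longrightarrow> \<phi> i \<in> wLp p \<delta>"
    using r by (auto simp: res_data_def)
  obtain C where C: "C > 0" "\<And>a (f :: real \<Rightarrow> 'a) (g :: real \<Rightarrow> 'a).
    \<lbrakk>a > 0; f \<in> wLp p \<delta>; strongly_measurable halfline g;
      \<And>x. 0 < x \<Longrightarrow> ennreal (norm (g x)) \<le> (\<integral>\<^sup>+y. expker a x y * (ennreal (norm (f y)) * indicator {x<..} y) \<partial>halfline)\<rbrakk>
    \<Longrightarrow> g \<in> wLp p \<delta> \<and> a * wnorm p \<delta> g \<le> C * wnorm p \<delta> f"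
    using expker_forward_bound[where 'b='a and 'c='a, OF p \<delta>] by blast
  have p1: "p \<ge> 1" and p0: "p > 0" using p by auto
  have "res_Gs s \<phi> i \<in> wLp p \<delta> \<and> (\<forall>x>0. ennreal (norm (res_Gs s \<phi> i x)) \<le>
      (\<integral>\<^sup>+y. expker (c * norm s) x y * (ennreal (norm (\<phi> i y)) * indicator {x<..} y) \<partial>halfline))"
    using i
  proof (induction i)
    case 0
    have b: "ennreal (norm (res_Gs s \<phi> 0 x)) \<le> (\<integral>\<^sup>+y. expker (c * norm s) x y * (ennreal (norm (\<phi> 0 y)) * indicator {x<..} y) \<partial>halfline)" for x
      using res_G_bound[OF res_data_Re[OF r] _ s(2), of "\<phi> 0" x] r by (simp add: res_data_def)
    have "res_Gs s \<phi> 0 \<in> wLp p \<delta>"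
      using C(2)[OF s(1) \<phi> has_ac_deriv_strongly_measurable[OF res_Gs_ac[OF r]], of 0 0] b by blast
    then show ?case using b by blast
  next
    case (Suc i)
    then have ih: "res_Gs s \<phi> i \<in> wLp p \<delta>" by simp
    have L: "res_Gs s \<phi> (Suc i) \<in> wLp p \<delta>"
      using wLp_diff(1)[OF wLp_scaleC(1)[OF ih p0, of s] \<phi>[of i] p1] Suc.prems by simp
    have ac: "has_ac_deriv (res_Gs s \<phi> (Suc i)) (\<lambda>t. s *\<^sub>C res_Gs s \<phi> (Suc i) t - \<phi> (Suc i) t)"
      using res_Gs_ac[OF r Suc.prems] by simp
    have "ennreal (norm (res_Gs s \<phi> (Suc i) x)) \<le> (\<integral>\<^sup>+y. expker (c * norm s) x y * (ennreal (norm (\<phi> (Suc i) y)) * indicator {x<..} y) \<partial>halfline)"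
      if "0 < x" for x
    proof (rule first_order_backward_bound[OF ac less_imp_le[OF s(1)] s(2) _ that])
      fix e :: real assume "e > 0"
      then show "\<exists>x1>x. norm (res_Gs s \<phi> (Suc i) x1) < e"
        using wLp_small_near_infinity[OF p \<delta> L, of e x] by blast
    qed
    with L show ?case by blast
  qed
  then show ?thesis using x by blast
qed

lemma res_Gs_bound:
  assumes p: "p > 1" and \<delta>: "-1 < \<delta>" and c: "c > 0" and \<beta>: "-1 < \<beta>"
  obtains C where "C > 0" "\<And>m s (\<phi> :: nat \<Rightarrow> real \<Rightarrow> 'a::complex_banach) i.
    \<lbrakk>res_data p \<delta> m c s \<phi>; i \<le> m; \<phi> i \<in> wLp p \<beta>\<rbrakk>
    \<Longrightarrow> res_Gs s \<phi> i \<in> wLp p \<beta> \<and> norm s * wnorm p \<beta> (res_Gs s \<phi> i) \<le> C * wnorm p \<beta> (\<phi> i)"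
proof -
  obtain C where C: "C > 0" "\<And>a (f :: real \<Rightarrow> 'a) (g :: real \<Rightarrow> 'a).
    \<lbrakk>a > 0; f \<in> wLp p \<beta>; strongly_measurable halfline g;
      \<And>x. 0 < x \<Longrightarrow> ennreal (norm (g x)) \<le> (\<integral>\<^sup>+y. expker a x y * (ennreal (norm (f y)) * indicator {x<..} y) \<partial>halfline)\<rbrakk>
    \<Longrightarrow> g \<in> wLp p \<beta> \<and> a * wnorm p \<beta> g \<le> C * wnorm p \<beta> f"
    using expker_forward_bound[where 'b='a and 'c='a, OF p \<beta>] by blast
  have C': "C / c > 0" using C c by simp
  show thesis
  proof (rule that[OF C'])
    fix m s and \<phi> :: "nat \<Rightarrow> real \<Rightarrow> 'a" and i
    assume r: "res_data p \<delta> m c s \<phi>" and i: "i \<le> m" and \<phi>: "\<phi> i \<in> wLp p \<beta>"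
    have "c * norm s > 0" using r c by (simp add: res_data_def)
    from C(2)[OF this \<phi> has_ac_deriv_strongly_measurable[OF res_Gs_ac[OF r c i]] res_Gs_pointwise[OF p \<delta> r c i]]
    have "res_Gs s \<phi> i \<in> wLp p \<beta>" "c * (norm s * wnorm p \<beta> (res_Gs s \<phi> i)) \<le> C * wnorm p \<beta> (\<phi> i)"
      by (auto simp: mult.assoc)
    then show "res_Gs s \<phi> i \<in> wLp p \<beta> \<and> norm s * wnorm p \<beta> (res_Gs s \<phi> i) \<le> C / c * wnorm p \<beta> (\<phi> i)"
      using c by (simp add: field_simps)
  qed
qed

text \<open>Hardy's inequality for \<open>\<phi> i\<close> and its derivative, iterated \<open>d\<close> times. The pointwise bound by
  the integral of the derivative over \<open>(x, \<infinity>)\<close> holds because \<open>\<phi> i\<close> becomes small at some points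
  near infinity.\<close>

lemma hardy_chain:
  assumes p: "p > 1" and \<delta>: "-1 < \<delta>" and d: "-1 < \<delta> - real d * p"
  obtains C where "C > 0" "\<And>m (\<phi> :: nat \<Rightarrow> real \<Rightarrow> 'a::banach) i.
    \<lbrakk>\<forall>i\<le>m. \<phi> i \<in> wLp p \<delta>; \<forall>i<m. has_ac_deriv (\<phi> i) (\<phi> (Suc i)); i + d \<le> m\<rbrakk>
    \<Longrightarrow> \<phi> i \<in> wLp p (\<delta> - real d * p) \<and> wnorm p (\<delta> - real d * p) (\<phi> i) \<le> C * wnorm p \<delta> (\<phi> (i + d))"
proof -
  have "\<exists>C>0. \<forall>m (\<phi> :: nat \<Rightarrow> real \<Rightarrow> 'a) i. (\<forall>i\<le>m. \<phi> i \<in> wLp p \<delta>) \<longrightarrow> (\<forall>i<m. has_ac_deriv (\<phi> i) (\<phi> (Suc i))) \<longrightarrow> i + d \<le> m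
    \<longrightarrow> \<phi> i \<in> wLp p (\<delta> - real d * p) \<and> wnorm p (\<delta> - real d * p) (\<phi> i) \<le> C * wnorm p \<delta> (\<phi> (i + d))"
    using d
  proof (induction d)
    case 0
    then show ?case by (intro exI[of _ 1]) auto
  next
    case (Suc d)
    define \<beta> where "\<beta> = \<delta> - real (Suc d) * p"
    have \<beta>: "-1 < \<beta>" "\<beta> + p = \<delta> - real d * p" using Suc.prems by (auto simp: \<beta>_def algebra_simps)
    then have "-1 < \<delta> - real d * p" using p by simp
    then obtain C1 where C1: "C1 > 0" "\<And>m (\<phi> :: nat \<Rightarrow> real \<Rightarrow> 'a) i. \<lbrakk>\<forall>i\<le>m. \<phi> i \<in> wLp p \<delta>; \<forall>i<m. has_ac_deriv (\<phi> i) (\<phi> (Suc i)); i + d \<le> m\<rbrakk>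
      \<Longrightarrow> \<phi> i \<in> wLp p (\<beta> + p) \<and> wnorm p (\<beta> + p) (\<phi> i) \<le> C1 * wnorm p \<delta> (\<phi> (i + d))"
      using Suc.IH unfolding \<beta>(2) by blast
    obtain C2 where C2: "C2 > 0" "\<And>(f :: real \<Rightarrow> 'a) (g :: real \<Rightarrow> 'a).
      \<lbrakk>f \<in> wLp p (\<beta> + p); strongly_measurable halfline g;
        \<And>x. 0 < x \<Longrightarrow> ennreal (norm (g x)) \<le> (\<integral>\<^sup>+y. ennreal (norm (f y)) * indicator {x<..} y \<partial>halfline)\<rbrakk>
      \<Longrightarrow> g \<in> wLp p \<beta> \<and> wnorm p \<beta> g \<le> C2 * wnorm p (\<beta> + p) f"
      using hardy_bound[where 'b='a and 'c='a, OF p \<beta>(1)] by blast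
    show ?case
    proof (intro exI[of _ "C2 * C1"] conjI allI impI)
      show "C2 * C1 > 0" using C1 C2 by simp
      fix m and \<phi> :: "nat \<Rightarrow> real \<Rightarrow> 'a" and i
      assume \<phi>: "\<forall>i\<le>m. \<phi> i \<in> wLp p \<delta>" and ac: "\<forall>i<m. has_ac_deriv (\<phi> i) (\<phi> (Suc i))" and i: "i + Suc d \<le> m"
      have 1: "\<phi> (Suc i) \<in> wLp p (\<beta> + p)" "wnorm p (\<beta> + p) (\<phi> (Suc i)) \<le> C1 * wnorm p \<delta> (\<phi> (i + Suc d))"
        using C1(2)[OF \<phi> ac, of "Suc i"] i by simp_all
      have aci: "has_ac_deriv (\<phi> i) (\<phi> (Suc i))" using ac i by simp
      have "ennreal (norm (\<phi> i x)) \<le> (\<integral>\<^sup>+y. ennreal (norm (\<phi> (Suc i) y)) * indicator {x<..} y \<partial>halfline)" (is "_ \<le> ?I") if x: "0 < x" for x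
      proof (rule ennreal_le_epsilon)
        fix e :: real assume "e > 0"
        moreover have "\<phi> i \<in> wLp p \<delta>" using \<phi> i by simp
        ultimately obtain x1 where x1: "x < x1" "norm (\<phi> i x1) < e"
          using wLp_small_near_infinity[OF p \<delta>, of "\<phi> i" e x] by blast
        have "ennreal (norm (\<phi> i x)) \<le> ennreal (norm (\<phi> i x1 - \<phi> i x)) + ennreal (norm (\<phi> i x1))"
          using norm_triangle_ineq4[of "\<phi> i x1" "\<phi> i x1 - \<phi> i x"] by (intro ennreal_le_plus) auto
        also have "ennreal (norm (\<phi> i x1 - \<phi> i x)) \<le> (\<integral>\<^sup>+y. ennreal (norm (\<phi> (Suc i) y)) * indicator {x<..x1} y \<partial>halfline)"
          by (rule has_ac_deriv_norm_le[OF aci x]) (use x1 in simp)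
        also have "\<dots> \<le> ?I" by (intro nn_integral_mono) (auto split: split_indicator)
        finally have "ennreal (norm (\<phi> i x)) \<le> ?I + ennreal (norm (\<phi> i x1))" by (simp add: add_right_mono)
        also have "\<dots> \<le> ?I + ennreal e" using x1 by (intro add_left_mono ennreal_leI) simp
        finally show "ennreal (norm (\<phi> i x)) \<le> ?I + ennreal e" .
      qed
      from C2(2)[OF 1(1) has_ac_deriv_strongly_measurable[OF aci] this]
      have 2: "\<phi> i \<in> wLp p \<beta>" "wnorm p \<beta> (\<phi> i) \<le> C2 * wnorm p (\<beta> + p) (\<phi> (Suc i))" by blast+
      from 2(1) show "\<phi> i \<in> wLp p (\<delta> - real (Suc d) * p)" by (simp only: \<beta>_def)
      have "wnorm p \<beta> (\<phi> i) \<le> C2 * (C1 * wnorm p \<delta> (\<phi> (i + Suc d)))"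
        by (rule order_trans[OF 2(2) mult_left_mono[OF 1(2) less_imp_le[OF C2(1)]]])
      then show "wnorm p (\<delta> - real (Suc d) * p) (\<phi> i) \<le> C2 * C1 * wnorm p \<delta> (\<phi> (i + Suc d))"
        by (simp only: \<beta>_def mult.assoc)
    qed
  qed
  then show thesis using that by blast
qed

lemma res_u_bound_low:
  assumes p: "p > 1" and \<delta>: "-1 < \<delta>" and c: "c > 0" and \<gamma>: "-1 < \<gamma>" "\<gamma> < p - 1"
  obtains C where "C > 0" "\<And>m s (\<phi> :: nat \<Rightarrow> real \<Rightarrow> 'a::complex_banach).
    \<lbrakk>res_data p \<delta> m c s \<phi>; \<phi> 0 \<in> wLp p \<gamma>\<rbrakk>
    \<Longrightarrow> res_us s \<phi> 0 \<in> wLp p \<gamma> \<and> (norm s)\<^sup>2 * wnorm p \<gamma> (res_us s \<phi> 0) \<le> C * wnorm p \<gamma> (\<phi> 0)"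
proof -
  obtain C where C: "C > 0" "\<And>a (f :: real \<Rightarrow> 'a) (g :: real \<Rightarrow> 'a).
    \<lbrakk>a > 0; f \<in> wLp p \<gamma>; strongly_measurable halfline g;
      \<And>x. 0 < x \<Longrightarrow> ennreal (norm (g x)) \<le> (\<integral>\<^sup>+y. expker a x y * ennreal (norm (f y)) \<partial>halfline)\<rbrakk>
    \<Longrightarrow> g \<in> wLp p \<gamma> \<and> a * wnorm p \<gamma> g \<le> C * wnorm p \<gamma> f"
    using expker_bound[where 'b='a and 'c='a, OF p \<gamma>] by blast
  have p0: "p > 0" using p by simp
  have C': "C / c > 0" using C c by simp
  show thesis
  proof (rule that[OF C'])
    fix m s and \<phi> :: "nat \<Rightarrow> real \<Rightarrow> 'a"
    assume r: "res_data p \<delta> m c s \<phi>" and \<phi>: "\<phi> 0 \<in> wLp p \<gamma>"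
    have s0: "s \<noteq> 0" and a: "0 < c * norm s" "c * norm s \<le> Re s" and ex: "exp_integrable (\<phi> 0)" using r c by (auto simp: res_data_def)
    have us: "strongly_measurable halfline (res_us s \<phi> 0)"
      using res_us_ac[OF r c, of 0] by (intro has_ac_deriv_strongly_measurable) auto
    let ?g = "\<lambda>x. s *\<^sub>C res_us s \<phi> 0 x"
    have "ennreal (norm (?g x)) \<le> (\<integral>\<^sup>+y. expker (c * norm s) x y * ennreal (norm (\<phi> 0 y)) \<partial>halfline)" (is "_ \<le> ?I") if x: "0 < x" for x
    proof -
      have "ennreal (norm (?g x)) = ennreal (norm s) * ennreal (norm (res_u s (\<phi> 0) x))" by (simp add: norm_scaleC ennreal_mult)
      also have "\<dots> \<le> ennreal (norm s) * (ennreal (1 / norm s) * ?I)"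
        by (intro mult_left_mono res_u_bound[OF res_data_Re[OF r c] ex less_imp_le[OF a(1)] a(2) x]) simp
      also have "\<dots> = ?I" using s0 by (simp add: mult.assoc[symmetric] ennreal_mult[symmetric])
      finally show ?thesis .
    qed
    from C(2)[OF a(1) \<phi> strongly_measurable_scaleC[OF us] this]
    have g: "?g \<in> wLp p \<gamma>" "c * norm s * wnorm p \<gamma> ?g \<le> C * wnorm p \<gamma> (\<phi> 0)" by auto
    have "norm (res_us s \<phi> 0 x) \<le> (1 / norm s) * norm (?g x)" for x using s0 by (simp add: norm_scaleC)
    from wLp_norm_le[OF g(1) us p0 _ this]
    have u: "res_us s \<phi> 0 \<in> wLp p \<gamma>" "wnorm p \<gamma> (res_us s \<phi> 0) \<le> (1 / norm s) * wnorm p \<gamma> ?g" by auto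
    have "norm s * wnorm p \<gamma> (res_us s \<phi> 0) \<le> norm s * ((1 / norm s) * wnorm p \<gamma> ?g)" by (rule mult_left_mono[OF u(2)]) simp
    then have "norm s * wnorm p \<gamma> (res_us s \<phi> 0) \<le> wnorm p \<gamma> ?g" using s0 by simp
    then have "c * norm s * (norm s * wnorm p \<gamma> (res_us s \<phi> 0)) \<le> c * norm s * wnorm p \<gamma> ?g" using a(1) by (intro mult_left_mono) auto
    also note g(2)
    finally show "res_us s \<phi> 0 \<in> wLp p \<gamma> \<and> (norm s)\<^sup>2 * wnorm p \<gamma> (res_us s \<phi> 0) \<le> C / c * wnorm p \<gamma> (\<phi> 0)"
      using u(1) c by (simp add: power2_eq_square field_simps)
  qed
qed

lemma res_u_bound_high:
  assumes p: "p > 1" and \<delta>: "p - 1 < \<delta>" and c: "c > 0" and \<gamma>: "\<gamma> < p - 1"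
  obtains C where "C > 0" "\<And>m s (\<phi> :: nat \<Rightarrow> real \<Rightarrow> 'a::complex_banach).
    \<lbrakk>res_data p \<delta> m c s \<phi>; \<phi> 0 \<in> wLp p \<gamma>\<rbrakk>
    \<Longrightarrow> res_us s \<phi> 0 \<in> wLp p \<delta> \<and> (norm s)\<^sup>2 * wnorm p \<delta> (res_us s \<phi> 0)
      \<le> C * (1 + norm s powr (- (\<delta> + 1 - p) / p)) * (wnorm p \<gamma> (\<phi> 0) + wnorm p \<delta> (\<phi> 0))"
proof -
  obtain C where C: "C > 0" "\<And>a J (f :: real \<Rightarrow> 'a) (g :: real \<Rightarrow> 'a).
    \<lbrakk>a > 0; f \<in> wLp p \<delta>; J \<ge> 0; (\<integral>\<^sup>+y. ennreal (norm (f y)) \<partial>halfline) \<le> ennreal J; strongly_measurable halfline g;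
      \<And>x. 0 < x \<Longrightarrow> ennreal (norm (g x)) \<le> (\<integral>\<^sup>+y. expker a x y * ennreal (norm (f y)) \<partial>halfline)\<rbrakk>
    \<Longrightarrow> g \<in> wLp p \<delta> \<and> a * wnorm p \<delta> g \<le> C * (wnorm p \<delta> f + a powr (- (\<delta> + 1 - p) / p) * J)"
    using expker_L1_bound[where 'b='a and 'c='a, OF p \<delta>] by blast
  obtain D where D: "D > 0" "\<And>f :: real \<Rightarrow> 'a. f \<in> wLp p \<gamma> \<Longrightarrow> f \<in> wLp p \<delta> \<Longrightarrow>
    (\<integral>\<^sup>+y. ennreal (norm (f y)) \<partial>halfline) \<le> ennreal (D * (wnorm p \<gamma> f + wnorm p \<delta> f))"
    using wLp_L1_bound[where 'a='a, OF p \<gamma> \<delta>] by blast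
  have p0: "p > 0" using p by simp
  define q where "q = - (\<delta> + 1 - p) / p"
  define C' where "C' = C * (1 + c powr q * D) / c"
  have cq: "c powr q > 0" using c by simp
  have C': "C' > 0" unfolding C'_def using C(1) c D(1) cq by (intro divide_pos_pos mult_pos_pos add_pos_pos) auto
  show thesis
  proof (rule that[OF C'])
    fix m s and \<phi> :: "nat \<Rightarrow> real \<Rightarrow> 'a"
    assume r: "res_data p \<delta> m c s \<phi>" and \<phi>: "\<phi> 0 \<in> wLp p \<gamma>"
    have s0: "s \<noteq> 0" and a: "0 < c * norm s" "c * norm s \<le> Re s" and ex: "exp_integrable (\<phi> 0)" and \<phi>\<delta>: "\<phi> 0 \<in> wLp p \<delta>"
      using r c by (auto simp: res_data_def)
    have us: "strongly_measurable halfline (res_us s \<phi> 0)"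
      using res_us_ac[OF r c, of 0] by (intro has_ac_deriv_strongly_measurable) auto
    let ?g = "\<lambda>x. s *\<^sub>C res_us s \<phi> 0 x"
    define N where "N = wnorm p \<gamma> (\<phi> 0) + wnorm p \<delta> (\<phi> 0)"
    have N: "0 \<le> N" "wnorm p \<delta> (\<phi> 0) \<le> N" using wnorm_nonneg[of p \<gamma> "\<phi> 0"] wnorm_nonneg[of p \<delta> "\<phi> 0"] by (auto simp: N_def)
    have J: "(\<integral>\<^sup>+y. ennreal (norm (\<phi> 0 y)) \<partial>halfline) \<le> ennreal (D * N)" using D(2)[OF \<phi> \<phi>\<delta>] by (simp add: N_def)
    have DN: "0 \<le> D * N" using D N by simp
    have "ennreal (norm (?g x)) \<le> (\<integral>\<^sup>+y. expker (c * norm s) x y * ennreal (norm (\<phi> 0 y)) \<partial>halfline)" (is "_ \<le> ?I") if x: "0 < x" for x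
    proof -
      have "ennreal (norm (?g x)) = ennreal (norm s) * ennreal (norm (res_u s (\<phi> 0) x))" by (simp add: norm_scaleC ennreal_mult)
      also have "\<dots> \<le> ennreal (norm s) * (ennreal (1 / norm s) * ?I)"
        by (intro mult_left_mono res_u_bound[OF res_data_Re[OF r c] ex less_imp_le[OF a(1)] a(2) x]) simp
      also have "\<dots> = ?I" using s0 by (simp add: mult.assoc[symmetric] ennreal_mult[symmetric])
      finally show ?thesis .
    qed
    from C(2)[OF a(1) \<phi>\<delta> DN J strongly_measurable_scaleC[OF us] this]
    have g: "?g \<in> wLp p \<delta>" "c * norm s * wnorm p \<delta> ?g \<le> C * (wnorm p \<delta> (\<phi> 0) + (c * norm s) powr q * (D * N))" by (auto simp: q_def)
    have "norm (res_us s \<phi> 0 x) \<le> (1 / norm s) * norm (?g x)" for x using s0 by (simp add: norm_scaleC)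
    from wLp_norm_le[OF g(1) us p0 _ this]
    have u: "res_us s \<phi> 0 \<in> wLp p \<delta>" "wnorm p \<delta> (res_us s \<phi> 0) \<le> (1 / norm s) * wnorm p \<delta> ?g" by auto
    have "norm s * wnorm p \<delta> (res_us s \<phi> 0) \<le> norm s * ((1 / norm s) * wnorm p \<delta> ?g)" by (rule mult_left_mono[OF u(2)]) simp
    then have "norm s * wnorm p \<delta> (res_us s \<phi> 0) \<le> wnorm p \<delta> ?g" using s0 by simp
    then have "c * norm s * (norm s * wnorm p \<delta> (res_us s \<phi> 0)) \<le> c * norm s * wnorm p \<delta> ?g" using a(1) by (intro mult_left_mono) auto
    also note g(2)
    also have "C * (wnorm p \<delta> (\<phi> 0) + (c * norm s) powr q * (D * N)) \<le> C * ((1 + c powr q * D) * (1 + norm s powr q) * N)"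
    proof (intro mult_left_mono)
      have "(c * norm s) powr q = c powr q * norm s powr q" using c by (simp add: powr_mult)
      moreover have "0 \<le> norm s powr q * N" "0 \<le> c powr q * D * N" using N D by simp_all
      ultimately show "wnorm p \<delta> (\<phi> 0) + (c * norm s) powr q * (D * N) \<le> (1 + c powr q * D) * (1 + norm s powr q) * N"
        using N(2) by (simp add: algebra_simps)
    qed (use C in simp)
    finally have "c * ((norm s)\<^sup>2 * wnorm p \<delta> (res_us s \<phi> 0)) \<le> C * ((1 + c powr q * D) * (1 + norm s powr q) * N)"
      by (simp add: power2_eq_square mult_ac)
    then have "(norm s)\<^sup>2 * wnorm p \<delta> (res_us s \<phi> 0) \<le> C' * (1 + norm s powr q) * N"
      using c by (simp add: C'_def field_simps)
    then show "res_us s \<phi> 0 \<in> wLp p \<delta> \<and> (norm s)\<^sup>2 * wnorm p \<delta> (res_us s \<phi> 0)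
      \<le> C' * (1 + norm s powr (- (\<delta> + 1 - p) / p)) * (wnorm p \<gamma> (\<phi> 0) + wnorm p \<delta> (\<phi> 0))"
      using u(1) by (simp only: q_def N_def)
  qed
qed

section \<open>Large spectral parameters\<close>

text \<open>One climbs from exponent \<open>\<gamma> + j p\<close> to \<open>\<gamma> + (j + 1) p\<close>. With \<open>J = j + 1\<close> the function
  \<open>w = x\<^sup>J v\<close>, where \<open>v\<close> is a derivative of \<open>u\<close>, solves \<open>w' = x\<^sup>J G + J x\<^sup>j v - s w\<close>. By the
  induction hypothesis \<open>x\<^sup>j v\<close> belongs to the space with exponent \<open>\<gamma> < p - 1\<close>, so \<open>w\<close> is small
  at some points near \<open>0\<close>, and the kernel estimate with exponent \<open>\<gamma>\<close> applies to \<open>w\<close>. The term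
  \<open>J x\<^sup>j v\<close> comes with one power of \<open>\<bar>s\<bar>\<close> less than \<open>w\<close>; for \<open>\<bar>s\<bar> \<ge> 1\<close> this is harmless.\<close>

lemma res_us_large_weight_step:
  assumes p: "p > 1" and c: "c > 0" and \<gamma>: "-1 < \<gamma>" "\<gamma> < p - 1" and \<delta>: "\<delta> = \<gamma> + real n * p" and m: "m = n + e"
    and base: "\<exists>C>0. \<forall>s (\<phi> :: nat \<Rightarrow> real \<Rightarrow> 'a::complex_banach). res_data p \<delta> m c s \<phi> \<longrightarrow> 1 \<le> norm s \<longrightarrow>
      res_us s \<phi> e \<in> wLp p \<gamma> \<and> (norm s)\<^sup>2 * wnorm p \<gamma> (res_us s \<phi> e) \<le> C * data_norm p \<delta> m \<phi>"
    and Q: "\<And>j. j \<le> n \<Longrightarrow> \<exists>C>0. \<forall>s (\<phi> :: nat \<Rightarrow> real \<Rightarrow> 'a) i. res_data p \<delta> m c s \<phi> \<longrightarrow> i \<le> j \<longrightarrow>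
      res_Gs s \<phi> (i + e) \<in> wLp p (\<gamma> + real j * p) \<and>
      norm s * wnorm p (\<gamma> + real j * p) (res_Gs s \<phi> (i + e)) \<le> C * data_norm p \<delta> m \<phi>"
    and j: "j \<le> n"
  shows "\<exists>C>0. \<forall>s (\<phi> :: nat \<Rightarrow> real \<Rightarrow> 'a) i. res_data p \<delta> m c s \<phi> \<longrightarrow> 1 \<le> norm s \<longrightarrow> i \<le> j \<longrightarrow>
      res_us s \<phi> (i + e) \<in> wLp p (\<gamma> + real j * p) \<and>
      (norm s)\<^sup>2 * wnorm p (\<gamma> + real j * p) (res_us s \<phi> (i + e)) \<le> C * data_norm p \<delta> m \<phi>"
  using j
proof (induction j)
  case 0
  then show ?case using base by simp
next
  case (Suc j)
  have p0: "p > 0" and p1: "p \<ge> 1" using p by auto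
  obtain C where C: "C > 0" "\<And>s (\<phi> :: nat \<Rightarrow> real \<Rightarrow> 'a) i. \<lbrakk>res_data p \<delta> m c s \<phi>; 1 \<le> norm s; i \<le> j\<rbrakk> \<Longrightarrow>
      res_us s \<phi> (i + e) \<in> wLp p (\<gamma> + real j * p) \<and>
      (norm s)\<^sup>2 * wnorm p (\<gamma> + real j * p) (res_us s \<phi> (i + e)) \<le> C * data_norm p \<delta> m \<phi>"
    using Suc by auto
  obtain Q1 where Q1: "Q1 > 0" "\<And>s (\<phi> :: nat \<Rightarrow> real \<Rightarrow> 'a) i. \<lbrakk>res_data p \<delta> m c s \<phi>; i \<le> j\<rbrakk> \<Longrightarrow>
      res_Gs s \<phi> (i + e) \<in> wLp p (\<gamma> + real j * p) \<and>
      norm s * wnorm p (\<gamma> + real j * p) (res_Gs s \<phi> (i + e)) \<le> Q1 * data_norm p \<delta> m \<phi>"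
    using Q[of j] Suc.prems by auto
  obtain Q2 where Q2: "Q2 > 0" "\<And>s (\<phi> :: nat \<Rightarrow> real \<Rightarrow> 'a) i. \<lbrakk>res_data p \<delta> m c s \<phi>; i \<le> Suc j\<rbrakk> \<Longrightarrow>
      res_Gs s \<phi> (i + e) \<in> wLp p (\<gamma> + real (Suc j) * p) \<and>
      norm s * wnorm p (\<gamma> + real (Suc j) * p) (res_Gs s \<phi> (i + e)) \<le> Q2 * data_norm p \<delta> m \<phi>"
    using Q[of "Suc j"] Suc.prems by auto
  obtain T where T: "T > 0" "\<And>a (f :: real \<Rightarrow> 'a) (g :: real \<Rightarrow> 'a).
    \<lbrakk>a > 0; f \<in> wLp p \<gamma>; strongly_measurable halfline g;
      \<And>x. 0 < x \<Longrightarrow> ennreal (norm (g x)) \<le> (\<integral>\<^sup>+y. expker a x y * ennreal (norm (f y)) \<partial>halfline)\<rbrakk>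
    \<Longrightarrow> g \<in> wLp p \<gamma> \<and> a * wnorm p \<gamma> g \<le> T * wnorm p \<gamma> f"
    using expker_bound[where 'b='a and 'c='a, OF p \<gamma>] by blast
  define M where "M = C + 2 * (Q1 + C)"
  define J where "J = real (Suc j)"
  define K where "K = T / c * (2 * (Q2 + J * M))"
  have M: "M > 0" using C(1) Q1(1) by (simp add: M_def)
  have J: "J > 0" by (simp add: J_def)
  have K: "K > 0" unfolding K_def using T(1) c Q2(1) J M by (intro mult_pos_pos divide_pos_pos add_pos_pos) auto
  show ?case
  proof (intro exI[of _ K] conjI allI impI)
    show "K > 0" by (rule K)
    fix s and \<phi> :: "nat \<Rightarrow> real \<Rightarrow> 'a" and i
    assume r: "res_data p \<delta> m c s \<phi>" and s1: "1 \<le> norm s" and i: "i \<le> Suc j"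
    let ?S = "data_norm p \<delta> m \<phi>" and ?\<beta> = "\<gamma> + real j * p"
    define v where "v = res_us s \<phi> (i + e)"
    define G where "G = res_Gs s \<phi> (i + e)"
    have S: "?S \<ge> 0" by (rule data_norm_nonneg)
    have a: "0 < c * norm s" "c * norm s \<le> Re s" using r c by (auto simp: res_data_def)
    (* For i \<le> j the extra factor norm s is at most (norm s)^2 because norm s \<ge> 1. For i = Suc j
       the recursion expresses v by functions of order j. *)
    have v: "v \<in> wLp p ?\<beta> \<and> norm s * wnorm p ?\<beta> v \<le> M * ?S"
    proof (cases "i \<le> j")
      case True
      have "norm s * wnorm p ?\<beta> v \<le> (norm s)\<^sup>2 * wnorm p ?\<beta> v"
        using mult_right_mono[OF s1, of "norm s"] by (intro mult_right_mono wnorm_nonneg) (simp add: power2_eq_square)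
      also have "\<dots> \<le> C * ?S" using C(2)[OF r s1 True] by (simp add: v_def)
      also have "\<dots> \<le> M * ?S" using S C(1) Q1(1) by (intro mult_right_mono) (auto simp: M_def)
      finally show ?thesis using C(2)[OF r s1 True] by (simp add: v_def)
    next
      case False
      then have ij: "i = Suc j" using i by simp
      have veq: "v = (\<lambda>x. res_Gs s \<phi> (j + e) x - s *\<^sub>C res_us s \<phi> (j + e) x)" by (simp add: v_def ij)
      note g = Q1(2)[OF r order_refl] and u = C(2)[OF r s1 order_refl]
      have su: "(\<lambda>x. s *\<^sub>C res_us s \<phi> (j + e) x) \<in> wLp p ?\<beta>"
        "wnorm p ?\<beta> (\<lambda>x. s *\<^sub>C res_us s \<phi> (j + e) x) \<le> norm s * wnorm p ?\<beta> (res_us s \<phi> (j + e))"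
        using wLp_scaleC[OF _ p0, of "res_us s \<phi> (j + e)" ?\<beta> s] u by auto
      have d: "v \<in> wLp p ?\<beta>" "wnorm p ?\<beta> v \<le> 2 * (wnorm p ?\<beta> (res_Gs s \<phi> (j + e)) + wnorm p ?\<beta> (\<lambda>x. s *\<^sub>C res_us s \<phi> (j + e) x))"
        unfolding veq using wLp_diff[OF _ su(1) p1, of "res_Gs s \<phi> (j + e)"] g by auto
      have "wnorm p ?\<beta> v \<le> 2 * (wnorm p ?\<beta> (res_Gs s \<phi> (j + e)) + norm s * wnorm p ?\<beta> (res_us s \<phi> (j + e)))"
        by (rule order_trans[OF d(2)], intro mult_left_mono add_left_mono su(2)) simp
      then have "norm s * wnorm p ?\<beta> v \<le> norm s * (2 * (wnorm p ?\<beta> (res_Gs s \<phi> (j + e)) + norm s * wnorm p ?\<beta> (res_us s \<phi> (j + e))))"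
        by (rule mult_left_mono) simp
      also have "\<dots> = 2 * (norm s * wnorm p ?\<beta> (res_Gs s \<phi> (j + e)) + (norm s)\<^sup>2 * wnorm p ?\<beta> (res_us s \<phi> (j + e)))"
        by (simp add: power2_eq_square algebra_simps)
      also have "\<dots> \<le> 2 * (Q1 * ?S + C * ?S)" using g u by (intro mult_left_mono add_mono) auto
      also have "\<dots> \<le> M * ?S" using S C(1) by (simp add: M_def algebra_simps)
      finally show ?thesis using d(1) by simp
    qed
    have G: "G \<in> wLp p (\<gamma> + J * p)" "norm s * wnorm p (\<gamma> + J * p) G \<le> Q2 * ?S"
      using Q2(2)[OF r i] by (simp_all only: G_def J_def)
    have vs: "strongly_measurable halfline v" and Gs: "strongly_measurable halfline G"
      using v G wLp_strongly_measurable by blast+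
    have acv: "has_ac_deriv v (\<lambda>x. G x - s *\<^sub>C v x)"
      using res_us_ac[OF r c, of "i + e"] i Suc.prems m by (simp add: v_def G_def)
    define w where "w x = x powr J *\<^sub>R v x" for x
    define R where "R x = x powr J *\<^sub>R G x + J *\<^sub>R (x powr real j *\<^sub>R v x)" for x
    have acw: "has_ac_deriv w (\<lambda>t. R t - s *\<^sub>C w t)"
    proof -
      have dv: "((\<lambda>x. x powr J) has_vector_derivative J * t powr real j) (at t)" if "0 < t" for t
        using has_real_derivative_powr[OF that, of J]
        by (simp add: has_real_derivative_iff_has_vector_derivative J_def)
      have "has_ac_deriv (\<lambda>t. t powr J *\<^sub>R v t) (\<lambda>t. (J * t powr real j) *\<^sub>R v t + t powr J *\<^sub>R (G t - s *\<^sub>C v t))"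
        by (rule has_ac_deriv_bilinear[OF bounded_bilinear_scaleR dv _ acv]) (auto intro!: continuous_intros)
      then show ?thesis
        by (rule has_ac_deriv_cong) (simp_all add: w_def R_def scaleR_diff_right scaleC.scaleR_right)
    qed
    have xv: "(\<lambda>x. x powr real j *\<^sub>R v x) \<in> wLp p \<gamma>" "wnorm p \<gamma> (\<lambda>x. x powr real j *\<^sub>R v x) = wnorm p ?\<beta> v"
      using v wLp_powr_scale(1)[OF p0 vs, of "real j" \<gamma>] wLp_powr_scale(2)[OF p0 vs, of \<gamma> "real j"] by auto
    have xG: "(\<lambda>x. x powr J *\<^sub>R G x) \<in> wLp p \<gamma>" "wnorm p \<gamma> (\<lambda>x. x powr J *\<^sub>R G x) = wnorm p (\<gamma> + J * p) G"
      using G wLp_powr_scale(1)[OF p0 Gs, of J \<gamma>] wLp_powr_scale(2)[OF p0 Gs, of \<gamma> J] by auto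
    have Jv: "(\<lambda>x. J *\<^sub>R (x powr real j *\<^sub>R v x)) \<in> wLp p \<gamma>"
      "wnorm p \<gamma> (\<lambda>x. J *\<^sub>R (x powr real j *\<^sub>R v x)) \<le> J * wnorm p ?\<beta> v"
    proof -
      have sm: "strongly_measurable halfline (\<lambda>x. J *\<^sub>R (x powr real j *\<^sub>R v x))"
        by (intro strongly_measurable_scaleR wLp_strongly_measurable[OF xv(1)]) simp
      have le: "norm (J *\<^sub>R (x powr real j *\<^sub>R v x)) \<le> J * norm (x powr real j *\<^sub>R v x)" for x using J by simp
      show "(\<lambda>x. J *\<^sub>R (x powr real j *\<^sub>R v x)) \<in> wLp p \<gamma>"
        "wnorm p \<gamma> (\<lambda>x. J *\<^sub>R (x powr real j *\<^sub>R v x)) \<le> J * wnorm p ?\<beta> v"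
        using wLp_norm_le[OF xv(1) sm p0 less_imp_le[OF J] le] xv(2) by auto
    qed
    have RL: "R \<in> wLp p \<gamma>" "wnorm p \<gamma> R \<le> 2 * (wnorm p (\<gamma> + J * p) G + J * wnorm p ?\<beta> v)"
      using wLp_add[OF xG(1) Jv(1) p1] xG(2) Jv(2) unfolding R_def[abs_def] by auto
    have near: "\<exists>x0. 0 < x0 \<and> x0 < \<epsilon> \<and> norm (w x0) < \<epsilon>" if \<epsilon>: "\<epsilon> > 0" for \<epsilon>
    proof -
      obtain x0 where x0: "0 < x0" "x0 < \<epsilon>" "x0 * norm (x0 powr real j *\<^sub>R v x0) < \<epsilon>"
        using wLp_small_near_0[OF p \<gamma>(2) xv(1) \<epsilon>] by blast
      have "norm (w x0) = x0 * norm (x0 powr real j *\<^sub>R v x0)"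
        using x0(1) by (simp add: w_def J_def powr_add)
      then show ?thesis using x0 by auto
    qed
    have le: "ennreal (norm (w x)) \<le> (\<integral>\<^sup>+y. expker (c * norm s) x y * ennreal (norm (R y)) \<partial>halfline)" if x: "0 < x" for x
      by (rule order_trans[OF first_order_forward_bound[OF acw less_imp_le[OF a(1)] a(2) near x]])
        (auto intro!: nn_integral_mono split: split_indicator)
    have ws: "strongly_measurable halfline w" by (rule has_ac_deriv_strongly_measurable[OF acw])
    from T(2)[OF a(1) RL(1) ws le]
    have w: "w \<in> wLp p \<gamma>" "c * norm s * wnorm p \<gamma> w \<le> T * wnorm p \<gamma> R" by auto
    have wv: "v \<in> wLp p (\<gamma> + J * p)" "wnorm p (\<gamma> + J * p) v = wnorm p \<gamma> w"
      using w(1) wLp_powr_scale(1)[OF p0 vs, of J \<gamma>] wLp_powr_scale(2)[OF p0 vs, of \<gamma> J] unfolding w_def[abs_def] by auto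
    show "res_us s \<phi> (i + e) \<in> wLp p (\<gamma> + real (Suc j) * p)" using wv(1) by (simp only: v_def J_def)
    have "c * ((norm s)\<^sup>2 * wnorm p (\<gamma> + J * p) v) = norm s * (c * norm s * wnorm p \<gamma> w)"
      by (simp add: wv(2) power2_eq_square mult_ac)
    also have "\<dots> \<le> norm s * (T * wnorm p \<gamma> R)" by (rule mult_left_mono[OF w(2)]) simp
    also have "\<dots> \<le> norm s * (T * (2 * (wnorm p (\<gamma> + J * p) G + J * wnorm p ?\<beta> v)))"
      using T(1) RL(2) by (intro mult_left_mono) auto
    also have "\<dots> = T * (2 * (norm s * wnorm p (\<gamma> + J * p) G + J * (norm s * wnorm p ?\<beta> v)))" by (simp add: algebra_simps)
    also have "\<dots> \<le> T * (2 * (Q2 * ?S + J * (M * ?S)))"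
      using T(1) J G(2) v by (intro mult_left_mono add_mono) auto
    also have "\<dots> = c * (K * ?S)" using c by (simp add: K_def algebra_simps)
    finally have "(norm s)\<^sup>2 * wnorm p (\<gamma> + J * p) v \<le> K * ?S" using c by simp
    then show "(norm s)\<^sup>2 * wnorm p (\<gamma> + real (Suc j) * p) (res_us s \<phi> (i + e)) \<le> K * ?S" by (simp only: v_def J_def)
  qed
qed

text \<open>Here the \<open>n - j\<close> derivatives above \<open>\<phi> i\<close> are exchanged for a lower exponent.\<close>

lemma res_data_derivatives_bound:
  assumes p: "p > 1" and c: "c > 0" and \<gamma>: "-1 < \<gamma>" and \<delta>: "\<delta> = \<gamma> + real n * p" and m: "m = n + e" and j: "j \<le> n"
  shows "\<exists>C>0. \<forall>s (\<phi> :: nat \<Rightarrow> real \<Rightarrow> 'a::complex_banach) i. res_data p \<delta> m c s \<phi> \<longrightarrow> i \<le> j + e \<longrightarrow>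
      \<phi> i \<in> wLp p (\<gamma> + real j * p) \<and> wnorm p (\<gamma> + real j * p) (\<phi> i) \<le> C * data_norm p \<delta> m \<phi>"
proof -
  have jp: "0 \<le> real j * p" "0 \<le> real n * p" using p by auto
  have \<delta>1: "-1 < \<delta>" using \<gamma> jp by (simp add: \<delta>)
  have eq: "\<delta> - real (n - j) * p = \<gamma> + real j * p" using j by (simp add: \<delta> of_nat_diff algebra_simps)
  have d: "-1 < \<delta> - real (n - j) * p" unfolding eq using \<gamma> jp by simp
  obtain C where C: "C > 0" "\<And>m (\<phi> :: nat \<Rightarrow> real \<Rightarrow> 'a) i.
    \<lbrakk>\<forall>i\<le>m. \<phi> i \<in> wLp p \<delta>; \<forall>i<m. has_ac_deriv (\<phi> i) (\<phi> (Suc i)); i + (n - j) \<le> m\<rbrakk>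
    \<Longrightarrow> \<phi> i \<in> wLp p (\<gamma> + real j * p) \<and> wnorm p (\<gamma> + real j * p) (\<phi> i) \<le> C * wnorm p \<delta> (\<phi> (i + (n - j)))"
    using hardy_chain[where 'a='a, OF p \<delta>1 d] unfolding eq by blast
  show ?thesis
  proof (intro exI[of _ C] conjI allI impI)
    show "C > 0" by (rule C)
    fix s and \<phi> :: "nat \<Rightarrow> real \<Rightarrow> 'a" and i
    assume r: "res_data p \<delta> m c s \<phi>" and i: "i \<le> j + e"
    have im: "i + (n - j) \<le> m" using i j m by simp
    have *: "\<phi> i \<in> wLp p (\<gamma> + real j * p) \<and> wnorm p (\<gamma> + real j * p) (\<phi> i) \<le> C * wnorm p \<delta> (\<phi> (i + (n - j)))"
      by (rule C(2)[OF _ _ im]) (use r in \<open>simp_all add: res_data_def\<close>)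
    then show "\<phi> i \<in> wLp p (\<gamma> + real j * p)" by blast
    have "wnorm p (\<gamma> + real j * p) (\<phi> i) \<le> C * wnorm p \<delta> (\<phi> (i + (n - j)))" using * by blast
    also have "\<dots> \<le> C * data_norm p \<delta> m \<phi>"
      using C(1) by (intro mult_left_mono wnorm_le_data_norm im) auto
    finally show "wnorm p (\<gamma> + real j * p) (\<phi> i) \<le> C * data_norm p \<delta> m \<phi>" .
  qed
qed

lemma res_us_1_near_0:
  fixes \<phi> :: "nat \<Rightarrow> real \<Rightarrow> 'a::complex_banach"
  assumes r: "res_data p \<delta> m c s \<phi>" "c > 0" and e: "e > 0"
  shows "\<exists>d>0. \<forall>x. 0 < x \<longrightarrow> x < d \<longrightarrow> norm (res_us s \<phi> 1 x) < e"
proof -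
  have ex: "exp_integrable (\<phi> 0)" using r by (simp add: res_data_def)
  note c = res_u_deriv_continuous[OF res_data_Re[OF r] ex]
  have "\<exists>d>0. \<forall>x\<in>{0..}. dist x 0 < d \<longrightarrow>
    dist (res_G s (\<phi> 0) x - s *\<^sub>C res_u s (\<phi> 0) x) (res_G s (\<phi> 0) 0 - s *\<^sub>C res_u s (\<phi> 0) 0) < e"
    using c(1)[unfolded continuous_on_iff, rule_format, of 0 e] e by simp
  then obtain d where d: "d > 0" "\<And>x. x \<in> {0..} \<Longrightarrow> dist x 0 < d \<Longrightarrow> dist (res_G s (\<phi> 0) x - s *\<^sub>C res_u s (\<phi> 0) x) 0 < e"
    unfolding c(2) by blast
  have "norm (res_us s \<phi> 1 x) < e" if "0 < x" "x < d" for x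
    using d(2)[of x] that by (simp add: dist_norm)
  then show ?thesis using d(1) by blast
qed

text \<open>The climb starts from exponent \<open>\<gamma>\<close> with the derivative of order \<open>e\<close>. For \<open>e = 0\<close> this is \<open>u\<close>
  itself and the kernel is bounded. For \<open>e = 1\<close> it is \<open>u'\<close>, which solves \<open>w' = G' - s w\<close> with
  initial value \<open>0\<close> by the Neumann condition.\<close>

lemma res_us_large:
  assumes p: "p > 1" and c: "c > 0" and \<gamma>: "-1 < \<gamma>" "\<gamma> < p - 1" and \<delta>: "\<delta> = \<gamma> + real n * p" and m: "m = n + e" and e: "e \<le> 1"
  obtains C where "C > 0" "\<And>s (\<phi> :: nat \<Rightarrow> real \<Rightarrow> 'a::complex_banach) i. \<lbrakk>res_data p \<delta> m c s \<phi>; 1 \<le> norm s; e \<le> i; i \<le> m\<rbrakk> \<Longrightarrow>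
    res_us s \<phi> i \<in> wLp p \<delta> \<and> (norm s)\<^sup>2 * wnorm p \<delta> (res_us s \<phi> i) \<le> C * data_norm p \<delta> m \<phi>"
proof -
  have p0: "p > 0" using p by simp
  have np: "0 \<le> real n * p" using p by simp
  have \<delta>1: "-1 < \<delta>" using \<gamma> np unfolding \<delta> by linarith
  have Q: "\<exists>C>0. \<forall>s (\<phi> :: nat \<Rightarrow> real \<Rightarrow> 'a) i. res_data p \<delta> m c s \<phi> \<longrightarrow> i \<le> j \<longrightarrow>
      res_Gs s \<phi> (i + e) \<in> wLp p (\<gamma> + real j * p) \<and>
      norm s * wnorm p (\<gamma> + real j * p) (res_Gs s \<phi> (i + e)) \<le> C * data_norm p \<delta> m \<phi>" if j: "j \<le> n" for j
  proof -
    have "0 \<le> real j * p" using p0 by simp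
    then have \<beta>: "-1 < \<gamma> + real j * p" using \<gamma> by linarith
    obtain C1 where C1: "C1 > 0" "\<And>s (\<phi> :: nat \<Rightarrow> real \<Rightarrow> 'a) i. res_data p \<delta> m c s \<phi> \<Longrightarrow> i \<le> j + e \<Longrightarrow>
      \<phi> i \<in> wLp p (\<gamma> + real j * p) \<and> wnorm p (\<gamma> + real j * p) (\<phi> i) \<le> C1 * data_norm p \<delta> m \<phi>"
      using res_data_derivatives_bound[where 'a='a, OF p c \<gamma>(1) \<delta> m j] by blast
    obtain C2 where C2: "C2 > 0" "\<And>m s (\<phi> :: nat \<Rightarrow> real \<Rightarrow> 'a) i.
      \<lbrakk>res_data p \<delta> m c s \<phi>; i \<le> m; \<phi> i \<in> wLp p (\<gamma> + real j * p)\<rbrakk>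
      \<Longrightarrow> res_Gs s \<phi> i \<in> wLp p (\<gamma> + real j * p) \<and> norm s * wnorm p (\<gamma> + real j * p) (res_Gs s \<phi> i) \<le> C2 * wnorm p (\<gamma> + real j * p) (\<phi> i)"
      using res_Gs_bound[where 'a='a, OF p \<delta>1 c \<beta>] by blast
    show ?thesis
    proof (intro exI[of _ "C2 * C1"] conjI allI impI)
      show "C2 * C1 > 0" using C1(1) C2(1) by simp
      fix s and \<phi> :: "nat \<Rightarrow> real \<Rightarrow> 'a" and i
      assume r: "res_data p \<delta> m c s \<phi>" and i: "i \<le> j"
      have 1: "\<phi> (i + e) \<in> wLp p (\<gamma> + real j * p)" "wnorm p (\<gamma> + real j * p) (\<phi> (i + e)) \<le> C1 * data_norm p \<delta> m \<phi>"
        using C1(2)[OF r, of "i + e"] i by auto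
      have 2: "res_Gs s \<phi> (i + e) \<in> wLp p (\<gamma> + real j * p)"
        "norm s * wnorm p (\<gamma> + real j * p) (res_Gs s \<phi> (i + e)) \<le> C2 * wnorm p (\<gamma> + real j * p) (\<phi> (i + e))"
        using C2(2)[OF r _ 1(1)] i j m by auto
      show "res_Gs s \<phi> (i + e) \<in> wLp p (\<gamma> + real j * p)" by (rule 2)
      show "norm s * wnorm p (\<gamma> + real j * p) (res_Gs s \<phi> (i + e)) \<le> C2 * C1 * data_norm p \<delta> m \<phi>"
        using order_trans[OF 2(2) mult_left_mono[OF 1(2) less_imp_le[OF C2(1)]]] by (simp add: mult.assoc)
    qed
  qed
  have base: "\<exists>C>0. \<forall>s (\<phi> :: nat \<Rightarrow> real \<Rightarrow> 'a). res_data p \<delta> m c s \<phi> \<longrightarrow> 1 \<le> norm s \<longrightarrow>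
      res_us s \<phi> e \<in> wLp p \<gamma> \<and> (norm s)\<^sup>2 * wnorm p \<gamma> (res_us s \<phi> e) \<le> C * data_norm p \<delta> m \<phi>"
  proof (cases "e = 0")
    case True
    obtain C1 where C1: "C1 > 0" "\<And>s (\<phi> :: nat \<Rightarrow> real \<Rightarrow> 'a). res_data p \<delta> m c s \<phi> \<Longrightarrow>
      \<phi> 0 \<in> wLp p \<gamma> \<and> wnorm p \<gamma> (\<phi> 0) \<le> C1 * data_norm p \<delta> m \<phi>"
      using res_data_derivatives_bound[where 'a='a, OF p c \<gamma>(1) \<delta> m, of 0] by auto
    obtain C2 where C2: "C2 > 0" "\<And>m s (\<phi> :: nat \<Rightarrow> real \<Rightarrow> 'a). \<lbrakk>res_data p \<delta> m c s \<phi>; \<phi> 0 \<in> wLp p \<gamma>\<rbrakk>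
      \<Longrightarrow> res_us s \<phi> 0 \<in> wLp p \<gamma> \<and> (norm s)\<^sup>2 * wnorm p \<gamma> (res_us s \<phi> 0) \<le> C2 * wnorm p \<gamma> (\<phi> 0)"
      using res_u_bound_low[where 'a='a, OF p \<delta>1 c \<gamma>] by blast
    show ?thesis
    proof (intro exI[of _ "C2 * C1"] conjI allI impI)
      show "C2 * C1 > 0" using C1(1) C2(1) by simp
      fix s and \<phi> :: "nat \<Rightarrow> real \<Rightarrow> 'a"
      assume r: "res_data p \<delta> m c s \<phi>"
      note 1 = C1(2)[OF r] and 2 = C2(2)[OF r conjunct1[OF C1(2)[OF r]]]
      show "res_us s \<phi> e \<in> wLp p \<gamma>" using 2 True by simp
      show "(norm s)\<^sup>2 * wnorm p \<gamma> (res_us s \<phi> e) \<le> C2 * C1 * data_norm p \<delta> m \<phi>"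
        using order_trans[OF conjunct2[OF 2] mult_left_mono[OF conjunct2[OF 1] less_imp_le[OF C2(1)]]] True by (simp add: mult.assoc)
    qed
  next
    case False
    then have e1: "e = 1" using e by simp
    obtain Q0 where Q0: "Q0 > 0" "\<And>s (\<phi> :: nat \<Rightarrow> real \<Rightarrow> 'a). res_data p \<delta> m c s \<phi> \<Longrightarrow>
      res_Gs s \<phi> 1 \<in> wLp p \<gamma> \<and> norm s * wnorm p \<gamma> (res_Gs s \<phi> 1) \<le> Q0 * data_norm p \<delta> m \<phi>"
      using Q[of 0] e1 by auto
    obtain T where T: "T > 0" "\<And>a (f :: real \<Rightarrow> 'a) (g :: real \<Rightarrow> 'a).
      \<lbrakk>a > 0; f \<in> wLp p \<gamma>; strongly_measurable halfline g;
        \<And>x. 0 < x \<Longrightarrow> ennreal (norm (g x)) \<le> (\<integral>\<^sup>+y. expker a x y * ennreal (norm (f y)) \<partial>halfline)\<rbrakk>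
      \<Longrightarrow> g \<in> wLp p \<gamma> \<and> a * wnorm p \<gamma> g \<le> T * wnorm p \<gamma> f"
      using expker_bound[where 'b='a and 'c='a, OF p \<gamma>] by blast
    show ?thesis
    proof (intro exI[of _ "T * Q0 / c"] conjI allI impI)
      show "T * Q0 / c > 0" using T(1) Q0(1) c by simp
      fix s and \<phi> :: "nat \<Rightarrow> real \<Rightarrow> 'a"
      assume r: "res_data p \<delta> m c s \<phi>"
      have a: "0 < c * norm s" "c * norm s \<le> Re s" using r c by (auto simp: res_data_def)
      have ac: "has_ac_deriv (res_us s \<phi> 1) (\<lambda>x. res_Gs s \<phi> 1 x - s *\<^sub>C res_us s \<phi> 1 x)"
        using res_us_ac[OF r c, of 1] m e1 by simp
      have near: "\<exists>x0. 0 < x0 \<and> x0 < \<epsilon> \<and> norm (res_us s \<phi> 1 x0) < \<epsilon>" if \<epsilon>: "\<epsilon> > 0" for \<epsilon>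
      proof -
        obtain d where d: "d > 0" "\<forall>x. 0 < x \<longrightarrow> x < d \<longrightarrow> norm (res_us s \<phi> 1 x) < \<epsilon>"
          using res_us_1_near_0[OF r c \<epsilon>] by blast
        then show ?thesis using \<epsilon> by (intro exI[of _ "min d \<epsilon> / 2"]) auto
      qed
      have le: "ennreal (norm (res_us s \<phi> 1 x)) \<le> (\<integral>\<^sup>+y. expker (c * norm s) x y * ennreal (norm (res_Gs s \<phi> 1 y)) \<partial>halfline)" if x: "0 < x" for x
        by (rule order_trans[OF first_order_forward_bound[OF ac less_imp_le[OF a(1)] a(2) near x]])
          (auto intro!: nn_integral_mono split: split_indicator)
      from T(2)[OF a(1) conjunct1[OF Q0(2)[OF r]] has_ac_deriv_strongly_measurable[OF ac] le]
      have u: "res_us s \<phi> 1 \<in> wLp p \<gamma>" "c * norm s * wnorm p \<gamma> (res_us s \<phi> 1) \<le> T * wnorm p \<gamma> (res_Gs s \<phi> 1)" by auto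
      show "res_us s \<phi> e \<in> wLp p \<gamma>" using u(1) by (simp only: e1)
      have "c * ((norm s)\<^sup>2 * wnorm p \<gamma> (res_us s \<phi> 1)) = norm s * (c * norm s * wnorm p \<gamma> (res_us s \<phi> 1))"
        by (simp only: power2_eq_square mult_ac)
      also have "\<dots> \<le> norm s * (T * wnorm p \<gamma> (res_Gs s \<phi> 1))" by (rule mult_left_mono[OF u(2)]) simp
      also have "\<dots> = T * (norm s * wnorm p \<gamma> (res_Gs s \<phi> 1))" by (simp only: mult_ac)
      also have "\<dots> \<le> T * (Q0 * data_norm p \<delta> m \<phi>)" using T(1) Q0(2)[OF r] by (intro mult_left_mono) auto
      finally show "(norm s)\<^sup>2 * wnorm p \<gamma> (res_us s \<phi> e) \<le> T * Q0 / c * data_norm p \<delta> m \<phi>"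
        using c by (simp only: e1) (simp add: field_simps)
    qed
  qed
  obtain C where C: "C > 0" "\<And>s (\<phi> :: nat \<Rightarrow> real \<Rightarrow> 'a) i. res_data p \<delta> m c s \<phi> \<Longrightarrow> 1 \<le> norm s \<Longrightarrow> i \<le> n \<Longrightarrow>
      res_us s \<phi> (i + e) \<in> wLp p (\<gamma> + real n * p) \<and>
      (norm s)\<^sup>2 * wnorm p (\<gamma> + real n * p) (res_us s \<phi> (i + e)) \<le> C * data_norm p \<delta> m \<phi>"
    using res_us_large_weight_step[where 'a='a, OF p c \<gamma> \<delta> m base Q order_refl] by blast
  show thesis
  proof (rule that[OF C(1)])
    fix s and \<phi> :: "nat \<Rightarrow> real \<Rightarrow> 'a" and i
    assume r: "res_data p \<delta> m c s \<phi>" and s: "1 \<le> norm s" and i: "e \<le> i" "i \<le> m"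
    then show "res_us s \<phi> i \<in> wLp p \<delta> \<and> (norm s)\<^sup>2 * wnorm p \<delta> (res_us s \<phi> i) \<le> C * data_norm p \<delta> m \<phi>"
      using C(2)[OF r s, of "i - e"] m by (simp add: \<delta>)
  qed
qed

section \<open>The resolvent estimate for all parameters\<close>

text \<open>Induction on the order of the derivative. The function \<open>u\<close> itself is estimated by the kernel,
  with the additional factor if \<open>\<delta> > p - 1\<close>. For higher derivatives and \<open>\<bar>s\<bar> \<ge> 1\<close> the preceding
  lemma applies, and for \<open>\<bar>s\<bar> \<le> 1\<close> the recursion \<open>u\<^sub>i\<^sub>+\<^sub>1 = G\<^sub>i - s u\<^sub>i\<close> loses nothing.\<close>

lemma res_us_bound:
  assumes p: "p > 1" and c: "c > 0" and \<gamma>: "-1 < \<gamma>" "\<gamma> < p - 1" and \<delta>: "\<delta> = \<gamma> + real n * p" and m: "m = n + e" and e: "e \<le> 1"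
  obtains C where "C > 0" "\<And>s (\<phi> :: nat \<Rightarrow> real \<Rightarrow> 'a::complex_banach) i. \<lbrakk>res_data p \<delta> m c s \<phi>; i \<le> m\<rbrakk> \<Longrightarrow>
    res_us s \<phi> i \<in> wLp p \<delta> \<and> (norm s)\<^sup>2 * wnorm p \<delta> (res_us s \<phi> i)
      \<le> C * (1 + norm s powr (- (max (\<delta> - p + 1) 0) / p)) * data_norm p \<delta> m \<phi>"
proof -
  define H where "H s = 1 + norm s powr (- (max (\<delta> - p + 1) 0) / p)" for s :: complex
  have H: "1 \<le> H s" for s by (simp add: H_def)
  have p0: "p > 0" and p1: "p \<ge> 1" using p by auto
  have np: "0 \<le> real n * p" using p by simp
  have \<delta>1: "-1 < \<delta>" using \<gamma> np unfolding \<delta> by linarith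
  obtain CL where CL: "CL > 0" "\<And>s (\<phi> :: nat \<Rightarrow> real \<Rightarrow> 'a) i. \<lbrakk>res_data p \<delta> m c s \<phi>; 1 \<le> norm s; e \<le> i; i \<le> m\<rbrakk> \<Longrightarrow>
    res_us s \<phi> i \<in> wLp p \<delta> \<and> (norm s)\<^sup>2 * wnorm p \<delta> (res_us s \<phi> i) \<le> CL * data_norm p \<delta> m \<phi>"
    using res_us_large[where 'a='a, OF p c \<gamma> \<delta> m e] by blast
  obtain CG where CG: "CG > 0" "\<And>m s (\<phi> :: nat \<Rightarrow> real \<Rightarrow> 'a) i.
    \<lbrakk>res_data p \<delta> m c s \<phi>; i \<le> m; \<phi> i \<in> wLp p \<delta>\<rbrakk>
    \<Longrightarrow> res_Gs s \<phi> i \<in> wLp p \<delta> \<and> norm s * wnorm p \<delta> (res_Gs s \<phi> i) \<le> CG * wnorm p \<delta> (\<phi> i)"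
    using res_Gs_bound[where 'a='a, OF p \<delta>1 c \<delta>1] by blast
  have u0: "\<exists>C>0. \<forall>s (\<phi> :: nat \<Rightarrow> real \<Rightarrow> 'a). res_data p \<delta> m c s \<phi> \<longrightarrow>
    res_us s \<phi> 0 \<in> wLp p \<delta> \<and> (norm s)\<^sup>2 * wnorm p \<delta> (res_us s \<phi> 0) \<le> C * H s * data_norm p \<delta> m \<phi>"
  proof (cases "\<delta> < p - 1")
    case True
    obtain C where C: "C > 0" "\<And>m s (\<phi> :: nat \<Rightarrow> real \<Rightarrow> 'a). \<lbrakk>res_data p \<delta> m c s \<phi>; \<phi> 0 \<in> wLp p \<delta>\<rbrakk>
      \<Longrightarrow> res_us s \<phi> 0 \<in> wLp p \<delta> \<and> (norm s)\<^sup>2 * wnorm p \<delta> (res_us s \<phi> 0) \<le> C * wnorm p \<delta> (\<phi> 0)"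
      using res_u_bound_low[where 'a='a, OF p \<delta>1 c \<delta>1 True] by blast
    show ?thesis
    proof (intro exI[of _ C] conjI allI impI)
      fix s and \<phi> :: "nat \<Rightarrow> real \<Rightarrow> 'a"
      assume r: "res_data p \<delta> m c s \<phi>"
      then have \<phi>: "\<phi> 0 \<in> wLp p \<delta>" by (simp add: res_data_def)
      show "res_us s \<phi> 0 \<in> wLp p \<delta>" using C(2)[OF r \<phi>] by blast
      have "(norm s)\<^sup>2 * wnorm p \<delta> (res_us s \<phi> 0) \<le> C * wnorm p \<delta> (\<phi> 0)" using C(2)[OF r \<phi>] by blast
      also have "\<dots> \<le> (C * H s) * data_norm p \<delta> m \<phi>"
        using C(1) H[of s] by (intro mult_mono wnorm_le_data_norm wnorm_nonneg) auto
      finally show "(norm s)\<^sup>2 * wnorm p \<delta> (res_us s \<phi> 0) \<le> C * H s * data_norm p \<delta> m \<phi>" .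
    qed (rule C)
  next
    case False
    have "n \<noteq> 0" using False \<gamma> \<delta> by (intro notI) simp
    then have "1 * p \<le> real n * p" using p0 by (intro mult_right_mono) auto
    then have hi: "p - 1 < \<delta>" using \<gamma>(1) by (simp add: \<delta>)
    obtain C1 where C1: "C1 > 0" "\<And>s (\<phi> :: nat \<Rightarrow> real \<Rightarrow> 'a). res_data p \<delta> m c s \<phi> \<Longrightarrow>
      \<phi> 0 \<in> wLp p \<gamma> \<and> wnorm p \<gamma> (\<phi> 0) \<le> C1 * data_norm p \<delta> m \<phi>"
      using res_data_derivatives_bound[where 'a='a, OF p c \<gamma>(1) \<delta> m, of 0] by auto
    obtain C where C: "C > 0" "\<And>m s (\<phi> :: nat \<Rightarrow> real \<Rightarrow> 'a). \<lbrakk>res_data p \<delta> m c s \<phi>; \<phi> 0 \<in> wLp p \<gamma>\<rbrakk>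
      \<Longrightarrow> res_us s \<phi> 0 \<in> wLp p \<delta> \<and> (norm s)\<^sup>2 * wnorm p \<delta> (res_us s \<phi> 0)
        \<le> C * (1 + norm s powr (- (\<delta> + 1 - p) / p)) * (wnorm p \<gamma> (\<phi> 0) + wnorm p \<delta> (\<phi> 0))"
      using res_u_bound_high[where 'a='a, OF p hi c \<gamma>(2)] by blast
    have Heq: "H s = 1 + norm s powr (- (\<delta> + 1 - p) / p)" for s using hi by (simp add: H_def max_def algebra_simps)
    show ?thesis
    proof (intro exI[of _ "C * (C1 + 1)"] conjI allI impI)
      show "C * (C1 + 1) > 0" using C(1) C1(1) by simp
      fix s and \<phi> :: "nat \<Rightarrow> real \<Rightarrow> 'a"
      assume r: "res_data p \<delta> m c s \<phi>"
      note 1 = C1(2)[OF r] and 2 = C(2)[OF r conjunct1[OF C1(2)[OF r]]]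
      show "res_us s \<phi> 0 \<in> wLp p \<delta>" using 2 by blast
      have "wnorm p \<gamma> (\<phi> 0) + wnorm p \<delta> (\<phi> 0) \<le> C1 * data_norm p \<delta> m \<phi> + data_norm p \<delta> m \<phi>"
        using 1 wnorm_le_data_norm[of 0 m p \<delta> \<phi>] by (intro add_mono) auto
      also have "\<dots> = (C1 + 1) * data_norm p \<delta> m \<phi>" by (simp add: algebra_simps)
      finally have "C * H s * (wnorm p \<gamma> (\<phi> 0) + wnorm p \<delta> (\<phi> 0)) \<le> C * H s * ((C1 + 1) * data_norm p \<delta> m \<phi>)"
        using C(1) H[of s] by (intro mult_left_mono) auto
      with 2 show "(norm s)\<^sup>2 * wnorm p \<delta> (res_us s \<phi> 0) \<le> C * (C1 + 1) * H s * data_norm p \<delta> m \<phi>"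
        by (simp add: Heq mult_ac)
    qed
  qed
  have all: "\<exists>C>0. \<forall>s (\<phi> :: nat \<Rightarrow> real \<Rightarrow> 'a). res_data p \<delta> m c s \<phi> \<longrightarrow>
    res_us s \<phi> i \<in> wLp p \<delta> \<and> (norm s)\<^sup>2 * wnorm p \<delta> (res_us s \<phi> i) \<le> C * H s * data_norm p \<delta> m \<phi>" if "i \<le> m" for i
    using that
  proof (induction i)
    case 0 show ?case by (rule u0)
  next
    case (Suc i)
    then obtain C where C: "C > 0" "\<And>s (\<phi> :: nat \<Rightarrow> real \<Rightarrow> 'a). res_data p \<delta> m c s \<phi> \<Longrightarrow>
      res_us s \<phi> i \<in> wLp p \<delta> \<and> (norm s)\<^sup>2 * wnorm p \<delta> (res_us s \<phi> i) \<le> C * H s * data_norm p \<delta> m \<phi>" by auto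
    define K where "K = CL + 2 * (CG + C)"
    have K: "K > 0" using CL(1) CG(1) C(1) by (simp add: K_def add_pos_pos)
    show ?case
    proof (intro exI[of _ K] conjI allI impI)
      show "K > 0" by (rule K)
      fix s and \<phi> :: "nat \<Rightarrow> real \<Rightarrow> 'a"
      assume r: "res_data p \<delta> m c s \<phi>"
      let ?S = "data_norm p \<delta> m \<phi>"
      have S: "0 \<le> ?S" by (rule data_norm_nonneg)
      have HS: "?S \<le> H s * ?S" using H[of s] S mult_right_mono[of 1 "H s" ?S] by simp
      have im: "i \<le> m" and \<phi>: "\<phi> i \<in> wLp p \<delta>" using Suc.prems r by (auto simp: res_data_def)
      note g = CG(2)[OF r im \<phi>] and u = C(2)[OF r]
      have gS: "norm s * wnorm p \<delta> (res_Gs s \<phi> i) \<le> CG * ?S"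
        using conjunct2[OF g] mult_left_mono[OF wnorm_le_data_norm[OF im, of p \<delta> \<phi>] less_imp_le[OF CG(1)]] by (rule order_trans)
      have su: "(\<lambda>x. s *\<^sub>C res_us s \<phi> i x) \<in> wLp p \<delta>"
        "wnorm p \<delta> (\<lambda>x. s *\<^sub>C res_us s \<phi> i x) \<le> norm s * wnorm p \<delta> (res_us s \<phi> i)"
        using wLp_scaleC[OF _ p0, of "res_us s \<phi> i" \<delta> s] u by auto
      have d: "res_us s \<phi> (Suc i) \<in> wLp p \<delta>"
        "wnorm p \<delta> (res_us s \<phi> (Suc i)) \<le> 2 * (wnorm p \<delta> (res_Gs s \<phi> i) + wnorm p \<delta> (\<lambda>x. s *\<^sub>C res_us s \<phi> i x))"
        using wLp_diff[OF _ su(1) p1, of "res_Gs s \<phi> i"] g by auto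
      show "res_us s \<phi> (Suc i) \<in> wLp p \<delta>" by (rule d)
      show "(norm s)\<^sup>2 * wnorm p \<delta> (res_us s \<phi> (Suc i)) \<le> K * H s * ?S"
      proof (cases "1 \<le> norm s")
        case True
        have "(norm s)\<^sup>2 * wnorm p \<delta> (res_us s \<phi> (Suc i)) \<le> CL * ?S"
          using CL(2)[OF r True _ Suc.prems] e by simp
        also have "\<dots> \<le> K * (H s * ?S)" using HS S K CL(1) CG(1) C(1) by (intro mult_mono) (auto simp: K_def)
        finally show ?thesis by (simp add: mult.assoc)
      next
        case False
        have "wnorm p \<delta> (res_us s \<phi> (Suc i)) \<le> 2 * (wnorm p \<delta> (res_Gs s \<phi> i) + norm s * wnorm p \<delta> (res_us s \<phi> i))"
          by (rule order_trans[OF d(2)], intro mult_left_mono add_left_mono su(2)) simp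
        then have "(norm s)\<^sup>2 * wnorm p \<delta> (res_us s \<phi> (Suc i)) \<le> (norm s)\<^sup>2 * (2 * (wnorm p \<delta> (res_Gs s \<phi> i) + norm s * wnorm p \<delta> (res_us s \<phi> i)))"
          by (rule mult_left_mono) simp
        also have "\<dots> = 2 * (norm s * (norm s * wnorm p \<delta> (res_Gs s \<phi> i)) + norm s * ((norm s)\<^sup>2 * wnorm p \<delta> (res_us s \<phi> i)))"
          by (simp add: power2_eq_square algebra_simps)
        also have "\<dots> \<le> 2 * (1 * (CG * ?S) + 1 * (C * H s * ?S))"
        proof -
          have s1: "norm s \<le> 1" using False by simp
          have "norm s * (norm s * wnorm p \<delta> (res_Gs s \<phi> i)) \<le> 1 * (CG * ?S)"
            by (rule mult_mono[OF s1 gS]) (simp_all add: wnorm_nonneg)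
          moreover have "norm s * ((norm s)\<^sup>2 * wnorm p \<delta> (res_us s \<phi> i)) \<le> 1 * (C * H s * ?S)"
            by (rule mult_mono[OF s1 conjunct2[OF u]]) (simp_all add: wnorm_nonneg)
          ultimately show ?thesis by (intro mult_left_mono add_mono) simp_all
        qed
        also have "\<dots> \<le> 2 * (CG * (H s * ?S) + C * H s * ?S)" using HS CG(1) by simp
        also have "\<dots> \<le> K * H s * ?S" using CL(1) H[of s] S by (simp add: K_def algebra_simps)
        finally show ?thesis .
      qed
    qed
  qed
  then have "\<forall>i\<in>{..m}. \<exists>C. C > 0 \<and> (\<forall>s (\<phi> :: nat \<Rightarrow> real \<Rightarrow> 'a). res_data p \<delta> m c s \<phi> \<longrightarrow>
    res_us s \<phi> i \<in> wLp p \<delta> \<and> (norm s)\<^sup>2 * wnorm p \<delta> (res_us s \<phi> i) \<le> C * H s * data_norm p \<delta> m \<phi>)" by simp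
  from bchoice[OF this] obtain Ci where Ci: "\<And>i. i \<le> m \<Longrightarrow> Ci i > 0"
    "\<And>i s (\<phi> :: nat \<Rightarrow> real \<Rightarrow> 'a). i \<le> m \<Longrightarrow> res_data p \<delta> m c s \<phi> \<Longrightarrow>
    res_us s \<phi> i \<in> wLp p \<delta> \<and> (norm s)\<^sup>2 * wnorm p \<delta> (res_us s \<phi> i) \<le> Ci i * H s * data_norm p \<delta> m \<phi>" by auto
  define C where "C = (\<Sum>i\<le>m. Ci i)"
  have C: "C > 0" unfolding C_def using Ci(1) by (intro sum_pos) auto
  have CiC: "Ci i \<le> C" if "i \<le> m" for i
    unfolding C_def using that Ci(1) by (intro member_le_sum) (auto intro: less_imp_le)
  show thesis
  proof (rule that[OF C])
    fix s and \<phi> :: "nat \<Rightarrow> real \<Rightarrow> 'a" and i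
    assume r: "res_data p \<delta> m c s \<phi>" and i: "i \<le> m"
    have "(norm s)\<^sup>2 * wnorm p \<delta> (res_us s \<phi> i) \<le> Ci i * H s * data_norm p \<delta> m \<phi>" using Ci(2)[OF i r] by blast
    also have "\<dots> \<le> C * H s * data_norm p \<delta> m \<phi>"
      using CiC[OF i] H[of s] by (intro mult_right_mono data_norm_nonneg) auto
    finally show "res_us s \<phi> i \<in> wLp p \<delta> \<and> (norm s)\<^sup>2 * wnorm p \<delta> (res_us s \<phi> i)
      \<le> C * (1 + norm s powr (- (max (\<delta> - p + 1) 0) / p)) * data_norm p \<delta> m \<phi>"
      using Ci(2)[OF i r] by (simp only: H_def)
  qed
qed

section \<open>Sobolev functions as chains of derivatives\<close>

text \<open>Each weak derivative is replaced by a representative that is an antiderivative of the next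
  one. The function of highest order has no successor and is left unchanged.\<close>

lemma sobolev_chain:
  fixes f :: "real \<Rightarrow> 'a::banach"
  assumes f: "f \<in> sobolev m p \<delta>"
  obtains \<phi> where "\<And>i. i \<le> m \<Longrightarrow> \<phi> i \<in> wLp p \<delta>" "\<And>i. i < m \<Longrightarrow> has_ac_deriv (\<phi> i) (\<phi> (Suc i))"
    "\<And>i. i \<le> m \<Longrightarrow> has_weak_deriv i f (\<phi> i)" "AE x in halfline. f x = \<phi> 0 x"
proof -
  have "\<forall>i\<in>{..m}. \<exists>v. v \<in> wLp p \<delta> \<and> has_weak_deriv i f v" using f by (auto simp: sobolev_def)
  from bchoice[OF this] obtain v where v: "\<And>i. i \<le> m \<Longrightarrow> v i \<in> wLp p \<delta>" "\<And>i. i \<le> m \<Longrightarrow> has_weak_deriv i f (v i)" by auto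
  have "\<forall>i\<in>{..<m}. \<exists>w. has_ac_deriv w (v (Suc i)) \<and> (AE x in halfline. v i x = w x)"
  proof
    fix i assume "i \<in> {..<m}"
    then have "has_weak_deriv 1 (v i) (v (Suc i))" using v(2)[of i] v(2)[of "Suc i"] has_weak_deriv_Suc_imp by simp
    then show "\<exists>w. has_ac_deriv w (v (Suc i)) \<and> (AE x in halfline. v i x = w x)"
      by (rule has_weak_deriv_imp_has_ac_deriv) blast
  qed
  from bchoice[OF this] obtain w where w: "\<And>i. i < m \<Longrightarrow> has_ac_deriv (w i) (v (Suc i))" "\<And>i. i < m \<Longrightarrow> AE x in halfline. v i x = w i x" by auto
  define \<phi> where "\<phi> i = (if i < m then w i else v i)" for i
  have eq: "AE x in halfline. v i x = \<phi> i x" if "i \<le> m" for i using w(2) by (simp add: \<phi>_def)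
  have sm: "strongly_measurable halfline (\<phi> i)" if "i \<le> m" for i
    using w(1)[of i] v(1)[OF that] wLp_strongly_measurable has_ac_deriv_strongly_measurable by (auto simp: \<phi>_def)
  have lf: "locally_integrable f" using v(2)[of 0] by (simp add: has_weak_deriv_def)
  have d: "has_weak_deriv i f (\<phi> i)" if i: "i \<le> m" for i
  proof (rule has_weak_deriv_AE_eq[OF v(2)[OF i] lf _ _ eq[OF i]])
    have "locally_integrable (v i)" using v(2)[OF i] by (simp add: has_weak_deriv_def)
    then show "locally_integrable (\<phi> i)" by (rule locally_integrable_AE_eq(1)[OF _ sm[OF i] eq[OF i]])
  qed simp
  show thesis
  proof (rule that)
    show "\<phi> i \<in> wLp p \<delta>" if "i \<le> m" for i by (rule wLp_AE_eq(1)[OF v(1)[OF that] sm[OF that] eq[OF that]])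
    show "has_ac_deriv (\<phi> i) (\<phi> (Suc i))" if i: "i < m" for i
      using has_ac_deriv_AE_eq[OF w(1)[OF i] sm[of "Suc i"] eq[of "Suc i"]] i by (simp add: \<phi>_def)
    show "has_weak_deriv i f (\<phi> i)" if "i \<le> m" for i by (rule d[OF that])
    show "AE x in halfline. f x = \<phi> 0 x" by (rule has_weak_deriv_unique[OF has_weak_deriv_0[OF lf] d]) simp
  qed
qed

context
  fixes w :: "nat \<Rightarrow> real \<Rightarrow> 'a::banach" and M :: nat and p \<delta> :: real
  assumes ac: "\<And>i. i < M \<Longrightarrow> has_ac_deriv (w i) (w (Suc i))" and L: "\<And>i. i \<le> M \<Longrightarrow> w i \<in> wLp p \<delta>" and M: "0 < M"
begin

lemma chain_locally_integrable: "i \<le> M \<Longrightarrow> locally_integrable (w i)"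
proof (cases "i = M")
  case True
  have "has_ac_deriv (w (M - 1)) (w M)" using ac[of "M - 1"] M by simp
  then show ?thesis using True by (simp add: has_ac_deriv_def)
next
  case False
  assume "i \<le> M"
  then have "i < M" using False by simp
  then show ?thesis by (intro has_ac_deriv_locally_integrable[OF ac])
qed

lemma chain_has_weak_deriv: "i + j \<le> M \<Longrightarrow> has_weak_deriv j (w i) (w (i + j))"
  by (rule has_ac_deriv_chain_imp_has_weak_deriv[of M]) (auto intro: ac chain_locally_integrable)

lemma chain_sobolev: "w 0 \<in> sobolev M p \<delta>"
  unfolding sobolev_def using L chain_has_weak_deriv[of 0] by auto

lemma chain_weak_deriv: "j \<le> M \<Longrightarrow> AE x in halfline. weak_deriv j (w 0) x = w j x"
  using weak_deriv_eqI(2)[OF chain_has_weak_deriv[of 0 j]] by simp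

lemma chain_sobolev_norm:
  assumes "j + m \<le> M" shows "sobolev_norm m p \<delta> (weak_deriv j (w 0)) = (\<Sum>i\<le>m. wnorm p \<delta> (w (i + j)))"
  unfolding sobolev_norm_def
proof (rule sum.cong)
  fix i assume "i \<in> {..m}"
  then have ij: "j + i \<le> M" using assms by simp
  have j: "j \<le> M" using assms by simp
  have 0: "has_weak_deriv j (w 0) (weak_deriv j (w 0))"
    using weak_deriv_eqI(1)[OF chain_has_weak_deriv[of 0 j]] j by simp
  then have l: "locally_integrable (weak_deriv j (w 0))" by (simp add: has_weak_deriv_def)
  have "AE x in halfline. w j x = weak_deriv j (w 0) x" using chain_weak_deriv[OF j] by eventually_elim simp
  then have "has_weak_deriv i (weak_deriv j (w 0)) (w (j + i))"
    by (rule has_weak_deriv_AE_eq[OF chain_has_weak_deriv[OF ij] l _ chain_locally_integrable[OF ij]]) simp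
  from weak_deriv_eqI[OF this]
  have "strongly_measurable halfline (weak_deriv i (weak_deriv j (w 0)))"
    "AE x in halfline. w (j + i) x = weak_deriv i (weak_deriv j (w 0)) x"
    by (auto simp: has_weak_deriv_def locally_integrable_def elim: eventually_mono)
  from wLp_AE_eq(2)[OF L[OF ij] this]
  show "wnorm p \<delta> (weak_deriv i (weak_deriv j (w 0))) = wnorm p \<delta> (w (i + j))" by (simp add: add.commute)
qed simp

end

lemma sobolev_norm_chain:
  fixes f :: "real \<Rightarrow> 'a::banach"
  assumes "\<And>i. i \<le> m \<Longrightarrow> \<phi> i \<in> wLp p \<delta>" "\<And>i. i \<le> m \<Longrightarrow> has_weak_deriv i f (\<phi> i)"
  shows "sobolev_norm m p \<delta> f = data_norm p \<delta> m \<phi>"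
  unfolding sobolev_norm_def data_norm_def
proof (rule sum.cong)
  fix i assume "i \<in> {..m}"
  then have i: "i \<le> m" by simp
  from weak_deriv_eqI[OF assms(2)[OF i]]
  have "strongly_measurable halfline (weak_deriv i f)" "AE x in halfline. \<phi> i x = weak_deriv i f x"
    by (auto simp: has_weak_deriv_def locally_integrable_def elim: eventually_mono)
  from wLp_AE_eq(2)[OF assms(1)[OF i] this] show "wnorm p \<delta> (weak_deriv i f) = wnorm p \<delta> (\<phi> i)" .
qed simp

section \<open>Uniqueness\<close>

text \<open>The function \<open>w = z' + s z\<close> solves \<open>w' = s w\<close> and is small at some points near infinity, so it
  vanishes by the backward estimate with zero right-hand side. Then \<open>z'\<close> solves \<open>w' = - s w\<close> and
  is small near \<open>0\<close>, so it vanishes by the forward estimate.\<close>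

lemma second_order_homogeneous_unique:
  fixes z z' :: "real \<Rightarrow> 'a::complex_banach"
  assumes p: "p > 1" and \<delta>: "-1 < \<delta>" and s: "Re s > 0"
    and z: "has_ac_deriv z z'" "has_ac_deriv z' (\<lambda>x. (s * s) *\<^sub>C z x)" and L: "z \<in> wLp p \<delta>" "z' \<in> wLp p \<delta>"
    and near: "\<And>e. e > 0 \<Longrightarrow> \<exists>x0. 0 < x0 \<and> x0 < e \<and> norm (z' x0) < e" and x: "0 < x"
  shows "z x = 0"
proof -
  have p0: "p > 0" and p1: "p \<ge> 1" using p by auto
  define w where "w x = z' x + s *\<^sub>C z x" for x
  have w0: "w x = 0" if x: "0 < x" for x
  proof -
    have "has_ac_deriv w (\<lambda>x. (s * s) *\<^sub>C z x + s *\<^sub>C z' x)"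
      unfolding w_def[abs_def] by (intro has_ac_deriv_add z has_ac_deriv_bounded_linear[OF scaleC.bounded_linear_right])
    then have ac: "has_ac_deriv w (\<lambda>x. s *\<^sub>C w x - 0)"
      by (rule has_ac_deriv_cong) (simp_all add: w_def scaleC.add_right scaleC_scaleC)
    have wL: "w \<in> wLp p \<delta>" unfolding w_def[abs_def] by (intro wLp_add(1) L wLp_scaleC(1) p0 p1)
    have "ennreal (norm (w x)) \<le> (\<integral>\<^sup>+y. expker 0 x y * (ennreal (norm (0 :: 'a)) * indicator {x<..} y) \<partial>halfline)"
    proof (rule first_order_backward_bound[OF ac order_refl less_imp_le[OF s] _ x])
      show "\<exists>x1>x. norm (w x1) < e" if "e > 0" for e
        using wLp_small_near_infinity[OF p \<delta> wL that, of x] by blast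
    qed
    then show ?thesis by simp
  qed
  have ac: "has_ac_deriv z' (\<lambda>x. 0 - s *\<^sub>C z' x)"
  proof (rule has_ac_deriv_cong[OF z(2)])
    fix t :: real assume "0 < t"
    then have "z' t = - (s *\<^sub>C z t)" using w0[of t] by (simp add: w_def eq_neg_iff_add_eq_0)
    then show "(s * s) *\<^sub>C z t = 0 - s *\<^sub>C z' t" by (simp add: scaleC.minus_right scaleC_scaleC)
  qed simp
  have "ennreal (norm (z' x)) \<le> (\<integral>\<^sup>+y. expker 0 x y * (ennreal (norm (0 :: 'a)) * indicator {..x} y) \<partial>halfline)"
    by (rule first_order_forward_bound[OF ac order_refl less_imp_le[OF s] near x])
  then have "z' x = 0" by simp
  with w0[OF x] have "s *\<^sub>C z x = 0" by (simp add: w_def)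
  then have "norm s * norm (z x) = 0" by (simp add: norm_scaleC[symmetric])
  then show ?thesis using s by auto
qed

section \<open>The Neumann problem\<close>

text \<open>The argument of the principal root is half of that of \<open>\<mu>\<close>, hence less than \<open>(pi - \<omega>) / 2\<close> in
  modulus.\<close>

lemma Re_csqrt_sector:
  assumes \<omega>: "0 < \<omega>" "\<omega> < pi" and \<mu>: "\<mu> \<in> sector (pi - \<omega>)"
  shows "csqrt \<mu> \<noteq> 0" "sin (\<omega> / 2) * norm (csqrt \<mu>) \<le> Re (csqrt \<mu>)"
proof -
  have \<mu>0: "\<mu> \<noteq> 0" and arg: "\<bar>Arg \<mu>\<bar> < pi - \<omega>" using \<mu> by (auto simp: sector_def)
  show "csqrt \<mu> \<noteq> 0" using \<mu>0 by simp
  have "csqrt \<mu> = exp (Ln \<mu> / 2)" using \<mu>0 by (rule csqrt_exp_Ln)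
  moreover have "Im (Ln \<mu>) = Arg \<mu>" using \<mu>0 by (simp add: Arg_eq_Im_Ln)
  ultimately have re: "Re (csqrt \<mu>) = norm (csqrt \<mu>) * cos (Arg \<mu> / 2)"
    by (simp add: Re_exp norm_exp_eq_Re)
  have "sin (\<omega> / 2) = cos ((pi - \<omega>) / 2)" by (simp add: sin_cos_eq diff_divide_distrib)
  also have "\<dots> \<le> cos (\<bar>Arg \<mu> / 2\<bar>)" using arg \<omega> by (intro cos_monotone_0_pi_le) auto
  also have "\<dots> = cos (Arg \<mu> / 2)" by (simp only: cos_abs_real)
  finally show "sin (\<omega> / 2) * norm (csqrt \<mu>) \<le> Re (csqrt \<mu>)" unfolding re
    by (subst mult.commute) (rule mult_left_mono, auto)
qed

theorem theorem3p2:
  fixes p \<gamma> \<omega> :: real and k :: int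
  assumes p: "1 < p"
    and k: "k \<ge> -1"
    and \<gamma>: "\<gamma> \<in> {-1<..<2 * p - 1} - {p - 1}"
    and \<gamma>k: "\<gamma> + of_int k * p > -1"
    and \<omega>: "\<omega> \<in> {0<..<pi}"
    and UMD: "UMD TYPE('a::complex_banach)"
  shows "\<exists>C>0. \<forall>f\<in>sobolev (nat (k + 1)) p (\<gamma> + of_int k * p) :: (real \<Rightarrow> 'a) set.
           \<forall>\<mu>\<in>sector (pi - \<omega>).
           \<exists>u\<in>sobolev_Neu (nat (k + 3)) p (\<gamma> + of_int k * p).
             resolvent_eq \<mu> u f \<and>
             (\<forall>v\<in>sobolev_Neu (nat (k + 3)) p (\<gamma> + of_int k * p).
                resolvent_eq \<mu> v f \<longrightarrow> (AE x in halfline. v x = u x)) \<and>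
             (\<Sum>j\<le>2. cmod \<mu> powr (1 - real j / 2) *
                sobolev_norm (nat (k + 1)) p (\<gamma> + of_int k * p) (weak_deriv j u))
               \<le> C * h_fun p (k + 1) \<gamma> \<mu> * sobolev_norm (nat (k + 1)) p (\<gamma> + of_int k * p) f"
proof -
  define m where "m = nat (k + 1)"
  define \<delta> where "\<delta> = \<gamma> + of_int k * p"
  have km: "of_int k = real m - 1" and m2: "nat (k + 3) = m + 2" using k by (auto simp: m_def)
  have \<delta>1: "-1 < \<delta>" using \<gamma>k by (simp add: \<delta>_def)
  have p0: "p > 0" and p1: "p \<ge> 1" using p by auto
  (* The exponent \<delta> modulo p. If \<gamma> < p - 1, then \<eta> = \<gamma> and one derivative of f is left over
     (e = 1); otherwise \<eta> = \<gamma> - p and all m derivatives are used up. *)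
  have "\<exists>\<eta> n e. -1 < \<eta> \<and> \<eta> < p - 1 \<and> \<delta> = \<eta> + real n * p \<and> m = n + e \<and> e \<le> (1::nat)"
  proof (cases "\<gamma> < p - 1")
    case True
    have "m \<noteq> 0" using \<delta>1 True p by (intro notI) (simp add: \<delta>_def km)
    then have "\<delta> = \<gamma> + real (m - 1) * p" by (simp add: \<delta>_def km of_nat_diff)
    then show ?thesis using True \<gamma> \<open>m \<noteq> 0\<close> by (intro exI[of _ \<gamma>] exI[of _ "m - 1"] exI[of _ 1]) auto
  next
    case False
    have "\<delta> = (\<gamma> - p) + real m * p" by (simp add: \<delta>_def km algebra_simps)
    then show ?thesis using False \<gamma> by (intro exI[of _ "\<gamma> - p"] exI[of _ m] exI[of _ 0]) auto
  qed
  then obtain \<eta> and n e :: nat where \<eta>: "-1 < \<eta>" "\<eta> < p - 1" and dn: "\<delta> = \<eta> + real n * p" and me: "m = n + e" and e1: "e \<le> 1"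
    by blast
  define c where "c = sin (\<omega> / 2)"
  have c: "c > 0" using \<omega> by (auto simp: c_def intro!: sin_gt_zero)
  have "-1 < \<delta> - real n * p" using \<eta> dn by simp
  then obtain CH where CH: "CH > 0" "\<And>m (\<phi> :: nat \<Rightarrow> real \<Rightarrow> 'a) i.
    \<lbrakk>\<forall>i\<le>m. \<phi> i \<in> wLp p \<delta>; \<forall>i<m. has_ac_deriv (\<phi> i) (\<phi> (Suc i)); i + n \<le> m\<rbrakk>
    \<Longrightarrow> \<phi> i \<in> wLp p (\<delta> - real n * p) \<and> wnorm p (\<delta> - real n * p) (\<phi> i) \<le> CH * wnorm p \<delta> (\<phi> (i + n))"
    using hardy_chain[where 'a='a, OF p \<delta>1] by blast
  obtain CG where CG: "CG > 0" "\<And>m s (\<phi> :: nat \<Rightarrow> real \<Rightarrow> 'a) i.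
    \<lbrakk>res_data p \<delta> m c s \<phi>; i \<le> m; \<phi> i \<in> wLp p \<delta>\<rbrakk>
    \<Longrightarrow> res_Gs s \<phi> i \<in> wLp p \<delta> \<and> norm s * wnorm p \<delta> (res_Gs s \<phi> i) \<le> CG * wnorm p \<delta> (\<phi> i)"
    using res_Gs_bound[where 'a='a, OF p \<delta>1 c \<delta>1] by blast
  obtain CM where CM: "CM > 0" "\<And>s (\<phi> :: nat \<Rightarrow> real \<Rightarrow> 'a) i. \<lbrakk>res_data p \<delta> m c s \<phi>; i \<le> m\<rbrakk> \<Longrightarrow>
    res_us s \<phi> i \<in> wLp p \<delta> \<and> (norm s)\<^sup>2 * wnorm p \<delta> (res_us s \<phi> i)
      \<le> CM * (1 + norm s powr (- (max (\<delta> - p + 1) 0) / p)) * data_norm p \<delta> m \<phi>"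
    using res_us_bound[where 'a='a, OF p c \<eta> dn me e1] by blast
  define C where "C = (real m + 1) * (CM + 2 * (CG + CM) + 2 * (CM + 1))"
  have "0 < real m + 1" by simp
  then have C: "C > 0" unfolding C_def using CM(1) CG(1) by (intro mult_pos_pos) simp_all
  have main: "\<exists>u\<in>sobolev_Neu (m + 2) p \<delta>. resolvent_eq \<mu> u f \<and>
      (\<forall>v\<in>sobolev_Neu (m + 2) p \<delta>. resolvent_eq \<mu> v f \<longrightarrow> (AE x in halfline. v x = u x)) \<and>
      (\<Sum>j\<le>2. cmod \<mu> powr (1 - real j / 2) * sobolev_norm m p \<delta> (weak_deriv j u))
        \<le> C * h_fun p (k + 1) \<gamma> \<mu> * sobolev_norm m p \<delta> f"
    if f: "f \<in> sobolev m p \<delta>" and \<mu>: "\<mu> \<in> sector (pi - \<omega>)" for f :: "real \<Rightarrow> 'a" and \<mu>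
  proof -
    define s where "s = csqrt \<mu>"
    have ss: "s * s = \<mu>" using power2_csqrt[of \<mu>] by (simp add: s_def power2_eq_square)
    have s0: "s \<noteq> 0" and sc: "c * norm s \<le> Re s" using Re_csqrt_sector[of \<omega> \<mu>] \<omega> \<mu> by (auto simp: s_def c_def)
    obtain \<phi> where \<phi>: "\<And>i. i \<le> m \<Longrightarrow> \<phi> i \<in> wLp p \<delta>" "\<And>i. i < m \<Longrightarrow> has_ac_deriv (\<phi> i) (\<phi> (Suc i))"
      "\<And>i. i \<le> m \<Longrightarrow> has_weak_deriv i f (\<phi> i)" "AE x in halfline. f x = \<phi> 0 x"
      using sobolev_chain[OF f] by blast
    have fS: "sobolev_norm m p \<delta> f = data_norm p \<delta> m \<phi>" by (rule sobolev_norm_chain[OF \<phi>(1,3)])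
    have "\<phi> 0 \<in> wLp p (\<delta> - real n * p)"
      using CH(2)[of m \<phi> 0] \<phi>(1,2) me by simp
    then have "\<phi> 0 \<in> wLp p \<eta>" by (simp add: dn)
    then have "exp_integrable (\<phi> 0)"
      using wLp_exp_integrable[OF p \<eta>] wLp_strongly_measurable unfolding exp_integrable_def by blast
    then have r: "res_data p \<delta> m c s \<phi>" using s0 sc \<phi>(1,2) by (simp add: res_data_def)
    note Re = res_data_Re[OF r c]
    define u where "u = res_us s \<phi>"
    define S where "S = data_norm p \<delta> m \<phi>"
    define H where "H = 1 + norm s powr (- (max (\<delta> - p + 1) 0) / p)"
    have S: "0 \<le> S" unfolding S_def by (rule data_norm_nonneg)
    have H1: "1 \<le> H" by (simp add: H_def)
    have uL: "u i \<in> wLp p \<delta>" "(norm s)\<^sup>2 * wnorm p \<delta> (u i) \<le> CM * H * S" if "i \<le> m" for i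
      using CM(2)[OF r that] by (auto simp: u_def H_def S_def)
    have GL: "res_Gs s \<phi> i \<in> wLp p \<delta>" "norm s * wnorm p \<delta> (res_Gs s \<phi> i) \<le> CG * S" if i: "i \<le> m" for i
    proof -
      note g = CG(2)[OF r i \<phi>(1)[OF i]]
      show "res_Gs s \<phi> i \<in> wLp p \<delta>" using g by blast
      show "norm s * wnorm p \<delta> (res_Gs s \<phi> i) \<le> CG * S"
        using conjunct2[OF g] mult_left_mono[OF wnorm_le_data_norm[OF i, of p \<delta> \<phi>] less_imp_le[OF CG(1)]]
        unfolding S_def by (rule order_trans)
    qed
    (* The first and second derivatives are estimated through u' = G - s u and u'' = \<mu> u - f. *)
    have u1: "u (Suc i) \<in> wLp p \<delta>" "norm s * wnorm p \<delta> (u (Suc i)) \<le> 2 * (CG * S + CM * H * S)" if i: "i \<le> m" for i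
    proof -
      note su = wLp_scaleC[OF uL(1)[OF i] p0, of s]
      have eq: "u (Suc i) = (\<lambda>x. res_Gs s \<phi> i x - s *\<^sub>C u i x)" by (simp add: u_def)
      note d = wLp_diff[OF GL(1)[OF i] su(1) p1, folded eq]
      show "u (Suc i) \<in> wLp p \<delta>" by (rule d(1))
      have "wnorm p \<delta> (u (Suc i)) \<le> 2 * (wnorm p \<delta> (res_Gs s \<phi> i) + norm s * wnorm p \<delta> (u i))"
        by (rule order_trans[OF d(2)], intro mult_left_mono add_left_mono su(2)) simp
      then have "norm s * wnorm p \<delta> (u (Suc i)) \<le> norm s * (2 * (wnorm p \<delta> (res_Gs s \<phi> i) + norm s * wnorm p \<delta> (u i)))"
        by (rule mult_left_mono) simp
      also have "\<dots> = 2 * (norm s * wnorm p \<delta> (res_Gs s \<phi> i) + (norm s)\<^sup>2 * wnorm p \<delta> (u i))"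
        by (simp add: power2_eq_square algebra_simps)
      also have "\<dots> \<le> 2 * (CG * S + CM * H * S)" by (intro mult_left_mono add_mono GL(2)[OF i] uL(2)[OF i]) simp
      finally show "norm s * wnorm p \<delta> (u (Suc i)) \<le> 2 * (CG * S + CM * H * S)" .
    qed
    have u2eq: "u (Suc (Suc i)) = (\<lambda>x. \<mu> *\<^sub>C u i x - \<phi> i x)" for i
      by (rule ext) (simp only: u_def res_us_Suc_Suc ss)
    have u2: "u (Suc (Suc i)) \<in> wLp p \<delta>" "wnorm p \<delta> (u (Suc (Suc i))) \<le> 2 * (CM * H * S + S)" if i: "i \<le> m" for i
    proof -
      note su = wLp_scaleC[OF uL(1)[OF i] p0, of \<mu>]
      note d = wLp_diff[OF su(1) \<phi>(1)[OF i] p1, folded u2eq]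
      show "u (Suc (Suc i)) \<in> wLp p \<delta>" by (rule d(1))
      have "norm \<mu> = (norm s)\<^sup>2" by (simp add: ss[symmetric] norm_mult power2_eq_square)
      then have "wnorm p \<delta> (\<lambda>x. \<mu> *\<^sub>C u i x) \<le> CM * H * S" using su(2) uL(2)[OF i] by simp
      moreover have "wnorm p \<delta> (\<phi> i) \<le> S" unfolding S_def by (rule wnorm_le_data_norm[OF i])
      ultimately show "wnorm p \<delta> (u (Suc (Suc i))) \<le> 2 * (CM * H * S + S)"
        by (intro order_trans[OF d(2)] mult_left_mono add_mono) auto
    qed
    have chL: "u i \<in> wLp p \<delta>" if im: "i \<le> m + 2" for i
    proof -
      consider "i \<le> m" | "i = Suc m" | "i = Suc (Suc m)" using im by linarith
      then show ?thesis using uL(1) u1(1) u2(1) by cases auto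
    qed
    have chA: "has_ac_deriv (u i) (u (Suc i))" if "i < m + 2" for i
      using res_us_ac[OF r c, of i] that by (simp add: u_def del: res_us.simps)
    have M0: "0 < m + 2" by simp
    note ch = chain_sobolev[of "m + 2" u, OF chA chL M0] chain_weak_deriv[of "m + 2" u, OF chA chL M0]
      chain_sobolev_norm[of "m + 2" u, OF chA chL M0]
    have tr: "has_trace (weak_deriv 1 (u 0)) 0" unfolding has_trace_def
    proof (intro exI[of _ "\<lambda>x. res_G s (\<phi> 0) x - s *\<^sub>C res_u s (\<phi> 0) x"] conjI)
      have ex: "exp_integrable (\<phi> 0)" using r by (simp add: res_data_def)
      show "continuous_on {0..} (\<lambda>x. res_G s (\<phi> 0) x - s *\<^sub>C res_u s (\<phi> 0) x)" by (rule res_u_deriv_continuous(1)[OF Re ex])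
      show "res_G s (\<phi> 0) 0 - s *\<^sub>C res_u s (\<phi> 0) 0 = 0" by (rule res_u_deriv_continuous(2)[OF Re ex])
      show "AE x in halfline. weak_deriv 1 (u 0) x = res_G s (\<phi> 0) x - s *\<^sub>C res_u s (\<phi> 0) x"
        using ch(2)[of 1] by (simp add: u_def)
    qed
    have uN: "u 0 \<in> sobolev_Neu (m + 2) p \<delta>" using ch(1) tr by (simp add: sobolev_Neu_def)
    have eqn: "resolvent_eq \<mu> (u 0) f" unfolding resolvent_eq_def
      using ch(2)[of 2, simplified] \<phi>(4)
    proof eventually_elim
      fix x assume a: "weak_deriv 2 (u 0) x = u 2 x" "f x = \<phi> 0 x"
      have "u 2 x = \<mu> *\<^sub>C u 0 x - \<phi> 0 x" using u2eq[of 0] by (simp add: numeral_2_eq_2)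
      then show "\<mu> *\<^sub>C u 0 x - weak_deriv 2 (u 0) x = f x" using a by simp
    qed
    have uniq: "AE x in halfline. v x = u 0 x" if v: "v \<in> sobolev_Neu (m + 2) p \<delta>" and veq: "resolvent_eq \<mu> v f" for v
    proof -
      have vs: "v \<in> sobolev (m + 2) p \<delta>" and vt: "has_trace (weak_deriv 1 v) 0" using v by (auto simp: sobolev_Neu_def)
      obtain \<psi> where \<psi>: "\<And>i. i \<le> m + 2 \<Longrightarrow> \<psi> i \<in> wLp p \<delta>" "\<And>i. i < m + 2 \<Longrightarrow> has_ac_deriv (\<psi> i) (\<psi> (Suc i))"
        "\<And>i. i \<le> m + 2 \<Longrightarrow> has_weak_deriv i v (\<psi> i)" "AE x in halfline. v x = \<psi> 0 x"
        using sobolev_chain[OF vs] by blast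
      define z where "z i x = \<psi> i x - u i x" for i x
      have zL: "z i \<in> wLp p \<delta>" if "i \<le> m + 2" for i
        unfolding z_def[abs_def] by (rule wLp_diff(1)[OF \<psi>(1)[OF that] chL[OF that] p1])
      have zA: "has_ac_deriv (z i) (z (Suc i))" if "i < m + 2" for i
        unfolding z_def[abs_def] by (rule has_ac_deriv_diff[OF \<psi>(2)[OF that] chA[OF that]])
      have w2: "AE x in halfline. weak_deriv 2 v x = \<psi> 2 x" "AE x in halfline. weak_deriv 1 v x = \<psi> 1 x"
        using weak_deriv_eqI(2)[OF \<psi>(3)] by auto
      have z2: "AE x in halfline. z 2 x = (s * s) *\<^sub>C z 0 x"
        using w2(1) veq[unfolded resolvent_eq_def] \<psi>(4) \<phi>(4)
      proof eventually_elim
        fix x assume a: "weak_deriv 2 v x = \<psi> 2 x" "\<mu> *\<^sub>C v x - weak_deriv 2 v x = f x" "v x = \<psi> 0 x" "f x = \<phi> 0 x"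
        have "u 2 x = \<mu> *\<^sub>C u 0 x - \<phi> 0 x" using u2eq[of 0] by (simp add: numeral_2_eq_2)
        moreover have "\<psi> 2 x = \<mu> *\<^sub>C \<psi> 0 x - \<phi> 0 x" using a by (simp add: algebra_simps)
        ultimately show "z 2 x = (s * s) *\<^sub>C z 0 x" by (simp add: z_def ss scaleC.diff_right)
      qed
      have z01: "has_ac_deriv (z 0) (z 1)" and z12: "has_ac_deriv (z 1) (z 2)"
        using zA[of 0] zA[of 1] by (simp_all add: numeral_2_eq_2)
      have z1: "has_ac_deriv (z 1) (\<lambda>x. (s * s) *\<^sub>C z 0 x)"
        by (rule has_ac_deriv_AE_eq[OF z12 strongly_measurable_scaleC[OF has_ac_deriv_strongly_measurable[OF z01]] z2])
      obtain g where g: "continuous_on {0..} g" "AE x in halfline. weak_deriv 1 v x = g x" "g 0 = 0"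
        using vt unfolding has_trace_def by blast
      (* The trace condition holds for a continuous representative g only; as g agrees with the
         derivative almost everywhere, there are points close to 0 at which both coincide. *)
      have near: "\<exists>x0. 0 < x0 \<and> x0 < \<epsilon> \<and> norm (z 1 x0) < \<epsilon>" if \<epsilon>: "\<epsilon> > 0" for \<epsilon>
      proof -
        have "\<epsilon> / 2 > 0" using \<epsilon> by simp
        obtain d1 where d1: "d1 > 0" "\<And>x. x \<in> {0..} \<Longrightarrow> dist x 0 < d1 \<Longrightarrow> dist (g x) (g 0) < \<epsilon> / 2"
          using g(1)[unfolded continuous_on_iff, rule_format, of 0 "\<epsilon> / 2"] \<epsilon> by auto
        obtain d2 where d2: "d2 > 0" "\<And>x. 0 < x \<Longrightarrow> x < d2 \<Longrightarrow> norm (u 1 x) < \<epsilon> / 2"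
          using res_us_1_near_0[OF r c \<open>\<epsilon> / 2 > 0\<close>] unfolding u_def by blast
        have "AE x in halfline. \<psi> 1 x = g x" using w2(2) g(2) by eventually_elim simp
        moreover have "0 < min \<epsilon> (min d1 d2)" using \<epsilon> d1 d2 by simp
        ultimately obtain x0 where x0: "0 < x0" "x0 < min \<epsilon> (min d1 d2)" "\<psi> 1 x0 = g x0"
          using AE_halfline_obtain[of "\<lambda>x. \<psi> 1 x = g x" 0 "min \<epsilon> (min d1 d2)"] by auto
        have "norm (z 1 x0) \<le> norm (g x0) + norm (u 1 x0)" using x0(3) norm_triangle_ineq4[of "g x0" "u 1 x0"] by (simp add: z_def)
        also have "\<dots> < \<epsilon> / 2 + \<epsilon> / 2" using d1(2)[of x0] d2(2)[of x0] x0 g(3) by (intro add_strict_mono) auto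
        finally show ?thesis using x0 by (intro exI[of _ x0]) auto
      qed
      have z0: "z 0 x = 0" if "0 < x" for x
        by (rule second_order_homogeneous_unique[OF p \<delta>1 Re z01 z1 zL zL near that]) auto
      have hpos: "AE x in halfline. 0 < x" by (rule AE_I2) simp
      show ?thesis using \<psi>(4) hpos
      proof eventually_elim
        fix x :: real assume "v x = \<psi> 0 x" "0 < x"
        then show "v x = u 0 x" using z0[of x] by (simp add: z_def)
      qed
    qed
    have n\<mu>: "cmod \<mu> = (norm s)\<^sup>2" by (simp add: ss[symmetric] norm_mult power2_eq_square)
    have ns: "norm s > 0" using s0 by simp
    (* The exponent of norm \<mu> in h is half of the exponent of norm s in H. *)
    have hH: "h_fun p (k + 1) \<gamma> \<mu> = H"
    proof -
      have "\<gamma> + of_int (k + 1) * p - 2 * p + 1 = \<delta> - p + 1" by (simp add: \<delta>_def algebra_simps)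
      moreover have "(norm s)\<^sup>2 powr y = norm s powr (2 * y)" for y
      proof -
        have "(norm s)\<^sup>2 = norm s powr 2" using ns by simp
        then show ?thesis by (simp only: powr_powr)
      qed
      ultimately show ?thesis unfolding h_fun_def H_def n\<mu> by simp
    qed
    have sn: "sobolev_norm m p \<delta> (weak_deriv j (u 0)) = (\<Sum>i\<le>m. wnorm p \<delta> (u (i + j)))" if "j \<le> 2" for j
      using ch(3)[of j m] that by (simp add: add.commute)
    have N0: "norm s ^ 2 * sobolev_norm m p \<delta> (weak_deriv 0 (u 0)) \<le> (real m + 1) * (CM * H * S)"
      using sum_mono[of "{..m}" "\<lambda>i. norm s ^ 2 * wnorm p \<delta> (u i)" "\<lambda>_. CM * H * S"] uL(2)
      by (simp add: sn sum_distrib_left add.commute[of 1])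
    have N1: "norm s * sobolev_norm m p \<delta> (weak_deriv 1 (u 0)) \<le> (real m + 1) * (2 * (CG * S + CM * H * S))"
      using sum_mono[of "{..m}" "\<lambda>i. norm s * wnorm p \<delta> (u (Suc i))" "\<lambda>_. 2 * (CG * S + CM * H * S)"] u1(2)
      by (simp add: sn sum_distrib_left add.commute[of 1])
    have N2: "sobolev_norm m p \<delta> (weak_deriv 2 (u 0)) \<le> (real m + 1) * (2 * (CM * H * S + S))"
      using sum_mono[of "{..m}" "\<lambda>i. wnorm p \<delta> (u (Suc (Suc i)))" "\<lambda>_. 2 * (CM * H * S + S)"] u2(2)
      by (simp add: sn add.commute[of 1])
    have "(\<Sum>j\<le>2. cmod \<mu> powr (1 - real j / 2) * sobolev_norm m p \<delta> (weak_deriv j (u 0)))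
      = norm s ^ 2 * sobolev_norm m p \<delta> (weak_deriv 0 (u 0)) + norm s * sobolev_norm m p \<delta> (weak_deriv 1 (u 0))
        + sobolev_norm m p \<delta> (weak_deriv 2 (u 0))"
      using ns by (simp add: numeral_2_eq_2 n\<mu> powr_half_sqrt)
    also have "\<dots> \<le> (real m + 1) * (CM * H * S) + (real m + 1) * (2 * (CG * S + CM * H * S)) + (real m + 1) * (2 * (CM * H * S + S))"
      by (intro add_mono N0 N1 N2)
    also have "\<dots> = (real m + 1) * (CM * (H * S) + 2 * (CG * S + CM * (H * S)) + 2 * (CM * (H * S) + S))"
      by (simp add: algebra_simps)
    also have "\<dots> \<le> (real m + 1) * (CM * (H * S) + 2 * (CG * (H * S) + CM * (H * S)) + 2 * (CM * (H * S) + H * S))"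
    proof -
      have "S \<le> H * S" using mult_right_mono[OF H1 S] by simp
      then have "CG * S \<le> CG * (H * S)" using CG(1) by simp
      with \<open>S \<le> H * S\<close> show ?thesis by (intro mult_left_mono) auto
    qed
    also have "\<dots> = C * H * S" by (simp add: C_def algebra_simps)
    finally have "(\<Sum>j\<le>2. cmod \<mu> powr (1 - real j / 2) * sobolev_norm m p \<delta> (weak_deriv j (u 0))) \<le> C * H * S" .
    then have est: "(\<Sum>j\<le>2. cmod \<mu> powr (1 - real j / 2) * sobolev_norm m p \<delta> (weak_deriv j (u 0)))
        \<le> C * h_fun p (k + 1) \<gamma> \<mu> * sobolev_norm m p \<delta> f" by (simp only: hH fS S_def)
    show ?thesis using uN eqn uniq est by blast
  qed
  show ?thesis unfolding m2 m_def[symmetric] \<delta>_def[symmetric] using C main by blast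
qed

end
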